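(* Let $1<p<\infty$, $n\ge2$, and let $\Omega\subseteq\mathbb{R}^n$ be a domain such that for every $x\in\partial\Omega$, $\Omega\cap B_r(x)$ is a domain for all sufficiently small $r>0$, and such that $\Omega$ has a smooth exhaustion $\{\omega_i\}_{i\in\mathbb{N}}$ for which $\Omega\setminus\overline{\omega_i}$ is a domain for all $i\in\mathbb{N}$; fix such an exhaustion. Let $H$ be an admissible norm family on $\Omega$ that is commonly uniformly convex and satisfies the Bregman lower bound, let $V\in M^q_{\mathrm{loc}}(p;\Omega)$ be such that $(H,V)$ has the gradient regularity property in $\Omega$, and suppose that $Q$ is subcritical in $\Omega$ (all these notions are defined in the context). Suppose moreover that whenever $\{\phi_k\}_{k\in\mathbb{N}}$ converges weakly to $\phi$ in $\widetilde{W}^{1,p}_0(\Omega)$, then up to a subsequence $\lim_{k\to\infty}\int_\Omega V^-|\phi_k|^p\,dx=\int_\Omega V^-|\phi|^p\,dx$, and for every $\chi\in C_c^\infty(\Omega)$, up to a subsequence, $\lim_{k\to\infty}\int_\Omega\chi V^-|\phi_k|^p\,dx=\int_\Omega\chi V^-|\phi|^p\,dx$. Let $g\in\mathcal{H}(\Omega)\setminus\{0\}$. Suppose that $S_g<\min\{S_g^*,S_g^\infty\}$ and that the closure $\overline{\Sigma_g}$ has Lebesgue measure zero. Then $S_g$ is attained at some $\phi\in\widetilde{W}^{1,p}_0(\Omega)\setminus\{0\}$, that is, $\int_\Omega|g||\phi|^p\,dx>0$ and $S_g=Q[\phi]/\int_\Omega|g||\phi|^p\,dx$.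
   Context: $\omega\Subset\Omega$ means that the closure of $\omega$ is a compact subset of $\Omega$; $C_c(\Omega)$: continuous functions with compact support in $\Omega$; $V^-=-\min\{V,0\}$; $B_r(x)$ is the open ball. A smooth exhaustion of $\Omega$ is a sequence of $C^1$ domains with $\omega_k\Subset\omega_{k+1}\Subset\Omega$ and $\bigcup_k\omega_k=\Omega$. Admissible norm family: $H:\Omega\times\mathbb{R}^n\to\mathbb{R}$ such that for a.e. $x$, $H(x,\cdot)$ is a norm on $\mathbb{R}^n$; $x\mapsto H(x,\xi)$ is measurable for all $\xi$; for every domain $\omega\Subset\Omega$ there are $0<\kappa_\omega\le\nu_\omega<\infty$ with $\kappa_\omega|\xi|\le H(x,\xi)\le\nu_\omega|\xi|$ for a.e. $x\in\omega$ and all $\xi$; for a.e. $x$, $\mathbb{R}^n_x=(\mathbb{R}^n,H(x,\cdot))$ is uniformly convex and $H(x,\cdot)$ is differentiable in $\mathbb{R}^n\setminus\{0\}$. Write $|\xi|_{\mathcal{A}}=H(x,\xi)$ and $\mathcal{A}(x,\xi)=\nabla_\xi(\tfrac1pH(x,\xi)^p)$. Common uniform convexity: there is a null set $N\subseteq\Omega$ with $\inf_{x\in\Omega\setminus N}\delta_{\mathbb{R}^n_x}(\varepsilon)>0$ for all $\varepsilon\in(0,2]$, where $\delta_X(\varepsilon)=\inf\{1-\|\frac{x+y}2\|:\|x\|=\|y\|=1,\ \|x-y\|\ge\varepsilon\}$. Bregman lower bound: for some locally bounded measurable $\tilde\delta:\Omega\to[2,\infty)$ and every domain $\omega\Subset\Omega$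 there is $C_\omega>0$ with $|\xi+\eta|_{\mathcal{A}}^p-|\xi|_{\mathcal{A}}^p-p\mathcal{A}(x,\xi)\cdot\eta\ge C_\omega|\eta|_{\mathcal{A}}^{\tilde\delta}(|\eta|_{\mathcal{A}}+|\xi|_{\mathcal{A}})^{p-\tilde\delta}$ for a.e. $x\in\omega$ and all $\xi,\eta\in\mathbb{R}^n$ (with $\tilde\delta=\tilde\delta(x)$). Morrey space: for a domain $\omega\Subset\Omega$: if $p<n$, $q>n/p$, $\|f\|_{M^q(p;\omega)}=\sup_{y\in\omega,0<r<\mathrm{diam}\,\omega}r^{-n/q'}\int_{\omega\cap B_r(y)}|f|\,dx$, $q'=q/(q-1)$; if $p=n$, $q>n$, $\|f\|_{M^q(n;\omega)}=\sup_{y\in\omega,0<r<\mathrm{diam}\,\omega}(\log(\mathrm{diam}(\omega)/r))^{q/n'}\int_{\omega\cap B_r(y)}|f|\,dx$, $n'=n/(n-1)$; then $M^q(p;\omega)=\{f\in L^1_{\mathrm{loc}}(\omega):\|f\|_{M^q(p;\omega)}<\infty\}$; if $p>n$, $q=1$, $M^q(p;\omega)=L^1(\omega)$. $M^q_{\mathrm{loc}}(p;\Omega)=\bigcap_{\omega\Subset\Omega}M^q(p;\omega)$. Functional and equation: for a domain $U\subseteq\Omega$, $Q[\phi;U]=\int_U(|\nabla\phi|_{\mathcal{A}}^p+V|\phi|^p)\,dx$, and $Q[\phi]=Q[\phi;\Omega]$. A solution of $Q'_{p,\mathcal{A},V}[u]=f$ in $U$, where $Q'_{p,\mathcal{A},V}[u]=-\mathrm{div}\,\mathcal{A}(x,\nabla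 u)+V|u|^{p-2}u$, is $v\in W^{1,p}_{\mathrm{loc}}(U)$ with $\int_U\mathcal{A}(x,\nabla v)\cdot\nabla\phi\,dx+\int_UV|v|^{p-2}v\phi\,dx=\int_Uf\phi\,dx$ for all $\phi\in C_c^\infty(U)$. Gradient regularity property of $(H,V)$ in $\Omega$: if $p<\tilde\delta$ on a set of positive measure, then for every subdomain $\Omega'\subseteq\Omega$ and $W\in L^\infty_{\mathrm{loc}}(\Omega')$ positive solutions of $Q'_{p,\mathcal{A},V-W}[u]=0$ in $\Omega'$ are in $W^{1,\infty}_{\mathrm{loc}}(\Omega')$, and for every $0\le f\in C_c^\infty(\Omega)\setminus\{0\}$ positive solutions of $Q'_{p,\mathcal{A},V}[u]=f$ in $\Omega$ are in $W^{1,\infty}_{\mathrm{loc}}(\Omega)$. Hardy-weights: for a domain $U\subseteq\Omega$, $g\in L^1_{\mathrm{loc}}(U)$ is a Hardy-weight of $Q$ in $U$ if there is $C>0$ with $Q[\phi;U]\ge C\int_U|g||\phi|^p\,dx$ for all $\phi\in C_c^\infty(U)$; $\mathcal{H}(U)$ is the space of all Hardy-weights. $Q$ is subcritical in $U$ if $Q\ge0$ on $C_c^\infty(U)$ and $\mathcal{H}(U)\ne\{0\}$. $S_g=\inf\{Q[\phi]/\int_\Omega|g||\phi|^p\,dx:\phi\in W^{1,p}(\Omega)\cap C_c(\Omega),\ \int_\Omega|g||\phi|^p\,dx>0\}$. Spaces: for a domain $U\subseteq\Omega$ in which $Q$ is subcritical, fix a positive $\mathcal{V}\in C(U)\cap\mathcal{H}(U)$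 (one exists; a functional subcritical in $\Omega$ is subcritical in all subdomains). $\widetilde{W}^{1,p}(U)$ is the set of $u\in L^p(U,(|V|+\mathcal{V})\,dx)$ with a weak gradient and finite norm $\left(\int_U(|\nabla u|_{\mathcal{A}}^p+(|V|+\mathcal{V})|u|^p)\,dx\right)^{1/p}$; $\widetilde{W}^{1,p}_0(U)$ is the closure of $W^{1,p}(U)\cap C_c(U)$ in it (independent of $\mathcal{V}$). Constants: $S_g^\infty=\lim_{i\to\infty}\inf\{Q[\phi;\Omega\setminus\overline{\omega_i}]:\phi\in\widetilde{W}^{1,p}_0(\Omega\setminus\overline{\omega_i}),\ \int_{\Omega\setminus\overline{\omega_i}}|g||\phi|^p\,dx=1\}$. For $x\in\overline\Omega$, $\mathbb{S}_g(x)=\lim_{r\to0^+}\inf\{Q[\phi;\Omega\cap B_r(x)]:\phi\in\widetilde{W}^{1,p}_0(\Omega\cap B_r(x)),\ \int_{\Omega\cap B_r(x)}|g||\phi|^p\,dx=1\}$; $S_g^*=\inf_{x\in\overline\Omega}\mathbb{S}_g(x)$; $\Sigma_g=\{x\in\overline\Omega:\mathbb{S}_g(x)<\infty\}$. *)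

theory Defs
  imports "HOL-Analysis.Analysis"
begin

text \<open>
  Functions on a set \<open>U\<close> are total functions whose values outside \<open>U\<close> are irrelevant; elements of
  function spaces are representatives, and equality in these spaces is equality a.e. on \<open>U\<close>.
  Functions with compact support in \<open>U\<close> are extended by zero. Measurability and
  integrals are with respect to Lebesgue measure. Infima that may be infinite
  (or taken over the empty set) are in \<^typ>\<open>ereal\<close>, so that the infimum of the empty set is \<open>\<infinity>\<close>.
\<close>


section \<open>Domains\<close>

definition is_domain :: "'a::euclidean_space set \<Rightarrow> bool" where
  "is_domain U \<longleftrightarrow> open U \<and> connected U \<and> U \<noteq> {}"

definition compactly_in :: "'a::euclidean_space set \<Rightarrow> 'a set \<Rightarrow> bool"  (infix \<open>\<Subset>\<close> 50) where
  "\<omega> \<Subset> U \<longleftrightarrow> compact (closure \<omega>) \<and> closure \<omega> \<subseteq> U"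

primrec Ck :: "nat \<Rightarrow> ('a::euclidean_space \<Rightarrow> real) \<Rightarrow> bool" where
  "Ck 0 f \<longleftrightarrow> continuous_on UNIV f"
| "Ck (Suc k) f \<longleftrightarrow> (\<forall>x. f differentiable (at x)) \<and>
     (\<forall>b\<in>Basis. Ck k (\<lambda>x. frechet_derivative f (at x) b))"

text \<open>
  Near each boundary point, \<open>\<omega>\<close> is the set above the graph of a \<open>C\<^sup>1\<close> function over the hyperplane
  orthogonal to some unit vector \<open>e\<close>; \<open>x - (x \<bullet> e) e\<close> is the projection of \<open>x\<close> to that hyperplane.
\<close>
definition C1_domain :: "'a::euclidean_space set \<Rightarrow> bool" where
  "C1_domain \<omega> \<longleftrightarrow> is_domain \<omega> \<and>
     (\<forall>z\<in>frontier \<omega>. \<exists>r>0. \<exists>e \<gamma>. norm e = 1 \<and> Ck 1 \<gamma> \<and>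
        \<omega> \<inter> ball z r = {x \<in> ball z r. x \<bullet> e > \<gamma> (x - (x \<bullet> e) *\<^sub>R e)})"

definition smooth_exhaustion :: "(nat \<Rightarrow> 'a::euclidean_space set) \<Rightarrow> 'a set \<Rightarrow> bool" where
  "smooth_exhaustion \<omega> \<Omega> \<longleftrightarrow>
     (\<forall>k. C1_domain (\<omega> k) \<and> \<omega> k \<Subset> \<omega> (Suc k) \<and> \<omega> (Suc k) \<Subset> \<Omega>) \<and> (\<Union>k. \<omega> k) = \<Omega>"


section \<open>Function spaces\<close>

definition Cc :: "'a::euclidean_space set \<Rightarrow> ('a \<Rightarrow> real) set" where
  "Cc U = {\<phi>. continuous_on UNIV \<phi> \<and> compact (closure {x. \<phi> x \<noteq> 0}) \<and> closure {x. \<phi> x \<noteq> 0} \<subseteq> U}"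

definition Cc_inf :: "'a::euclidean_space set \<Rightarrow> ('a \<Rightarrow> real) set" where
  "Cc_inf U = {\<phi> \<in> Cc U. \<forall>k. Ck k \<phi>}"

definition Lp :: "'a::euclidean_space set \<Rightarrow> real \<Rightarrow> ('a \<Rightarrow> 'b::euclidean_space) set" where
  "Lp U p = {f \<in> borel_measurable (lebesgue_on U).
     integrable (lebesgue_on U) (\<lambda>x. norm (f x) powr p)}"

definition Lp_loc :: "'a::euclidean_space set \<Rightarrow> real \<Rightarrow> ('a \<Rightarrow> 'b::euclidean_space) set" where
  "Lp_loc U p = {f. \<forall>K. compact K \<and> K \<subseteq> U \<longrightarrow> f \<in> Lp K p}"

definition Linf_loc :: "'a::euclidean_space set \<Rightarrow> ('a \<Rightarrow> 'b::euclidean_space) set" where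
  "Linf_loc U = {f. \<forall>K. compact K \<and> K \<subseteq> U \<longrightarrow>
     f \<in> borel_measurable (lebesgue_on K) \<and> (\<exists>C. AE x in lebesgue_on K. norm (f x) \<le> C)}"

definition grad :: "('a::euclidean_space \<Rightarrow> real) \<Rightarrow> 'a \<Rightarrow> 'a" where
  "grad f x = (THE D. GDERIV f x :> D)"

definition weak_gradient :: "'a::euclidean_space set \<Rightarrow> ('a \<Rightarrow> real) \<Rightarrow> ('a \<Rightarrow> 'a) \<Rightarrow> bool" where
  "weak_gradient U u G \<longleftrightarrow> u \<in> Lp_loc U 1 \<and> G \<in> Lp_loc U 1 \<and>
     (\<forall>\<phi>\<in>Cc_inf U. (LINT x|lebesgue_on U. u x *\<^sub>R grad \<phi> x) = - (LINT x|lebesgue_on U. \<phi> x *\<^sub>R G x))"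

text \<open>The weak gradient is unique up to null sets; \<open>wgrad U u\<close> is some representative of it.\<close>
definition wgrad :: "'a::euclidean_space set \<Rightarrow> ('a \<Rightarrow> real) \<Rightarrow> 'a \<Rightarrow> 'a" where
  "wgrad U u = (SOME G. weak_gradient U u G)"

definition has_weak_gradient :: "'a::euclidean_space set \<Rightarrow> ('a \<Rightarrow> real) \<Rightarrow> bool" where
  "has_weak_gradient U u \<longleftrightarrow> (\<exists>G. weak_gradient U u G)"

definition W1p :: "'a::euclidean_space set \<Rightarrow> real \<Rightarrow> ('a \<Rightarrow> real) set" where
  "W1p U p = {u. has_weak_gradient U u \<and> u \<in> Lp U p \<and> wgrad U u \<in> Lp U p}"

definition W1p_loc :: "'a::euclidean_space set \<Rightarrow> real \<Rightarrow> ('a \<Rightarrow> real) set" where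
  "W1p_loc U p = {u. has_weak_gradient U u \<and> u \<in> Lp_loc U p \<and> wgrad U u \<in> Lp_loc U p}"

definition W1inf_loc :: "'a::euclidean_space set \<Rightarrow> ('a \<Rightarrow> real) set" where
  "W1inf_loc U = {u. has_weak_gradient U u \<and> u \<in> Linf_loc U \<and> wgrad U u \<in> Linf_loc U}"


section \<open>Morrey spaces\<close>

definition morrey_exponent :: "real \<Rightarrow> real \<Rightarrow> real \<Rightarrow> bool" where
  "morrey_exponent n p q \<longleftrightarrow> (p < n \<longrightarrow> q > n / p) \<and> (p = n \<longrightarrow> q > n) \<and> (p > n \<longrightarrow> q = 1)"

text \<open>Only used for \<open>p \<le> n\<close>; the first weight is for \<open>p < n\<close>, the second one for \<open>p = n\<close>.\<close>
definition morrey_norm ::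
    "real \<Rightarrow> real \<Rightarrow> 'a::euclidean_space set \<Rightarrow> ('a \<Rightarrow> real) \<Rightarrow> ennreal" where
  "morrey_norm p q \<omega> f = (let n = real DIM('a) in
     SUP (y, r) \<in> \<omega> \<times> {0<..<diameter \<omega>}.
       ennreal (if p < n then r powr (- (n / (q / (q - 1))))
                else ln (diameter \<omega> / r) powr (q / (n / (n - 1))))
       * (\<integral>\<^sup>+x\<in>\<omega> \<inter> ball y r. ennreal \<bar>f x\<bar> \<partial>lebesgue))"

definition morrey :: "real \<Rightarrow> real \<Rightarrow> 'a::euclidean_space set \<Rightarrow> ('a \<Rightarrow> real) set" where
  "morrey p q \<omega> = (if p > real DIM('a) then Lp \<omega> 1
     else {f \<in> Lp_loc \<omega> 1. morrey_norm p q \<omega> f < \<infinity>})"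

definition morrey_loc :: "real \<Rightarrow> real \<Rightarrow> 'a::euclidean_space set \<Rightarrow> ('a \<Rightarrow> real) set" where
  "morrey_loc p q \<Omega> = (\<Inter>\<omega>\<in>{\<omega>. is_domain \<omega> \<and> \<omega> \<Subset> \<Omega>}. morrey p q \<omega>)"


section \<open>Norm families\<close>

definition is_norm :: "('a::euclidean_space \<Rightarrow> real) \<Rightarrow> bool" where
  "is_norm N \<longleftrightarrow> (\<forall>\<xi>. 0 \<le> N \<xi>) \<and> (\<forall>\<xi>. N \<xi> = 0 \<longleftrightarrow> \<xi> = 0) \<and>
     (\<forall>c \<xi>. N (c *\<^sub>R \<xi>) = \<bar>c\<bar> * N \<xi>) \<and> (\<forall>\<xi> \<eta>. N (\<xi> + \<eta>) \<le> N \<xi> + N \<eta>)"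

definition convexity_modulus :: "('a::euclidean_space \<Rightarrow> real) \<Rightarrow> real \<Rightarrow> ereal" where
  "convexity_modulus N \<epsilon> =
     Inf {ereal (1 - N ((\<xi> + \<eta>) /\<^sub>R 2)) |\<xi> \<eta>. N \<xi> = 1 \<and> N \<eta> = 1 \<and> N (\<xi> - \<eta>) \<ge> \<epsilon>}"

definition uniformly_convex :: "('a::euclidean_space \<Rightarrow> real) \<Rightarrow> bool" where
  "uniformly_convex N \<longleftrightarrow> (\<forall>\<epsilon>\<in>{0<..2}. convexity_modulus N \<epsilon> > 0)"

definition admissible_norm_family ::
    "'a::euclidean_space set \<Rightarrow> ('a \<Rightarrow> 'a \<Rightarrow> real) \<Rightarrow> bool" where
  "admissible_norm_family \<Omega> H \<longleftrightarrow>
     (AE x in lebesgue_on \<Omega>. is_norm (H x)) \<and>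
     (\<forall>\<xi>. (\<lambda>x. H x \<xi>) \<in> borel_measurable (lebesgue_on \<Omega>)) \<and>
     (\<forall>\<omega>. is_domain \<omega> \<and> \<omega> \<Subset> \<Omega> \<longrightarrow> (\<exists>\<kappa> \<nu>. 0 < \<kappa> \<and> \<kappa> \<le> \<nu> \<and>
        (AE x in lebesgue_on \<omega>. \<forall>\<xi>. \<kappa> * norm \<xi> \<le> H x \<xi> \<and> H x \<xi> \<le> \<nu> * norm \<xi>))) \<and>
     (AE x in lebesgue_on \<Omega>. uniformly_convex (H x) \<and> (\<forall>\<xi>. \<xi> \<noteq> 0 \<longrightarrow> H x differentiable (at \<xi>)))"

definition commonly_uniformly_convex ::
    "'a::euclidean_space set \<Rightarrow> ('a \<Rightarrow> 'a \<Rightarrow> real) \<Rightarrow> bool" where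
  "commonly_uniformly_convex \<Omega> H \<longleftrightarrow> (\<exists>N. N \<subseteq> \<Omega> \<and> N \<in> null_sets lebesgue \<and>
     (\<forall>\<epsilon>\<in>{0<..2}. (INF x\<in>\<Omega> - N. convexity_modulus (H x) \<epsilon>) > 0))"

definition Aop ::
    "real \<Rightarrow> ('a::euclidean_space \<Rightarrow> 'a \<Rightarrow> real) \<Rightarrow> 'a \<Rightarrow> 'a \<Rightarrow> 'a" where
  "Aop p H x \<xi> = grad (\<lambda>\<zeta>. 1 / p * H x \<zeta> powr p) \<xi>"

text \<open>
  The exponent function \<open>d\<close> is an argument, since the gradient regularity property refers to it, too.
\<close>
definition bregman_lower_bound ::
    "real \<Rightarrow> 'a::euclidean_space set \<Rightarrow> ('a \<Rightarrow> 'a \<Rightarrow> real) \<Rightarrow> ('a \<Rightarrow> real) \<Rightarrow> bool" where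
  "bregman_lower_bound p \<Omega> H d \<longleftrightarrow>
     (\<forall>x\<in>\<Omega>. 2 \<le> d x) \<and> d \<in> borel_measurable (lebesgue_on \<Omega>) \<and>
     (\<forall>K. compact K \<and> K \<subseteq> \<Omega> \<longrightarrow> bounded (d ` K)) \<and>
     (\<forall>\<omega>. is_domain \<omega> \<and> \<omega> \<Subset> \<Omega> \<longrightarrow> (\<exists>C>0. AE x in lebesgue_on \<omega>. \<forall>\<xi> \<eta>.
        H x (\<xi> + \<eta>) powr p - H x \<xi> powr p - p * (Aop p H x \<xi> \<bullet> \<eta>)
          \<ge> C * H x \<eta> powr d x * (H x \<eta> + H x \<xi>) powr (p - d x)))"


section \<open>The functional and the equation\<close>

definition Q :: "real \<Rightarrow> ('a::euclidean_space \<Rightarrow> 'a \<Rightarrow> real) \<Rightarrow> ('a \<Rightarrow> real) \<Rightarrow>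
    ('a \<Rightarrow> real) \<Rightarrow> 'a set \<Rightarrow> real" where
  "Q p H V \<phi> U = (LINT x|lebesgue_on U. H x (wgrad U \<phi> x) powr p + V x * \<bar>\<phi> x\<bar> powr p)"

definition weighted_mass :: "real \<Rightarrow> ('a::euclidean_space \<Rightarrow> real) \<Rightarrow> ('a \<Rightarrow> real) \<Rightarrow> 'a set \<Rightarrow> real"
  where "weighted_mass p g \<phi> U = (LINT x|lebesgue_on U. \<bar>g x\<bar> * \<bar>\<phi> x\<bar> powr p)"

text \<open>
  For \<open>V \<in> M\<^sup>q\<^sub>l\<^sub>o\<^sub>c(p; U)\<close> the two integrability conditions hold for every \<open>v \<in> W\<^sup>1\<^sup>,\<^sup>p\<^sub>l\<^sub>o\<^sub>c(U)\<close>; they only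
  rule out that the library's default value \<open>0\<close> of an undefined integral is used.
\<close>
definition is_solution :: "real \<Rightarrow> ('a::euclidean_space \<Rightarrow> 'a \<Rightarrow> real) \<Rightarrow> ('a \<Rightarrow> real) \<Rightarrow>
    ('a \<Rightarrow> real) \<Rightarrow> 'a set \<Rightarrow> ('a \<Rightarrow> real) \<Rightarrow> bool" where
  "is_solution p H V f U v \<longleftrightarrow> v \<in> W1p_loc U p \<and>
     (\<forall>\<phi>\<in>Cc_inf U.
        integrable (lebesgue_on U) (\<lambda>x. Aop p H x (wgrad U v x) \<bullet> grad \<phi> x) \<and>
        integrable (lebesgue_on U) (\<lambda>x. V x * \<bar>v x\<bar> powr (p - 2) * v x * \<phi> x) \<and>
        (LINT x|lebesgue_on U. Aop p H x (wgrad U v x) \<bullet> grad \<phi> x)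
          + (LINT x|lebesgue_on U. V x * \<bar>v x\<bar> powr (p - 2) * v x * \<phi> x)
          = (LINT x|lebesgue_on U. f x * \<phi> x))"

definition positive_solution :: "real \<Rightarrow> ('a::euclidean_space \<Rightarrow> 'a \<Rightarrow> real) \<Rightarrow> ('a \<Rightarrow> real) \<Rightarrow>
    ('a \<Rightarrow> real) \<Rightarrow> 'a set \<Rightarrow> ('a \<Rightarrow> real) \<Rightarrow> bool" where
  "positive_solution p H V f U v \<longleftrightarrow> is_solution p H V f U v \<and> (AE x in lebesgue_on U. v x > 0)"

definition gradient_regularity :: "real \<Rightarrow> 'a::euclidean_space set \<Rightarrow> ('a \<Rightarrow> 'a \<Rightarrow> real) \<Rightarrow>
    ('a \<Rightarrow> real) \<Rightarrow> ('a \<Rightarrow> real) \<Rightarrow> bool" where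
  "gradient_regularity p \<Omega> H d V \<longleftrightarrow> (emeasure lebesgue {x \<in> \<Omega>. p < d x} > 0 \<longrightarrow>
     (\<forall>\<Omega>' W v. is_domain \<Omega>' \<and> \<Omega>' \<subseteq> \<Omega> \<and> W \<in> Linf_loc \<Omega>' \<and>
        positive_solution p H (\<lambda>x. V x - W x) (\<lambda>_. 0) \<Omega>' v \<longrightarrow> v \<in> W1inf_loc \<Omega>') \<and>
     (\<forall>f v. f \<in> Cc_inf \<Omega> \<and> (\<forall>x. 0 \<le> f x) \<and> f \<noteq> (\<lambda>_. 0) \<and>
        positive_solution p H V f \<Omega> v \<longrightarrow> v \<in> W1inf_loc \<Omega>))"


section \<open>Hardy-weights and subcriticality\<close>

definition hardy_weights :: "real \<Rightarrow> ('a::euclidean_space \<Rightarrow> 'a \<Rightarrow> real) \<Rightarrow> ('a \<Rightarrow> real) \<Rightarrow>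
    'a set \<Rightarrow> ('a \<Rightarrow> real) set" where
  "hardy_weights p H V U = {g \<in> Lp_loc U 1.
     \<exists>C>0. \<forall>\<phi>\<in>Cc_inf U. Q p H V \<phi> U \<ge> C * weighted_mass p g \<phi> U}"

definition nonzero_on :: "'a::euclidean_space set \<Rightarrow> ('a \<Rightarrow> real) \<Rightarrow> bool" where
  "nonzero_on U g \<longleftrightarrow> \<not> (AE x in lebesgue_on U. g x = 0)"

definition subcritical :: "real \<Rightarrow> ('a::euclidean_space \<Rightarrow> 'a \<Rightarrow> real) \<Rightarrow> ('a \<Rightarrow> real) \<Rightarrow>
    'a set \<Rightarrow> bool" where
  "subcritical p H V U \<longleftrightarrow> (\<forall>\<phi>\<in>Cc_inf U. Q p H V \<phi> U \<ge> 0) \<and>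
     (\<exists>g\<in>hardy_weights p H V U. nonzero_on U g)"


section \<open>The generalised Sobolev spaces\<close>

text \<open>A choice \<open>w U\<close> of a positive continuous Hardy-weight for each subdomain \<open>U\<close> of \<open>\<Omega>\<close>.\<close>
definition weight_choice :: "real \<Rightarrow> ('a::euclidean_space \<Rightarrow> 'a \<Rightarrow> real) \<Rightarrow> ('a \<Rightarrow> real) \<Rightarrow>
    'a set \<Rightarrow> ('a set \<Rightarrow> 'a \<Rightarrow> real) \<Rightarrow> bool" where
  "weight_choice p H V \<Omega> w \<longleftrightarrow> (\<forall>U. is_domain U \<and> U \<subseteq> \<Omega> \<and> subcritical p H V U \<longrightarrow>
     continuous_on U (w U) \<and> (\<forall>x\<in>U. w U x > 0) \<and> w U \<in> hardy_weights p H V U)"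

definition Wt_density :: "real \<Rightarrow> ('a::euclidean_space \<Rightarrow> 'a \<Rightarrow> real) \<Rightarrow> ('a \<Rightarrow> real) \<Rightarrow>
    ('a set \<Rightarrow> 'a \<Rightarrow> real) \<Rightarrow> 'a set \<Rightarrow> ('a \<Rightarrow> real) \<Rightarrow> 'a \<Rightarrow> real" where
  "Wt_density p H V w U u x =
     H x (wgrad U u x) powr p + (\<bar>V x\<bar> + w U x) * \<bar>u x\<bar> powr p"

definition Wt :: "real \<Rightarrow> ('a::euclidean_space \<Rightarrow> 'a \<Rightarrow> real) \<Rightarrow> ('a \<Rightarrow> real) \<Rightarrow>
    ('a set \<Rightarrow> 'a \<Rightarrow> real) \<Rightarrow> 'a set \<Rightarrow> ('a \<Rightarrow> real) set" where
  "Wt p H V w U = {u \<in> borel_measurable (lebesgue_on U).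
     integrable (lebesgue_on U) (\<lambda>x. (\<bar>V x\<bar> + w U x) * \<bar>u x\<bar> powr p) \<and>
     has_weak_gradient U u \<and> integrable (lebesgue_on U) (Wt_density p H V w U u)}"

definition Wt_norm :: "real \<Rightarrow> ('a::euclidean_space \<Rightarrow> 'a \<Rightarrow> real) \<Rightarrow> ('a \<Rightarrow> real) \<Rightarrow>
    ('a set \<Rightarrow> 'a \<Rightarrow> real) \<Rightarrow> 'a set \<Rightarrow> ('a \<Rightarrow> real) \<Rightarrow> real" where
  "Wt_norm p H V w U u = (LINT x|lebesgue_on U. Wt_density p H V w U u x) powr (1 / p)"

definition Wt0 :: "real \<Rightarrow> ('a::euclidean_space \<Rightarrow> 'a \<Rightarrow> real) \<Rightarrow> ('a \<Rightarrow> real) \<Rightarrow>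
    ('a set \<Rightarrow> 'a \<Rightarrow> real) \<Rightarrow> 'a set \<Rightarrow> ('a \<Rightarrow> real) set" where
  "Wt0 p H V w U = {u \<in> Wt p H V w U.
     \<exists>\<phi>. (\<forall>k::nat. \<phi> k \<in> W1p U p \<inter> Cc U) \<and>
       (\<lambda>k. Wt_norm p H V w U (\<lambda>x. u x - \<phi> k x)) \<longlonglongrightarrow> 0}"

text \<open>Bounded linear functionals; by boundedness they respect equality a.e.\<close>
definition Wt0_dual :: "real \<Rightarrow> ('a::euclidean_space \<Rightarrow> 'a \<Rightarrow> real) \<Rightarrow> ('a \<Rightarrow> real) \<Rightarrow>
    ('a set \<Rightarrow> 'a \<Rightarrow> real) \<Rightarrow> 'a set \<Rightarrow> (('a \<Rightarrow> real) \<Rightarrow> real) set" where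
  "Wt0_dual p H V w U = {l.
     (\<forall>u\<in>Wt0 p H V w U. \<forall>v\<in>Wt0 p H V w U. l (\<lambda>x. u x + v x) = l u + l v) \<and>
     (\<forall>c. \<forall>u\<in>Wt0 p H V w U. l (\<lambda>x. c * u x) = c * l u) \<and>
     (\<exists>C. \<forall>u\<in>Wt0 p H V w U. \<bar>l u\<bar> \<le> C * Wt_norm p H V w U u)}"

definition Wt0_weakly_converges :: "real \<Rightarrow> ('a::euclidean_space \<Rightarrow> 'a \<Rightarrow> real) \<Rightarrow> ('a \<Rightarrow> real) \<Rightarrow>
    ('a set \<Rightarrow> 'a \<Rightarrow> real) \<Rightarrow> 'a set \<Rightarrow> (nat \<Rightarrow> 'a \<Rightarrow> real) \<Rightarrow> ('a \<Rightarrow> real) \<Rightarrow> bool" where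
  "Wt0_weakly_converges p H V w U u v \<longleftrightarrow>
     (\<forall>k. u k \<in> Wt0 p H V w U) \<and> v \<in> Wt0 p H V w U \<and>
     (\<forall>l\<in>Wt0_dual p H V w U. (\<lambda>k. l (u k)) \<longlonglongrightarrow> l v)"

definition neg_part :: "('a \<Rightarrow> real) \<Rightarrow> 'a \<Rightarrow> real" where
  "neg_part V x = - min (V x) 0"

definition neg_part_compactness :: "real \<Rightarrow> ('a::euclidean_space \<Rightarrow> 'a \<Rightarrow> real) \<Rightarrow> ('a \<Rightarrow> real) \<Rightarrow>
    ('a set \<Rightarrow> 'a \<Rightarrow> real) \<Rightarrow> 'a set \<Rightarrow> bool" where
  "neg_part_compactness p H V w \<Omega> \<longleftrightarrow>
     (\<forall>u v. Wt0_weakly_converges p H V w \<Omega> u v \<longrightarrow>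
        (\<exists>s. strict_mono s \<and>
          (\<lambda>k. LINT x|lebesgue_on \<Omega>. neg_part V x * \<bar>u (s k) x\<bar> powr p)
            \<longlonglongrightarrow> (LINT x|lebesgue_on \<Omega>. neg_part V x * \<bar>v x\<bar> powr p)) \<and>
        (\<forall>\<psi>\<in>Cc_inf \<Omega>. \<exists>s. strict_mono s \<and>
          (\<lambda>k. LINT x|lebesgue_on \<Omega>. \<psi> x * neg_part V x * \<bar>u (s k) x\<bar> powr p)
            \<longlonglongrightarrow> (LINT x|lebesgue_on \<Omega>. \<psi> x * neg_part V x * \<bar>v x\<bar> powr p)))"


section \<open>The best constants\<close>

definition S_const :: "real \<Rightarrow> ('a::euclidean_space \<Rightarrow> 'a \<Rightarrow> real) \<Rightarrow> ('a \<Rightarrow> real) \<Rightarrow>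
    'a set \<Rightarrow> ('a \<Rightarrow> real) \<Rightarrow> ereal" where
  "S_const p H V \<Omega> g = Inf {ereal (Q p H V \<phi> \<Omega> / weighted_mass p g \<phi> \<Omega>) |\<phi>.
     \<phi> \<in> W1p \<Omega> p \<inter> Cc \<Omega> \<and> weighted_mass p g \<phi> \<Omega> > 0}"

definition S_on :: "real \<Rightarrow> ('a::euclidean_space \<Rightarrow> 'a \<Rightarrow> real) \<Rightarrow> ('a \<Rightarrow> real) \<Rightarrow>
    ('a set \<Rightarrow> 'a \<Rightarrow> real) \<Rightarrow> ('a \<Rightarrow> real) \<Rightarrow> 'a set \<Rightarrow> ereal" where
  "S_on p H V w g U = Inf {ereal (Q p H V \<phi> U) |\<phi>.
     \<phi> \<in> Wt0 p H V w U \<and> weighted_mass p g \<phi> U = 1}"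

definition S_infinity :: "real \<Rightarrow> ('a::euclidean_space \<Rightarrow> 'a \<Rightarrow> real) \<Rightarrow> ('a \<Rightarrow> real) \<Rightarrow>
    ('a set \<Rightarrow> 'a \<Rightarrow> real) \<Rightarrow> 'a set \<Rightarrow> (nat \<Rightarrow> 'a set) \<Rightarrow> ('a \<Rightarrow> real) \<Rightarrow> ereal" where
  "S_infinity p H V w \<Omega> \<omega> g = lim (\<lambda>i. S_on p H V w g (\<Omega> - closure (\<omega> i)))"

definition S_local :: "real \<Rightarrow> ('a::euclidean_space \<Rightarrow> 'a \<Rightarrow> real) \<Rightarrow> ('a \<Rightarrow> real) \<Rightarrow>
    ('a set \<Rightarrow> 'a \<Rightarrow> real) \<Rightarrow> 'a set \<Rightarrow> ('a \<Rightarrow> real) \<Rightarrow> 'a \<Rightarrow> ereal" where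
  "S_local p H V w \<Omega> g x = Lim (at_right 0) (\<lambda>r. S_on p H V w g (\<Omega> \<inter> ball x r))"

definition S_star :: "real \<Rightarrow> ('a::euclidean_space \<Rightarrow> 'a \<Rightarrow> real) \<Rightarrow> ('a \<Rightarrow> real) \<Rightarrow>
    ('a set \<Rightarrow> 'a \<Rightarrow> real) \<Rightarrow> 'a set \<Rightarrow> ('a \<Rightarrow> real) \<Rightarrow> ereal" where
  "S_star p H V w \<Omega> g = (INF x\<in>closure \<Omega>. S_local p H V w \<Omega> g x)"

definition Sigma_set :: "real \<Rightarrow> ('a::euclidean_space \<Rightarrow> 'a \<Rightarrow> real) \<Rightarrow> ('a \<Rightarrow> real) \<Rightarrow>
    ('a set \<Rightarrow> 'a \<Rightarrow> real) \<Rightarrow> 'a set \<Rightarrow> ('a \<Rightarrow> real) \<Rightarrow> 'a set" where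
  "Sigma_set p H V w \<Omega> g = {x \<in> closure \<Omega>. S_local p H V w \<Omega> g x < \<infinity>}"

end

theory Submission
  imports Defs "HOL-Complex_Analysis.Great_Picard" "HOL-Library.Diagonal_Subsequence"
begin

text \<open>
  Let \<open>S = S\<^sub>g\<close> and let \<open>u\<^sub>k\<close> be a minimising sequence of test functions with mass
  \<open>\<integral> |g| |u\<^sub>k|\<^sup>p = 1\<close>. The compactness of \<open>V\<^sup>-\<close> makes the norm of the energy space controlled by \<open>Q\<close>, so
  \<open>u\<^sub>k\<close> is bounded. By common uniform convexity the energy space is uniformly convex; convex
  combinations of a bounded, locally convergent sequence then converge strongly, which gives a weak
  limit \<open>\<phi>\<close> and lower semicontinuity, and Rellich's theorem gives convergence in \<open>L\<^sup>p\<^sub>l\<^sub>o\<^sub>c\<close>. Write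
  \<open>u\<^sub>k = a\<^sub>k + v\<^sub>k\<close> with test functions \<open>a\<^sub>k \<rightarrow> \<phi>\<close> in the energy space, so that \<open>v\<^sub>k \<rightarrow> 0\<close> in \<open>L\<^sup>p\<^sub>l\<^sub>o\<^sub>c\<close>.

  Choose \<open>c > S\<close> below \<open>S\<^sup>*\<close> and \<open>S\<^sup>\<infinity>\<close>, and a partition \<open>\<Sum> \<psi>\<^sub>j\<^sup>p = 1\<close> into a piece near infinity, small balls
  centred at the closure of \<open>\<Sigma>\<^sub>g\<close>, and small balls elsewhere. As \<open>v\<^sub>k \<rightarrow> 0\<close> in \<open>L\<^sup>p\<^sub>l\<^sub>o\<^sub>c\<close>, cutting off costs nothing in
  the limit. On the last kind of balls the best constant is as large as desired, so \<open>v\<^sub>k\<close> carries almost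
  no mass there; on the other pieces the constant exceeds \<open>c\<close>, and \<open>\<phi>\<close> has almost no energy there because
  \<open>\<Sigma>\<^sub>g\<close> is null up to closure. Adding up gives \<open>c (1 - t) \<le> S - Q[\<phi>]\<close>, where \<open>t \<le> 1\<close> is the mass of \<open>\<phi>\<close>. Since
  \<open>S t \<le> Q[\<phi>]\<close> and \<open>S < c\<close>, it follows that \<open>t = 1\<close> and \<open>Q[\<phi>] = S\<close>.
\<close>

section \<open>Inequalities for powers and norms\<close>

text \<open>The obstacle is that p-th powers do not split. No pointwise limits of the gradients of
  the minimising sequence are used, so the energy of \<phi> + v is not separated into those of
  \<phi> and v. What remains is (x + y)^p \<le> (1 + e) x^p + C(e) y^p, useful only where y is
  negligible, and this dictates the partition: where the best constant merely exceeds c, \<phi> is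
  made negligible and the sequence is compared with v; elsewhere the mass of v is made negligible by
  a huge constant R and the sequence is compared with \<phi>. The choices are made in the order e,
  C(e), the smallness of \<phi> and R, the partition, the index k. Moreover Q is not convex. It is
  treated as the difference of two convex functionals, belonging to V^+ and V^-: lower
  semicontinuity serves the former, the compactness hypothesis the latter. Finally, weak gradients
  and weights are chosen separately on every subdomain. All best constants are therefore rewritten
  as infima over smooth test functions, evaluated in \<Omega>.\<close>

lemma convex_on_powr_atLeast:
  assumes "1 \<le> p"
  shows "convex_on {0..} (\<lambda>x::real. x powr p)"
proof (rule convex_onI)
  fix t x y :: real
  assume t: "0 < t" "t < 1" and xy: "x \<in> {0..}" "y \<in> {0..}"
  \<comment> \<open>If one endpoint is 0, homogeneity reduces convexity to this bound for the
    weights t and 1 - t; the remaining case is convexity on the positive reals.\<close>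
  have le: "s powr p \<le> s" if "0 < s" "s < 1" for s :: real
    using powr_mono_both[of 1 p s 1] powr_mono'[of 1 p s] that assms by simp
  show "((1 - t) *\<^sub>R x + t *\<^sub>R y) powr p \<le> (1 - t) * x powr p + t * y powr p"
  proof (cases "x = 0 \<or> y = 0")
    case True
    then show ?thesis
      using t xy assms le[of t] le[of "1 - t"] by (auto simp: powr_mult intro!: mult_right_mono)
  next
    case False
    then show ?thesis
      using convex_onD[OF powr_convex[OF assms], of t x y] t xy by auto
  qed
qed simp

text \<open>Convexity of the power at the points a / (1 - l) and b / l with weights 1 - l and l. As
  l tends to 0 the first constant tends to 1, which makes this the substitute for a triangle
  inequality when b is small.\<close>

lemma powr_add_le:
  fixes a b l p :: real
  assumes "1 \<le> p" "0 < l" "l < 1" "0 \<le> a" "0 \<le> b"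
  shows "(a + b) powr p \<le> (1 - l) powr (1 - p) * a powr p + l powr (1 - p) * b powr p"
proof -
  have cvx: "convex_on {0..} (\<lambda>x::real. x powr p)"
    using assms by (intro convex_on_powr_atLeast)
  have "((1 - l) *\<^sub>R (a / (1 - l)) + l *\<^sub>R (b / l)) powr p
      \<le> (1 - l) * (a / (1 - l)) powr p + l * (b / l) powr p"
    by (rule convex_onD[OF cvx]) (use assms in auto)
  moreover have "(1 - l) *\<^sub>R (a / (1 - l)) + l *\<^sub>R (b / l) = a + b"
    using assms by simp
  moreover have "t * (c / t) powr p = t powr (1 - p) * c powr p" if "0 < t" "0 \<le> c" for t c :: real
    using that by (simp add: powr_divide powr_diff)
  ultimately show ?thesis using assms by simp
qed

text \<open>Write c^p = c * c^(p - 1) and enlarge both factors c^(p - 1) to (a + b)^(p - 1).\<close>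

lemma powr_superadd:
  fixes a b p :: real
  assumes "1 \<le> p" "0 \<le> a" "0 \<le> b"
  shows "a powr p + b powr p \<le> (a + b) powr p"
proof (cases "a + b = 0")
  case False
  then have pos: "0 < a + b" using assms by simp
  have split: "c powr p = c * c powr (p - 1)" if "0 \<le> c" for c :: real
    using that by (cases "c = 0") (auto simp: powr_diff)
  have "a powr p \<le> a * (a + b) powr (p - 1)" "b powr p \<le> b * (a + b) powr (p - 1)"
    using assms by (auto simp: split intro!: mult_left_mono powr_mono2)
  then have "a powr p + b powr p \<le> (a + b) * (a + b) powr (p - 1)"
    by (simp add: algebra_simps)
  then show ?thesis using split[of "a + b"] pos by simp
qed (use assms in \<open>auto simp: add_nonneg_eq_0_iff\<close>)

lemma powr_add_le_two:
  fixes a b p :: real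
  assumes "1 \<le> p" "0 \<le> a" "0 \<le> b"
  shows "(a + b) powr p \<le> 2 powr p * (a powr p + b powr p)"
proof -
  have "(a + b) powr p \<le> (2 * max a b) powr p"
    using assms by (intro powr_mono2) auto
  also have "\<dots> = 2 powr p * max a b powr p" using assms by (simp add: powr_mult)
  also have "max a b powr p \<le> a powr p + b powr p"
    by (simp add: max_def)
  finally show ?thesis by simp
qed

text \<open>Either t \<le> e, or t^(1 - p) \<le> e^(1 - p). Integrated over a set of finite measure,
  it bounds an L^1 norm by a small constant plus a multiple of a p-energy.\<close>

lemma le_eps_powr:
  fixes t e p :: real
  assumes "1 \<le> p" "0 \<le> t" "0 < e"
  shows "t \<le> e + e powr (1 - p) * t powr p"
proof (cases "t \<le> e")
  case False
  then have "t = t powr p * t powr (1 - p)"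
    using assms by (simp flip: powr_add)
  also have "\<dots> \<le> t powr p * e powr (1 - p)"
    using assms False by (intro mult_left_mono powr_mono2') auto
  finally show ?thesis using assms by (simp add: mult.commute)
qed (use assms in \<open>auto intro: add_increasing2\<close>)

text \<open>The gain in midpoint convexity of the p-th power between the values 1 and s; it is what
  two vectors of different length contribute to uniform convexity.\<close>

definition powr_gap :: "real \<Rightarrow> real \<Rightarrow> real" where
  "powr_gap p s = (1 + s powr p) / 2 - ((1 + s) / 2) powr p"

text \<open>The derivative is p / 2 times s^(p - 1) - ((1 + s) / 2)^(p - 1), negative on (0, 1), and
  the gap is 0 at s = 1.\<close>

lemma powr_gap_pos_antimono:
  assumes "1 < p" "0 \<le> r" "r < 1"
  shows "0 < powr_gap p r" and "0 \<le> s \<Longrightarrow> s \<le> r \<Longrightarrow> powr_gap p r \<le> powr_gap p s"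
proof -
  have dec: "powr_gap p b < powr_gap p a" if "0 \<le> a" "a < b" "b \<le> 1" for a b
  proof (rule DERIV_neg_imp_decreasing_open[OF that(2)])
    fix x assume x: "a < x" "x < b"
    have "(powr_gap p has_real_derivative
            (p * x powr (p - 1)) / 2 - p * ((1 + x) / 2) powr (p - 1) * (1 / 2)) (at x)"
      unfolding powr_gap_def
      by (rule derivative_eq_intros refl | use x that assms in force)+
    moreover have "x powr (p - 1) < ((1 + x) / 2) powr (p - 1)"
      using x that assms by (intro powr_less_mono2) auto
    ultimately show "\<exists>y. (powr_gap p has_real_derivative y) (at x) \<and> y < 0"
      using assms by (intro exI conjI) (assumption, simp)
  next
    show "continuous_on {a..b} (powr_gap p)"
      unfolding powr_gap_def using that assms
      by (intro continuous_intros continuous_on_powr') auto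
  qed
  show "0 < powr_gap p r"
    using dec[of r 1] assms by (simp add: powr_gap_def)
  show "powr_gap p r \<le> powr_gap p s" if "0 \<le> s" "s \<le> r"
    using dec[of s r] that assms by (cases "s = r") auto
qed

section \<open>Uniform convexity of p-th powers of norms\<close>

lemma is_norm_mid_powr_le:
  assumes "1 \<le> p" "is_norm N"
  shows "N ((x + y) /\<^sub>R 2) powr p \<le> (N x powr p + N y powr p) / 2"
proof -
  have "N ((x + y) /\<^sub>R 2) = N (x + y) / 2" using assms by (simp add: is_norm_def)
  also have "\<dots> \<le> (N x + N y) / 2" using assms by (simp add: is_norm_def)
  finally have "N ((x + y) /\<^sub>R 2) powr p \<le> ((N x + N y) / 2) powr p"
    using assms by (intro powr_mono2) (auto simp: is_norm_def)
  also have "\<dots> \<le> (N x powr p + N y powr p) / 2"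
  proof -
    have "convex_on {0..} (\<lambda>x::real. x powr p)"
      using assms by (intro convex_on_powr_atLeast)
    from convex_onD[OF this, of "1/2" "N x" "N y"] show ?thesis
      using assms by (simp add: is_norm_def field_simps)
  qed
  finally show ?thesis .
qed

text \<open>Says that the modulus of convexity at \<open>e\<close> is at least \<delta>, without an
  infimum, so that one real number \<delta> can serve almost all the norms
  \<open>H x\<close>.\<close>

definition convexity_bound :: "('a::euclidean_space \<Rightarrow> real) \<Rightarrow> real \<Rightarrow> real \<Rightarrow> bool" where
  "convexity_bound N e \<delta> \<longleftrightarrow>
     (\<forall>x y. N x = 1 \<longrightarrow> N y = 1 \<longrightarrow> N (x - y) \<ge> e \<longrightarrow> N ((x + y) /\<^sub>R 2) \<le> 1 - \<delta>)"

lemma is_norm_simps: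
  assumes "is_norm N"
  shows "0 \<le> N x" "N (c *\<^sub>R x) = \<bar>c\<bar> * N x" "N (x + y) \<le> N x + N y" "N x = 0 \<longleftrightarrow> x = 0"
    "N (- x) = N x" "N (x - y) \<le> N x + N y" "N (x - y) = N (y - x)"
proof -
  show *: "0 \<le> N x" "N (c *\<^sub>R x) = \<bar>c\<bar> * N x" "N (x + y) \<le> N x + N y" "N x = 0 \<longleftrightarrow> x = 0"
    for x y c using assms by (auto simp: is_norm_def)
  show m: "N (- x) = N x" for x using *(2)[of "- 1" x] by simp
  show "N (x - y) \<le> N x + N y" using *(3)[of x "- y"] m[of y] by simp
  show "N (x - y) = N (y - x)" using m[of "x - y"] by simp
qed

text \<open>If N y stays below 1 by e / 4, the different lengths already give a gap. Otherwise y is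
  close to its projection z to the unit sphere, x and z are still e / 2 apart, and the convexity
  bound applies to them.\<close>

lemma convexity_bound_gap:
  assumes p: "1 < p" and N: "is_norm N" and e: "0 < e" "e \<le> 1" and d: "0 < \<delta>"
    and cb: "convexity_bound N (e / 2) \<delta>"
    and x: "N x = 1" and y: "N y \<le> 1" and xy: "e \<le> N (x - y)"
  shows "min (powr_gap p (1 - e / 4)) ((\<delta> / 2) powr p) \<le> (1 + N y powr p) / 2 - N ((x + y) /\<^sub>R 2) powr p"
proof -
  note Ns = is_norm_simps[OF N]
  define s where "s = N y"
  have s: "0 \<le> s" "s \<le> 1" using y Ns(1)[of y] by (auto simp: s_def)
  show ?thesis
  proof (cases "s \<le> 1 - e / 4")
    case True
    have "N ((x + y) /\<^sub>R 2) \<le> (1 + s) / 2"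
      using Ns(3)[of x y] x by (simp add: Ns(2) s_def)
    then have "N ((x + y) /\<^sub>R 2) powr p \<le> ((1 + s) / 2) powr p"
      using p by (intro powr_mono2) (auto simp: Ns)
    moreover have "powr_gap p (1 - e / 4) \<le> powr_gap p s"
      using powr_gap_pos_antimono(2)[OF p, of "1 - e / 4" s] e True s by auto
    ultimately show ?thesis unfolding powr_gap_def s_def by simp
  next
    case False
    with e have s': "3 / 4 \<le> s" by simp
    define z where "z = y /\<^sub>R s"
    have Nz: "N z = 1" using s' by (simp add: z_def Ns(2) s_def[symmetric])
    have "N (y - z) = 1 - s"
    proof -
      have "y - z = (s - 1) *\<^sub>R z" using s' by (simp add: z_def algebra_simps)
      then show ?thesis using Nz s by (simp add: Ns(2))
    qed
    moreover have "N (x - y) \<le> N (x - z) + N (z - y)" using Ns(3)[of "x - z" "z - y"] by simp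
    ultimately have "e / 2 \<le> N (x - z)" using xy False Ns(7)[of y z] e by simp
    then have mid: "N ((x + z) /\<^sub>R 2) \<le> 1 - \<delta>"
      using cb x Nz by (simp add: convexity_bound_def)
    \<comment> \<open>The midpoint of x and y is the midpoint of x and z, scaled by s, plus a small
      multiple of x. So the deficit \<delta> survives with the factor s \<ge> 3 / 4.\<close>
    have "(x + y) /\<^sub>R 2 = s *\<^sub>R ((x + z) /\<^sub>R 2) + ((1 - s) / 2) *\<^sub>R x"
      using s' by (simp add: z_def algebra_simps flip: scaleR_add_left) (simp add: diff_divide_distrib field_simps flip: scaleR_add_left)
    then have "N ((x + y) /\<^sub>R 2) \<le> N (s *\<^sub>R ((x + z) /\<^sub>R 2)) + N (((1 - s) / 2) *\<^sub>R x)"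
      using Ns(3) by metis
    also have "\<dots> = s * N ((x + z) /\<^sub>R 2) + (1 - s) / 2"
      unfolding Ns(2)[of s] Ns(2)[of "(1 - s)/2"] using s x by simp
    also have "\<dots> \<le> s * (1 - \<delta>) + (1 - s) / 2"
      using mid s by (simp add: mult_left_mono)
    also have "\<dots> \<le> (1 + s) / 2 - \<delta> / 2"
    proof -
      have "(3/4) * \<delta> \<le> s * \<delta>" using s' d by (intro mult_right_mono) auto
      then show ?thesis using d by (simp add: field_simps)
    qed
    finally have le: "N ((x + y) /\<^sub>R 2) \<le> (1 + s) / 2 - \<delta> / 2" .
    then have "N ((x + y) /\<^sub>R 2) powr p \<le> ((1 + s) / 2 - \<delta> / 2) powr p"
      using p by (intro powr_mono2) (auto simp: Ns)
    also have "\<dots> \<le> ((1 + s) / 2) powr p - (\<delta> / 2) powr p"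
      using powr_superadd[of p "(1 + s) / 2 - \<delta> / 2" "\<delta> / 2"] p d
        order_trans[OF Ns(1) le] by simp
    also have "((1 + s) / 2) powr p \<le> (1 + s powr p) / 2"
      using powr_gap_pos_antimono(1)[OF p, of s] s
      by (cases "s = 1") (auto simp: powr_gap_def)
    finally show ?thesis unfolding s_def by simp
  qed
qed

text \<open>The constant depends on p, e and \<delta> but not on the norm, so the inequality can be
  integrated with N = \<open>H x\<close>. Vectors closer than e times the longer length are absorbed
  by the first summand; other pairs are scaled so that the longer one is a unit vector.\<close>

lemma uniformly_convex_powr_bound:
  fixes p e \<delta> :: real
  assumes p: "1 < p" and e: "0 < e" "e \<le> 1" and d: "0 < \<delta>"
  obtains c where "0 < c"
    and "\<And>N (x::'a::euclidean_space) y. is_norm N \<Longrightarrow> convexity_bound N (e / 2) \<delta> \<Longrightarrow>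
      c * N (x - y) powr p \<le> c * e powr p * (N x powr p + N y powr p)
        + ((N x powr p + N y powr p) / 2 - N ((x + y) /\<^sub>R 2) powr p)"
proof -
  define c0 where "c0 = min (powr_gap p (1 - e / 4)) ((\<delta> / 2) powr p)"
  \<comment> \<open>The divisor compensates for N (x - y) being as large as twice the longer
    length.\<close>
  define c where "c = c0 / 2 powr p"
  have c0: "0 < c0" using powr_gap_pos_antimono(1)[OF p, of "1 - e / 4"] e d by (simp add: c0_def)
  then have c: "0 < c" by (simp add: c_def)
  have main: "c * N (x - y) powr p \<le> c * e powr p * (N x powr p + N y powr p)
        + ((N x powr p + N y powr p) / 2 - N ((x + y) /\<^sub>R 2) powr p)"
    if N: "is_norm N" and cb: "convexity_bound N (e / 2) \<delta>" and le: "N y \<le> N x"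
    for N and x y :: 'a
  proof -
    note Ns = is_norm_simps[OF N]
    define a where "a = N x"
    have a0: "0 \<le> a" by (simp add: a_def Ns)
    have D: "0 \<le> (N x powr p + N y powr p) / 2 - N ((x + y) /\<^sub>R 2) powr p"
      using is_norm_mid_powr_le[OF _ N, of p x y] p by simp
    consider "a = 0" | "0 < a" "N (x - y) < e * a" | "0 < a" "e * a \<le> N (x - y)"
      using a0 by linarith
    then show ?thesis
    proof cases
      case 1
      then have "x = 0" "y = 0" using le Ns(1)[of y] Ns(4)[of x] Ns(4)[of y] by (auto simp: a_def)
      then show ?thesis using D Ns(4)[of 0] p by simp
    next
      case 2
      then have "N (x - y) powr p \<le> (e * a) powr p"
        using p by (intro powr_mono2) (auto simp: Ns)
      also have "\<dots> = e powr p * a powr p" using e a0 by (simp add: powr_mult)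
      also have "\<dots> \<le> e powr p * (N x powr p + N y powr p)"
        by (intro mult_left_mono) (auto simp: a_def)
      finally have "c * N (x - y) powr p \<le> c * (e powr p * (N x powr p + N y powr p))"
        using c by simp
      then show ?thesis using D unfolding mult.assoc by linarith
    next
      case 3
      have sc: "N (z /\<^sub>R a) = N z / a" for z
        using 3 by (simp add: Ns(2) divide_inverse_commute)
      have h1: "N (x /\<^sub>R a) = 1" "N (y /\<^sub>R a) = N y / a"
        using sc[of x] sc[of y] 3 by (auto simp: a_def)
      have h2: "x /\<^sub>R a - y /\<^sub>R a = (x - y) /\<^sub>R a" "(x /\<^sub>R a + y /\<^sub>R a) /\<^sub>R 2 = ((x + y) /\<^sub>R 2) /\<^sub>R a"
        by (auto simp: algebra_simps)
      note h3 = sc[of "x - y"] sc[of "(x + y) /\<^sub>R 2"]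
      have "c0 \<le> (1 + (N y / a) powr p) / 2 - (N ((x + y) /\<^sub>R 2) / a) powr p"
      proof -
        have "N y / a \<le> 1" "e \<le> N (x - y) / a"
          using 3 le by (auto simp: a_def pos_le_divide_eq)
        then show ?thesis
          using convexity_bound_gap[OF p N e d cb, of "x /\<^sub>R a" "y /\<^sub>R a"]
          unfolding c0_def h1 h2 h3 by blast
      qed
      then have "c0 * a powr p \<le> ((1 + (N y / a) powr p) / 2 - (N ((x + y) /\<^sub>R 2) / a) powr p) * a powr p"
        by (intro mult_right_mono) auto
      also have "\<dots> = (N x powr p + N y powr p) / 2 - N ((x + y) /\<^sub>R 2) powr p"
        using 3 by (simp add: powr_divide Ns field_simps) (simp add: a_def)
      finally have D': "c0 * a powr p \<le> (N x powr p + N y powr p) / 2 - N ((x + y) /\<^sub>R 2) powr p" .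
      have "N (x - y) powr p \<le> (2 * a) powr p"
        using Ns(6)[of x y] le p by (intro powr_mono2) (auto simp: Ns(1) a_def)
      also have "\<dots> = 2 powr p * a powr p" using a0 by (simp add: powr_mult)
      finally have "c * N (x - y) powr p \<le> c * (2 powr p * a powr p)" using c by simp
      also have "\<dots> = c0 * a powr p" by (simp add: c_def)
      finally have "c * N (x - y) powr p \<le> (N x powr p + N y powr p) / 2 - N ((x + y) /\<^sub>R 2) powr p"
        using D' by simp
      then show ?thesis using c by (simp add: add_increasing)
    qed
  qed
  show ?thesis
  proof (rule that[OF c])
    fix N :: "'a \<Rightarrow> real" and x y :: 'a
    assume N: "is_norm N" and cb: "convexity_bound N (e / 2) \<delta>"
    show "c * N (x - y) powr p \<le> c * e powr p * (N x powr p + N y powr p)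
        + ((N x powr p + N y powr p) / 2 - N ((x + y) /\<^sub>R 2) powr p)"
      using main[OF N cb, of y x] main[OF N cb, of x y] is_norm_simps(7)[OF N, of x y]
      by (cases "N y \<le> N x") (auto simp: add.commute)
  qed
qed

lemma is_norm_abs: "is_norm (abs :: real \<Rightarrow> real)"
  by (auto simp: is_norm_def abs_mult)

text \<open>Distinct real numbers of absolute value 1 are opposite, so their midpoint is 0.\<close>

lemma convexity_bound_abs: "0 < e \<Longrightarrow> convexity_bound (abs :: real \<Rightarrow> real) e 1"
  unfolding convexity_bound_def by (auto simp: abs_if split: if_splits)

text \<open>The odd extension of the p-th power. For p > 1 it is continuously differentiable, and
  its differences dominate p-th powers of differences, so that L^1 compactness of
  \<open>spowr p u\<close> yields L^p compactness of u.\<close>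

definition spowr :: "real \<Rightarrow> real \<Rightarrow> real" where
  "spowr p t = \<bar>t\<bar> powr (p - 1) * t"

lemma abs_spowr: "1 < p \<Longrightarrow> \<bar>spowr p t\<bar> = \<bar>t\<bar> powr p"
  unfolding spowr_def abs_mult by (cases "t = 0") (auto simp: powr_diff)

lemma spowr_nonneg: "0 \<le> t \<Longrightarrow> 1 < p \<Longrightarrow> spowr p t = t powr p"
  using abs_spowr[of p t] by (simp add: spowr_def)

lemma spowr_minus: "spowr p (- t) = - spowr p t"
  by (simp add: spowr_def)

text \<open>Equal signs are treated by superadditivity of the power, opposite signs by (a + b)^p
  \<le> 2^p (a^p + b^p).\<close>

lemma abs_diff_powr_le_spowr:
  assumes "1 < p"
  shows "\<bar>a - b\<bar> powr p \<le> 2 powr p * \<bar>spowr p a - spowr p b\<bar>"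
proof -
  have same: "\<bar>a - b\<bar> powr p \<le> 2 powr p * \<bar>spowr p a - spowr p b\<bar>" if "0 \<le> b" "b \<le> a" for a b
  proof -
    have "(a - b) powr p \<le> spowr p a - spowr p b"
      using powr_superadd[of p "a - b" b] that assms by (simp add: spowr_nonneg)
    also have "\<dots> \<le> 2 powr p * \<bar>spowr p a - spowr p b\<bar>"
    proof -
      have "1 \<le> (2::real) powr p" using assms by (intro ge_one_powr_ge_zero) auto
      then have "1 * \<bar>spowr p a - spowr p b\<bar> \<le> 2 powr p * \<bar>spowr p a - spowr p b\<bar>"
        by (intro mult_right_mono) auto
      then show ?thesis using abs_ge_self[of "spowr p a - spowr p b"] by simp
    qed
    finally show ?thesis using that by simp
  qed
  have opp: "\<bar>a - b\<bar> powr p \<le> 2 powr p * \<bar>spowr p a - spowr p b\<bar>" if "b \<le> 0" "0 \<le> a" for a b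
  proof -
    have "(a - b) powr p \<le> 2 powr p * (a powr p + (- b) powr p)"
      using powr_add_le_two[of p a "- b"] that assms by simp
    also have "a powr p + (- b) powr p = spowr p a - spowr p b"
      using that assms spowr_nonneg[of a p] spowr_nonneg[of "- b" p] spowr_minus[of p b] by simp
    also have "\<dots> \<le> \<bar>spowr p a - spowr p b\<bar>" by simp
    finally show ?thesis using that by simp
  qed
  consider "0 \<le> b" "b \<le> a" | "0 \<le> a" "a \<le> b" | "a \<le> 0" "0 \<le> b" | "b \<le> 0" "0 \<le> a"
    | "a \<le> 0" "b \<le> a" | "b \<le> 0" "a \<le> b" by linarith
  then show ?thesis
    using same[of b a] same[of a b] opp[of b a] opp[of a b] same[of "- a" "- b"] same[of "- b" "- a"]
    by cases (auto simp: spowr_minus abs_minus_commute)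
qed

lemma has_real_derivative_spowr:
  assumes "1 < p"
  shows "(spowr p has_real_derivative p * \<bar>t\<bar> powr (p - 1)) (at t)"
proof -
  consider "0 < t" | "t < 0" | "t = 0" by linarith
  then show ?thesis
  proof cases
    case 1
    have "((\<lambda>t. t powr p) has_real_derivative p * \<bar>t\<bar> powr (p - 1)) (at t)"
      using 1 by (auto intro!: derivative_eq_intros)
    then show ?thesis
      by (rule has_field_derivative_transform_within_open[where S = "{0<..}"])
         (use 1 assms in \<open>auto simp: spowr_nonneg\<close>)
  next
    case 2
    have "((\<lambda>t. - ((- t) powr p)) has_real_derivative p * \<bar>t\<bar> powr (p - 1)) (at t)"
      using 2 by (auto intro!: derivative_eq_intros)
    then show ?thesis
    proof (rule has_field_derivative_transform_within_open[where S = "{..<0}"])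
      fix x :: real assume "x \<in> {..<0}"
      then show "- ((- x) powr p) = spowr p x"
        using spowr_nonneg[of "- x" p] spowr_minus[of p x] assms by auto
    qed (use 2 in auto)
  next
    case 3
    have "((\<lambda>y. (spowr p y - spowr p 0) / (y - 0)) \<longlongrightarrow> 0) (at 0)"
    proof (rule Lim_transform_eventually[where f = "\<lambda>y. \<bar>y\<bar> powr (p - 1)"])
      have "((\<lambda>y::real. \<bar>y\<bar> powr (p - 1)) \<longlongrightarrow> \<bar>0\<bar> powr (p - 1)) (at 0)"
        using assms by (intro tendsto_intros tendsto_powr2) auto
      then show "((\<lambda>y::real. \<bar>y\<bar> powr (p - 1)) \<longlongrightarrow> 0) (at 0)" using assms by simp
      show "\<forall>\<^sub>F y in at 0. \<bar>y\<bar> powr (p - 1) = (spowr p y - spowr p 0) / (y - 0)"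
        by (auto simp: eventually_at_filter spowr_def)
    qed
    then show ?thesis using 3 assms by (simp add: has_field_derivative_iff)
  qed
qed

section \<open>Smooth functions\<close>

lemma Ck_SucI:
  assumes "\<And>x. (f has_derivative f' x) (at x)" "\<And>b. b \<in> Basis \<Longrightarrow> Ck k (\<lambda>x. f' x b)"
  shows "Ck (Suc k) f"
proof -
  have "frechet_derivative f (at x) = f' x" for x
    using frechet_derivative_at[OF assms(1)] by simp
  then show ?thesis using assms by (auto simp: differentiable_def)
qed

lemma Ck_Suc_has_derivative:
  "Ck (Suc k) f \<Longrightarrow> (f has_derivative frechet_derivative f (at x)) (at x)"
  by (simp add: frechet_derivative_works[symmetric])

lemma Ck_SucD: "Ck (Suc k) f \<Longrightarrow> Ck k f"
proof (induction k arbitrary: f)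
  case 0
  then show ?case
    by (auto intro!: differentiable_imp_continuous_on simp: differentiable_on_def)
next
  case (Suc k)
  then show ?case by (metis Ck.simps(2))
qed

lemma Ck_le: "Ck k f \<Longrightarrow> j \<le> k \<Longrightarrow> Ck j f"
  by (induction k) (auto simp: le_Suc_eq simp del: Ck.simps dest: Ck_SucD)

lemma Ck_continuous: "Ck k f \<Longrightarrow> continuous_on UNIV f"
  using Ck_le[of k f 0] by simp

lemma Ck_const [simp]: "Ck k (\<lambda>_. c)"
proof (induction k arbitrary: c)
  case (Suc k)
  show ?case by (rule Ck_SucI[where f' = "\<lambda>_ _. 0"]) (use Suc in auto)
qed simp

lemma Ck_inner: "Ck k (\<lambda>x. x \<bullet> b)"
proof (cases k)
  case (Suc j)
  show ?thesis unfolding Suc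
    by (rule Ck_SucI[where f' = "\<lambda>_ h. h \<bullet> b"]) (auto intro!: derivative_eq_intros)
qed (auto intro!: continuous_intros)

lemma Ck_add: "Ck k f \<Longrightarrow> Ck k g \<Longrightarrow> Ck k (\<lambda>x. f x + g x)"
proof (induction k arbitrary: f g)
  case (Suc k)
  note has_derivative_add[OF Ck_Suc_has_derivative Ck_Suc_has_derivative, OF Suc.prems]
  then show ?case by (rule Ck_SucI) (use Suc in auto)
qed (auto intro!: continuous_intros)

lemma Ck_mult: "Ck k f \<Longrightarrow> Ck k g \<Longrightarrow> Ck k (\<lambda>x. f x * g x)"
proof (induction k arbitrary: f g)
  case (Suc k)
  note has_derivative_mult[OF Ck_Suc_has_derivative Ck_Suc_has_derivative, OF Suc.prems]
  then show ?case
  proof (rule Ck_SucI)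
    fix b :: 'a assume "b \<in> Basis"
    then have "Ck k (\<lambda>x. frechet_derivative f (at x) b)" "Ck k (\<lambda>x. frechet_derivative g (at x) b)"
      using Suc.prems by auto
    moreover have "Ck k f" "Ck k g" using Suc.prems Ck_SucD by blast+
    ultimately show "Ck k (\<lambda>x. f x * frechet_derivative g (at x) b + frechet_derivative f (at x) b * g x)"
      by (intro Ck_add Suc.IH)
  qed
qed (auto intro!: continuous_intros)

lemma Ck_cmult: "Ck k f \<Longrightarrow> Ck k (\<lambda>x. c * f x)"
  by (intro Ck_mult Ck_const)

lemma Ck_minus: "Ck k f \<Longrightarrow> Ck k (\<lambda>x. - f x)"
  using Ck_cmult[of k f "- 1"] by simp

lemma Ck_diff: "Ck k f \<Longrightarrow> Ck k g \<Longrightarrow> Ck k (\<lambda>x. f x - g x)"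
  using Ck_add[of k f "\<lambda>x. - g x"] Ck_minus[of k g] by simp

lemma Ck_sum: "(\<And>i. i \<in> I \<Longrightarrow> Ck k (f i)) \<Longrightarrow> Ck k (\<lambda>x. \<Sum>i\<in>I. f i x)"
  by (induction I rule: infinite_finite_induct) (auto intro: Ck_add)

lemma Ck_translate: "Ck k f \<Longrightarrow> Ck k (\<lambda>y. f (x - y))"
proof (induction k arbitrary: f)
  case 0
  then show ?case by (auto intro!: continuous_on_compose2[of UNIV f] continuous_intros)
next
  case (Suc k)
  have "((\<lambda>y. f (x - y)) has_derivative (\<lambda>h. frechet_derivative f (at (x - y)) (- h))) (at y)" for y
    by (rule has_derivative_compose[OF _ Ck_Suc_has_derivative[OF Suc.prems]])
       (auto intro!: derivative_eq_intros)
  moreover have "frechet_derivative f (at z) (- h) = - frechet_derivative f (at z) h" for z h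
    using has_derivative_bounded_linear[OF Ck_Suc_has_derivative[OF Suc.prems]]
    by (simp add: linear_neg bounded_linear.linear)
  ultimately have "((\<lambda>y. f (x - y)) has_derivative (\<lambda>h. - frechet_derivative f (at (x - y)) h)) (at y)" for y
    by simp
  then show ?case
    by (rule Ck_SucI) (use Suc in \<open>auto intro!: Ck_minus\<close>)
qed

text \<open>The functions \<open>t\<^sup>-\<^sup>n exp(-1/t)\<close>, extended by zero, are closed under differentiation up to
  linear combinations.\<close>
definition expdecay :: "nat \<Rightarrow> real \<Rightarrow> real" where
  "expdecay n t = (if 0 < t then (1 / t) ^ n * exp (- (1 / t)) else 0)"

lemma DERIV_expdecay:
  "(expdecay n has_real_derivative expdecay (n + 2) t - real n * expdecay (n + 1) t) (at t)"
proof -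
  consider "0 < t" | "t < 0" | "t = 0" by linarith
  then show ?thesis
  proof cases
    case 1
    have "((\<lambda>t. (1 / t) ^ n * exp (- (1 / t))) has_real_derivative
        expdecay (n + 2) t - real n * expdecay (n + 1) t) (at t)"
    proof -
      define y where "y = 1 / t"
      have d: "((\<lambda>t. 1 / t) has_real_derivative - (y ^ 2)) (at t)"
        using 1 by (auto intro!: derivative_eq_intros simp: y_def power2_eq_square)
      have "((\<lambda>t. (1 / t) ^ n * exp (- (1 / t))) has_real_derivative
          of_nat n * (- (y ^ 2) * (1 / t) ^ (n - Suc 0)) * exp (- (1 / t))
          + exp (- (1 / t)) * (- (- (y ^ 2))) * (1 / t) ^ n) (at t)"
        by (intro DERIV_mult DERIV_power DERIV_fun_exp DERIV_minus d)
      moreover have "of_nat n * (- (y ^ 2) * y ^ (n - Suc 0)) * exp (- y)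
          + exp (- y) * (- (- (y ^ 2))) * y ^ n = y ^ (n + 2) * exp (- y) - real n * (y ^ (n + 1) * exp (- y))"
        by (cases n) (auto simp: power2_eq_square algebra_simps)
      ultimately show ?thesis using 1 by (simp add: expdecay_def y_def)
    qed
    then show ?thesis
      by (rule has_field_derivative_transform_within_open[where S = "{0<..}"])
         (use 1 in \<open>auto simp: expdecay_def\<close>)
  next
    case 2
    have "((\<lambda>t. 0) has_real_derivative expdecay (n + 2) t - real n * expdecay (n + 1) t) (at t)"
      using 2 by (simp add: expdecay_def)
    then show ?thesis
      by (rule has_field_derivative_transform_within_open[where S = "{..<0}"])
         (use 2 in \<open>auto simp: expdecay_def\<close>)
  next
    case 3
    \<comment> \<open>The difference quotient of \<open>expdecay n\<close> at 0 is
      \<open>expdecay (Suc n)\<close>; its right limit is the decay of y^(n + 1) exp (- y) at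
      infinity.\<close>
    have "((\<lambda>y. expdecay (Suc n) y) \<longlongrightarrow> 0) (at_right 0)"
    proof (rule Lim_transform_eventually)
      show "((\<lambda>y. inverse y ^ Suc n / exp (inverse y)) \<longlongrightarrow> (0::real)) (at_right 0)"
        by (rule filterlim_compose[OF tendsto_power_div_exp_0 filterlim_inverse_at_top_right])
      show "\<forall>\<^sub>F y in at_right 0. inverse y ^ Suc n / exp (inverse y) = expdecay (Suc n) y"
        by (auto simp: eventually_at_filter expdecay_def exp_minus field_simps)
    qed
    moreover have "((\<lambda>y. expdecay (Suc n) y) \<longlongrightarrow> 0) (at_left 0)"
      by (rule Lim_transform_eventually[where f = "\<lambda>_. 0"])
         (auto simp: eventually_at_filter expdecay_def)
    ultimately have "((\<lambda>y. expdecay (Suc n) y) \<longlongrightarrow> 0) (at 0)"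
      by (simp add: filterlim_split_at)
    then have "((\<lambda>y. (expdecay n y - expdecay n 0) / (y - 0)) \<longlongrightarrow> 0) (at 0)"
      by (rule Lim_transform_eventually) (auto simp: eventually_at_filter expdecay_def)
    then show ?thesis using 3 by (simp add: has_field_derivative_iff expdecay_def)
  qed
qed

lemma expdecay_nonneg: "0 \<le> expdecay n t"
  by (simp add: expdecay_def)

lemma expdecay_pos_iff: "0 < expdecay n t \<longleftrightarrow> 0 < t"
  by (simp add: expdecay_def)

lemma Ck_expdecay:
  assumes "\<And>k. Ck k q"
  shows "Ck k (\<lambda>x. expdecay n (q x))"
proof (induction k arbitrary: n)
  case 0
  have "continuous_on UNIV (expdecay n)"
    by (auto intro!: DERIV_continuous_on DERIV_expdecay)
  then show ?case
    using Ck_continuous[OF assms[of 0]] by (auto intro: continuous_on_compose2)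
next
  case (Suc k)
  have "((\<lambda>x. expdecay n (q x)) has_derivative
      (\<lambda>h. (expdecay (n + 2) (q x) - real n * expdecay (n + 1) (q x)) * frechet_derivative q (at x) h)) (at x)" for x
    by (rule has_derivative_compose[OF Ck_Suc_has_derivative[OF assms]
          DERIV_expdecay[unfolded has_field_derivative_def]])
  then show ?case
  proof (rule Ck_SucI)
    fix b :: 'a assume "b \<in> Basis"
    then have "Ck k (\<lambda>x. frechet_derivative q (at x) b)"
      using assms[of "Suc k"] by simp
    then show "Ck k (\<lambda>x. (expdecay (n + 2) (q x) - real n * expdecay (n + 1) (q x)) * frechet_derivative q (at x) b)"
      by (intro Ck_mult Ck_diff Ck_cmult Suc)
  qed
qed

lemma Ck_inner_self: "Ck k (\<lambda>x. x \<bullet> x)"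
proof -
  have "(\<lambda>x::'a. x \<bullet> x) = (\<lambda>x. \<Sum>b\<in>Basis. (x \<bullet> b) * (x \<bullet> b))"
    by (auto simp: euclidean_inner[of x x for x])
  then show ?thesis by (auto intro!: Ck_sum Ck_mult Ck_inner)
qed

subsection \<open>Gradients\<close>

lemma grad_eqI: "GDERIV f x :> D \<Longrightarrow> grad f x = D"
  unfolding grad_def
proof (rule the_equality)
  fix D' assume "GDERIV f x :> D" "GDERIV f x :> D'"
  then have "(\<lambda>h. h \<bullet> D) = (\<lambda>h. h \<bullet> D')"
    unfolding gderiv_def by (rule has_derivative_unique)
  then show "D' = D" by (metis inner_commute vector_eq_ldot)
qed

lemma differentiable_GDERIV:
  assumes "f differentiable (at x)"
  shows "GDERIV f x :> grad f x"
    and "grad f x = (\<Sum>b\<in>Basis. frechet_derivative f (at x) b *\<^sub>R b)"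
    and "frechet_derivative f (at x) h = h \<bullet> grad f x"
proof -
  have f: "(f has_derivative frechet_derivative f (at x)) (at x)"
    using assms by (simp add: frechet_derivative_works)
  have "frechet_derivative f (at x) = (\<lambda>h. h \<bullet> (\<Sum>b\<in>Basis. frechet_derivative f (at x) b *\<^sub>R b))"
    (is "_ = ?R")
  proof
    fix h
    have "frechet_derivative f (at x) h = frechet_derivative f (at x) (\<Sum>b\<in>Basis. (h \<bullet> b) *\<^sub>R b)"
      by (simp add: euclidean_representation)
    also have "\<dots> = (\<Sum>b\<in>Basis. (h \<bullet> b) * frechet_derivative f (at x) b)"
      using has_derivative_bounded_linear[OF f]
      by (simp add: linear_sum linear_scale bounded_linear.linear)
    finally show "frechet_derivative f (at x) h = ?R h"
      by (simp add: inner_sum_right mult.commute)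
  qed
  then have "GDERIV f x :> (\<Sum>b\<in>Basis. frechet_derivative f (at x) b *\<^sub>R b)"
    using f by (simp add: gderiv_def)
  then show *: "grad f x = (\<Sum>b\<in>Basis. frechet_derivative f (at x) b *\<^sub>R b)" "GDERIV f x :> grad f x"
    using grad_eqI by metis+
  then show "frechet_derivative f (at x) h = h \<bullet> grad f x"
    using has_derivative_unique[OF f] unfolding gderiv_def by metis
qed

lemma Ck_1_iff: "Ck 1 f \<longleftrightarrow> (\<forall>x. GDERIV f x :> grad f x) \<and> continuous_on UNIV (grad f)"
proof
  assume C: "Ck 1 f"
  then have d: "f differentiable (at x)" for x by simp
  have "continuous_on UNIV (\<lambda>x. \<Sum>b\<in>Basis. frechet_derivative f (at x) b *\<^sub>R b)"
    using C by (intro continuous_intros) auto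
  then show "(\<forall>x. GDERIV f x :> grad f x) \<and> continuous_on UNIV (grad f)"
    using differentiable_GDERIV(1)[OF d]
    unfolding differentiable_GDERIV(2)[OF d, symmetric] by blast
next
  assume A: "(\<forall>x. GDERIV f x :> grad f x) \<and> continuous_on UNIV (grad f)"
  have "Ck (Suc 0) f"
    by (rule Ck_SucI[where f' = "\<lambda>x h. h \<bullet> grad f x"])
       (use A in \<open>auto simp: gderiv_def intro!: continuous_intros\<close>)
  then show "Ck 1 f" by simp
qed

lemma Ck_1I:
  assumes "\<And>x. GDERIV f x :> F x" "continuous_on UNIV F"
  shows "Ck 1 f" "grad f = F"
proof -
  show "grad f = F" using assms grad_eqI by blast
  then show "Ck 1 f" using assms unfolding Ck_1_iff by simp
qed

lemma Ck_1D: "Ck 1 f \<Longrightarrow> GDERIV f x :> grad f x" "Ck 1 f \<Longrightarrow> continuous_on UNIV (grad f)"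
  unfolding Ck_1_iff by simp_all

lemma grad_mult:
  assumes "Ck 1 f" "Ck 1 g"
  shows "grad (\<lambda>x. f x * g x) x = f x *\<^sub>R grad g x + g x *\<^sub>R grad f x"
  by (rule grad_eqI) (intro GDERIV_mult Ck_1D assms)

text \<open>The constant is left free because the cut-off near infinity equals 1, not 0, outside a
  compact set.\<close>

lemma grad_const_outside:
  assumes "closed K" "\<And>y. y \<notin> K \<Longrightarrow> f y = c" "x \<notin> K"
  shows "grad f x = 0"
proof (rule grad_eqI)
  have "((\<lambda>_. c) has_derivative (\<lambda>h. 0)) (at x)" by simp
  then have "(f has_derivative (\<lambda>h. 0)) (at x)"
    by (rule has_derivative_transform_within_open[where s = "- K"]) (use assms in auto)
  then show "GDERIV f x :> 0" by (simp add: gderiv_def)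
qed

subsection \<open>Compactly supported functions\<close>

lemma CcI:
  assumes "continuous_on UNIV f" "compact K" "K \<subseteq> U" "\<And>x. x \<notin> K \<Longrightarrow> f x = 0"
  shows "f \<in> Cc U"
proof -
  have "{x. f x \<noteq> 0} \<subseteq> K" using assms by auto
  then have "closure {x. f x \<noteq> 0} \<subseteq> K"
    using assms by (simp add: closure_minimal compact_imp_closed)
  then show ?thesis
    using assms compact_Int_closed[of K "closure {x. f x \<noteq> 0}"]
    by (auto simp: Cc_def Int_absorb1)
qed

lemma CcE:
  assumes "f \<in> Cc U"
  obtains K where "compact K" "K \<subseteq> U" "\<And>x. x \<notin> K \<Longrightarrow> f x = 0"
  using assms closure_subset[of "{x. f x \<noteq> 0}"] that[of "closure {x. f x \<noteq> 0}"]
  unfolding Cc_def by blast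

lemma Cc_continuous: "f \<in> Cc U \<Longrightarrow> continuous_on UNIV f"
  by (simp add: Cc_def)

lemma Cc_outside: "f \<in> Cc U \<Longrightarrow> x \<notin> U \<Longrightarrow> f x = 0"
  by (metis CcE subsetD)

lemma Cc_mono: "U \<subseteq> U' \<Longrightarrow> Cc U \<subseteq> Cc U'"
  by (auto simp: Cc_def)

lemma Cc_inf_mono: "U \<subseteq> U' \<Longrightarrow> Cc_inf U \<subseteq> Cc_inf U'"
  using Cc_mono by (auto simp: Cc_inf_def)

lemma Cc_mult: "f \<in> Cc U \<Longrightarrow> continuous_on UNIV h \<Longrightarrow> (\<lambda>x. h x * f x) \<in> Cc U"
proof -
  assume f: "f \<in> Cc U" and h: "continuous_on UNIV h"
  obtain K where "compact K" "K \<subseteq> U" "\<And>x. x \<notin> K \<Longrightarrow> f x = 0" using CcE[OF f] by blast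
  then show ?thesis
    by (intro CcI[where K = K]) (auto intro!: continuous_intros h Cc_continuous[OF f])
qed

lemma Cc_add: "f \<in> Cc U \<Longrightarrow> h \<in> Cc U \<Longrightarrow> (\<lambda>x. f x + h x) \<in> Cc U"
proof -
  assume fh: "f \<in> Cc U" "h \<in> Cc U"
  obtain K L where "compact K" "K \<subseteq> U" "\<And>x. x \<notin> K \<Longrightarrow> f x = 0"
    "compact L" "L \<subseteq> U" "\<And>x. x \<notin> L \<Longrightarrow> h x = 0" using fh CcE by metis
  then show ?thesis
    by (intro CcI[where K = "K \<union> L"]) (use fh in \<open>auto intro!: continuous_intros simp: Cc_def\<close>)
qed

text \<open>Normalising a smooth partition takes p-th powers and p-th roots, so the resulting
  cut-offs, and their products with test functions, are only known to be C^1. This class is stable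
  under such products.\<close>

definition C1c :: "'a::euclidean_space set \<Rightarrow> ('a \<Rightarrow> real) set" where
  "C1c U = {f \<in> Cc U. Ck 1 f}"

lemma Cc_inf_C1c: "Cc_inf U \<subseteq> C1c U"
  by (auto simp: Cc_inf_def C1c_def simp del: One_nat_def)

lemma C1c_mono: "U \<subseteq> U' \<Longrightarrow> C1c U \<subseteq> C1c U'"
  using Cc_mono by (auto simp: C1c_def)

lemma C1cD:
  assumes "f \<in> C1c U"
  shows "f \<in> Cc U" "Ck 1 f" "GDERIV f x :> grad f x" "continuous_on UNIV (grad f)" "continuous_on UNIV f"
  using assms Ck_1D[of f] Cc_continuous unfolding C1c_def by auto

lemma Cc_inf_Cc: "f \<in> Cc_inf U \<Longrightarrow> f \<in> Cc U"
  by (simp add: Cc_inf_def)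

lemma Cc_inf_add: "f \<in> Cc_inf U \<Longrightarrow> h \<in> Cc_inf U \<Longrightarrow> (\<lambda>x. f x + h x) \<in> Cc_inf U"
  by (auto simp: Cc_inf_def intro: Cc_add Ck_add)

lemma Cc_inf_cmult: "f \<in> Cc_inf U \<Longrightarrow> (\<lambda>x. c * f x) \<in> Cc_inf U"
  by (auto simp: Cc_inf_def intro: Cc_mult Ck_cmult)

lemma Cc_inf_diff: "f \<in> Cc_inf U \<Longrightarrow> h \<in> Cc_inf U \<Longrightarrow> (\<lambda>x. f x - h x) \<in> Cc_inf U"
  using Cc_inf_add[of f U "\<lambda>x. (- 1) * h x"] Cc_inf_cmult[of h U "- 1"] by simp

lemma C1c_mult: "f \<in> C1c U \<Longrightarrow> Ck 1 h \<Longrightarrow> (\<lambda>x. h x * f x) \<in> C1c U"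
  by (auto simp: C1c_def simp del: One_nat_def intro: Cc_mult Ck_mult Ck_continuous)

lemma C1c_grad_outside:
  assumes "f \<in> C1c U" obtains K where "compact K" "K \<subseteq> U" "\<And>x. x \<notin> K \<Longrightarrow> f x = 0" "\<And>x. x \<notin> K \<Longrightarrow> grad f x = 0"
  using assms CcE[OF C1cD(1)[OF assms]] grad_const_outside compact_imp_closed by metis

lemma compact_support_bounded:
  fixes f :: "'a::euclidean_space \<Rightarrow> 'b::real_normed_vector"
  assumes "continuous_on UNIV f" "compact K" "\<And>x. x \<notin> K \<Longrightarrow> f x = 0"
  obtains B where "0 < B" "\<And>x. norm (f x) \<le> B"
proof -
  have "bounded (f ` K)"
    by (intro compact_imp_bounded compact_continuous_image continuous_on_subset[OF assms(1)] assms(2)) auto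
  then obtain B where "0 < B" "\<forall>x\<in>f ` K. norm x \<le> B" using bounded_pos by blast
  moreover have "norm (f x) \<le> B" for x
    using calculation assms(3)[of x] by (cases "x \<in> K") auto
  ultimately show thesis by (intro that)
qed

text \<open>Heine-Cantor on a ball exceeding the support by 1: if two points are closer than 1 and
  one of them is outside that ball, both miss the support.\<close>

lemma compact_support_uniformly_continuous:
  fixes f :: "'a::euclidean_space \<Rightarrow> 'b::real_normed_vector"
  assumes "continuous_on UNIV f" "compact K" "\<And>x. x \<notin> K \<Longrightarrow> f x = 0"
  shows "uniformly_continuous_on UNIV f"
proof -
  obtain R where R: "K \<subseteq> cball 0 R"
    using compact_imp_bounded[OF assms(2)] unfolding bounded_any_center[of _ 0] by (auto simp: subset_iff)
  have uc: "uniformly_continuous_on (cball 0 (R + 1)) f"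
    by (intro compact_uniformly_continuous continuous_on_subset[OF assms(1)]) auto
  show ?thesis
    unfolding uniformly_continuous_on_def
  proof (intro allI impI)
    fix e :: real assume "0 < e"
    then obtain d where d: "0 < d" "\<And>x x'. x \<in> cball 0 (R + 1) \<Longrightarrow> x' \<in> cball 0 (R + 1) \<Longrightarrow> dist x' x < d \<Longrightarrow> dist (f x') (f x) < e"
      using uc unfolding uniformly_continuous_on_def by metis
    show "\<exists>d>0. \<forall>x\<in>UNIV. \<forall>x'\<in>UNIV. dist x' x < d \<longrightarrow> dist (f x') (f x) < e"
    proof (intro exI[of _ "min d 1"] conjI ballI impI)
      fix x x' :: 'a assume xx: "dist x' x < min d 1"
      show "dist (f x') (f x) < e"
      proof (cases "x \<in> cball 0 (R + 1) \<and> x' \<in> cball 0 (R + 1)")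
        case False
        have "norm x \<le> norm x' + dist x' x" "norm x' \<le> norm x + dist x' x"
          using norm_triangle_ineq2[of x x'] norm_triangle_ineq2[of x' x] by (auto simp: dist_norm norm_minus_commute)
        then have "x \<notin> K" "x' \<notin> K" using False xx R by (auto simp: subset_iff)
        then show ?thesis using assms(3) \<open>0 < e\<close> by simp
      qed (use d xx in auto)
    qed (use d in auto)
  qed
qed

section \<open>Mollification\<close>

lemma compact_thickening:
  fixes K :: "'a::euclidean_space set"
  assumes "compact K"
  shows "compact (\<Union>x\<in>K. cball x d)"
proof -
  have "(\<Union>x\<in>K. cball x d) = (\<Union>x\<in>K. \<Union>y\<in>cball 0 d. {x + y})"
  proof (intro set_eqI iffI)
    fix z assume "z \<in> (\<Union>x\<in>K. cball x d)"
    then obtain x where "x \<in> K" "dist x z \<le> d" by auto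
    then show "z \<in> (\<Union>x\<in>K. \<Union>y\<in>cball 0 d. {x + y})"
      by (intro UN_I[of x] UN_I[of "z - x"]) (auto simp: dist_norm norm_minus_commute)
  qed (force simp: dist_norm)
  then show ?thesis using compact_sums'[OF assms compact_cball[of 0 d]] by simp
qed

lemma lborel_distr_reflect: "distr lborel borel (\<lambda>y. x - y) = (lborel :: 'a::euclidean_space measure)"
  using lborel_affine[of "-1" x] by (simp add: density_1)

lemma integral_reflect:
  fixes f :: "'a::euclidean_space \<Rightarrow> 'b::{banach, second_countable_topology}"
  assumes [measurable]: "f \<in> borel_measurable borel"
  shows "(LINT y|lborel. f (x - y)) = (LINT y|lborel. f y)"
  using integral_distr[of "\<lambda>y. x - y" lborel borel f] by (simp add: lborel_distr_reflect)

lemma nn_integral_reflect: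
  fixes f :: "'a::euclidean_space \<Rightarrow> ennreal"
  assumes [measurable]: "f \<in> borel_measurable borel"
  shows "(\<integral>\<^sup>+y. f (x - y) \<partial>lborel) = (\<integral>\<^sup>+y. f y \<partial>lborel)"
  using nn_integral_distr[of "\<lambda>y. x - y" lborel borel f] by (simp add: lborel_distr_reflect)

lemma nn_integral_translate:
  fixes f :: "'a::euclidean_space \<Rightarrow> ennreal"
  assumes [measurable]: "f \<in> borel_measurable borel"
  shows "(\<integral>\<^sup>+y. f (y + x) \<partial>lborel) = (\<integral>\<^sup>+y. f y \<partial>lborel)"
  using nn_integral_distr[of "(+) x" lborel borel f] by (simp add: lborel_distr_plus add.commute)

lemma integrable_mult_bounded:
  fixes f :: "'a \<Rightarrow> 'b::{banach, second_countable_topology}" and h :: "'a \<Rightarrow> real"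
  assumes "integrable M f" and [measurable]: "h \<in> borel_measurable M" and "AE x in M. \<bar>h x\<bar> \<le> B"
  shows "integrable M (\<lambda>x. h x *\<^sub>R f x)"
proof (rule Bochner_Integration.integrable_bound)
  show "integrable M (\<lambda>x. B *\<^sub>R f x)" using assms(1) by simp
  show "(\<lambda>x. h x *\<^sub>R f x) \<in> borel_measurable M"
    using borel_measurable_integrable[OF assms(1)] by measurable
  show "AE x in M. norm (h x *\<^sub>R f x) \<le> norm (B *\<^sub>R f x)"
    using assms(3) by eventually_elim (auto intro!: mult_right_mono)
qed

lemma compact_support_integrable:
  fixes f :: "'a::euclidean_space \<Rightarrow> 'b::{banach, second_countable_topology}"
  assumes "continuous_on UNIV f" "compact K" "\<And>x. x \<notin> K \<Longrightarrow> f x = 0"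
  shows "integrable lborel f"
proof -
  have "(\<lambda>x. indicator K x *\<^sub>R f x) = f" using assms(3) by (auto simp: indicator_def)
  then show ?thesis
    using borel_integrable_compact[OF assms(2), of f] continuous_on_subset[OF assms(1)] by simp
qed

definition conv :: "('a::euclidean_space \<Rightarrow> real) \<Rightarrow> ('a \<Rightarrow> real) \<Rightarrow> 'a \<Rightarrow> real" where
  "conv f \<rho> x = (LINT y|lborel. f y * \<rho> (x - y))"

text \<open>Uniform continuity of the gradient makes the first-order remainder of \<rho> small
  uniformly in the base point, so that it can be integrated against f.\<close>

lemma conv_GDERIV:
  assumes f: "integrable lborel f" and \<rho>: "\<rho> \<in> C1c UNIV"
  shows "GDERIV (conv f \<rho>) x :> (LINT y|lborel. f y *\<^sub>R grad \<rho> (x - y))"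
proof -
  obtain K where K: "compact K" "\<And>x. x \<notin> K \<Longrightarrow> \<rho> x = 0" "\<And>x. x \<notin> K \<Longrightarrow> grad \<rho> x = 0"
    using C1c_grad_outside[OF \<rho>] by metis
  note cont = C1cD(5)[OF \<rho>] C1cD(4)[OF \<rho>]
  have [measurable]: "\<rho> \<in> borel_measurable borel" "grad \<rho> \<in> borel_measurable borel" "f \<in> borel_measurable borel"
    using cont f by (auto intro: borel_measurable_continuous_onI)
  obtain B where B: "\<And>x. norm (\<rho> x) \<le> B" using compact_support_bounded[OF cont(1) K(1,2)] by metis
  obtain B' where B': "\<And>x. norm (grad \<rho> x) \<le> B'" using compact_support_bounded[OF cont(2) K(1,3)] by metis
  have int0: "integrable lborel (\<lambda>y. f y * \<rho> (z - y))" for z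
    using integrable_mult_bounded[OF f, of "\<lambda>y. \<rho> (z - y)" B] B by (simp add: mult.commute)
  have int1: "integrable lborel (\<lambda>y. f y *\<^sub>R grad \<rho> (z - y))" for z
  proof (rule Bochner_Integration.integrable_bound)
    show "integrable lborel (\<lambda>y. B' * f y)" using f by simp
    show "AE y in lborel. norm (f y *\<^sub>R grad \<rho> (z - y)) \<le> norm (B' * f y)"
      using B' order_trans[OF norm_ge_zero B'] by (auto simp: abs_mult mult.commute[of "\<bar>f _\<bar>"] intro!: mult_right_mono)
  qed measurable
  define M where "M = (LINT y|lborel. \<bar>f y\<bar>)"
  have M: "0 \<le> M" by (simp add: M_def)
  show ?thesis
    unfolding gderiv_def has_derivative_at_alt
  proof (intro conjI allI impI)
    show "bounded_linear (\<lambda>h. h \<bullet> (LINT y|lborel. f y *\<^sub>R grad \<rho> (x - y)))"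
      by (rule bounded_linear_inner_left)
    fix e :: real assume e: "0 < e"
    \<comment> \<open>After integration against f the remainder is at most e' * M times the
      increment; the summand 1 avoids a division by 0.\<close>
    define e' where "e' = e / (M + 1)"
    have e': "0 < e'" "e' * M \<le> e" using e M by (auto simp: e'_def field_simps)
    obtain d where d: "0 < d" "\<And>z z'. dist z' z < d \<Longrightarrow> dist (grad \<rho> z') (grad \<rho> z) < e'"
      using compact_support_uniformly_continuous[OF cont(2) K(1,3)] e'(1)
      unfolding uniformly_continuous_on_def by (metis UNIV_I)
    have lin: "\<bar>\<rho> (z + h) - \<rho> z - h \<bullet> grad \<rho> z\<bar> \<le> e' * norm h" if h: "norm h < d" for z h
    proof -
      have "norm ((\<rho> (z + h) - (z + h) \<bullet> grad \<rho> z) - (\<rho> z - z \<bullet> grad \<rho> z)) \<le> e' * norm ((z + h) - z)"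
      proof (rule differentiable_bound[where S = "ball z d"])
        fix z' assume z': "z' \<in> ball z d"
        show "((\<lambda>y. \<rho> y - y \<bullet> grad \<rho> z) has_derivative (\<lambda>k. k \<bullet> grad \<rho> z' - k \<bullet> grad \<rho> z)) (at z' within ball z d)"
          using C1cD(3)[OF \<rho>, of z'] unfolding gderiv_def
          by (intro has_derivative_diff has_derivative_inner_left has_derivative_ident)
            (rule has_derivative_at_withinI)
        show "onorm (\<lambda>k. k \<bullet> grad \<rho> z' - k \<bullet> grad \<rho> z) \<le> e'"
        proof (rule onorm_le)
          fix k
          have "norm (k \<bullet> grad \<rho> z' - k \<bullet> grad \<rho> z) \<le> norm k * norm (grad \<rho> z' - grad \<rho> z)"
            by (metis inner_diff_right Cauchy_Schwarz_ineq2 real_norm_def)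
          also have "\<dots> \<le> norm k * e'"
            using d(2)[of z' z] z' by (intro mult_left_mono) (auto simp: dist_norm norm_minus_commute)
          finally show "norm (k \<bullet> grad \<rho> z' - k \<bullet> grad \<rho> z) \<le> e' * norm k" by (simp add: mult.commute)
        qed
      qed (use h d in \<open>auto simp: dist_norm\<close>)
      then show ?thesis by (simp add: inner_add_left algebra_simps)
    qed
    show "\<exists>d>0. \<forall>y. norm (y - x) < d \<longrightarrow>
        norm (conv f \<rho> y - conv f \<rho> x - (y - x) \<bullet> (LINT y|lborel. f y *\<^sub>R grad \<rho> (x - y))) \<le> e * norm (y - x)"
    proof (intro exI[of _ d] conjI allI impI d)
      fix y assume y: "norm (y - x) < d"
      have int2: "integrable lborel (\<lambda>z. (y - x) \<bullet> (f z *\<^sub>R grad \<rho> (x - z)))"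
        by (rule integrable_inner_right[OF int1])
      have eq: "f z * (\<rho> (y - z) - \<rho> (x - z) - (y - x) \<bullet> grad \<rho> (x - z))
          = f z * \<rho> (y - z) - f z * \<rho> (x - z) - (y - x) \<bullet> (f z *\<^sub>R grad \<rho> (x - z))" for z
        by (simp add: algebra_simps)
      have "conv f \<rho> y - conv f \<rho> x - (y - x) \<bullet> (LINT y|lborel. f y *\<^sub>R grad \<rho> (x - y))
          = (LINT z|lborel. f z * (\<rho> (y - z) - \<rho> (x - z) - (y - x) \<bullet> grad \<rho> (x - z)))"
        unfolding eq conv_def integral_inner_right[OF int1, symmetric]
        using int0 int2 by simp
      also have "norm \<dots> \<le> (LINT z|lborel. \<bar>f z\<bar> * (e' * norm (y - x)))"
      proof (rule Bochner_Integration.integral_norm_bound_integral)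
        show "integrable lborel (\<lambda>z. f z * (\<rho> (y - z) - \<rho> (x - z) - (y - x) \<bullet> grad \<rho> (x - z)))"
          unfolding eq using int0 int2 by simp
        show "norm (f z * (\<rho> (y - z) - \<rho> (x - z) - (y - x) \<bullet> grad \<rho> (x - z))) \<le> \<bar>f z\<bar> * (e' * norm (y - x))" for z
          using lin[OF y, of "x - z"] by (auto simp: abs_mult intro!: mult_left_mono)
      qed (use f in auto)
      also have "\<dots> = e' * M * norm (y - x)" by (simp add: M_def)
      also have "\<dots> \<le> e * norm (y - x)" using e' by (intro mult_right_mono) auto
      finally show "norm (conv f \<rho> y - conv f \<rho> x - (y - x) \<bullet> (LINT y|lborel. f y *\<^sub>R grad \<rho> (x - y))) \<le> e * norm (y - x)" .
    qed
  qed
qed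

lemma Cc_inf_directional:
  assumes "\<rho> \<in> Cc_inf U" "b \<in> Basis"
  shows "(\<lambda>z. b \<bullet> grad \<rho> z) \<in> Cc_inf U"
proof -
  have C: "\<rho> \<in> C1c U" using assms Cc_inf_C1c by auto
  have Ck: "Ck k (\<lambda>z. b \<bullet> grad \<rho> z)" for k
  proof -
    have S: "Ck (Suc k) \<rho>" using assms by (auto simp: Cc_inf_def simp del: Ck.simps)
    then have "(\<lambda>z. frechet_derivative \<rho> (at z) b) = (\<lambda>z. b \<bullet> grad \<rho> z)"
      using differentiable_GDERIV(3) by (metis Ck.simps(2))
    then show ?thesis using S assms by (metis Ck.simps(2))
  qed
  obtain K where "compact K" "K \<subseteq> U" "\<And>x. x \<notin> K \<Longrightarrow> grad \<rho> x = 0"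
    using C1c_grad_outside[OF C] by metis
  then have "(\<lambda>z. b \<bullet> grad \<rho> z) \<in> Cc U"
    by (intro CcI[OF Ck_continuous[OF Ck[of 0]], of K]) auto
  then show ?thesis using Ck by (simp add: Cc_inf_def)
qed

text \<open>The induction keeps \<rho> arbitrary: a directional derivative of the convolution is the
  convolution with the directional derivative of \<rho>.\<close>

lemma Ck_conv:
  assumes "integrable lborel f"
  shows "\<rho> \<in> Cc_inf UNIV \<Longrightarrow> Ck k (conv f \<rho>)"
proof (induction k arbitrary: \<rho>)
  case 0
  then have "\<rho> \<in> C1c UNIV" using Cc_inf_C1c by auto
  then have "conv f \<rho> differentiable (at x)" for x
    using conv_GDERIV[OF assms] unfolding gderiv_def differentiable_def by blast
  then show ?case by (auto intro!: differentiable_imp_continuous_on simp: differentiable_on_def)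
next
  case (Suc k)
  then have \<rho>: "\<rho> \<in> C1c UNIV" using Cc_inf_C1c by auto
  show ?case
  proof (rule Ck_SucI)
    show "(conv f \<rho> has_derivative (\<lambda>h. h \<bullet> (LINT y|lborel. f y *\<^sub>R grad \<rho> (x - y)))) (at x)" for x
      using conv_GDERIV[OF assms \<rho>] by (simp add: gderiv_def)
    fix b :: 'a assume b: "b \<in> Basis"
    have "b \<bullet> (LINT y|lborel. f y *\<^sub>R grad \<rho> (x - y)) = conv f (\<lambda>z. b \<bullet> grad \<rho> z) x" for x
    proof -
      obtain K where K: "compact K" "\<And>x. x \<notin> K \<Longrightarrow> grad \<rho> x = 0"
        using C1c_grad_outside[OF \<rho>] by metis
      obtain B where B: "0 < B" "\<And>x. norm (grad \<rho> x) \<le> B"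
        using compact_support_bounded[OF C1cD(4)[OF \<rho>] K] by metis
      have [measurable]: "grad \<rho> \<in> borel_measurable borel" "f \<in> borel_measurable borel"
        using C1cD(4)[OF \<rho>] assms by (auto intro: borel_measurable_continuous_onI)
      have "integrable lborel (\<lambda>y. f y *\<^sub>R grad \<rho> (x - y))"
      proof (rule Bochner_Integration.integrable_bound)
        show "integrable lborel (\<lambda>y. B * f y)" using assms by simp
        show "AE y in lborel. norm (f y *\<^sub>R grad \<rho> (x - y)) \<le> norm (B * f y)"
          using B by (auto simp: abs_mult mult.commute[of "\<bar>f _\<bar>"] intro!: mult_right_mono)
      qed measurable
      from integral_inner_right[OF this, of b] show ?thesis
        by (simp add: conv_def)
    qed
    then show "Ck k (\<lambda>x. b \<bullet> (LINT y|lborel. f y *\<^sub>R grad \<rho> (x - y)))"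
      using Suc.IH[OF Cc_inf_directional[OF Suc.prems b]] by simp
  qed
qed

text \<open>Convolving F with the indicator of a ball that exceeds the support by 1 gives a function
  that is constant near 0. Its gradient at 0 vanishes, and equals the integral of the gradient of
  F.\<close>

lemma integral_grad_eq_0:
  fixes F :: "'a::euclidean_space \<Rightarrow> real"
  assumes F: "F \<in> C1c UNIV"
  shows "(LINT x|lborel. grad F x) = 0"
proof -
  obtain K where K: "compact K" "\<And>x. x \<notin> K \<Longrightarrow> F x = 0" "\<And>x. x \<notin> K \<Longrightarrow> grad F x = 0"
    using C1c_grad_outside[OF F] by metis
  obtain r where r: "\<And>x. x \<in> K \<Longrightarrow> norm x \<le> r"
    using compact_imp_bounded[OF K(1)] unfolding bounded_iff by blast
  have [measurable]: "F \<in> borel_measurable borel" "grad F \<in> borel_measurable borel"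
    using C1cD[OF F] by (auto intro: borel_measurable_continuous_onI)
  define f :: "'a \<Rightarrow> real" where "f = indicator (ball 0 (r + 1))"
  have f: "integrable lborel f"
    unfolding f_def using emeasure_bounded_finite[of "ball 0 (r + 1)"]
    by (auto intro!: integrable_real_indicator simp: emeasure_lborel_ball_finite)
  have f1: "f y * F (x - y) = F (x - y)" "f y *\<^sub>R grad F (x - y) = grad F (x - y)" if "norm x < 1" for x y
  proof -
    have "F (x - y) = 0 \<and> grad F (x - y) = 0" if "y \<notin> ball 0 (r + 1)"
    proof -
      have "norm y - norm x \<le> norm (x - y)" by (metis norm_minus_commute norm_triangle_ineq2)
      then have "x - y \<notin> K" using r[of "x - y"] that \<open>norm x < 1\<close> by auto
      then show ?thesis using K by simp
    qed
    then show "f y * F (x - y) = F (x - y)" "f y *\<^sub>R grad F (x - y) = grad F (x - y)"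
      by (auto simp: f_def indicator_def)
  qed
  have const: "conv f F x = (LINT y|lborel. F y)" if "norm x < 1" for x
    unfolding conv_def f1(1)[OF that] by (rule integral_reflect) measurable
  have "((\<lambda>x. LINT y|lborel. F y) has_derivative (\<lambda>h. 0)) (at 0)" by simp
  then have "(conv f F has_derivative (\<lambda>h. 0)) (at 0)"
    by (rule has_derivative_transform_within_open[where s = "ball 0 1"]) (auto simp: const)
  then have "GDERIV (conv f F) 0 :> 0" by (simp add: gderiv_def)
  then have "(LINT y|lborel. f y *\<^sub>R grad F (0 - y)) = 0"
    using conv_GDERIV[OF f F, of 0] grad_eqI by metis
  then have "(LINT y|lborel. grad F (0 - y)) = 0" using f1(2)[of 0] by simp
  then show ?thesis using integral_reflect[of "grad F" 0] by simp
qed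

definition mollifier :: "real \<Rightarrow> ('a::euclidean_space \<Rightarrow> real) \<Rightarrow> bool" where
  "mollifier e \<rho> \<longleftrightarrow> \<rho> \<in> Cc_inf UNIV \<and> (\<forall>x. 0 \<le> \<rho> x) \<and> (\<forall>x. e \<le> norm x \<longrightarrow> \<rho> x = 0) \<and>
     (LINT x|lborel. \<rho> x) = 1"

lemma Cc_integrable: "f \<in> Cc U \<Longrightarrow> integrable lborel f"
  using compact_support_integrable[of f] CcE Cc_continuous by metis

lemma mollifier_exists:
  assumes "0 < e"
  shows "\<exists>\<rho> :: 'a::euclidean_space \<Rightarrow> real. mollifier e \<rho>"
proof -
  define b :: "'a \<Rightarrow> real" where "b x = expdecay 0 (e\<^sup>2 - x \<bullet> x)" for x
  have Ck: "Ck k b" for k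
    unfolding b_def by (intro Ck_expdecay Ck_diff Ck_const Ck_inner_self)
  have pos: "0 < b x \<longleftrightarrow> norm x < e" for x
    unfolding b_def expdecay_pos_iff using assms
    by (auto simp: power2_norm_eq_inner[symmetric] abs_le_square_iff[symmetric] not_le[symmetric])
  have nn: "0 \<le> b x" for x by (simp add: b_def expdecay_nonneg)
  have b0: "b x = 0" if "e \<le> norm x" for x using pos[of x] nn[of x] that by simp
  have bCc: "b \<in> Cc UNIV"
    by (rule CcI[OF Ck_continuous[OF Ck[of 0]], of "cball 0 e"]) (auto intro: b0)
  have int: "integrable lborel b" by (rule Cc_integrable[OF bCc])
  have "(LINT x|lborel. b x) \<noteq> 0"
  proof
    assume "(LINT x|lborel. b x) = 0"
    then have "AE x in lborel. b x = 0"
      using integral_nonneg_eq_0_iff_AE[OF int] nn by simp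
    then have "AE x::'a in lborel. x \<notin> ball 0 e"
      by (rule eventually_mono) (use pos in \<open>auto simp: order.strict_iff_order\<close>)
    then have "emeasure lborel (ball 0 e :: 'a set) = 0"
      by (subst (asm) AE_iff_measurable[of "ball 0 e"]) auto
    then show False using assms content_ball_eq_0_iff[of "0::'a" e] by (simp add: measure_def)
  qed
  moreover have "0 \<le> (LINT x|lborel. b x)" using nn by simp
  ultimately have Ipos: "0 < (LINT x|lborel. b x)" by simp
  define c where "c = 1 / (LINT x|lborel. b x)"
  have "b \<in> Cc_inf UNIV" using bCc Ck by (simp add: Cc_inf_def)
  then have "mollifier e (\<lambda>x. c * b x)"
    unfolding mollifier_def using Ipos nn b0 Cc_inf_cmult[of b UNIV c] by (auto simp: c_def)
  then show ?thesis by blast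
qed

lemma conv_outside:
  assumes "mollifier e \<rho>" "\<And>y. f y \<noteq> 0 \<Longrightarrow> e \<le> dist x y"
  shows "conv f \<rho> x = 0"
proof -
  have "(\<lambda>y. f y * \<rho> (x - y)) = (\<lambda>_. 0)"
    using assms by (force simp: mollifier_def dist_norm)
  then show ?thesis by (simp add: conv_def)
qed

lemma Cc_bounded:
  assumes "f \<in> Cc U" obtains B where "0 < B" "\<And>x. \<bar>f x\<bar> \<le> B"
proof -
  obtain K where K: "compact K" "K \<subseteq> U" "\<And>x. x \<notin> K \<Longrightarrow> f x = 0"
    using CcE[OF assms] by metis
  obtain B where "0 < B" "\<And>x. norm (f x) \<le> B"
    using compact_support_bounded[OF Cc_continuous[OF assms] K(1,3)] by metis
  then show thesis using that[of B] by simp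
qed

lemma mollifier_reflect:
  assumes "mollifier e \<rho>"
  shows "(LINT y|lborel. \<rho> (x - y)) = 1" "integrable lborel (\<lambda>y. \<rho> (x - y))"
    "\<rho> \<in> borel_measurable borel" "0 \<le> \<rho> z"
proof -
  have C: "\<rho> \<in> Cc UNIV" using assms by (simp add: mollifier_def Cc_inf_def)
  then show [measurable]: "\<rho> \<in> borel_measurable borel"
    by (intro borel_measurable_continuous_onI Cc_continuous)
  show "(LINT y|lborel. \<rho> (x - y)) = 1"
    using integral_reflect[of \<rho> x] assms by (simp add: mollifier_def)
  then show "integrable lborel (\<lambda>y. \<rho> (x - y))"
    using not_integrable_integral_eq by fastforce
  show "0 \<le> \<rho> z" using assms by (simp add: mollifier_def)
qed

text \<open>The convolution averages f over a ball of radius e. With c = f x this gives uniform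
  convergence, with a fixed c it bounds the range of the convolution.\<close>

lemma conv_diff_le:
  assumes f: "f \<in> Cc U" and \<rho>: "mollifier e \<rho>"
    and le: "\<And>y. dist x y < e \<Longrightarrow> \<bar>f y - c\<bar> \<le> d"
  shows "\<bar>conv f \<rho> x - c\<bar> \<le> d"
proof -
  note m = mollifier_reflect[OF \<rho>]
  have [measurable]: "\<rho> \<in> borel_measurable borel" by (rule m)
  have int: "integrable lborel (\<lambda>y. f y * \<rho> (x - y))"
  proof -
    have "\<rho> \<in> Cc UNIV" using \<rho> by (simp add: mollifier_def Cc_inf_def)
    then obtain B where "\<And>y. \<bar>\<rho> y\<bar> \<le> B" using Cc_bounded by blast
    then show ?thesis
      using integrable_mult_bounded[OF Cc_integrable[OF f], of "\<lambda>y. \<rho> (x - y)" B] by (simp add: mult.commute)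
  qed
  have "conv f \<rho> x - c = (LINT y|lborel. f y * \<rho> (x - y)) - (LINT y|lborel. c * \<rho> (x - y))"
    using m(1,2)[of x] by (simp add: conv_def)
  also have "\<dots> = (LINT y|lborel. (f y - c) * \<rho> (x - y))"
    using int m(2)[of x] by (simp add: left_diff_distrib)
  also have "norm \<dots> \<le> (LINT y|lborel. d * \<rho> (x - y))"
  proof (rule Bochner_Integration.integral_norm_bound_integral)
    show "integrable lborel (\<lambda>y. (f y - c) * \<rho> (x - y))"
      using int m(2)[of x] by (simp add: left_diff_distrib)
    show "norm ((f y - c) * \<rho> (x - y)) \<le> d * \<rho> (x - y)" for y
    proof (cases "dist x y < e")
      case True
      then show ?thesis using le[OF True] m(4)[of "x - y"] by (auto simp: abs_mult intro!: mult_right_mono)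
    next
      case False
      then show ?thesis using \<rho> by (simp add: mollifier_def dist_norm)
    qed
  qed (use m(2)[of x] in simp)
  also have "\<dots> = d" using m(1)[of x] by simp
  finally show ?thesis by simp
qed

lemma conv_Cc_inf:
  assumes f: "f \<in> Cc V" and K: "compact K" "\<And>x. x \<notin> K \<Longrightarrow> f x = 0"
    and U: "(\<Union>x\<in>K. cball x d) \<subseteq> U" and \<rho>: "mollifier e \<rho>" and e: "e \<le> d"
  shows "conv f \<rho> \<in> Cc_inf U" "\<And>x. x \<notin> (\<Union>x\<in>K. cball x d) \<Longrightarrow> conv f \<rho> x = 0"
proof -
  have Ck: "Ck k (conv f \<rho>)" for k
    using Ck_conv[OF Cc_integrable[OF f]] \<rho> by (simp add: mollifier_def)
  show out: "conv f \<rho> x = 0" if "x \<notin> (\<Union>x\<in>K. cball x d)" for x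
  proof (rule conv_outside[OF \<rho>])
    fix y assume "f y \<noteq> 0"
    then have "y \<in> K" using K by auto
    then have "\<not> dist y x \<le> d" using that by auto
    then show "e \<le> dist x y" using e by (simp add: dist_commute)
  qed
  show "conv f \<rho> \<in> Cc_inf U"
    unfolding Cc_inf_def
    using CcI[OF Ck_continuous[OF Ck[of 0]] compact_thickening[OF K(1)] U out] Ck by auto
qed

lemma smooth_cutoff:
  fixes K :: "'a::euclidean_space set"
  assumes K: "compact K" "K \<subseteq> U" and U: "open U"
  obtains \<eta> W where "\<eta> \<in> Cc_inf U" "\<And>x. 0 \<le> \<eta> x" "\<And>x. \<eta> x \<le> 1" "open W" "K \<subseteq> W" "\<And>x. x \<in> W \<Longrightarrow> \<eta> x = 1"
proof (cases "K = {}")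
  case True
  have "(\<lambda>_::'a. 0::real) \<in> Cc_inf U"
    unfolding Cc_inf_def by (auto intro!: CcI[of _ "{}"])
  then show thesis using True by (intro that[of "\<lambda>_. 0" "{}"]) auto
next
  case False
  obtain d0 where d0: "0 < d0" "(\<Union>x\<in>K. cball x d0) \<subseteq> U"
    using compact_subset_open_imp_cball_epsilon_subset[OF K(1) U K(2)] by metis
  define d where "d = d0 / 4"
  have d: "0 < d" using d0 by (simp add: d_def)
  \<comment> \<open>A tent that is 1 within distance d of K and 0 beyond 2 * d. Mollified at the
    scale d / 2 it is still 1 within d / 2 and is supported within 3 * d, which is less than
    d0.\<close>
  define f where "f x = max 0 (min 1 (2 - infdist x K / d))" for x
  have f0: "f x = 0" if "x \<notin> (\<Union>x\<in>K. cball x (2 * d))" for x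
  proof -
    obtain y where "y \<in> K" "infdist x K = dist x y"
      using infdist_attains_inf[of K x] False compact_imp_closed[OF K(1)] by metis
    then have "2 * d < infdist x K" using that by (auto simp: dist_commute not_le)
    then have "2 \<le> infdist x K / d" using d by (simp add: pos_le_divide_eq)
    then show ?thesis by (simp add: f_def)
  qed
  have fcont: "continuous_on UNIV f"
    unfolding f_def using d by (intro continuous_intros) auto
  have f: "f \<in> Cc UNIV"
    by (rule CcI[OF fcont compact_thickening[OF K(1)] _ f0]) auto
  obtain \<rho> :: "'a \<Rightarrow> real" where \<rho>: "mollifier (d / 2) \<rho>"
    using mollifier_exists[of "d / 2"] d by auto
  have sub: "(\<Union>x\<in>(\<Union>x\<in>K. cball x (2 * d)). cball x d) \<subseteq> (\<Union>x\<in>K. cball x d0)"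
  proof
    fix z assume "z \<in> (\<Union>x\<in>(\<Union>x\<in>K. cball x (2 * d)). cball x d)"
    then obtain x y where xy: "x \<in> K" "dist x y \<le> 2 * d" "dist y z \<le> d" by auto
    then have "dist x z \<le> d0" using dist_triangle[of x z y] d by (simp add: d_def)
    then show "z \<in> (\<Union>x\<in>K. cball x d0)" using xy by auto
  qed
  have 1: "conv f \<rho> \<in> Cc_inf U"
    by (rule conv_Cc_inf(1)[OF f compact_thickening[OF K(1)] f0 order_trans[OF sub d0(2)] \<rho>]) (use d in auto)
  \<comment> \<open>The range [0, 1] is expressed as distance at most 1 / 2 from 1 / 2, the form
    that \<open>conv_diff_le\<close> provides.\<close>
  have "\<bar>conv f \<rho> x - 1/2\<bar> \<le> 1/2" for x
    by (rule conv_diff_le[OF f \<rho>]) (auto simp: f_def max_def min_def abs_if)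
  then have 2: "0 \<le> conv f \<rho> x \<and> conv f \<rho> x \<le> 1" for x
    using abs_le_iff[of "conv f \<rho> x - 1/2" "1/2"] by (simp add: field_simps)
  have 3: "conv f \<rho> x = 1" if xW: "x \<in> (\<Union>x\<in>K. ball x (d/2))" for x
  proof -
    obtain k where k: "k \<in> K" "dist k x < d / 2"
      using xW unfolding UN_iff mem_ball by blast
    have "\<bar>f y - 1\<bar> \<le> 0" if "dist x y < d / 2" for y
    proof -
      have "infdist y K \<le> dist y k" using k by (simp add: infdist_le)
      also have "\<dots> < d" using dist_triangle[of y k x] k that by (simp add: dist_commute)
      finally have "infdist y K / d \<le> 1" using d by simp
      then show ?thesis by (simp add: f_def)
    qed
    from conv_diff_le[OF f \<rho> this] show ?thesis by simp
  qed
  have "K \<subseteq> (\<Union>x\<in>K. ball x (d / 2))"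
  proof
    fix x assume "x \<in> K"
    then show "x \<in> (\<Union>x\<in>K. ball x (d / 2))" using d by (intro UN_I[of x]) auto
  qed
  with 1 2 3 show thesis
    by (intro that[of "conv f \<rho>" "\<Union>x\<in>K. ball x (d / 2)"]) auto
qed

text \<open>One compact set K, with room r around it inside U, carries f and all its mollifications.
  This permits uniform convergence to be integrated against functions that are only locally
  integrable.\<close>

lemma mollify_Cc:
  fixes f :: "'a::euclidean_space \<Rightarrow> real"
  assumes f: "f \<in> Cc U" and U: "open U"
  obtains K r \<rho> where "compact K" "0 < r" "(\<Union>x\<in>K. cball x r) \<subseteq> U"
    "\<And>n. mollifier (r / (real n + 1)) (\<rho> n)" "\<And>n. conv f (\<rho> n) \<in> Cc_inf U"
    "\<And>x. x \<notin> K \<Longrightarrow> f x = 0" "\<And>n x. x \<notin> K \<Longrightarrow> conv f (\<rho> n) x = 0"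
    "uniform_limit UNIV (\<lambda>n. conv f (\<rho> n)) f sequentially"
proof -
  obtain K where K: "compact K" "K \<subseteq> U" "\<And>x. x \<notin> K \<Longrightarrow> f x = 0" using CcE[OF f] by blast
  obtain d where d: "0 < d" "(\<Union>x\<in>K. cball x d) \<subseteq> U"
    using compact_subset_open_imp_cball_epsilon_subset[OF K(1) U K(2)] by metis
  define r where "r = d / 2"
  have r: "0 < r" using d by (simp add: r_def)
  define K' where "K' = (\<Union>x\<in>K. cball x r)"
  have K': "compact K'" "K \<subseteq> K'"
    unfolding K'_def using compact_thickening[OF K(1)] r by (auto intro!: UN_I)
  have K'd: "(\<Union>x\<in>K'. cball x r) \<subseteq> U"
  proof
    fix z assume "z \<in> (\<Union>x\<in>K'. cball x r)"
    then obtain x y where xy: "x \<in> K" "dist x y \<le> r" "dist y z \<le> r" by (auto simp: K'_def)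
    then have "dist x z \<le> d" using dist_triangle[of x z y] by (simp add: r_def)
    then have "z \<in> (\<Union>x\<in>K. cball x d)" using xy by auto
    then show "z \<in> U" using d by blast
  qed
  have "\<exists>\<rho> :: 'a \<Rightarrow> real. mollifier (r / (real n + 1)) \<rho>" for n
    using mollifier_exists[of "r / (real n + 1)"] r by simp
  then obtain \<rho> :: "nat \<Rightarrow> 'a \<Rightarrow> real" where \<rho>: "\<And>n. mollifier (r / (real n + 1)) (\<rho> n)" by metis
  have le: "r / (real n + 1) \<le> r" for n using r by (simp add: divide_simps)
  have sub: "(\<Union>x\<in>K. cball x r) \<subseteq> U"
    using K'd K'(2) by auto
  note c = conv_Cc_inf[OF f K(1,3) sub \<rho> le]
  have "uniform_limit UNIV (\<lambda>n. conv f (\<rho> n)) f sequentially"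
  proof (rule uniform_limitI)
    fix e :: real assume e: "0 < e"
    obtain \<delta> where \<delta>: "0 < \<delta>" "\<And>x y. dist x y < \<delta> \<Longrightarrow> dist (f x) (f y) < e / 2"
      using compact_support_uniformly_continuous[OF Cc_continuous[OF f] K(1,3)] e
      unfolding uniformly_continuous_on_def by (metis UNIV_I half_gt_zero dist_commute)
    have "(\<lambda>n. r / (real n + 1)) \<longlonglongrightarrow> 0"
      using tendsto_mult_left[OF LIMSEQ_inverse_real_of_nat, of r]
      by (simp add: divide_inverse add.commute)
    then have "\<forall>\<^sub>F n in sequentially. r / (real n + 1) < \<delta>"
      using \<delta>(1) by (rule order_tendstoD)
    then show "\<forall>\<^sub>F n in sequentially. \<forall>x\<in>UNIV. dist (conv f (\<rho> n) x) (f x) < e"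
    proof eventually_elim
      case (elim n)
      show ?case
      proof
        fix x
        have "\<bar>conv f (\<rho> n) x - f x\<bar> \<le> e / 2"
        proof (rule conv_diff_le[OF f \<rho>])
          fix y assume "dist x y < r / (real n + 1)"
          then have "dist (f x) (f y) < e / 2" using elim by (intro \<delta>) auto
          then show "\<bar>f y - f x\<bar> \<le> e / 2" by (simp add: dist_real_def abs_minus_commute)
        qed
        then show "dist (conv f (\<rho> n) x) (f x) < e" using e by (simp add: dist_real_def)
      qed
    qed
  qed
  moreover have "x \<notin> K' \<Longrightarrow> f x = 0" for x using K K' by auto
  ultimately show thesis
    using that[OF K'(1) r K'd \<rho> c(1)] c(2) unfolding K'_def by blast
qed

section \<open>Weak gradients\<close>

lemma lebesgue_on_integral_outside:
  fixes f :: "'a::euclidean_space \<Rightarrow> 'b::{banach, second_countable_topology}"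
  assumes "U \<in> sets lebesgue" "\<And>x. x \<notin> U \<Longrightarrow> f x = 0"
  shows "(LINT x|lebesgue_on U. f x) = (LINT x|lebesgue. f x)"
    and "integrable (lebesgue_on U) f \<longleftrightarrow> integrable lebesgue f"
proof -
  have "(\<lambda>x. indicator U x *\<^sub>R f x) = f" using assms(2) by (auto simp: indicator_def)
  then show "(LINT x|lebesgue_on U. f x) = (LINT x|lebesgue. f x)"
    "integrable (lebesgue_on U) f \<longleftrightarrow> integrable lebesgue f"
    using assms(1) by (simp_all add: integral_restrict_space integrable_restrict_space)
qed

lemma Lp_loc_1_iff:
  "f \<in> Lp_loc U 1 \<longleftrightarrow> (\<forall>K. compact K \<and> K \<subseteq> U \<longrightarrow> integrable (lebesgue_on K) f)"
proof -
  have "f \<in> Lp K 1 \<longleftrightarrow> integrable (lebesgue_on K) f" for K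
    by (auto simp: Lp_def integrable_norm_iff)
  then show ?thesis by (simp add: Lp_loc_def)
qed

lemma compact_lebesgue [simp]: "compact K \<Longrightarrow> K \<in> sets lebesgue" for K :: "'a::euclidean_space set"
  by (simp add: compact_imp_closed)

lemma AE_lebesgue_on_compacts:
  fixes U :: "'a::euclidean_space set"
  assumes U: "open U" and "\<And>K. compact K \<Longrightarrow> K \<subseteq> U \<Longrightarrow> AE x in lebesgue. x \<in> K \<longrightarrow> P x"
  shows "AE x in lebesgue_on U. P x"
proof -
  obtain C where C: "\<And>n::nat. compact (C n)" "\<And>n. C n \<subseteq> U" "\<Union>(range C) = U"
    using open_Union_compact_subsets[OF U] by metis
  have "AE x in lebesgue. \<forall>n. x \<in> C n \<longrightarrow> P x"
    unfolding AE_all_countable using assms(2) C by blast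
  then have "AE x in lebesgue. x \<in> U \<longrightarrow> P x"
    by eventually_elim (use C in auto)
  then show ?thesis using U by (simp add: AE_restrict_space_iff)
qed

lemma borel_measurable_on_compacts:
  fixes U :: "'a::euclidean_space set" and f :: "'a \<Rightarrow> 'b::topological_space"
  assumes U: "open U" and f: "\<And>K. compact K \<Longrightarrow> K \<subseteq> U \<Longrightarrow> f \<in> borel_measurable (lebesgue_on K)"
  shows "f \<in> borel_measurable (lebesgue_on U)"
proof -
  obtain C where C: "\<And>n::nat. compact (C n)" "\<And>n. C n \<subseteq> U" "\<Union>(range C) = U"
    using open_Union_compact_subsets[OF U] by metis
  show ?thesis
  proof (rule measurable_piecewise_restrict[where C = "range C"])
    show "space (lebesgue_on U) \<subseteq> \<Union>(range C)" using C by simp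
    fix \<Omega> assume "\<Omega> \<in> range C"
    then obtain n where n: "\<Omega> = C n" by auto
    have eq: "U \<inter> C n = C n" using C(2)[of n] by auto
    show "\<Omega> \<inter> space (lebesgue_on U) \<in> sets (lebesgue_on U)"
      using C(1)[of n] C(2)[of n] U unfolding n
      by (auto simp: sets_restrict_space_iff Int_absorb2)
    show "f \<in> restrict_space (lebesgue_on U) \<Omega> \<rightarrow>\<^sub>M borel"
      unfolding n using f[OF C(1,2)[of n]] U C(1)[of n] by (simp add: restrict_restrict_space eq)
  qed auto
qed

lemma Lp_loc_1_measurable:
  "open U \<Longrightarrow> f \<in> Lp_loc U 1 \<Longrightarrow> f \<in> borel_measurable (lebesgue_on U)"
  unfolding Lp_loc_1_iff
  by (rule borel_measurable_on_compacts) (auto intro: borel_measurable_integrable)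

lemma Cc_mult_integrable:
  fixes h :: "'a::euclidean_space \<Rightarrow> 'b::euclidean_space"
  assumes "\<phi> \<in> Cc U" "h \<in> Lp_loc U 1"
  shows "integrable lebesgue (\<lambda>x. \<phi> x *\<^sub>R h x)"
proof -
  obtain K where K: "compact K" "K \<subseteq> U" "\<And>x. x \<notin> K \<Longrightarrow> \<phi> x = 0" using CcE[OF assms(1)] by blast
  obtain B where B: "\<And>x. norm (\<phi> x) \<le> B"
    using compact_support_bounded[OF Cc_continuous[OF assms(1)] K(1,3)] by metis
  have "\<phi> \<in> borel_measurable (lebesgue_on K)"
    using borel_measurable_continuous_onI[OF Cc_continuous[OF assms(1)]]
    by (intro measurable_restrict_space1 measurable_completion) simp
  then have "integrable (lebesgue_on K) (\<lambda>x. \<phi> x *\<^sub>R h x)"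
    using assms(2) K B by (intro integrable_mult_bounded[where B = B]) (auto simp: Lp_loc_1_iff)
  then show ?thesis
    using lebesgue_on_integral_outside(2)[of K "\<lambda>x. \<phi> x *\<^sub>R h x"] K by simp
qed

text \<open>The mollifications of \<psi> converge uniformly and all live on one compact set, on
  which h is integrable.\<close>

lemma integral_Cc_inf_eq_0_imp_Cc:
  fixes h :: "'a::euclidean_space \<Rightarrow> real"
  assumes U: "open U" and h: "h \<in> Lp_loc U 1"
    and 0: "\<And>\<phi>. \<phi> \<in> Cc_inf U \<Longrightarrow> (LINT x|lebesgue. \<phi> x * h x) = 0"
    and \<psi>: "\<psi> \<in> Cc U"
  shows "(LINT x|lebesgue. \<psi> x * h x) = 0"
proof -
  obtain K r \<rho> where K: "compact K" "0 < r" "(\<Union>x\<in>K. cball x r) \<subseteq> U"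
    and C: "\<And>n. conv \<psi> (\<rho> n) \<in> Cc_inf U"
    and out: "\<And>x. x \<notin> K \<Longrightarrow> \<psi> x = 0" "\<And>n x. x \<notin> K \<Longrightarrow> conv \<psi> (\<rho> n) x = 0"
    and lim: "uniform_limit UNIV (\<lambda>n. conv \<psi> (\<rho> n)) \<psi> sequentially"
    using mollify_Cc[OF \<psi> U] by metis
  have "K \<subseteq> U" using K(2,3) by force
  then have hK: "integrable (lebesgue_on K) h" using h K(1) by (auto simp: Lp_loc_1_iff)
  define g where "g x = indicator K x * \<bar>h x\<bar>" for x
  have g: "integrable lebesgue g"
  proof -
    have "g = (\<lambda>x. \<bar>indicator K x *\<^sub>R h x\<bar>)" by (auto simp: g_def abs_mult)
    then show ?thesis using hK K(1) by (simp add: integrable_restrict_space del: real_scaleR_def)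
  qed
  define M where "M = (LINT x|lebesgue. g x)"
  have M: "0 \<le> M" unfolding M_def g_def by simp
  have int: "integrable lebesgue (\<lambda>x. \<psi> x * h x)"
    "integrable lebesgue (\<lambda>x. conv \<psi> (\<rho> n) x * h x)" for n
    using Cc_mult_integrable[OF \<psi> h] Cc_mult_integrable[OF Cc_inf_Cc[OF C] h] by auto
  have le: "\<bar>LINT x|lebesgue. \<psi> x * h x\<bar> \<le> e" if e: "0 < e" for e
  proof -
    have e': "0 < e / (M + 1)" using e M by simp
    obtain n where n: "\<And>x. dist (conv \<psi> (\<rho> n) x) (\<psi> x) < e / (M + 1)"
      using uniform_limitD[OF lim e'] by (force simp: eventually_sequentially)
    have "(LINT x|lebesgue. \<psi> x * h x) = (LINT x|lebesgue. \<psi> x * h x - conv \<psi> (\<rho> n) x * h x)"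
      using 0[OF C] int by simp
    also have "norm \<dots> \<le> (LINT x|lebesgue. e / (M + 1) * g x)"
    proof (rule Bochner_Integration.integral_norm_bound_integral)
      fix x
      show "norm (\<psi> x * h x - conv \<psi> (\<rho> n) x * h x) \<le> e / (M + 1) * g x"
      proof (cases "x \<in> K")
        case True
        have "norm (\<psi> x * h x - conv \<psi> (\<rho> n) x * h x) = \<bar>\<psi> x - conv \<psi> (\<rho> n) x\<bar> * \<bar>h x\<bar>"
          by (simp add: left_diff_distrib[symmetric] abs_mult)
        also have "\<dots> \<le> e / (M + 1) * \<bar>h x\<bar>"
          using n[of x] by (intro mult_right_mono) (auto simp: dist_real_def abs_minus_commute)
        finally show ?thesis using True by (simp add: g_def)
      qed (use out in \<open>simp add: g_def\<close>)
    qed (use int g in auto)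
    also have "\<dots> = e / (M + 1) * M" using g by (simp add: M_def)
    also have "\<dots> \<le> e" using e M by (simp add: field_simps)
    finally show ?thesis by simp
  qed
  have "\<bar>LINT x|lebesgue. \<psi> x * h x\<bar> \<le> 0" by (rule field_le_epsilon) (use le in simp)
  then show ?thesis by simp
qed

text \<open>The sign of h is an almost everywhere limit of continuous functions. Tested with these,
  multiplied by a cut-off \<eta>, the hypothesis says in the limit that \<eta> times the absolute
  value of h has integral 0.\<close>

lemma fundamental_lemma_real:
  fixes h :: "'a::euclidean_space \<Rightarrow> real"
  assumes U: "open U" and h: "h \<in> Lp_loc U 1"
    and 0: "\<And>\<phi>. \<phi> \<in> Cc_inf U \<Longrightarrow> (LINT x|lebesgue. \<phi> x * h x) = 0"
  shows "AE x in lebesgue_on U. h x = 0"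
proof (rule AE_lebesgue_on_compacts[OF U])
  fix K assume K: "compact K" "K \<subseteq> U"
  obtain \<eta> W where \<eta>: "\<eta> \<in> Cc_inf U" "\<And>x. 0 \<le> \<eta> x" "K \<subseteq> W" "\<And>x. x \<in> W \<Longrightarrow> \<eta> x = 1"
    using smooth_cutoff[OF K U] by metis
  have hm: "h \<in> borel_measurable (lebesgue_on U)" by (rule Lp_loc_1_measurable[OF U h])
  define s where "s x = sgn (if x \<in> U then h x else 0)" for x
  have "(\<lambda>x. if x \<in> U then h x else 0) \<in> borel_measurable lebesgue"
    using hm U by (intro measurable_If_restrict_space_iff[THEN iffD2]) auto
  then have "s \<in> borel_measurable lebesgue" unfolding s_def by measurable
  then have "s measurable_on UNIV" by (intro lebesgue_measurable_imp_measurable_on) auto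
  then obtain N F where N: "negligible N" and F: "\<And>n. continuous_on UNIV (F n)"
    and lim: "\<And>x. x \<notin> N \<Longrightarrow> (\<lambda>n. F n x) \<longlonglongrightarrow> s x"
    unfolding measurable_on_def by auto
  \<comment> \<open>Truncation to [-1, 1] supplies the dominating function and does not move the
    limit, whose values are -1, 0 and 1.\<close>
  define G where "G n x = max (- 1) (min 1 (F n x))" for n x
  have G: "continuous_on UNIV (G n)" for n
    unfolding G_def by (intro continuous_intros F)
  have limG: "(\<lambda>n. G n x) \<longlonglongrightarrow> s x" if "x \<notin> N" for x
  proof -
    have "(\<lambda>n. G n x) \<longlonglongrightarrow> max (- 1) (min 1 (s x))"
      unfolding G_def by (intro tendsto_intros lim that)
    then show ?thesis by (simp add: s_def sgn_if)
  qed
  have AEN: "AE x in lebesgue. x \<notin> N"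
    using N by (metis AE_not_in negligible_iff_null_sets)
  have intm: "integrable lebesgue (\<lambda>x. \<eta> x * h x)"
    using Cc_mult_integrable[OF Cc_inf_Cc[OF \<eta>(1)] h] by simp
  have Gm: "(\<lambda>x. (G n x * \<eta> x) * h x) \<in> borel_measurable lebesgue" for n
    using Cc_mult_integrable[OF Cc_mult[OF Cc_inf_Cc[OF \<eta>(1)] G[of n]] h] by auto
  have "(\<lambda>n. LINT x|lebesgue. (G n x * \<eta> x) * h x) \<longlonglongrightarrow> (LINT x|lebesgue. s x * (\<eta> x * h x))"
  proof (rule integral_dominated_convergence)
    show "integrable lebesgue (\<lambda>x. \<bar>\<eta> x * h x\<bar>)" using intm by simp
    show "(\<lambda>x. s x * (\<eta> x * h x)) \<in> borel_measurable lebesgue"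
      using \<open>s \<in> borel_measurable lebesgue\<close> borel_measurable_integrable[OF intm] by measurable
    show "AE x in lebesgue. (\<lambda>n. (G n x * \<eta> x) * h x) \<longlonglongrightarrow> s x * (\<eta> x * h x)"
      using AEN by eventually_elim (auto intro!: tendsto_eq_intros limG)
    show "AE x in lebesgue. norm ((G n x * \<eta> x) * h x) \<le> \<bar>\<eta> x * h x\<bar>" for n
    proof (rule AE_I2)
      fix x
      have "\<bar>G n x\<bar> * \<bar>\<eta> x * h x\<bar> \<le> 1 * \<bar>\<eta> x * h x\<bar>"
        by (intro mult_right_mono) (auto simp: G_def)
      then show "norm ((G n x * \<eta> x) * h x) \<le> \<bar>\<eta> x * h x\<bar>" by (simp add: abs_mult)
    qed
  qed (rule Gm)
  moreover have "(LINT x|lebesgue. (G n x * \<eta> x) * h x) = 0" for n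
    using integral_Cc_inf_eq_0_imp_Cc[OF U h 0 Cc_mult[OF Cc_inf_Cc[OF \<eta>(1)] G[of n]]] by simp
  ultimately have I0: "(LINT x|lebesgue. s x * (\<eta> x * h x)) = 0"
    by (simp add: LIMSEQ_const_iff)
  have eq: "s x * (\<eta> x * h x) = \<bar>\<eta> x * h x\<bar>" for x
  proof (cases "x \<in> U")
    case True
    then show ?thesis using \<eta>(2)[of x] by (auto simp: s_def sgn_if abs_mult)
  qed (use Cc_outside[OF Cc_inf_Cc[OF \<eta>(1)]] in simp)
  have "AE x in lebesgue. \<bar>\<eta> x * h x\<bar> = 0"
    using I0 intm unfolding eq by (subst (asm) integral_nonneg_eq_0_iff_AE) auto
  then show "AE x in lebesgue. x \<in> K \<longrightarrow> h x = 0"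
    by eventually_elim (use \<eta> in auto)
qed

lemma Lp_loc_inner:
  fixes h :: "'a::euclidean_space \<Rightarrow> 'b::euclidean_space"
  shows "h \<in> Lp_loc U 1 \<Longrightarrow> (\<lambda>x. h x \<bullet> b) \<in> Lp_loc U 1"
  unfolding Lp_loc_1_iff by (auto intro: integrable_inner_left)

lemma fundamental_lemma:
  fixes h :: "'a::euclidean_space \<Rightarrow> 'b::euclidean_space"
  assumes U: "open U" and h: "h \<in> Lp_loc U 1"
    and 0: "\<And>\<phi>. \<phi> \<in> Cc_inf U \<Longrightarrow> (LINT x|lebesgue. \<phi> x *\<^sub>R h x) = 0"
  shows "AE x in lebesgue_on U. h x = 0"
proof -
  have "AE x in lebesgue_on U. h x \<bullet> b = 0" if "b \<in> Basis" for b
  proof (rule fundamental_lemma_real[OF U Lp_loc_inner[OF h]])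
    fix \<phi> assume \<phi>: "\<phi> \<in> Cc_inf U"
    show "(LINT x|lebesgue. \<phi> x * (h x \<bullet> b)) = 0"
      using integral_inner_left[OF Cc_mult_integrable[OF Cc_inf_Cc[OF \<phi>] h], of b] 0[OF \<phi>] by simp
  qed
  then have "AE x in lebesgue_on U. \<forall>b\<in>Basis. h x \<bullet> b = 0"
    by (simp add: AE_finite_all)
  then show ?thesis by eventually_elim (auto simp: euclidean_all_zero_iff)
qed

lemma loc_mult_integrable:
  fixes u :: "'a::euclidean_space \<Rightarrow> real" and F :: "'a \<Rightarrow> 'b::euclidean_space"
  assumes u: "u \<in> Lp_loc U 1" and F: "continuous_on UNIV F"
    and K: "compact K" "K \<subseteq> U" "\<And>x. x \<notin> K \<Longrightarrow> F x = 0"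
  shows "integrable lebesgue (\<lambda>x. u x *\<^sub>R F x)"
proof -
  obtain B where B: "\<And>x. norm (F x) \<le> B" using compact_support_bounded[OF F K(1,3)] by metis
  have uK: "integrable (lebesgue_on K) u" using u K by (auto simp: Lp_loc_1_iff)
  have Fm: "F \<in> borel_measurable (lebesgue_on K)"
    using borel_measurable_continuous_onI[OF F] by (intro measurable_restrict_space1 measurable_completion) simp
  have "integrable (lebesgue_on K) (\<lambda>x. u x *\<^sub>R F x)"
  proof (rule Bochner_Integration.integrable_bound)
    show "integrable (lebesgue_on K) (\<lambda>x. B * u x)" using uK by simp
    show "AE x in lebesgue_on K. norm (u x *\<^sub>R F x) \<le> norm (B * u x)"
    proof (rule AE_I2)
      fix x
      have "\<bar>u x\<bar> * norm (F x) \<le> \<bar>u x\<bar> * \<bar>B\<bar>"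
        using B[of x] by (intro mult_left_mono) auto
      then show "norm (u x *\<^sub>R F x) \<le> norm (B * u x)" by (simp add: abs_mult mult.commute)
    qed
    show "(\<lambda>x. u x *\<^sub>R F x) \<in> borel_measurable (lebesgue_on K)"
      using Fm borel_measurable_integrable[OF uK] by measurable
  qed
  then show ?thesis
    using lebesgue_on_integral_outside(2)[of K "\<lambda>x. u x *\<^sub>R F x"] K by simp
qed

lemma Cc_inf_grad:
  assumes "\<phi> \<in> Cc_inf U"
  shows "continuous_on UNIV (grad \<phi>)"
    and "\<exists>K. compact K \<and> K \<subseteq> U \<and> (\<forall>x. x \<notin> K \<longrightarrow> \<phi> x = 0 \<and> grad \<phi> x = 0)"
proof -
  have C: "\<phi> \<in> C1c U" using assms Cc_inf_C1c by auto
  show "continuous_on UNIV (grad \<phi>)" by (rule C1cD(4)[OF C])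
  show "\<exists>K. compact K \<and> K \<subseteq> U \<and> (\<forall>x. x \<notin> K \<longrightarrow> \<phi> x = 0 \<and> grad \<phi> x = 0)"
    using C1c_grad_outside[OF C] by metis
qed

lemma weak_gradient_iff:
  assumes U: "open U"
  shows "weak_gradient U u G \<longleftrightarrow> u \<in> Lp_loc U 1 \<and> G \<in> Lp_loc U 1 \<and>
    (\<forall>\<phi>\<in>Cc_inf U. (LINT x|lebesgue. u x *\<^sub>R grad \<phi> x) = - (LINT x|lebesgue. \<phi> x *\<^sub>R G x))"
proof -
  have "(LINT x|lebesgue_on U. u x *\<^sub>R grad \<phi> x) = (LINT x|lebesgue. u x *\<^sub>R grad \<phi> x)"
    "(LINT x|lebesgue_on U. \<phi> x *\<^sub>R G x) = (LINT x|lebesgue. \<phi> x *\<^sub>R G x)" if \<phi>: "\<phi> \<in> Cc_inf U" for \<phi>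
  proof -
    obtain K where "K \<subseteq> U" "\<forall>x. x \<notin> K \<longrightarrow> \<phi> x = 0 \<and> grad \<phi> x = 0" using Cc_inf_grad(2)[OF \<phi>] by auto
    then have "\<phi> x = 0 \<and> grad \<phi> x = 0" if "x \<notin> U" for x using that by auto
    then show "(LINT x|lebesgue_on U. u x *\<^sub>R grad \<phi> x) = (LINT x|lebesgue. u x *\<^sub>R grad \<phi> x)"
      "(LINT x|lebesgue_on U. \<phi> x *\<^sub>R G x) = (LINT x|lebesgue. \<phi> x *\<^sub>R G x)"
      using U by (intro lebesgue_on_integral_outside(1); simp)+
  qed
  then show ?thesis by (simp add: weak_gradient_def)
qed

lemma weak_gradient_wgrad: "has_weak_gradient U u \<Longrightarrow> weak_gradient U u (wgrad U u)"
  unfolding has_weak_gradient_def wgrad_def by (erule someI_ex)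

lemma Lp_loc_1_diff:
  fixes f :: "'a::euclidean_space \<Rightarrow> 'b::euclidean_space"
  shows "f \<in> Lp_loc U 1 \<Longrightarrow> h \<in> Lp_loc U 1 \<Longrightarrow> (\<lambda>x. f x - h x) \<in> Lp_loc U 1"
  unfolding Lp_loc_1_iff by auto

lemma Lp_loc_1_lin:
  fixes f :: "'a::euclidean_space \<Rightarrow> 'b::euclidean_space"
  shows "f \<in> Lp_loc U 1 \<Longrightarrow> h \<in> Lp_loc U 1 \<Longrightarrow> (\<lambda>x. a *\<^sub>R f x + b *\<^sub>R h x) \<in> Lp_loc U 1"
  unfolding Lp_loc_1_iff by auto

lemma AE_lebesgue_on_subset:
  fixes U :: "'a::euclidean_space set"
  assumes "AE x in lebesgue_on U. P x" "U \<in> sets lebesgue" "K \<in> sets lebesgue" "K \<subseteq> U"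
  shows "AE x in lebesgue_on K. P x"
proof -
  have "AE x in lebesgue. x \<in> U \<longrightarrow> P x" using assms by (simp add: AE_restrict_space_iff)
  then have "AE x in lebesgue. x \<in> K \<longrightarrow> P x" by eventually_elim (use assms in auto)
  then show ?thesis using assms by (simp add: AE_restrict_space_iff)
qed

lemma borel_measurable_lebesgue_on_cong_AE:
  fixes f g :: "'a::euclidean_space \<Rightarrow> 'b::euclidean_space"
  assumes "f \<in> borel_measurable (lebesgue_on U)" "U \<in> sets lebesgue" "AE x in lebesgue_on U. f x = g x"
  shows "g \<in> borel_measurable (lebesgue_on U)"
proof -
  obtain N where N: "N \<in> null_sets (lebesgue_on U)" "\<And>x. x \<in> U - N \<Longrightarrow> f x = g x"
    using assms(3) by (elim AE_E3) auto
  have "(\<lambda>x. if x \<in> U then f x else 0) \<in> borel_measurable lebesgue"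
    using assms by (simp add: borel_measurable_if)
  moreover have "AE x in lebesgue. (if x \<in> U then f x else 0) = (if x \<in> U then g x else 0)"
    using assms by (auto simp: AE_restrict_space_iff elim!: eventually_mono)
  ultimately have "(\<lambda>x. if x \<in> U then g x else 0) \<in> borel_measurable lebesgue"
    by (rule borel_measurable_AE)
  then show ?thesis using assms by (simp add: borel_measurable_if)
qed

lemma Lp_loc_1_cong_AE:
  fixes f g :: "'a::euclidean_space \<Rightarrow> 'b::euclidean_space"
  assumes U: "open U" and f: "f \<in> Lp_loc U 1" and ae: "AE x in lebesgue_on U. f x = g x"
  shows "g \<in> Lp_loc U 1"
  unfolding Lp_loc_1_iff
proof safe
  fix K assume K: "compact K" "K \<subseteq> U"
  have aeK: "AE x in lebesgue_on K. f x = g x"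
    by (rule AE_lebesgue_on_subset[OF ae]) (use K U in auto)
  have fK: "integrable (lebesgue_on K) f" using f K by (auto simp: Lp_loc_1_iff)
  then have "g \<in> borel_measurable (lebesgue_on K)"
    using borel_measurable_lebesgue_on_cong_AE[OF _ _ aeK] K by auto
  then show "integrable (lebesgue_on K) g"
    using fK aeK by (subst integrable_cong_AE[of _ _ f]) auto
qed

lemma integral_lebesgue_cong_AE_on:
  fixes f g :: "'a::euclidean_space \<Rightarrow> 'b::euclidean_space" and h :: "'a \<Rightarrow> real"
  assumes U: "open U" and ae: "AE x in lebesgue_on U. f x = g x"
    and "\<And>x. x \<notin> U \<Longrightarrow> h x = 0" and "integrable lebesgue (\<lambda>x. h x *\<^sub>R f x)"
  shows "(LINT x|lebesgue. h x *\<^sub>R f x) = (LINT x|lebesgue. h x *\<^sub>R g x)"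
proof -
  have "AE x in lebesgue. x \<in> U \<longrightarrow> f x = g x" using ae U by (simp add: AE_restrict_space_iff)
  then have ae': "AE x in lebesgue. h x *\<^sub>R f x = h x *\<^sub>R g x"
    by eventually_elim (use assms(3) in force)
  moreover have "(\<lambda>x. h x *\<^sub>R g x) \<in> borel_measurable lebesgue"
    by (rule borel_measurable_AE[OF borel_measurable_integrable[OF assms(4)] ae'])
  ultimately show ?thesis using assms(4) by (intro integral_cong_AE) auto
qed

text \<open>The difference of two weak gradients is orthogonal to all test functions. This gives
  meaning to \<open>wgrad\<close>, which is an arbitrary choice among them.\<close>

lemma weak_gradient_unique:
  assumes U: "open U" and "weak_gradient U u G" "weak_gradient U u G'"
  shows "AE x in lebesgue_on U. G x = G' x"
proof -
  have G: "G \<in> Lp_loc U 1" "G' \<in> Lp_loc U 1" using assms by (auto simp: weak_gradient_def)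
  have "AE x in lebesgue_on U. G x - G' x = 0"
  proof (rule fundamental_lemma[OF U Lp_loc_1_diff[OF G]])
    fix \<phi> assume \<phi>: "\<phi> \<in> Cc_inf U"
    have "(LINT x|lebesgue. \<phi> x *\<^sub>R G x) = (LINT x|lebesgue. \<phi> x *\<^sub>R G' x)"
      using assms \<phi> by (auto simp: weak_gradient_iff[OF U])
    then show "(LINT x|lebesgue. \<phi> x *\<^sub>R (G x - G' x)) = 0"
      using Cc_mult_integrable[OF Cc_inf_Cc[OF \<phi>] G(1)] Cc_mult_integrable[OF Cc_inf_Cc[OF \<phi>] G(2)]
      by (simp add: scaleR_diff_right)
  qed
  then show ?thesis by simp
qed

lemma wgrad_AE:
  assumes "open U" "weak_gradient U u G"
  shows "AE x in lebesgue_on U. wgrad U u x = G x"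
  using weak_gradient_unique[OF assms(1) weak_gradient_wgrad assms(2)] assms(2)
  by (auto simp: has_weak_gradient_def)

lemma weak_gradient_cong_AE:
  assumes U: "open U" and wg: "weak_gradient U u G"
    and u: "AE x in lebesgue_on U. u x = u' x" and G: "AE x in lebesgue_on U. G x = G' x"
  shows "weak_gradient U u' G'"
  unfolding weak_gradient_iff[OF U]
proof (intro conjI ballI)
  have uG: "u \<in> Lp_loc U 1" "G \<in> Lp_loc U 1" using wg by (auto simp: weak_gradient_def)
  show u': "u' \<in> Lp_loc U 1" "G' \<in> Lp_loc U 1"
    using Lp_loc_1_cong_AE[OF U _ u] Lp_loc_1_cong_AE[OF U _ G] uG by auto
  fix \<phi> assume \<phi>: "\<phi> \<in> Cc_inf U"
  obtain K where K: "compact K" "K \<subseteq> U" "\<And>x. x \<notin> K \<Longrightarrow> \<phi> x = 0" "\<And>x. x \<notin> K \<Longrightarrow> grad \<phi> x = 0"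
    using Cc_inf_grad(2)[OF \<phi>] by metis
  have int: "integrable lebesgue (\<lambda>x. u x *\<^sub>R grad \<phi> x)" "integrable lebesgue (\<lambda>x. u' x *\<^sub>R grad \<phi> x)"
    using loc_mult_integrable[OF uG(1) Cc_inf_grad(1)[OF \<phi>] K(1,2,4)]
      loc_mult_integrable[OF u'(1) Cc_inf_grad(1)[OF \<phi>] K(1,2,4)] by auto
  have "AE x in lebesgue. x \<in> U \<longrightarrow> u x = u' x" using u U by (simp add: AE_restrict_space_iff)
  then have ae': "AE x in lebesgue. u x *\<^sub>R grad \<phi> x = u' x *\<^sub>R grad \<phi> x"
    by eventually_elim (use K in force)
  have 1: "(LINT x|lebesgue. u x *\<^sub>R grad \<phi> x) = (LINT x|lebesgue. u' x *\<^sub>R grad \<phi> x)"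
    by (rule integral_cong_AE[OF _ _ ae']) (use int in auto)
  have 2: "(LINT x|lebesgue. \<phi> x *\<^sub>R G x) = (LINT x|lebesgue. \<phi> x *\<^sub>R G' x)"
    by (rule integral_lebesgue_cong_AE_on[OF U G])
      (use K Cc_mult_integrable[OF Cc_inf_Cc[OF \<phi>] uG(2)] in auto)
  show "(LINT x|lebesgue. u' x *\<^sub>R grad \<phi> x) = - (LINT x|lebesgue. \<phi> x *\<^sub>R G' x)"
    using wg \<phi> by (simp add: weak_gradient_iff[OF U] 1[symmetric] 2[symmetric])
qed

lemma weak_gradient_lin:
  assumes U: "open U" and "weak_gradient U u G" "weak_gradient U v F"
  shows "weak_gradient U (\<lambda>x. a * u x + b * v x) (\<lambda>x. a *\<^sub>R G x + b *\<^sub>R F x)"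
  unfolding weak_gradient_iff[OF U]
proof (intro conjI ballI)
  have l: "u \<in> Lp_loc U 1" "v \<in> Lp_loc U 1" "G \<in> Lp_loc U 1" "F \<in> Lp_loc U 1"
    using assms by (auto simp: weak_gradient_def)
  show "(\<lambda>x. a * u x + b * v x) \<in> Lp_loc U 1" using Lp_loc_1_lin[OF l(1,2), of a b] by simp
  show "(\<lambda>x. a *\<^sub>R G x + b *\<^sub>R F x) \<in> Lp_loc U 1" using Lp_loc_1_lin[OF l(3,4)] .
  fix \<phi> assume \<phi>: "\<phi> \<in> Cc_inf U"
  obtain K where K: "compact K" "K \<subseteq> U" "\<And>x. x \<notin> K \<Longrightarrow> \<phi> x = 0" "\<And>x. x \<notin> K \<Longrightarrow> grad \<phi> x = 0"
    using Cc_inf_grad(2)[OF \<phi>] by metis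
  note int = loc_mult_integrable[OF l(1) Cc_inf_grad(1)[OF \<phi>] K(1,2,4)]
    loc_mult_integrable[OF l(2) Cc_inf_grad(1)[OF \<phi>] K(1,2,4)]
    Cc_mult_integrable[OF Cc_inf_Cc[OF \<phi>] l(3)] Cc_mult_integrable[OF Cc_inf_Cc[OF \<phi>] l(4)]
  have "(LINT x|lebesgue. (a * u x + b * v x) *\<^sub>R grad \<phi> x)
      = (LINT x|lebesgue. a *\<^sub>R (u x *\<^sub>R grad \<phi> x) + b *\<^sub>R (v x *\<^sub>R grad \<phi> x))"
    by (simp add: scaleR_add_left)
  also have "\<dots> = a *\<^sub>R (LINT x|lebesgue. u x *\<^sub>R grad \<phi> x) + b *\<^sub>R (LINT x|lebesgue. v x *\<^sub>R grad \<phi> x)"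
    using int by (subst Bochner_Integration.integral_add) (auto simp del: scaleR_scaleR)
  also have "\<dots> = - (a *\<^sub>R (LINT x|lebesgue. \<phi> x *\<^sub>R G x) + b *\<^sub>R (LINT x|lebesgue. \<phi> x *\<^sub>R F x))"
    using assms \<phi> by (simp add: weak_gradient_iff[OF U])
  also have "a *\<^sub>R (LINT x|lebesgue. \<phi> x *\<^sub>R G x) + b *\<^sub>R (LINT x|lebesgue. \<phi> x *\<^sub>R F x)
      = (LINT x|lebesgue. a *\<^sub>R (\<phi> x *\<^sub>R G x) + b *\<^sub>R (\<phi> x *\<^sub>R F x))"
    using int by (subst Bochner_Integration.integral_add) (auto simp del: scaleR_scaleR)
  also have "\<dots> = (LINT x|lebesgue. \<phi> x *\<^sub>R (a *\<^sub>R G x + b *\<^sub>R F x))"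
    by (simp add: scaleR_add_right mult.commute)
  finally show "(LINT x|lebesgue. (a * u x + b * v x) *\<^sub>R grad \<phi> x)
      = - (LINT x|lebesgue. \<phi> x *\<^sub>R (a *\<^sub>R G x + b *\<^sub>R F x))" .
qed

lemma continuous_Lp_loc:
  fixes f :: "'a::euclidean_space \<Rightarrow> 'b::euclidean_space"
  assumes "continuous_on UNIV f" shows "f \<in> Lp_loc U 1"
  unfolding Lp_loc_1_iff
proof safe
  fix K :: "'a set" assume K: "compact K"
  have "integrable lborel (\<lambda>x. indicator K x *\<^sub>R f x)"
    using K continuous_on_subset[OF assms] by (intro borel_integrable_compact) auto
  then have "integrable lebesgue (\<lambda>x. indicator K x *\<^sub>R f x)"
    using borel_measurable_integrable integrable_completion by blast
  then show "integrable (lebesgue_on K) f" using K by (simp add: integrable_restrict_space)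
qed

text \<open>Integration by parts: the gradient of f * \<phi> has integral 0.\<close>

lemma Ck_1_weak_gradient:
  assumes U: "open U" and f: "Ck 1 f"
  shows "weak_gradient U f (grad f)"
  unfolding weak_gradient_iff[OF U]
proof (intro conjI ballI)
  have fc: "continuous_on UNIV f" "continuous_on UNIV (grad f)" using f Ck_1D Ck_continuous by blast+
  then show l: "f \<in> Lp_loc U 1" "grad f \<in> Lp_loc U 1" by (auto intro: continuous_Lp_loc)
  fix \<phi> assume \<phi>: "\<phi> \<in> Cc_inf U"
  obtain K where K: "compact K" "K \<subseteq> U" "\<And>x. x \<notin> K \<Longrightarrow> \<phi> x = 0" "\<And>x. x \<notin> K \<Longrightarrow> grad \<phi> x = 0"
    using Cc_inf_grad(2)[OF \<phi>] by metis
  have \<phi>C: "\<phi> \<in> C1c U" using \<phi> Cc_inf_C1c by auto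
  have prod: "(\<lambda>x. f x * \<phi> x) \<in> C1c UNIV" using C1c_mult[OF \<phi>C f] C1c_mono[of U UNIV] by auto
  note int = loc_mult_integrable[OF l(1) Cc_inf_grad(1)[OF \<phi>] K(1,2,4)]
    Cc_mult_integrable[OF Cc_inf_Cc[OF \<phi>] l(2)]
  have "0 = (LINT x|lborel. grad (\<lambda>x. f x * \<phi> x) x)" using integral_grad_eq_0[OF prod] by simp
  also have "\<dots> = (LINT x|lebesgue. grad (\<lambda>x. f x * \<phi> x) x)"
    using C1cD(4)[OF prod] by (simp add: integral_completion borel_measurable_continuous_onI)
  also have "\<dots> = (LINT x|lebesgue. f x *\<^sub>R grad \<phi> x + \<phi> x *\<^sub>R grad f x)"
    by (simp add: grad_mult[OF f C1cD(2)[OF \<phi>C]])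
  also have "\<dots> = (LINT x|lebesgue. f x *\<^sub>R grad \<phi> x) + (LINT x|lebesgue. \<phi> x *\<^sub>R grad f x)"
    using int by simp
  finally show "(LINT x|lebesgue. f x *\<^sub>R grad \<phi> x) = - (LINT x|lebesgue. \<phi> x *\<^sub>R grad f x)"
    by (simp add: eq_neg_iff_add_eq_0)
qed

text \<open>Local integrability is part of the notion, since a non-integrable function has integral
  0 by default and would satisfy the limit condition for no reason.\<close>

definition L1_loc_conv :: "'a::euclidean_space set \<Rightarrow> (nat \<Rightarrow> 'a \<Rightarrow> 'b::euclidean_space) \<Rightarrow> ('a \<Rightarrow> 'b) \<Rightarrow> bool" where
  "L1_loc_conv U f F \<longleftrightarrow> (\<forall>k. f k \<in> Lp_loc U 1) \<and> F \<in> Lp_loc U 1 \<and>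
    (\<forall>K. compact K \<and> K \<subseteq> U \<longrightarrow> (\<lambda>k. LINT x|lebesgue_on K. norm (f k x - F x)) \<longlonglongrightarrow> 0)"

lemma integral_tendsto_L1:
  fixes f :: "nat \<Rightarrow> 'a \<Rightarrow> 'b::{banach, second_countable_topology}"
  assumes "\<And>k. integrable M (f k)" "integrable M F" "(\<lambda>k. LINT x|M. norm (f k x - F x)) \<longlonglongrightarrow> 0"
  shows "(\<lambda>k. LINT x|M. f k x) \<longlonglongrightarrow> (LINT x|M. F x)"
proof (rule Lim_null[THEN iffD2], rule Lim_null_comparison[OF _ assms(3)], rule always_eventually, rule allI)
  fix k
  have "norm ((LINT x|M. f k x) - (LINT x|M. F x)) = norm (LINT x|M. f k x - F x)"
    using assms by simp
  also have "\<dots> \<le> (LINT x|M. norm (f k x - F x))" by (rule integral_norm_bound)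
  finally show "norm ((LINT x|M. f k x) - (LINT x|M. F x)) \<le> (LINT x|M. norm (f k x - F x))" .
qed

text \<open>The bilinear map b lets one statement serve both sides of the definition of a weak
  gradient: scalar functions against vector-valued tests, and conversely.\<close>

lemma L1_loc_conv_test_tendsto:
  fixes f :: "nat \<Rightarrow> 'a::euclidean_space \<Rightarrow> 'b::euclidean_space" and T :: "'a \<Rightarrow> 'c::euclidean_space"
  assumes f: "L1_loc_conv U f F" and T: "\<And>x. x \<notin> K \<Longrightarrow> T x = 0" "\<And>x. norm (T x) \<le> B"
    and K: "compact K" "K \<subseteq> U" and b: "bounded_bilinear b"
    and int: "\<And>k. integrable lebesgue (\<lambda>x. b (T x) (f k x) :: 'd::euclidean_space)" "integrable lebesgue (\<lambda>x. b (T x) (F x))"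
  shows "(\<lambda>k. LINT x|lebesgue. b (T x) (f k x)) \<longlonglongrightarrow> (LINT x|lebesgue. b (T x) (F x))"
proof (rule integral_tendsto_L1[OF int])
  obtain C where C: "0 < C" "\<And>a c. norm (b a c) \<le> norm a * norm c * C"
    using bounded_bilinear.pos_bounded[OF b] by auto
  have iK: "integrable (lebesgue_on K) (\<lambda>x. norm (f k x - F x))" for k
    using f K by (auto simp: L1_loc_conv_def Lp_loc_1_iff)
  have lim: "(\<lambda>k. (\<bar>B\<bar> * C) * (LINT x|lebesgue_on K. norm (f k x - F x))) \<longlonglongrightarrow> 0"
    using f K by (intro tendsto_mult_right_zero) (auto simp: L1_loc_conv_def)
  show "(\<lambda>k. LINT x|lebesgue. norm (b (T x) (f k x) - b (T x) (F x))) \<longlonglongrightarrow> 0"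
  proof (rule Lim_null_comparison[OF _ lim], rule always_eventually, rule allI)
    fix k
    have out: "norm (b (T x) (f k x) - b (T x) (F x)) = 0" if "x \<notin> K" for x
      using T(1)[OF that] bounded_bilinear.zero_left[OF b] by simp
    note out' = lebesgue_on_integral_outside[where U = K and f = "\<lambda>x. norm (b (T x) (f k x) - b (T x) (F x))"]
    have intd: "integrable lebesgue (\<lambda>x. norm (b (T x) (f k x) - b (T x) (F x)))" using int by simp
    have "(LINT x|lebesgue. norm (b (T x) (f k x) - b (T x) (F x)))
        = (LINT x|lebesgue_on K. norm (b (T x) (f k x) - b (T x) (F x)))"
      using out'(1) out K by simp
    also have "\<dots> \<le> (LINT x|lebesgue_on K. (\<bar>B\<bar> * C) * norm (f k x - F x))"
    proof (rule integral_mono)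
      show "integrable (lebesgue_on K) (\<lambda>x. norm (b (T x) (f k x) - b (T x) (F x)))"
        using out'(2) out K intd by simp
      fix x
      have "norm (b (T x) (f k x) - b (T x) (F x)) = norm (b (T x) (f k x - F x))"
        by (simp add: bounded_bilinear.diff_right[OF b])
      also have "\<dots> \<le> norm (T x) * norm (f k x - F x) * C" by (rule C)
      also have "\<dots> \<le> \<bar>B\<bar> * norm (f k x - F x) * C"
        using T(2)[of x] C by (intro mult_right_mono) auto
      finally show "norm (b (T x) (f k x) - b (T x) (F x)) \<le> \<bar>B\<bar> * C * norm (f k x - F x)"
        by (simp add: ac_simps)
    qed (use iK in simp)
    also have "\<dots> = (\<bar>B\<bar> * C) * (LINT x|lebesgue_on K. norm (f k x - F x))" by simp
    finally show "norm (LINT x|lebesgue. norm (b (T x) (f k x) - b (T x) (F x)))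
        \<le> (\<bar>B\<bar> * C) * (LINT x|lebesgue_on K. norm (f k x - F x))" by simp
  qed
qed

lemma weak_gradient_limit:
  assumes U: "open U" and wg: "\<And>k. weak_gradient U (u k) (G k)"
    and u: "L1_loc_conv U u v" and G: "L1_loc_conv U G F"
  shows "weak_gradient U v F"
  unfolding weak_gradient_iff[OF U]
proof (intro conjI ballI)
  show v: "v \<in> Lp_loc U 1" and F: "F \<in> Lp_loc U 1" using u G by (auto simp: L1_loc_conv_def)
  have uk: "u k \<in> Lp_loc U 1" "G k \<in> Lp_loc U 1" for k using u G by (auto simp: L1_loc_conv_def)
  fix \<phi> assume \<phi>: "\<phi> \<in> Cc_inf U"
  obtain K where K: "compact K" "K \<subseteq> U" "\<And>x. x \<notin> K \<Longrightarrow> \<phi> x = 0" "\<And>x. x \<notin> K \<Longrightarrow> grad \<phi> x = 0"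
    using Cc_inf_grad(2)[OF \<phi>] by metis
  obtain B where B: "\<And>x. norm (grad \<phi> x) \<le> B"
    using compact_support_bounded[OF Cc_inf_grad(1)[OF \<phi>] K(1,4)] by metis
  obtain B' where B': "\<And>x. norm (\<phi> x) \<le> B'" using Cc_bounded[OF Cc_inf_Cc[OF \<phi>]] by (metis real_norm_def)
  have "(\<lambda>k. LINT x|lebesgue. (\<lambda>a c. c *\<^sub>R a) (grad \<phi> x) (u k x)) \<longlonglongrightarrow> (LINT x|lebesgue. (\<lambda>a c. c *\<^sub>R a) (grad \<phi> x) (v x))"
    by (rule L1_loc_conv_test_tendsto[OF u K(4) B K(1,2)])
      (auto intro!: bounded_bilinear.flip bounded_bilinear_scaleR
         loc_mult_integrable[OF _ Cc_inf_grad(1)[OF \<phi>] K(1,2,4)] v uk)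
  moreover have "(\<lambda>k. LINT x|lebesgue. \<phi> x *\<^sub>R G k x) \<longlonglongrightarrow> (LINT x|lebesgue. \<phi> x *\<^sub>R F x)"
    by (rule L1_loc_conv_test_tendsto[OF G K(3) B' K(1,2) bounded_bilinear_scaleR])
      (auto intro!: Cc_mult_integrable Cc_inf_Cc \<phi> uk F)
  then have "(\<lambda>k. - (LINT x|lebesgue. \<phi> x *\<^sub>R G k x)) \<longlonglongrightarrow> - (LINT x|lebesgue. \<phi> x *\<^sub>R F x)"
    by (rule tendsto_minus)
  ultimately show "(LINT x|lebesgue. v x *\<^sub>R grad \<phi> x) = - (LINT x|lebesgue. \<phi> x *\<^sub>R F x)"
    using wg \<phi> LIMSEQ_unique by (fastforce simp: weak_gradient_iff[OF U])
qed

lemma fatou_real: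
  fixes h :: "nat \<Rightarrow> 'a \<Rightarrow> real"
  assumes int: "\<And>j. integrable M (h j)" and nn: "\<And>j. AE x in M. 0 \<le> h j x"
    and lim: "AE x in M. (\<lambda>j. h j x) \<longlonglongrightarrow> F x" and F [measurable]: "F \<in> borel_measurable M"
    and le: "\<And>j. (LINT x|M. h j x) \<le> B"
  shows "integrable M F" "(LINT x|M. F x) \<le> B"
proof -
  have [measurable]: "h j \<in> borel_measurable M" for j using int by auto
  have nn': "AE x in M. \<forall>j. 0 \<le> h j x" using nn by (simp add: AE_all_countable)
  have F0: "AE x in M. 0 \<le> F x"
    using nn' lim by eventually_elim (auto intro: LIMSEQ_le_const)
  have B: "0 \<le> B" using integral_nonneg_AE[OF nn[of 0]] le[of 0] by linarith
  have "(\<integral>\<^sup>+x. ennreal (F x) \<partial>M) = (\<integral>\<^sup>+x. liminf (\<lambda>j. ennreal (h j x)) \<partial>M)"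
  proof (rule nn_integral_cong_AE)
    show "AE x in M. ennreal (F x) = liminf (\<lambda>j. ennreal (h j x))"
      using lim by eventually_elim (metis lim_imp_Liminf sequentially_bot tendsto_ennrealI)
  qed
  also have "\<dots> \<le> liminf (\<lambda>j. \<integral>\<^sup>+x. ennreal (h j x) \<partial>M)"
    by (rule nn_integral_liminf) measurable
  also have "\<dots> \<le> liminf (\<lambda>j. ennreal B)"
    using le nn int by (intro Liminf_mono always_eventually allI) (simp add: nn_integral_eq_integral ennreal_leI)
  also have "\<dots> = ennreal B" by (simp add: Liminf_const)
  finally have le': "(\<integral>\<^sup>+x. ennreal (F x) \<partial>M) \<le> ennreal B" .
  then show i: "integrable M F"
    using F0 by (intro integrableI_nonneg) (auto simp: le_less_trans)
  show "(LINT x|M. F x) \<le> B"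
    using le' nn_integral_eq_integral[OF i F0] B by (simp add: integral_nonneg_AE F0)
qed

text \<open>A diagonal subsequence over exhausting compact sets converges almost everywhere and
  defines the limit. Fatou's lemma for \<open>f k - f (s j)\<close>, with k fixed and j growing,
  shows that the whole sequence converges to it.\<close>

lemma L1_loc_complete:
  fixes f :: "nat \<Rightarrow> 'a::euclidean_space \<Rightarrow> 'b::euclidean_space"
  assumes U: "open U" and f: "\<And>k. f k \<in> Lp_loc U 1"
    and cau: "\<And>K e. compact K \<Longrightarrow> K \<subseteq> U \<Longrightarrow> 0 < e \<Longrightarrow>
      \<exists>N. \<forall>i\<ge>N. \<forall>j\<ge>N. (LINT x|lebesgue_on K. norm (f i x - f j x)) < e"
  obtains F s where "strict_mono s" "AE x in lebesgue_on U. (\<lambda>k. f (s k) x) \<longlonglongrightarrow> F x" "L1_loc_conv U f F"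
proof -
  obtain C where C: "\<And>n::nat. compact (C n)" "\<And>n. C n \<subseteq> U" "\<Union>(range C) = U"
    using open_Union_compact_subsets[OF U] by metis
  have fC: "integrable (lebesgue_on (C n)) (f k)" for n k
    using f C by (auto simp: Lp_loc_1_iff)
  define P where "P n s \<longleftrightarrow> (AE x in lebesgue_on (C n). convergent (\<lambda>k. f (s k) x))" for n and s :: "nat \<Rightarrow> nat"
  interpret subseqs P
  proof
    fix n and s :: "nat \<Rightarrow> nat" assume s: "strict_mono s"
    obtain r where "strict_mono r" "AE x in lebesgue_on (C n). Cauchy (\<lambda>i. (f (s (r i))) x)"
    proof (rule cauchy_L1_AE_cauchy_subseq[of "lebesgue_on (C n)" "\<lambda>k. f (s k)"])
      fix e :: real assume "0 < e"
      then obtain N where "\<forall>i\<ge>N. \<forall>j\<ge>N. (LINT x|lebesgue_on (C n). norm (f i x - f j x)) < e"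
        using cau[OF C(1,2)] by blast
      then show "\<exists>N. \<forall>i\<ge>N. \<forall>j\<ge>N. (LINT x|lebesgue_on (C n). norm (f (s i) x - f (s j) x)) < e"
        using seq_suble[OF s] order_trans by metis
    qed (use fC in auto)
    then show "\<exists>r'. strict_mono r' \<and> P n (s \<circ> r')"
      by (auto simp: P_def Cauchy_convergent_iff o_def)
  qed
  define s where "s = diagseq"
  have s: "strict_mono s" by (simp add: s_def subseq_diagseq)
  have "P n (s \<circ> (+) (Suc n))" for n
    unfolding s_def
  proof (rule diagseq_holds)
    fix r s n assume "strict_mono (r :: nat \<Rightarrow> nat)" "P n s"
    then show "P n (s \<circ> r)"
      unfolding P_def by (auto elim!: eventually_mono dest: convergent_subseq_convergent simp: o_def)
  qed
  then have conv: "AE x in lebesgue_on (C n). convergent (\<lambda>k. f (s k) x)" for n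
    unfolding P_def
  proof (rule eventually_mono)
    fix x assume "convergent (\<lambda>k. f ((s \<circ> (+) (Suc n)) k) x)"
    then have "convergent (\<lambda>k. f (s (k + Suc n)) x)" by (simp add: o_def add.commute)
    then show "convergent (\<lambda>k. f (s k) x)"
      using convergent_ignore_initial_segment[of "\<lambda>k. f (s k) x" "Suc n"] by simp
  qed
  have aeC: "AE x in lebesgue. x \<in> C n \<longrightarrow> convergent (\<lambda>k. f (s k) x)" for n
    using conv[of n] C(1)[of n] by (simp add: AE_restrict_space_iff)
  have "AE x in lebesgue. \<forall>n. x \<in> C n \<longrightarrow> convergent (\<lambda>k. f (s k) x)"
    unfolding AE_all_countable using aeC by blast
  then have "AE x in lebesgue. x \<in> U \<longrightarrow> convergent (\<lambda>k. f (s k) x)"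
    by eventually_elim (use C in auto)
  then have convU: "AE x in lebesgue_on U. convergent (\<lambda>k. f (s k) x)"
    using U by (simp add: AE_restrict_space_iff)
  define F where "F x = lim (\<lambda>k. f (s k) x)" for x
  have lim: "AE x in lebesgue_on U. (\<lambda>k. f (s k) x) \<longlonglongrightarrow> F x"
    using convU by eventually_elim (simp add: F_def convergent_LIMSEQ_iff)
  have Fm: "F \<in> borel_measurable (lebesgue_on U)"
    unfolding F_def using Lp_loc_1_measurable[OF U f] by (intro borel_measurable_lim_metric) auto
  have K: "integrable (lebesgue_on K) F \<and> (\<lambda>k. LINT x|lebesgue_on K. norm (f k x - F x)) \<longlonglongrightarrow> 0"
    if K: "compact K" "K \<subseteq> U" for K
  proof -
    have fK: "integrable (lebesgue_on K) (f k)" for k using f K by (auto simp: Lp_loc_1_iff)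
    have limK: "AE x in lebesgue_on K. (\<lambda>k. f (s k) x) \<longlonglongrightarrow> F x"
      by (rule AE_lebesgue_on_subset[OF lim]) (use K U in auto)
    have FmK: "F \<in> borel_measurable (lebesgue_on K)"
      using Fm K by (meson measurable_restrict_mono)
    have tail: "\<exists>N. \<forall>k\<ge>N. integrable (lebesgue_on K) (\<lambda>x. norm (f k x - F x)) \<and> (LINT x|lebesgue_on K. norm (f k x - F x)) \<le> e"
      if e: "0 < e" for e
    proof -
      obtain N where N: "\<forall>i\<ge>N. \<forall>j\<ge>N. (LINT x|lebesgue_on K. norm (f i x - f j x)) < e"
        using cau[OF K e] by blast
      have "integrable (lebesgue_on K) (\<lambda>x. norm (f k x - F x))" "(LINT x|lebesgue_on K. norm (f k x - F x)) \<le> e"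
        if k: "k \<ge> N" for k
      proof -
        note fatou = fatou_real[where M = "lebesgue_on K" and h = "\<lambda>j x. norm (f k x - f (s (j + N)) x)"
            and F = "\<lambda>x. norm (f k x - F x)" and B = e]
        have 1: "AE x in lebesgue_on K. (\<lambda>j. norm (f k x - f (s (j + N)) x)) \<longlonglongrightarrow> norm (f k x - F x)"
          using limK by eventually_elim (auto intro!: tendsto_intros LIMSEQ_ignore_initial_segment)
        have 2: "(LINT x|lebesgue_on K. norm (f k x - f (s (j + N)) x)) \<le> e" for j
        proof -
          have "N \<le> s (j + N)" using seq_suble[OF s, of "j + N"] by simp
          then show ?thesis using N k by (simp add: less_imp_le)
        qed
        have 3: "(\<lambda>x. norm (f k x - F x)) \<in> borel_measurable (lebesgue_on K)"
          using FmK borel_measurable_integrable[OF fK[of k]] by measurable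
        show "integrable (lebesgue_on K) (\<lambda>x. norm (f k x - F x))"
          by (rule fatou(1)) (use 1 2 3 fK in auto)
        show "(LINT x|lebesgue_on K. norm (f k x - F x)) \<le> e"
          by (rule fatou(2)) (use 1 2 3 fK in auto)
      qed
      then show ?thesis by blast
    qed
    obtain N where "integrable (lebesgue_on K) (\<lambda>x. norm (f N x - F x))" using tail[of 1] by auto
    then have "integrable (lebesgue_on K) (\<lambda>x. f N x - F x)"
      using FmK borel_measurable_integrable[OF fK[of N]] by (subst (asm) integrable_norm_iff) auto
    from Bochner_Integration.integrable_diff[OF fK[of N] this] have "integrable (lebesgue_on K) F" by simp
    moreover have "(\<lambda>k. LINT x|lebesgue_on K. norm (f k x - F x)) \<longlonglongrightarrow> 0"
    proof (rule LIMSEQ_I)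
      fix r :: real assume r: "0 < r"
      obtain N where "\<forall>k\<ge>N. (LINT x|lebesgue_on K. norm (f k x - F x)) \<le> r / 2" using tail[of "r / 2"] r by auto
      then show "\<exists>no. \<forall>n\<ge>no. norm ((LINT x|lebesgue_on K. norm (f n x - F x)) - 0) < r"
        using r by (intro exI[of _ N]) (force simp: )
    qed
    ultimately show ?thesis ..
  qed
  then have "L1_loc_conv U f F"
    using f by (auto simp: L1_loc_conv_def Lp_loc_1_iff)
  with s lim show thesis by (rule that)
qed

lemma L1_loc_conv_unique:
  fixes f :: "nat \<Rightarrow> 'a::euclidean_space \<Rightarrow> 'b::euclidean_space"
  assumes U: "open U" and "L1_loc_conv U f F" "L1_loc_conv U f F'"
  shows "AE x in lebesgue_on U. F x = F' x"
proof (rule AE_lebesgue_on_compacts[OF U])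
  fix K assume K: "compact K" "K \<subseteq> U"
  have i: "integrable (lebesgue_on K) (f k)" "integrable (lebesgue_on K) F" "integrable (lebesgue_on K) F'" for k
    using assms K by (auto simp: L1_loc_conv_def Lp_loc_1_iff)
  have "(\<lambda>k. (LINT x|lebesgue_on K. norm (f k x - F x)) + (LINT x|lebesgue_on K. norm (f k x - F' x))) \<longlonglongrightarrow> 0 + 0"
    using assms K by (intro tendsto_add) (auto simp: L1_loc_conv_def)
  moreover have "(LINT x|lebesgue_on K. norm (F x - F' x))
      \<le> (LINT x|lebesgue_on K. norm (f k x - F x)) + (LINT x|lebesgue_on K. norm (f k x - F' x))" for k
  proof -
    have "(LINT x|lebesgue_on K. norm (F x - F' x)) \<le> (LINT x|lebesgue_on K. norm (f k x - F x) + norm (f k x - F' x))"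
      using i norm_triangle_ineq4[of "f k x - F' x" "f k x - F x" for x]
      by (intro integral_mono) (auto simp: add.commute)
    then show ?thesis using i by simp
  qed
  ultimately have "(LINT x|lebesgue_on K. norm (F x - F' x)) \<le> 0"
    by (intro LIMSEQ_le_const[of _ 0]) auto
  then have "(LINT x|lebesgue_on K. norm (F x - F' x)) = 0" by (simp add: antisym)
  then have "AE x in lebesgue_on K. F x = F' x"
    using i by (subst (asm) integral_nonneg_eq_0_iff_AE) auto
  then show "AE x in lebesgue. x \<in> K \<longrightarrow> F x = F' x"
    using K by (simp add: AE_restrict_space_iff)
qed

section \<open>The energy space\<close>

text \<open>A single open set is fixed, so that the results can be used in \<Omega>, in its
  subdomains, and also with the constant weight 1 on open sets for which no Hardy-weight has been
  chosen. The convexity assumption asks for one \<delta> for almost all x, which is the common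
  uniform convexity in integrable form.\<close>

locale energy_space =
  fixes p :: real and H :: "'a::euclidean_space \<Rightarrow> 'a \<Rightarrow> real" and V :: "'a \<Rightarrow> real"
    and w :: "'a set \<Rightarrow> 'a \<Rightarrow> real" and U :: "'a set"
  assumes p: "1 < p" and U: "open U"
    and H_norm: "AE x in lebesgue_on U. is_norm (H x)"
    and H_meas: "\<And>\<xi>. (\<lambda>x. H x \<xi>) \<in> borel_measurable (lebesgue_on U)"
    and H_bounds: "\<And>K. compact K \<Longrightarrow> K \<subseteq> U \<Longrightarrow> \<exists>\<kappa> \<nu>. 0 < \<kappa> \<and> 0 < \<nu> \<and>
      (AE x in lebesgue_on K. \<forall>\<xi>. \<kappa> * norm \<xi> \<le> H x \<xi> \<and> H x \<xi> \<le> \<nu> * norm \<xi>)"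
    and H_convex: "\<And>e. 0 < e \<Longrightarrow> e \<le> 1 \<Longrightarrow> \<exists>\<delta>>0. AE x in lebesgue_on U. convexity_bound (H x) e \<delta>"
    and V_loc: "V \<in> Lp_loc U 1"
    and w_cont: "continuous_on U (w U)" and w_pos: "\<And>x. x \<in> U \<Longrightarrow> 0 < w U x"
begin

abbreviation "M \<equiv> lebesgue_on U"
abbreviation "X \<equiv> Wt p H V w U"
abbreviation "X0 \<equiv> Wt0 p H V w U"

definition m :: "'a \<Rightarrow> real" where "m x = \<bar>V x\<bar> + w U x"

lemma V_meas [measurable]: "V \<in> borel_measurable M"
  by (rule Lp_loc_1_measurable[OF U V_loc])

lemma w_meas [measurable]: "w U \<in> borel_measurable M"
  by (rule continuous_imp_measurable_on_sets_lebesgue[OF w_cont]) (use U in auto)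

lemma m_meas [measurable]: "m \<in> borel_measurable M"
  unfolding m_def by measurable

lemma AE_M: "(AE x in M. P x) \<longleftrightarrow> (AE x in lebesgue. x \<in> U \<longrightarrow> P x)"
  using U by (simp add: AE_restrict_space_iff)

lemma AE_in_U: "AE x in M. x \<in> U"
  by (simp add: AE_M)

lemma m_nonneg: "AE x in M. 0 \<le> m x"
  using AE_in_U by eventually_elim (simp add: m_def w_pos less_imp_le)

text \<open>A norm bounded by a multiple of the Euclidean norm is Lipschitz. So this is the almost
  everywhere continuity of \<open>H x\<close>, obtained by exhausting U with compact sets.\<close>

lemma H_good: "AE x in M. is_norm (H x) \<and> (\<exists>\<nu>>0. \<forall>\<xi>. H x \<xi> \<le> \<nu> * norm \<xi>)"
proof -
  have "AE x in M. \<exists>\<nu>>0. \<forall>\<xi>. H x \<xi> \<le> \<nu> * norm \<xi>"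
  proof (rule AE_lebesgue_on_compacts[OF U])
    fix K assume K: "compact K" "K \<subseteq> U"
    obtain \<nu> where "0 < \<nu>" "AE x in lebesgue_on K. \<forall>\<xi>. H x \<xi> \<le> \<nu> * norm \<xi>"
    proof -
      obtain \<kappa> \<nu> where \<nu>: "0 < \<nu>"
          "AE x in lebesgue_on K. \<forall>\<xi>. \<kappa> * norm \<xi> \<le> H x \<xi> \<and> H x \<xi> \<le> \<nu> * norm \<xi>"
        using H_bounds[OF K] by blast
      have "AE x in lebesgue_on K. \<forall>\<xi>. H x \<xi> \<le> \<nu> * norm \<xi>" using \<nu>(2) by eventually_elim auto
      with \<nu>(1) show thesis by (rule that)
    qed
    then show "AE x in lebesgue. x \<in> K \<longrightarrow> (\<exists>\<nu>>0. \<forall>\<xi>. H x \<xi> \<le> \<nu> * norm \<xi>)"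
      using K by (auto simp: AE_restrict_space_iff elim!: eventually_mono)
  qed
  with H_norm show ?thesis by eventually_elim auto
qed

lemma norm_bounded_tendsto:
  assumes N: "is_norm N" and b: "\<forall>\<xi>::'a. N \<xi> \<le> \<nu> * norm \<xi>" and lim: "(f \<longlongrightarrow> l) F"
  shows "((\<lambda>i. N (f i)) \<longlongrightarrow> N l) F"
proof -
  have le: "\<bar>N a - N l\<bar> \<le> \<nu> * norm (a - l)" for a
  proof -
    have "N a \<le> N (a - l) + N l" "N l \<le> N (l - a) + N a"
      using is_norm_simps(3)[OF N, of "a - l" l] is_norm_simps(3)[OF N, of "l - a" a] by auto
    moreover have "N (l - a) = N (a - l)" by (rule is_norm_simps(7)[OF N])
    ultimately show ?thesis using b[rule_format, of "a - l"] by linarith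
  qed
  have "((\<lambda>i. \<nu> * norm (f i - l)) \<longlongrightarrow> \<nu> * norm (l - l)) F" by (intro tendsto_intros lim)
  then have z: "((\<lambda>i. \<nu> * norm (f i - l)) \<longlongrightarrow> 0) F" by simp
  have "((\<lambda>i. N (f i) - N l) \<longlongrightarrow> 0) F"
    by (rule Lim_null_comparison[OF always_eventually z]) (use le in simp)
  then show ?thesis by (rule Lim_null[THEN iffD2])
qed

text \<open>H is a Caratheodory function, measurable in x and continuous in \<xi>: G is approximated
  by simple functions, and the values converge almost everywhere.\<close>

lemma H_comp_meas [measurable (raw)]:
  assumes G: "G \<in> borel_measurable M"
  shows "(\<lambda>x. H x (G x)) \<in> borel_measurable M"
proof -
  obtain F where F: "\<And>i::nat. simple_function M (F i)" and lim: "\<And>x. x \<in> space M \<Longrightarrow> (\<lambda>i. F i x) \<longlonglongrightarrow> G x"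
    using borel_measurable_implies_sequence_metric[OF G, of 0] by blast
  have Fm: "(\<lambda>x. H x (F i x)) \<in> borel_measurable M" for i
  proof -
    have "(\<lambda>x. \<Sum>\<xi>\<in>F i ` space M. indicator (F i -` {\<xi>} \<inter> space M) x * H x \<xi>) \<in> borel_measurable M"
      using simple_functionD[OF F[of i]] H_meas
      by (intro borel_measurable_sum borel_measurable_times borel_measurable_indicator) auto
    moreover have "(\<Sum>\<xi>\<in>F i ` space M. indicator (F i -` {\<xi>} \<inter> space M) x * H x \<xi>) = H x (F i x)"
      if x: "x \<in> space M" for x
    proof -
      have "(\<Sum>\<xi>\<in>F i ` space M. indicator (F i -` {\<xi>} \<inter> space M) x * H x \<xi>)
          = (\<Sum>\<xi>\<in>F i ` space M. if \<xi> = F i x then H x \<xi> else 0)"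
        using x by (intro sum.cong refl) (auto simp: indicator_def)
      also have "\<dots> = H x (F i x)"
        using x simple_functionD(1)[OF F[of i]] by (subst sum.delta) auto
      finally show ?thesis .
    qed
    ultimately show ?thesis by (subst (asm) measurable_cong) auto
  qed
  have lim_meas: "(\<lambda>x. lim (\<lambda>i. H x (F i x))) \<in> borel_measurable M"
    by (intro borel_measurable_lim_metric Fm)
  moreover have "AE x in M. lim (\<lambda>i. H x (F i x)) = H x (G x)"
    using H_good AE_in_U
  proof eventually_elim
    case (elim x)
    then obtain \<nu> where "\<forall>\<xi>. H x \<xi> \<le> \<nu> * norm \<xi>" "is_norm (H x)" by blast
    then have "(\<lambda>i. H x (F i x)) \<longlonglongrightarrow> H x (G x)"
      using norm_bounded_tendsto[of "H x" \<nu> "\<lambda>i. F i x" "G x"] lim[of x] elim by simp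
    then show ?case by (rule limI)
  qed
  ultimately show ?thesis
    using borel_measurable_lebesgue_on_cong_AE[OF lim_meas] U by auto
qed

text \<open>Free coefficients let one calculus cover the energy, the positive and negative parts of
  Q, the weighted masses, and the versions of these localised by a cut-off.\<close>

definition D :: "('a \<Rightarrow> real) \<Rightarrow> ('a \<Rightarrow> real) \<Rightarrow> ('a \<Rightarrow> real) \<Rightarrow> 'a \<Rightarrow> real" where
  "D \<alpha> \<beta> u x = \<alpha> x * H x (wgrad U u x) powr p + \<beta> x * \<bar>u x\<bar> powr p"

definition I :: "('a \<Rightarrow> real) \<Rightarrow> ('a \<Rightarrow> real) \<Rightarrow> ('a \<Rightarrow> real) \<Rightarrow> real" where
  "I \<alpha> \<beta> u = (LINT x|M. D \<alpha> \<beta> u x)"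

abbreviation "E \<equiv> I (\<lambda>_. 1) m"

definition sob :: "('a \<Rightarrow> real) set" where
  "sob = {u \<in> borel_measurable M. has_weak_gradient U u}"

definition coeff :: "('a \<Rightarrow> real) \<Rightarrow> bool" where
  "coeff \<alpha> \<longleftrightarrow> \<alpha> \<in> borel_measurable M \<and> (AE x in M. 0 \<le> \<alpha> x)"

lemma coeff_simps [simp]: "coeff (\<lambda>_. 1)" "coeff (\<lambda>_. 0)" "coeff m"
  using m_nonneg by (auto simp: coeff_def)

lemma wgrad_meas:
  assumes "has_weak_gradient U u" shows "wgrad U u \<in> borel_measurable M"
  using weak_gradient_wgrad[OF assms] Lp_loc_1_measurable[OF U] by (auto simp: weak_gradient_def)

lemma D_meas:
  assumes "u \<in> sob" "coeff \<alpha>" "coeff \<beta>"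
  shows "D \<alpha> \<beta> u \<in> borel_measurable M"
proof -
  have [measurable]: "u \<in> borel_measurable M" "wgrad U u \<in> borel_measurable M" "\<alpha> \<in> borel_measurable M" "\<beta> \<in> borel_measurable M"
    using assms wgrad_meas by (auto simp: sob_def coeff_def)
  show ?thesis unfolding D_def by measurable
qed

lemma D_nonneg:
  assumes "coeff \<alpha>" "coeff \<beta>" shows "AE x in M. 0 \<le> D \<alpha> \<beta> u x"
proof -
  have "AE x in M. 0 \<le> \<alpha> x" "AE x in M. 0 \<le> \<beta> x" using assms by (auto simp: coeff_def)
  then show ?thesis by eventually_elim (simp add: D_def)
qed

lemma Wt_density_eq: "Wt_density p H V w U u = D (\<lambda>_. 1) m u"
  by (auto simp: Wt_density_def D_def m_def)

lemma Wt_iff: "u \<in> X \<longleftrightarrow> u \<in> sob \<and> integrable M (D (\<lambda>_. 1) m u)"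
proof -
  have "integrable M (\<lambda>x. (\<bar>V x\<bar> + w U x) * \<bar>u x\<bar> powr p)" if "u \<in> sob" "integrable M (D (\<lambda>_. 1) m u)"
  proof (rule Bochner_Integration.integrable_bound[OF that(2)])
    have [measurable]: "u \<in> borel_measurable M" using that by (simp add: sob_def)
    show "(\<lambda>x. (\<bar>V x\<bar> + w U x) * \<bar>u x\<bar> powr p) \<in> borel_measurable M" by measurable
    show "AE x in M. norm ((\<bar>V x\<bar> + w U x) * \<bar>u x\<bar> powr p) \<le> norm (D (\<lambda>_. 1) m u x)"
      using m_nonneg by eventually_elim (simp add: D_def m_def)
  qed
  then show ?thesis
    unfolding Wt_def Wt_density_eq by (auto simp: sob_def)
qed

lemma Wt_norm_eq: "Wt_norm p H V w U u = E u powr (1 / p)"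
  by (simp add: Wt_norm_def Wt_density_eq I_def)

lemma sob_lin:
  assumes "u \<in> sob" "v \<in> sob"
  shows "(\<lambda>x. a * u x + b * v x) \<in> sob"
    and "AE x in M. wgrad U (\<lambda>x. a * u x + b * v x) x = a *\<^sub>R wgrad U u x + b *\<^sub>R wgrad U v x"
proof -
  have wg: "weak_gradient U (\<lambda>x. a * u x + b * v x) (\<lambda>x. a *\<^sub>R wgrad U u x + b *\<^sub>R wgrad U v x)"
    using assms by (intro weak_gradient_lin[OF U] weak_gradient_wgrad) (auto simp: sob_def)
  then show "AE x in M. wgrad U (\<lambda>x. a * u x + b * v x) x = a *\<^sub>R wgrad U u x + b *\<^sub>R wgrad U v x"
    by (rule wgrad_AE[OF U])
  show "(\<lambda>x. a * u x + b * v x) \<in> sob"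
    using wg assms by (auto simp: sob_def has_weak_gradient_def)
qed

lemma sob_cong_AE:
  assumes "u \<in> sob" "AE x in M. u x = v x"
  shows "v \<in> sob" "AE x in M. D \<alpha> \<beta> u x = D \<alpha> \<beta> v x"
proof -
  have wg: "weak_gradient U u (wgrad U u)" using assms by (intro weak_gradient_wgrad) (auto simp: sob_def)
  have wg': "weak_gradient U v (wgrad U u)"
    by (rule weak_gradient_cong_AE[OF U wg assms(2)]) simp
  then have "AE x in M. wgrad U v x = wgrad U u x" by (rule wgrad_AE[OF U])
  with assms(2) show "AE x in M. D \<alpha> \<beta> u x = D \<alpha> \<beta> v x"
    by eventually_elim (simp add: D_def)
  show "v \<in> sob"
    using wg' borel_measurable_lebesgue_on_cong_AE[OF _ _ assms(2)] assms(1) U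
    by (auto simp: sob_def has_weak_gradient_def)
qed

lemma is_norm_powr_add:
  assumes N: "is_norm N" and l: "0 < l" "l < 1"
  shows "N (x + y) powr p \<le> (1 - l) powr (1 - p) * N x powr p + l powr (1 - p) * N y powr p"
proof -
  have "N (x + y) powr p \<le> (N x + N y) powr p"
    using is_norm_simps[OF N] p by (intro powr_mono2) auto
  also have "\<dots> \<le> (1 - l) powr (1 - p) * N x powr p + l powr (1 - p) * N y powr p"
    using is_norm_simps[OF N] p l by (intro powr_add_le) auto
  finally show ?thesis .
qed

lemma D_add:
  assumes "u \<in> sob" "v \<in> sob" and ab: "coeff \<alpha>" "coeff \<beta>" and l: "0 < l" "l < 1"
  shows "AE x in M. D \<alpha> \<beta> (\<lambda>x. u x + v x) x
      \<le> (1 - l) powr (1 - p) * D \<alpha> \<beta> u x + l powr (1 - p) * D \<alpha> \<beta> v x"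
proof -
  have c: "AE x in M. 0 \<le> \<alpha> x" "AE x in M. 0 \<le> \<beta> x" using ab by (auto simp: coeff_def)
  show ?thesis
    using sob_lin(2)[OF assms(1,2), of 1 1] H_norm c
  proof eventually_elim
    case (elim x)
    have "\<alpha> x * H x (wgrad U u x + wgrad U v x) powr p
        \<le> \<alpha> x * ((1 - l) powr (1 - p) * H x (wgrad U u x) powr p + l powr (1 - p) * H x (wgrad U v x) powr p)"
      using elim l by (intro mult_left_mono is_norm_powr_add) auto
    moreover have "\<beta> x * \<bar>u x + v x\<bar> powr p
        \<le> \<beta> x * ((1 - l) powr (1 - p) * \<bar>u x\<bar> powr p + l powr (1 - p) * \<bar>v x\<bar> powr p)"
      using elim l is_norm_powr_add[OF is_norm_abs l] by (intro mult_left_mono) auto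
    ultimately show ?case using elim by (simp add: D_def algebra_simps)
  qed
qed

lemma D_scale:
  assumes "u \<in> sob"
  shows "AE x in M. D \<alpha> \<beta> (\<lambda>x. c * u x) x = \<bar>c\<bar> powr p * D \<alpha> \<beta> u x"
  using sob_lin(2)[OF assms assms, of c 0] H_norm
proof eventually_elim
  case (elim x)
  then have "H x (wgrad U (\<lambda>x. c * u x) x) = \<bar>c\<bar> * H x (wgrad U u x)"
    by (simp add: is_norm_simps(2))
  then show ?case
    using is_norm_simps(1)[of "H x"] elim by (simp add: D_def abs_mult powr_mult algebra_simps)
qed

definition fin :: "('a \<Rightarrow> real) \<Rightarrow> ('a \<Rightarrow> real) \<Rightarrow> ('a \<Rightarrow> real) set" where
  "fin \<alpha> \<beta> = {u \<in> sob. integrable M (D \<alpha> \<beta> u)}"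

lemma X_eq_fin: "X = fin (\<lambda>_. 1) m"
  by (auto simp: fin_def Wt_iff)

lemma fin_add:
  assumes u: "u \<in> fin \<alpha> \<beta>" and v: "v \<in> fin \<alpha> \<beta>" and ab: "coeff \<alpha>" "coeff \<beta>"
  shows "(\<lambda>x. u x + v x) \<in> fin \<alpha> \<beta>"
    and "0 < l \<Longrightarrow> l < 1 \<Longrightarrow> I \<alpha> \<beta> (\<lambda>x. u x + v x)
      \<le> (1 - l) powr (1 - p) * I \<alpha> \<beta> u + l powr (1 - p) * I \<alpha> \<beta> v"
proof -
  have s: "u \<in> sob" "v \<in> sob" and i: "integrable M (D \<alpha> \<beta> u)" "integrable M (D \<alpha> \<beta> v)"
    using u v by (auto simp: fin_def)
  have s': "(\<lambda>x. u x + v x) \<in> sob" using sob_lin(1)[OF s, of 1 1] by simp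
  have half: "0 < (1 / 2 :: real)" "(1 / 2 :: real) < 1" by simp_all
  have "integrable M (D \<alpha> \<beta> (\<lambda>x. u x + v x))"
  proof (rule Bochner_Integration.integrable_bound)
    show "integrable M (\<lambda>x. (1 - 1/2) powr (1 - p) * D \<alpha> \<beta> u x + (1/2) powr (1 - p) * D \<alpha> \<beta> v x)"
      using i by auto
    show "D \<alpha> \<beta> (\<lambda>x. u x + v x) \<in> borel_measurable M" by (rule D_meas[OF s' ab])
    show "AE x in M. norm (D \<alpha> \<beta> (\<lambda>x. u x + v x) x)
        \<le> norm ((1 - 1/2) powr (1 - p) * D \<alpha> \<beta> u x + (1/2) powr (1 - p) * D \<alpha> \<beta> v x)"
      using D_add[OF s ab half] D_nonneg[OF ab, of "\<lambda>x. u x + v x"] by eventually_elim auto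
  qed
  then show F: "(\<lambda>x. u x + v x) \<in> fin \<alpha> \<beta>" using s' by (simp add: fin_def)
  assume l: "0 < l" "l < 1"
  have "I \<alpha> \<beta> (\<lambda>x. u x + v x) \<le> (LINT x|M. (1 - l) powr (1 - p) * D \<alpha> \<beta> u x + l powr (1 - p) * D \<alpha> \<beta> v x)"
    unfolding I_def using F i D_add[OF s ab l] by (intro integral_mono_AE) (auto simp: fin_def)
  then show "I \<alpha> \<beta> (\<lambda>x. u x + v x) \<le> (1 - l) powr (1 - p) * I \<alpha> \<beta> u + l powr (1 - p) * I \<alpha> \<beta> v"
    using i by (simp add: I_def)
qed

lemma fin_scale:
  assumes u: "u \<in> fin \<alpha> \<beta>" and ab: "coeff \<alpha>" "coeff \<beta>"
  shows "(\<lambda>x. c * u x) \<in> fin \<alpha> \<beta>" and "I \<alpha> \<beta> (\<lambda>x. c * u x) = \<bar>c\<bar> powr p * I \<alpha> \<beta> u"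
proof -
  have s: "u \<in> sob" and i: "integrable M (D \<alpha> \<beta> u)" using u by (auto simp: fin_def)
  have s': "(\<lambda>x. c * u x) \<in> sob" using sob_lin(1)[OF s s, of c 0] by simp
  have ae: "AE x in M. D \<alpha> \<beta> (\<lambda>x. c * u x) x = \<bar>c\<bar> powr p * D \<alpha> \<beta> u x" by (rule D_scale[OF s])
  have me: "D \<alpha> \<beta> (\<lambda>x. c * u x) \<in> borel_measurable M" "(\<lambda>x. \<bar>c\<bar> powr p * D \<alpha> \<beta> u x) \<in> borel_measurable M"
    using D_meas[OF s' ab] D_meas[OF s ab] by auto
  show "(\<lambda>x. c * u x) \<in> fin \<alpha> \<beta>"
    using s' i integrable_cong_AE[OF me ae] by (simp add: fin_def)
  show "I \<alpha> \<beta> (\<lambda>x. c * u x) = \<bar>c\<bar> powr p * I \<alpha> \<beta> u"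
    using integral_cong_AE[OF me ae] by (simp add: I_def)
qed

lemma fin_cong_AE:
  assumes u: "u \<in> fin \<alpha> \<beta>" and ab: "coeff \<alpha>" "coeff \<beta>" and ae: "AE x in M. u x = v x"
  shows "v \<in> fin \<alpha> \<beta>" and "I \<alpha> \<beta> v = I \<alpha> \<beta> u"
proof -
  have s: "u \<in> sob" and i: "integrable M (D \<alpha> \<beta> u)" using u by (auto simp: fin_def)
  note c = sob_cong_AE[OF s ae]
  note me = D_meas[OF s ab] D_meas[OF c(1) ab]
  show "v \<in> fin \<alpha> \<beta>" using c(1) i integrable_cong_AE[OF me c(2)] by (simp add: fin_def)
  show "I \<alpha> \<beta> v = I \<alpha> \<beta> u" using integral_cong_AE[OF me c(2)] by (simp add: I_def)
qed

lemma I_nonneg: "coeff \<alpha> \<Longrightarrow> coeff \<beta> \<Longrightarrow> 0 \<le> I \<alpha> \<beta> u"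
  unfolding I_def using D_nonneg by (rule integral_nonneg_AE)

text \<open>With l = t in \<open>fin_add\<close> the constants (1 - t)^(1 - p) and t^(1 - p) combine
  with p-homogeneity to the weights 1 - t and t.\<close>

lemma fin_convex:
  assumes u: "u \<in> fin \<alpha> \<beta>" and v: "v \<in> fin \<alpha> \<beta>" and ab: "coeff \<alpha>" "coeff \<beta>" and t: "0 \<le> t" "t \<le> 1"
  shows "(\<lambda>x. (1 - t) * u x + t * v x) \<in> fin \<alpha> \<beta>"
    and "I \<alpha> \<beta> (\<lambda>x. (1 - t) * u x + t * v x) \<le> (1 - t) * I \<alpha> \<beta> u + t * I \<alpha> \<beta> v"
proof -
  note f = fin_scale(1)[OF u ab, of "1 - t"] fin_scale(1)[OF v ab, of t]
  show "(\<lambda>x. (1 - t) * u x + t * v x) \<in> fin \<alpha> \<beta>" by (rule fin_add(1)[OF f ab])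
  consider "t = 0" | "t = 1" | "0 < t" "t < 1" using t by linarith
  then show "I \<alpha> \<beta> (\<lambda>x. (1 - t) * u x + t * v x) \<le> (1 - t) * I \<alpha> \<beta> u + t * I \<alpha> \<beta> v"
  proof cases
    case 3
    have "s powr (1 - p) * s powr p = s" if "0 < s" for s :: real
      using that by (simp add: powr_diff)
    then show ?thesis
      using fin_add(2)[OF f ab 3] 3 by (simp add: fin_scale(2)[OF u ab] fin_scale(2)[OF v ab] mult.assoc[symmetric])
  qed auto
qed

lemma fin_lin:
  assumes u: "u \<in> fin \<alpha> \<beta>" and v: "v \<in> fin \<alpha> \<beta>" and ab: "coeff \<alpha>" "coeff \<beta>"
  shows "(\<lambda>x. a * u x + b * v x) \<in> fin \<alpha> \<beta>"
  by (intro fin_add(1) fin_scale(1) assms)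

lemma fin_diff:
  assumes u: "u \<in> fin \<alpha> \<beta>" and v: "v \<in> fin \<alpha> \<beta>" and ab: "coeff \<alpha>" "coeff \<beta>"
  shows "(\<lambda>x. u x - v x) \<in> fin \<alpha> \<beta>"
  using fin_lin[OF assms, of 1 "- 1"] by simp

lemma I_minus:
  assumes u: "u \<in> fin \<alpha> \<beta>" and v: "v \<in> fin \<alpha> \<beta>" and ab: "coeff \<alpha>" "coeff \<beta>"
  shows "I \<alpha> \<beta> (\<lambda>x. u x - v x) = I \<alpha> \<beta> (\<lambda>x. v x - u x)"
  using fin_scale(2)[OF fin_diff[OF assms] ab, of "- 1"] by simp

text \<open>Splits u as v + (u - v). For small l the value at v enters with a factor near 1, and the
  whole cost is put on the difference.\<close>

lemma fin_perturb:
  assumes u: "u \<in> fin \<alpha> \<beta>" and v: "v \<in> fin \<alpha> \<beta>" and ab: "coeff \<alpha>" "coeff \<beta>" and l: "0 < l" "l < 1"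
  shows "I \<alpha> \<beta> u \<le> (1 - l) powr (1 - p) * I \<alpha> \<beta> v + l powr (1 - p) * I \<alpha> \<beta> (\<lambda>x. u x - v x)"
  using fin_add(2)[OF v fin_diff[OF u v ab] ab l] by simp

end

text \<open>The convex hull, generated by binary combinations so that every property stable under
  these is proved by rule induction.\<close>

inductive_set cvx :: "('a \<Rightarrow> real) set \<Rightarrow> ('a \<Rightarrow> real) set" for A where
  base: "a \<in> A \<Longrightarrow> a \<in> cvx A"
| step: "z \<in> cvx A \<Longrightarrow> z' \<in> cvx A \<Longrightarrow> 0 \<le> t \<Longrightarrow> t \<le> 1 \<Longrightarrow> (\<lambda>x. (1 - t) * z x + t * z' x) \<in> cvx A"

lemma cvx_mono: "A \<subseteq> B \<Longrightarrow> cvx A \<subseteq> cvx B"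
proof
  fix z assume "A \<subseteq> B" "z \<in> cvx A"
  from this(2,1) show "z \<in> cvx B" by induction (auto intro: cvx.intros)
qed

lemma integrable_lebesgue_on_subset:
  fixes f :: "'a::euclidean_space \<Rightarrow> real"
  assumes "integrable (lebesgue_on U) f" "U \<in> sets lebesgue" "K \<in> sets lebesgue" "K \<subseteq> U"
  shows "integrable (lebesgue_on K) f"
    and "AE x in lebesgue_on U. 0 \<le> f x \<Longrightarrow> (LINT x|lebesgue_on K. f x) \<le> (LINT x|lebesgue_on U. f x)"
proof -
  have i: "integrable lebesgue (\<lambda>x. indicator U x *\<^sub>R f x)"
    using assms by (simp add: integrable_restrict_space)
  from integrable_mult_bounded[OF this, of "indicator K" 1]
  have "integrable lebesgue (\<lambda>x. indicator K x *\<^sub>R (indicator U x *\<^sub>R f x))"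
    using assms by (auto simp: indicator_def)
  moreover have "(\<lambda>x. indicator K x *\<^sub>R (indicator U x *\<^sub>R f x)) = (\<lambda>x. indicator K x *\<^sub>R f x)"
    by (rule ext) (use assms(4) in \<open>auto simp: indicator_def\<close>)
  ultimately have i': "integrable lebesgue (\<lambda>x. indicator K x *\<^sub>R f x)" by simp
  then show "integrable (lebesgue_on K) f" using assms by (simp add: integrable_restrict_space)
  assume "AE x in lebesgue_on U. 0 \<le> f x"
  then have "AE x in lebesgue. x \<in> U \<longrightarrow> 0 \<le> f x" using assms by (simp add: AE_restrict_space_iff)
  then have "AE x in lebesgue. indicator K x *\<^sub>R f x \<le> indicator U x *\<^sub>R f x"
    by eventually_elim (use assms(4) in \<open>auto simp: indicator_def\<close>)
  then have "(LINT x|lebesgue. indicator K x *\<^sub>R f x) \<le> (LINT x|lebesgue. indicator U x *\<^sub>R f x)"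
    by (rule integral_mono_AE[OF i' i])
  then show "(LINT x|lebesgue_on K. f x) \<le> (LINT x|lebesgue_on U. f x)"
    using assms by (simp add: integral_restrict_space)
qed

lemma integrable_Pair:
  fixes f :: "'a \<Rightarrow> 'b::{banach, second_countable_topology}" and g :: "'a \<Rightarrow> 'c::{banach, second_countable_topology}"
  assumes "integrable M f" "integrable M g"
  shows "integrable M (\<lambda>x. (f x, g x))"
proof -
  have "integrable M (\<lambda>x. (f x, 0::'c))" "integrable M (\<lambda>x. (0::'b, g x))"
    using assms by (auto intro: integrable_bounded_linear[OF bounded_linear_Pair[OF bounded_linear_ident bounded_linear_zero]]
      integrable_bounded_linear[OF bounded_linear_Pair[OF bounded_linear_zero bounded_linear_ident]])
  from Bochner_Integration.integrable_add[OF this] show ?thesis by simp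
qed

lemma weak_gradient_integrable:
  assumes "weak_gradient U u G" "compact K" "K \<subseteq> U"
  shows "integrable (lebesgue_on K) u" "integrable (lebesgue_on K) G"
  using assms unfolding weak_gradient_def Lp_loc_1_iff by auto

section \<open>Uniform convexity, completeness and Mazur's lemma\<close>

context energy_space
begin

lemma mid_eq: "(1 - 1 / 2) *\<^sub>R a + (1 / 2) *\<^sub>R b = (a + b) /\<^sub>R 2" for a b :: "'b::real_vector"
  by (simp add: scaleR_add_right)

text \<open>Integrates the uniform convexity of p-th powers, for \<open>H x\<close> on the gradients
  and for the absolute value, with the factor \<open>m\<close>, on the functions themselves. The
  constant is uniform because the \<delta> of \<open>H_convex\<close> does not depend on x.\<close>

lemma E_uniformly_convex:
  assumes B: "0 \<le> B" and e: "0 < e"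
  obtains \<delta> where "0 < \<delta>"
    and "\<And>u v. u \<in> X \<Longrightarrow> v \<in> X \<Longrightarrow> E u \<le> B \<Longrightarrow> E v \<le> B \<Longrightarrow>
      (E u + E v) / 2 - E (\<lambda>x. (1 - 1 / 2) * u x + (1 / 2) * v x) \<le> \<delta> \<Longrightarrow> E (\<lambda>x. u x - v x) \<le> e"
proof -
  \<comment> \<open>Half of e pays for the term with \<epsilon>^p, whose other factor E u + E v is
    at most 2 * B; the other half pays for the midpoint gap.\<close>
  define q where "q = e / (4 * (B + 1))"
  have q: "0 < q" "q * (2 * B) \<le> e / 2" using B e by (auto simp: q_def field_simps)
  define \<epsilon> where "\<epsilon> = min 1 (q powr (1 / p))"
  have \<epsilon>: "0 < \<epsilon>" "\<epsilon> \<le> 1" using q by (auto simp: \<epsilon>_def)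
  have "\<epsilon> powr p \<le> (q powr (1 / p)) powr p"
    using \<epsilon> p by (intro powr_mono2) (auto simp: \<epsilon>_def)
  then have \<epsilon>p: "\<epsilon> powr p \<le> q" using p q by (simp add: powr_powr)
  have \<epsilon>2: "0 < \<epsilon> / 2" "\<epsilon> / 2 \<le> 1" using \<epsilon> by auto
  obtain \<delta>0 where \<delta>0: "0 < \<delta>0" "AE x in M. convexity_bound (H x) (\<epsilon> / 2) \<delta>0"
    using H_convex[OF \<epsilon>2] by blast
  obtain c1 where c1: "0 < c1" and c1': "\<And>N (x::'a) y. is_norm N \<Longrightarrow> convexity_bound N (\<epsilon> / 2) \<delta>0 \<Longrightarrow>
      c1 * N (x - y) powr p \<le> c1 * \<epsilon> powr p * (N x powr p + N y powr p)
        + ((N x powr p + N y powr p) / 2 - N ((x + y) /\<^sub>R 2) powr p)"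
    using uniformly_convex_powr_bound[OF p \<epsilon> \<delta>0(1)] by metis
  obtain c2 where c2: "0 < c2" and c2': "\<And>N (x::real) y. is_norm N \<Longrightarrow> convexity_bound N (\<epsilon> / 2) 1 \<Longrightarrow>
      c2 * N (x - y) powr p \<le> c2 * \<epsilon> powr p * (N x powr p + N y powr p)
        + ((N x powr p + N y powr p) / 2 - N ((x + y) /\<^sub>R 2) powr p)"
    using uniformly_convex_powr_bound[OF p \<epsilon>, of 1] by (metis zero_less_one)
  define c where "c = min c1 c2"
  have c: "0 < c" using c1 c2 by (simp add: c_def)
  \<comment> \<open>Both pointwise inequalities are brought to the smaller constant c, which is
    possible because the midpoint gap G is nonnegative.\<close>
  have scale: "A \<le> \<epsilon> powr p * S + (1 / c) * G" if "k * A \<le> k * \<epsilon> powr p * S + G" "0 \<le> G" "c \<le> k" for A S G k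
  proof -
    have k: "0 < k" using that c by simp
    have "A \<le> \<epsilon> powr p * S + G / k" using that k by (simp add: field_simps)
    also have "G / k \<le> G / c" using that c by (intro divide_left_mono) auto
    finally show ?thesis by simp
  qed
  show thesis
  proof (rule that[of "c * e / 2"])
    show "0 < c * e / 2" using c e by simp
    fix u v
    assume u: "u \<in> X" and v: "v \<in> X" and B': "E u \<le> B" "E v \<le> B"
      and gap: "(E u + E v) / 2 - E (\<lambda>x. (1 - 1 / 2) * u x + (1 / 2) * v x) \<le> c * e / 2"
    have s: "u \<in> sob" "v \<in> sob" using u v by (auto simp: Wt_iff)
    let ?mid = "\<lambda>x. (1 - 1 / 2) * u x + (1 / 2) * v x"
    let ?D = "D (\<lambda>_. 1) m"
    have mid: "?mid \<in> X" using fin_convex(1)[of u "\<lambda>_. 1" m v "1/2"] u v by (simp add: X_eq_fin)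
    have diff: "(\<lambda>x. u x - v x) \<in> X" using fin_diff[of u "\<lambda>_. 1" m v] u v by (simp add: X_eq_fin)
    have "AE x in M. ?D (\<lambda>x. u x - v x) x
        \<le> \<epsilon> powr p * (?D u x + ?D v x) + (1 / c) * ((?D u x + ?D v x) / 2 - ?D ?mid x)"
      using sob_lin(2)[OF s, of 1 "- 1"] sob_lin(2)[OF s, of "1 - 1/2" "1/2"] H_norm \<delta>0(2) m_nonneg
    proof eventually_elim
      case (elim x)
      let ?a = "wgrad U u x" and ?b = "wgrad U v x"
      have g1: "wgrad U (\<lambda>x. u x - v x) x = ?a - ?b" and g2: "wgrad U ?mid x = (?a + ?b) /\<^sub>R 2"
        using elim(1,2) unfolding mid_eq by auto
      have 1: "H x (?a - ?b) powr p \<le> \<epsilon> powr p * (H x ?a powr p + H x ?b powr p)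
          + (1 / c) * ((H x ?a powr p + H x ?b powr p) / 2 - H x ((?a + ?b) /\<^sub>R 2) powr p)"
        using c1'[OF elim(3,4), of ?a ?b] is_norm_mid_powr_le[OF _ elim(3), of p ?a ?b] p
        by (intro scale[of c1]) (auto simp: c_def)
      have "\<bar>u x - v x\<bar> powr p \<le> \<epsilon> powr p * (\<bar>u x\<bar> powr p + \<bar>v x\<bar> powr p)
          + (1 / c) * ((\<bar>u x\<bar> powr p + \<bar>v x\<bar> powr p) / 2 - \<bar>(u x + v x) /\<^sub>R 2\<bar> powr p)"
        using c2'[OF is_norm_abs convexity_bound_abs[OF \<epsilon>2(1)], of "u x" "v x"]
          is_norm_mid_powr_le[OF _ is_norm_abs, of p "u x" "v x"] p
        by (intro scale[of c2]) (auto simp: c_def)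
      from mult_left_mono[OF this elim(5)]
      have 2: "m x * \<bar>u x - v x\<bar> powr p \<le> \<epsilon> powr p * (m x * \<bar>u x\<bar> powr p + m x * \<bar>v x\<bar> powr p)
          + (1 / c) * ((m x * \<bar>u x\<bar> powr p + m x * \<bar>v x\<bar> powr p) / 2 - m x * \<bar>(u x + v x) /\<^sub>R 2\<bar> powr p)"
        by (simp add: algebra_simps diff_divide_distrib)
      have 3: "\<bar>?mid x\<bar> = \<bar>(u x + v x) /\<^sub>R 2\<bar>" by (simp add: field_simps)
      have "?D (\<lambda>x. u x - v x) x = H x (?a - ?b) powr p + m x * \<bar>u x - v x\<bar> powr p"
        "?D ?mid x = H x ((?a + ?b) /\<^sub>R 2) powr p + m x * \<bar>(u x + v x) /\<^sub>R 2\<bar> powr p"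
        "?D u x = H x ?a powr p + m x * \<bar>u x\<bar> powr p" "?D v x = H x ?b powr p + m x * \<bar>v x\<bar> powr p"
        unfolding D_def g1 g2 3 by simp_all
      then show ?case using add_mono[OF 1 2] by (simp add: algebra_simps add_divide_distrib)
    qed
    then have "E (\<lambda>x. u x - v x)
        \<le> (LINT x|M. \<epsilon> powr p * (?D u x + ?D v x) + (1 / c) * ((?D u x + ?D v x) / 2 - ?D ?mid x))"
      unfolding I_def using diff u v mid by (intro integral_mono_AE) (auto simp: Wt_iff)
    also have "\<dots> = \<epsilon> powr p * (E u + E v) + (1 / c) * ((E u + E v) / 2 - E ?mid)"
      unfolding I_def using u v mid by (simp add: Wt_iff)
    also have "\<dots> \<le> q * (2 * B) + (1 / c) * (c * e / 2)"
    proof (rule add_mono)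
      show "\<epsilon> powr p * (E u + E v) \<le> q * (2 * B)"
        using \<epsilon>p B' q I_nonneg[of "\<lambda>_. 1" m u] I_nonneg[of "\<lambda>_. 1" m v] by (intro mult_mono) auto
      show "1 / c * ((E u + E v) / 2 - E ?mid) \<le> (1 / c) * (c * e / 2)"
        by (rule mult_left_mono[OF gap]) (use c in simp)
    qed
    also have "\<dots> \<le> e" using q c by simp
    finally show "E (\<lambda>x. u x - v x) \<le> e" .
  qed
qed

text \<open>On K the weight has a positive lower bound and \<open>H x\<close> dominates a multiple
  of the Euclidean norm. The free parameter e keeps the bound linear in E u: it is fixed before the
  energy is made small, so that no p-th root enters.\<close>

lemma L1_control:
  assumes K: "compact K" "K \<subseteq> U"
  shows "\<exists>C\<ge>0. \<forall>u\<in>X. \<forall>e>0.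
    (LINT x|lebesgue_on K. norm (u x, wgrad U u x)) \<le> C * (e + e powr (1 - p) * E u)"
proof -
  obtain c where c: "0 < c" "\<And>x. x \<in> K \<Longrightarrow> c \<le> w U x"
  proof (cases "K = {}")
    case False
    obtain z where "z \<in> K" "\<And>x. x \<in> K \<Longrightarrow> w U z \<le> w U x"
      using continuous_attains_inf[OF K(1) False continuous_on_subset[OF w_cont K(2)]] by blast
    then show thesis using that[of "w U z"] w_pos K by auto
  qed (use that[of 1] in auto)
  obtain \<kappa> \<nu> where \<kappa>: "0 < \<kappa>" "AE x in lebesgue_on K. \<forall>\<xi>. \<kappa> * norm \<xi> \<le> H x \<xi> \<and> H x \<xi> \<le> \<nu> * norm \<xi>"
    using H_bounds[OF K] by blast
  define C0 where "C0 = 1 / c + 1 / \<kappa> powr p"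
  define L where "L = measure lebesgue K"
  have C0: "0 \<le> C0" using c \<kappa> by (simp add: C0_def)
  have Kl: "K \<in> sets lebesgue" "U \<in> sets lebesgue" using K U by auto
  show ?thesis
  proof (intro exI[of _ "max (2 * L) C0"] conjI ballI allI impI)
    show "0 \<le> max (2 * L) C0" using C0 by simp
    fix u and e :: real assume u: "u \<in> X" and e: "0 < e"
    let ?D = "D (\<lambda>_. 1) m u"
    have iD: "integrable M ?D" and wg: "weak_gradient U u (wgrad U u)"
      using u by (auto simp: Wt_iff sob_def intro: weak_gradient_wgrad)
    have iDK: "integrable (lebesgue_on K) ?D" by (rule integrable_lebesgue_on_subset(1)[OF iD Kl(2,1) K(2)])
    have iu: "integrable (lebesgue_on K) u" "integrable (lebesgue_on K) (wgrad U u)"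
      using wg K by (auto simp: weak_gradient_def Lp_loc_1_iff)
    have iconst: "integrable (lebesgue_on K) (\<lambda>x. 2 * e)"
      using continuous_Lp_loc[of "\<lambda>_. 2 * e" K] K by (auto simp: Lp_loc_1_iff)
    then have iD2: "integrable (lebesgue_on K) (\<lambda>x. 2 * e + e powr (1 - p) * C0 * ?D x)"
      using iDK by simp
    have AEK: "AE x in lebesgue_on K. x \<in> K" using Kl by (simp add: AE_restrict_space_iff)
    have DK: "0 \<le> (LINT x|lebesgue_on K. ?D x)"
      using AE_lebesgue_on_subset[OF D_nonneg Kl(2,1) K(2), of "\<lambda>_. 1" m u]
      by (intro integral_nonneg_AE) auto
    have "AE x in lebesgue_on K. norm (u x, wgrad U u x) \<le> 2 * e + e powr (1 - p) * C0 * ?D x"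
      using \<kappa>(2) AEK
    proof eventually_elim
      case (elim x)
      have m: "c \<le> m x" using c(2)[OF elim(2)] by (simp add: m_def)
      have "norm (wgrad U u x) powr p \<le> (H x (wgrad U u x) / \<kappa>) powr p"
        using elim(1) \<kappa>(1) p by (intro powr_mono2) (auto simp: field_simps)
      also have "\<dots> = H x (wgrad U u x) powr p / \<kappa> powr p"
        by (rule powr_divide)
      also have "\<dots> \<le> ?D x / \<kappa> powr p"
        using m c(1) by (intro divide_right_mono) (auto simp: D_def)
      finally have 1: "norm (wgrad U u x) powr p \<le> ?D x / \<kappa> powr p" .
      have "c * \<bar>u x\<bar> powr p \<le> m x * \<bar>u x\<bar> powr p" using m by (intro mult_right_mono) auto
      also have "\<dots> \<le> ?D x" by (simp add: D_def)
      finally have 2: "\<bar>u x\<bar> powr p \<le> ?D x / c" using c(1) by (simp add: field_simps)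
      have "norm (u x, wgrad U u x) \<le> \<bar>u x\<bar> + norm (wgrad U u x)"
        using norm_Pair_le[of "u x" "wgrad U u x"] by simp
      also have "\<dots> \<le> (e + e powr (1 - p) * \<bar>u x\<bar> powr p) + (e + e powr (1 - p) * norm (wgrad U u x) powr p)"
        using p e by (intro add_mono le_eps_powr) auto
      also have "\<dots> \<le> (e + e powr (1 - p) * (?D x / c)) + (e + e powr (1 - p) * (?D x / \<kappa> powr p))"
        using 1 2 by (intro add_mono mult_left_mono) auto
      also have "\<dots> = 2 * e + e powr (1 - p) * C0 * ?D x" by (simp add: C0_def algebra_simps)
      finally show ?case .
    qed
    then have "(LINT x|lebesgue_on K. norm (u x, wgrad U u x))
        \<le> (LINT x|lebesgue_on K. 2 * e + e powr (1 - p) * C0 * ?D x)"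
    proof (intro integral_mono_AE)
      show "integrable (lebesgue_on K) (\<lambda>x. norm (u x, wgrad U u x))"
        using iu by (intro integrable_norm integrable_Pair)
      show "integrable (lebesgue_on K) (\<lambda>x. 2 * e + e powr (1 - p) * C0 * ?D x)"
        by (rule iD2)
    qed
    also have "\<dots> = 2 * L * e + C0 * (e powr (1 - p) * (LINT x|lebesgue_on K. ?D x))"
      using iDK iconst by (simp add: L_def measure_restrict_space Kl)
    also have "2 * L * e + C0 * (e powr (1 - p) * (LINT x|lebesgue_on K. ?D x)) \<le> max (2 * L) C0 * e + max (2 * L) C0 * (e powr (1 - p) * E u)"
    proof (intro add_mono mult_mono)
      show "(LINT x|lebesgue_on K. ?D x) \<le> E u"
        unfolding I_def by (rule integrable_lebesgue_on_subset(2)[OF iD Kl(2,1) K(2) D_nonneg]) auto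
    qed (use e C0 DK in auto)
    finally show "(LINT x|lebesgue_on K. norm (u x, wgrad U u x)) \<le> max (2 * L) C0 * (e + e powr (1 - p) * E u)"
      by (simp add: algebra_simps)
  qed
qed

lemma E_tendsto_L1_loc:
  assumes u: "\<And>k. u k \<in> X" and v: "v \<in> X" and lim: "(\<lambda>k. E (\<lambda>x. u k x - v x)) \<longlonglongrightarrow> 0"
  shows "L1_loc_conv U u v" "L1_loc_conv U (\<lambda>k. wgrad U (u k)) (wgrad U v)"
proof -
  have sob: "u k \<in> sob" "v \<in> sob" for k using u v by (auto simp: Wt_iff)
  have wg: "weak_gradient U (u k) (wgrad U (u k))" "weak_gradient U v (wgrad U v)" for k
    using sob by (auto simp: sob_def intro: weak_gradient_wgrad)
  have diff: "(\<lambda>x. u k x - v x) \<in> X" for k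
    using fin_diff[of "u k" "\<lambda>_. 1" m v] u v by (simp add: X_eq_fin)
  have *: "(\<lambda>k. LINT x|lebesgue_on K. norm (u k x - v x)) \<longlonglongrightarrow> 0 \<and>
      (\<lambda>k. LINT x|lebesgue_on K. norm (wgrad U (u k) x - wgrad U v x)) \<longlonglongrightarrow> 0"
    if K: "compact K" "K \<subseteq> U" for K
  proof -
    obtain C where C: "0 \<le> C" "\<And>u e. u \<in> X \<Longrightarrow> 0 < e \<Longrightarrow>
      (LINT x|lebesgue_on K. norm (u x, wgrad U u x)) \<le> C * (e + e powr (1 - p) * E u)"
      using L1_control[OF K] by blast
    define P where "P k = (LINT x|lebesgue_on K. norm (u k x - v x, wgrad U (u k) x - wgrad U v x))" for k
    have iK: "integrable (lebesgue_on K) (u k)" "integrable (lebesgue_on K) v"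
      "integrable (lebesgue_on K) (wgrad U (u k))" "integrable (lebesgue_on K) (wgrad U v)" for k
      using weak_gradient_integrable[OF wg(1) K] weak_gradient_integrable[OF wg(2) K] by auto
    have iP: "integrable (lebesgue_on K) (\<lambda>x. norm (u k x - v x, wgrad U (u k) x - wgrad U v x))" for k
      using iK by (intro integrable_norm integrable_Pair) auto
    have PE: "P k \<le> C * (e + e powr (1 - p) * E (\<lambda>x. u k x - v x))" if "0 < e" for k e
    proof -
      have ae: "AE x in lebesgue_on K. wgrad U (\<lambda>x. u k x - v x) x = wgrad U (u k) x - wgrad U v x"
      proof (rule AE_lebesgue_on_subset)
        show "AE x in M. wgrad U (\<lambda>x. u k x - v x) x = wgrad U (u k) x - wgrad U v x"
          using sob_lin(2)[OF sob(1,2), of 1 k "- 1"] by simp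
      qed (use K U in auto)
      have "weak_gradient U (\<lambda>x. u k x - v x) (wgrad U (\<lambda>x. u k x - v x))"
        using diff[of k] by (auto simp: Wt_iff sob_def intro: weak_gradient_wgrad)
      then have "integrable (lebesgue_on K) (wgrad U (\<lambda>x. u k x - v x))"
        using K by (auto simp: weak_gradient_def Lp_loc_1_iff)
      then have "integrable (lebesgue_on K) (\<lambda>x. norm (u k x - v x, wgrad U (\<lambda>x. u k x - v x) x))"
        using iK by (intro integrable_norm integrable_Pair) auto
      then have "P k = (LINT x|lebesgue_on K. norm (u k x - v x, wgrad U (\<lambda>x. u k x - v x) x))"
        unfolding P_def using iP[of k] by (intro integral_cong_AE) (auto intro!: eventually_mono[OF ae])
      then show ?thesis using C(2)[OF diff that] by simp
    qed
    have P0: "P \<longlonglongrightarrow> 0"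
    proof (rule LIMSEQ_I)
      fix r :: real assume r: "0 < r"
      define e where "e = r / (2 * (C + 1))"
      have e: "0 < e" "C * e \<le> r / 2" using r C(1) by (auto simp: e_def field_simps)
      have "(\<lambda>k. C * (e powr (1 - p) * E (\<lambda>x. u k x - v x))) \<longlonglongrightarrow> 0"
        by (intro tendsto_mult_right_zero lim)
      then have "\<forall>\<^sub>F k in sequentially. C * (e powr (1 - p) * E (\<lambda>x. u k x - v x)) < r / 2"
        using r by (intro order_tendstoD) auto
      then obtain N where N: "\<And>k. k \<ge> N \<Longrightarrow> C * (e powr (1 - p) * E (\<lambda>x. u k x - v x)) < r / 2"
        by (auto simp: eventually_sequentially)
      have "norm (P k - 0) < r" if "k \<ge> N" for k
      proof -
        have "0 \<le> P k" by (simp add: P_def)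
        then show ?thesis using PE[OF e(1), of k] N[OF that] e(2) by (simp add: algebra_simps)
      qed
      then show "\<exists>no. \<forall>n\<ge>no. norm (P n - 0) < r" by blast
    qed
    have "(LINT x|lebesgue_on K. norm (u k x - v x)) \<le> P k"
      "(LINT x|lebesgue_on K. norm (wgrad U (u k) x - wgrad U v x)) \<le> P k" for k
      unfolding P_def using iK iP norm_fst_le[of "u k x - v x" "wgrad U (u k) x - wgrad U v x" for x]
        norm_snd_le[of "wgrad U (u k) x - wgrad U v x" "u k x - v x" for x]
      by (intro integral_mono; simp)+
    then show ?thesis
      by (intro conjI Lim_null_comparison[OF always_eventually P0]) auto
  qed
  show "L1_loc_conv U u v" "L1_loc_conv U (\<lambda>k. wgrad U (u k)) (wgrad U v)"
    unfolding L1_loc_conv_def using * wg by (auto simp: weak_gradient_def)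
qed

lemma fin_I_le_Fatou:
  assumes D: "\<And>j. integrable M (f j)" "\<And>j. AE x in M. 0 \<le> f j x" "\<And>j. (LINT x|M. f j x) \<le> B"
    and lim: "AE x in M. (\<lambda>j. f j x) \<longlonglongrightarrow> D \<alpha> \<beta> u x" and u: "u \<in> sob" and ab: "coeff \<alpha>" "coeff \<beta>"
  shows "u \<in> fin \<alpha> \<beta>" "I \<alpha> \<beta> u \<le> B"
  using fatou_real[OF D(1,2) lim D_meas[OF u ab] D(3)] u by (auto simp: fin_def I_def)

text \<open>The limit is found locally in L^1, function and gradient together as one pair-valued
  map. The weak gradient survives this limit, and Fatou's lemma along an almost everywhere
  convergent subsequence carries the energy estimates over.\<close>

lemma X_complete:
  assumes z: "\<And>i. z i \<in> X"
    and cau: "\<And>e. 0 < e \<Longrightarrow> \<exists>N. \<forall>i\<ge>N. \<forall>j\<ge>N. E (\<lambda>x. z i x - z j x) \<le> e"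
  obtains v where "v \<in> X" "(\<lambda>i. E (\<lambda>x. z i x - v x)) \<longlonglongrightarrow> 0"
proof -
  have sob: "z i \<in> sob" for i using z by (auto simp: Wt_iff)
  have wg: "weak_gradient U (z i) (wgrad U (z i))" for i
    using sob by (auto simp: sob_def intro: weak_gradient_wgrad)
  have diff: "(\<lambda>x. z i x - z j x) \<in> X" for i j
    using fin_diff[of "z i" "\<lambda>_. 1" m "z j"] z by (simp add: X_eq_fin)
  have wgd: "AE x in M. wgrad U (\<lambda>x. z i x - z j x) x = wgrad U (z i) x - wgrad U (z j) x" for i j
    using sob_lin(2)[OF sob sob, of 1 i "- 1" j] by simp
  define f where "f i x = (z i x, wgrad U (z i) x)" for i x
  have f: "f i \<in> Lp_loc U 1" for i
    using wg[of i] unfolding f_def weak_gradient_def Lp_loc_1_iff by (auto intro!: integrable_Pair)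
  obtain F s where s: "strict_mono s" and ae: "AE x in M. (\<lambda>k. f (s k) x) \<longlonglongrightarrow> F x" and L1: "L1_loc_conv U f F"
  proof (rule L1_loc_complete[OF U f])
    fix K and r :: real assume K: "compact K" "K \<subseteq> U" and r: "0 < r"
    obtain C where C: "0 \<le> C" "\<And>u e. u \<in> X \<Longrightarrow> 0 < e \<Longrightarrow>
      (LINT x|lebesgue_on K. norm (u x, wgrad U u x)) \<le> C * (e + e powr (1 - p) * E u)"
      using L1_control[OF K] by blast
    define e where "e = r / (4 * (C + 1))"
    have e: "0 < e" "C * e \<le> r / 4" using r C(1) by (auto simp: e_def field_simps)
    \<comment> \<open>Chosen such that e^(1 - p) * e' = e, which balances the two summands of
      \<open>L1_control\<close>.\<close>
    define e' where "e' = e / e powr (1 - p)"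
    have e': "0 < e'" "e powr (1 - p) * e' = e" using e by (auto simp: e'_def)
    obtain N where N: "\<And>i j. i \<ge> N \<Longrightarrow> j \<ge> N \<Longrightarrow> E (\<lambda>x. z i x - z j x) \<le> e'" using cau[OF e'(1)] by blast
    have "(LINT x|lebesgue_on K. norm (f i x - f j x)) < r" if "i \<ge> N" "j \<ge> N" for i j
    proof -
      have aeK: "AE x in lebesgue_on K. wgrad U (\<lambda>x. z i x - z j x) x = wgrad U (z i) x - wgrad U (z j) x"
        by (rule AE_lebesgue_on_subset[OF wgd]) (use K U in auto)
      have "weak_gradient U (\<lambda>x. z i x - z j x) (wgrad U (\<lambda>x. z i x - z j x))"
        using diff[of i j] by (auto simp: Wt_iff sob_def intro: weak_gradient_wgrad)
      then have "integrable (lebesgue_on K) (\<lambda>x. z i x - z j x)" "integrable (lebesgue_on K) (wgrad U (\<lambda>x. z i x - z j x))"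
        using K by (auto simp: weak_gradient_def Lp_loc_1_iff)
      then have 1: "integrable (lebesgue_on K) (\<lambda>x. norm (z i x - z j x, wgrad U (\<lambda>x. z i x - z j x) x))"
        by (intro integrable_norm integrable_Pair) auto
      have 2: "integrable (lebesgue_on K) (\<lambda>x. norm (f i x - f j x))"
        using Lp_loc_1_diff[OF f f, of i j] K by (auto simp: Lp_loc_1_iff)
      have "(LINT x|lebesgue_on K. norm (f i x - f j x))
          = (LINT x|lebesgue_on K. norm (z i x - z j x, wgrad U (\<lambda>x. z i x - z j x) x))"
        using 1 2 by (intro integral_cong_AE) (auto simp: f_def intro!: eventually_mono[OF aeK])
      also have "\<dots> \<le> C * (e + e powr (1 - p) * E (\<lambda>x. z i x - z j x))" by (rule C(2)[OF diff e(1)])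
      also have "\<dots> \<le> C * (e + e powr (1 - p) * e')"
        using N[OF that] C(1) by (intro mult_left_mono add_left_mono) auto
      also have "\<dots> = 2 * (C * e)" using e' by simp
      also have "\<dots> < r" using e r by simp
      finally show ?thesis .
    qed
    then show "\<exists>N. \<forall>i\<ge>N. \<forall>j\<ge>N. (LINT x|lebesgue_on K. norm (f i x - f j x)) < r" by blast
  qed blast
  define v where "v x = fst (F x)" for x
  define G where "G x = snd (F x)" for x
  have Floc: "F \<in> Lp_loc U 1" using L1 by (simp add: L1_loc_conv_def)
  have vG: "v \<in> Lp_loc U 1" "G \<in> Lp_loc U 1"
    using Floc unfolding v_def G_def Lp_loc_1_iff by (auto intro: integrable_fst integrable_snd)
  have Lz: "L1_loc_conv U z v" and LG: "L1_loc_conv U (\<lambda>i. wgrad U (z i)) G"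
  proof -
    have "(\<lambda>k. LINT x|lebesgue_on K. norm (z k x - v x)) \<longlonglongrightarrow> 0 \<and>
        (\<lambda>k. LINT x|lebesgue_on K. norm (wgrad U (z k) x - G x)) \<longlonglongrightarrow> 0" if K: "compact K" "K \<subseteq> U" for K
    proof -
      have lim: "(\<lambda>k. LINT x|lebesgue_on K. norm (f k x - F x)) \<longlonglongrightarrow> 0" using L1 K by (simp add: L1_loc_conv_def)
      have i: "integrable (lebesgue_on K) (\<lambda>x. norm (f k x - F x))"
        "integrable (lebesgue_on K) (\<lambda>x. norm (z k x - v x))" "integrable (lebesgue_on K) (\<lambda>x. norm (wgrad U (z k) x - G x))" for k
        using f[of k] Floc wg[of k] vG K unfolding weak_gradient_def Lp_loc_1_iff by auto
      have eq: "f k x - F x = (z k x - v x, wgrad U (z k) x - G x)" for k x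
        by (simp add: f_def v_def G_def prod_eq_iff)
      have "(LINT x|lebesgue_on K. norm (z k x - v x)) \<le> (LINT x|lebesgue_on K. norm (f k x - F x))"
        "(LINT x|lebesgue_on K. norm (wgrad U (z k) x - G x)) \<le> (LINT x|lebesgue_on K. norm (f k x - F x))" for k
        using i[of k] unfolding eq by (intro integral_mono norm_fst_le norm_snd_le; simp)+
      then show ?thesis
        by (intro conjI Lim_null_comparison[OF always_eventually lim]) auto
    qed
    then show "L1_loc_conv U z v" "L1_loc_conv U (\<lambda>i. wgrad U (z i)) G"
      unfolding L1_loc_conv_def using wg vG by (auto simp: weak_gradient_def)
  qed
  have wgv: "weak_gradient U v G" by (rule weak_gradient_limit[OF U wg Lz LG])
  have vs: "v \<in> sob"
    using wgv Lp_loc_1_measurable[OF U vG(1)] by (auto simp: sob_def has_weak_gradient_def)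
  have ds: "(\<lambda>x. z i x - v x) \<in> sob" for i using sob_lin(1)[OF sob vs, of 1 i "- 1"] by simp
  let ?D = "D (\<lambda>_. 1) m"
  have lim: "AE x in M. (\<lambda>j. ?D (\<lambda>x. z i x - z (s (j + N)) x) x) \<longlonglongrightarrow> ?D (\<lambda>x. z i x - v x) x" for i N
  proof -
    have 1: "AE x in M. \<forall>j. wgrad U (\<lambda>x. z i x - z (s (j + N)) x) x = wgrad U (z i) x - wgrad U (z (s (j + N))) x"
      using wgd by (simp add: AE_all_countable)
    have 2: "AE x in M. wgrad U (\<lambda>x. z i x - v x) x = wgrad U (z i) x - wgrad U v x"
      using sob_lin(2)[OF sob vs, of 1 i "- 1"] by simp
    show ?thesis
      using 1 2 wgrad_AE[OF U wgv] ae H_good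
    proof eventually_elim
      case (elim x)
      then obtain \<nu> where \<nu>: "is_norm (H x)" "\<forall>\<xi>. H x \<xi> \<le> \<nu> * norm \<xi>" by blast
      have l: "(\<lambda>k. z (s k) x) \<longlonglongrightarrow> v x" "(\<lambda>k. wgrad U (z (s k)) x) \<longlonglongrightarrow> G x"
        using tendsto_fst[OF elim(4)] tendsto_snd[OF elim(4)] by (simp_all add: f_def v_def G_def)
      note l' = LIMSEQ_ignore_initial_segment[OF l(1), of N] LIMSEQ_ignore_initial_segment[OF l(2), of N]
      have "(\<lambda>j. H x (wgrad U (z i) x - wgrad U (z (s (j + N))) x)) \<longlonglongrightarrow> H x (wgrad U (z i) x - G x)"
        by (rule norm_bounded_tendsto[OF \<nu>]) (intro tendsto_intros l')
      then have "(\<lambda>j. H x (wgrad U (z i) x - wgrad U (z (s (j + N))) x) powr p + m x * \<bar>z i x - z (s (j + N)) x\<bar> powr p)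
          \<longlonglongrightarrow> H x (wgrad U (z i) x - G x) powr p + m x * \<bar>z i x - v x\<bar> powr p"
        using p by (intro tendsto_intros tendsto_powr' l') (auto simp: is_norm_simps(1)[OF \<nu>(1)])
      then show ?case using elim(1-3) by (simp add: D_def)
    qed
  qed
  have tail: "(\<lambda>x. z i x - v x) \<in> X \<and> E (\<lambda>x. z i x - v x) \<le> e" if N: "\<forall>i\<ge>N. \<forall>j\<ge>N. E (\<lambda>x. z i x - z j x) \<le> e" and i: "i \<ge> N" for N i e
  proof -
    have "E (\<lambda>x. z i x - z (s (j + N)) x) \<le> e" for j
    proof -
      have "N \<le> s (j + N)" using seq_suble[OF s, of "j + N"] by simp
      then show ?thesis using N i by simp
    qed
    moreover have "integrable M (?D (\<lambda>x. z i x - z (s (j + N)) x))" for j using diff by (simp add: Wt_iff)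
    ultimately show ?thesis
      using fin_I_le_Fatou[of "\<lambda>j. ?D (\<lambda>x. z i x - z (s (j + N)) x)" e, OF _ _ _ lim ds] D_nonneg
      by (auto simp: I_def X_eq_fin)
  qed
  obtain N where "\<forall>i\<ge>N. \<forall>j\<ge>N. E (\<lambda>x. z i x - z j x) \<le> 1" using cau[of 1] by auto
  from tail[OF this order_refl] have "(\<lambda>x. z N x - v x) \<in> X" by blast
  then have v: "v \<in> X" using fin_diff[of "z N" "\<lambda>_. 1" m "\<lambda>x. z N x - v x"] z[of N] by (simp add: X_eq_fin)
  have "(\<lambda>i. E (\<lambda>x. z i x - v x)) \<longlonglongrightarrow> 0"
  proof (rule LIMSEQ_I)
    fix r :: real assume r: "0 < r"
    obtain N where N: "\<forall>i\<ge>N. \<forall>j\<ge>N. E (\<lambda>x. z i x - z j x) \<le> r / 2" using cau[of "r / 2"] r by auto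
    have "norm (E (\<lambda>x. z i x - v x) - 0) < r" if "i \<ge> N" for i
      using tail[OF N that] r I_nonneg[of "\<lambda>_. 1" m "\<lambda>x. z i x - v x"] by simp
    then show "\<exists>no. \<forall>n\<ge>no. norm (E (\<lambda>x. z n x - v x) - 0) < r" by blast
  qed
  with v show thesis by (rule that)
qed

lemma X_diff: "u \<in> X \<Longrightarrow> v \<in> X \<Longrightarrow> (\<lambda>x. u x - v x) \<in> X"
  using fin_diff[of u "\<lambda>_. 1" m v] by (simp add: X_eq_fin)

lemma X_lin: "u \<in> X \<Longrightarrow> v \<in> X \<Longrightarrow> (\<lambda>x. a * u x + b * v x) \<in> X"
  using fin_lin[of u "\<lambda>_. 1" m v] by (simp add: X_eq_fin)

lemma X_sob: "u \<in> X \<Longrightarrow> u \<in> sob"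
  by (simp add: Wt_iff)

lemma X_loc: "u \<in> X \<Longrightarrow> u \<in> Lp_loc U 1"
  using weak_gradient_wgrad by (auto simp: Wt_iff sob_def weak_gradient_def)

lemma E_nonneg: "0 \<le> E u"
  by (rule I_nonneg) auto

lemma cvx_fin:
  assumes "z \<in> cvx A" "A \<subseteq> fin \<alpha> \<beta>" "coeff \<alpha>" "coeff \<beta>" "\<And>a. a \<in> A \<Longrightarrow> I \<alpha> \<beta> a \<le> B"
  shows "z \<in> fin \<alpha> \<beta> \<and> I \<alpha> \<beta> z \<le> B"
  using assms(1)
proof induction
  case (step z z' t)
  have "I \<alpha> \<beta> (\<lambda>x. (1 - t) * z x + t * z' x) \<le> (1 - t) * I \<alpha> \<beta> z + t * I \<alpha> \<beta> z'"
    using step assms by (intro fin_convex(2)) auto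
  also have "\<dots> \<le> (1 - t) * B + t * B"
    using step by (intro add_mono mult_left_mono) auto
  finally show ?case using fin_convex(1)[of z \<alpha> \<beta> z' t] step assms by (simp add: algebra_simps)
qed (use assms in auto)

lemma cvx_L1:
  assumes "z \<in> cvx A" and v: "integrable (lebesgue_on K) v"
    and A: "\<And>a. a \<in> A \<Longrightarrow> integrable (lebesgue_on K) a \<and> (LINT x|lebesgue_on K. \<bar>a x - v x\<bar>) \<le> r"
  shows "integrable (lebesgue_on K) z \<and> (LINT x|lebesgue_on K. \<bar>z x - v x\<bar>) \<le> r"
  using assms(1)
proof induction
  case (step z z' t)
  have "(LINT x|lebesgue_on K. \<bar>(1 - t) * z x + t * z' x - v x\<bar>)
      \<le> (LINT x|lebesgue_on K. (1 - t) * \<bar>z x - v x\<bar> + t * \<bar>z' x - v x\<bar>)"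
  proof (rule integral_mono)
    fix x
    have "(1 - t) * z x + t * z' x - v x = (1 - t) * (z x - v x) + t * (z' x - v x)"
      by (simp add: algebra_simps)
    then show "\<bar>(1 - t) * z x + t * z' x - v x\<bar> \<le> (1 - t) * \<bar>z x - v x\<bar> + t * \<bar>z' x - v x\<bar>"
      using step abs_triangle_ineq[of "(1 - t) * (z x - v x)" "t * (z' x - v x)"] by (simp add: abs_mult)
  qed (use step v in auto)
  also have "\<dots> = (1 - t) * (LINT x|lebesgue_on K. \<bar>z x - v x\<bar>) + t * (LINT x|lebesgue_on K. \<bar>z' x - v x\<bar>)"
    using step v by simp
  also have "\<dots> \<le> (1 - t) * r + t * r"
    using step by (intro add_mono mult_left_mono) auto
  finally show ?case using step by (simp add: algebra_simps)
qed (use A in auto)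

text \<open>Nearly energy-minimal elements of the convex hulls of the tails form a Cauchy sequence by
  uniform convexity; this replaces reflexivity.\<close>
theorem mazur:
  assumes u: "\<And>k. u k \<in> X" and B: "\<And>k. E (u k) \<le> B" and conv: "L1_loc_conv U u v"
  shows "v \<in> X" and "0 < e \<Longrightarrow> \<exists>z\<in>cvx (u ` {N..}). E (\<lambda>x. z x - v x) \<le> e"
proof -
  define T where "T N = cvx (u ` {N..})" for N :: nat
  have T: "z \<in> X" "E z \<le> B" if "z \<in> T N" for z N
    using cvx_fin[of z "u ` {N..}" "\<lambda>_. 1" m B] that u B by (auto simp: T_def X_eq_fin)
  have uT: "u k \<in> T N" if "k \<ge> N" for k N using that by (auto simp: T_def intro: cvx.base)
  have Tmono: "T j \<subseteq> T i" if "i \<le> j" for i j unfolding T_def by (rule cvx_mono) (use that in auto)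
  have B0: "0 \<le> B" using E_nonneg[of "u 0"] B[of 0] by linarith
  \<comment> \<open>The tails shrink, so d increases, and it is bounded by B. Once d N is close to
    its limit dd, near-minimisers of all later tails are nearly minimal already in the tail
    N.\<close>
  define d where "d N = Inf (E ` T N)" for N
  have bdd: "bdd_below (E ` T N)" for N by (rule bdd_belowI2[of _ 0]) (rule E_nonneg)
  have dle: "d N \<le> E z" if "z \<in> T N" for z N
    unfolding d_def by (rule cInf_lower[OF imageI[OF that] bdd])
  have dB: "d N \<le> B" for N using dle[OF uT[of N N]] B[of N] by simp
  have dmono: "d i \<le> d j" if "i \<le> j" for i j
    unfolding d_def by (rule cInf_superset_mono[OF _ bdd image_mono[OF Tmono[OF that]]]) (use uT in auto)
  define dd where "dd = (SUP N. d N)"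
  have bddd: "bdd_above (range d)" using dB by (intro bdd_aboveI2)
  have ddN: "d N \<le> dd" for N unfolding dd_def by (rule cSUP_upper[OF UNIV_I bddd])
  have dlim: "d \<longlonglongrightarrow> dd"
    unfolding dd_def using bddd dmono by (intro LIMSEQ_incseq_SUP) (auto simp: incseq_def)
  have "\<exists>z\<in>T N. E z < d N + 1 / (real N + 1)" for N
  proof -
    have "Inf (E ` T N) < d N + 1 / (real N + 1)" by (simp add: d_def)
    then show ?thesis using cInf_lessD[of "E ` T N"] uT[of N N] by auto
  qed
  then obtain z where z: "\<And>N. z N \<in> T N" "\<And>N. E (z N) < d N + 1 / (real N + 1)" by metis
  have zX: "z N \<in> X" "E (z N) \<le> B" for N using T[OF z(1)] by auto
  have cau: "\<exists>N. \<forall>i\<ge>N. \<forall>j\<ge>N. E (\<lambda>x. z i x - z j x) \<le> e" if e: "0 < e" for e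
  proof -
    obtain \<delta> where \<delta>: "0 < \<delta>" "\<And>u v. u \<in> X \<Longrightarrow> v \<in> X \<Longrightarrow> E u \<le> B \<Longrightarrow> E v \<le> B \<Longrightarrow>
      (E u + E v) / 2 - E (\<lambda>x. (1 - 1 / 2) * u x + (1 / 2) * v x) \<le> \<delta> \<Longrightarrow> E (\<lambda>x. u x - v x) \<le> e"
      using E_uniformly_convex[OF B0 e] by blast
    have "(\<lambda>N. dd + inverse (real (Suc N)) - d N) \<longlonglongrightarrow> dd + 0 - dd"
      by (intro tendsto_intros dlim LIMSEQ_inverse_real_of_nat)
    then have "\<forall>\<^sub>F N in sequentially. dd + inverse (real (Suc N)) - d N < \<delta>"
      using \<delta>(1) by (intro order_tendstoD) auto
    then obtain N where N: "dd + inverse (real (Suc N)) - d N < \<delta>" by (auto simp: eventually_sequentially)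
    have zN: "E (z i) \<le> dd + inverse (real (Suc N))" if "i \<ge> N" for i
    proof -
      have "1 / (real i + 1) \<le> inverse (real (Suc N))"
        using that by (simp add: divide_inverse add.commute le_imp_inverse_le)
      then show ?thesis using z(2)[of i] ddN[of i] by simp
    qed
    have "E (\<lambda>x. z i x - z j x) \<le> e" if ij: "i \<ge> N" "j \<ge> N" for i j
    proof (rule \<delta>(2)[OF zX(1) zX(1) zX(2) zX(2)])
      \<comment> \<open>The midpoint stays in the convex hull of the tail N, so its energy is at
        least d N, while both ends have energy at most dd + 1 / (N + 1).\<close>
      have midT: "(\<lambda>x. (1 - 1 / 2) * z i x + (1 / 2) * z j x) \<in> T N"
        using z(1)[of i] z(1)[of j] Tmono ij unfolding T_def by (intro cvx.step) auto
      have aux: "(a + b) / 2 - c \<le> \<delta>" if "d N \<le> c" "a \<le> s" "b \<le> s" "s - d N < \<delta>" for a b c s :: real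
      proof -
        have "(a + b) / 2 \<le> s" using that(2,3) by simp
        then show ?thesis using that(1,4) by linarith
      qed
      from dle[OF midT] show "(E (z i) + E (z j)) / 2 - E (\<lambda>x. (1 - 1 / 2) * z i x + (1 / 2) * z j x) \<le> \<delta>"
        by (rule aux[OF _ zN[OF ij(1)] zN[OF ij(2)] N])
    qed
    then show ?thesis by blast
  qed
  obtain y where y: "y \<in> X" "(\<lambda>i. E (\<lambda>x. z i x - y x)) \<longlonglongrightarrow> 0"
    by (rule X_complete[of z, OF zX(1) cau])
  have zy: "L1_loc_conv U z y" by (rule E_tendsto_L1_loc(1)[OF zX(1) y])
  \<comment> \<open>Convex combinations of late terms are as close to v in L^1 as the terms
    themselves. Hence the energy limit y agrees with v almost everywhere.\<close>
  have zv: "L1_loc_conv U z v"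
    unfolding L1_loc_conv_def
  proof (intro conjI allI impI)
    show "z k \<in> Lp_loc U 1" for k by (rule X_loc[OF zX(1)])
    show vl: "v \<in> Lp_loc U 1" using conv by (simp add: L1_loc_conv_def)
    fix K assume K: "compact K \<and> K \<subseteq> U"
    have lim: "(\<lambda>k. LINT x|lebesgue_on K. norm (u k x - v x)) \<longlonglongrightarrow> 0"
      using conv K by (simp add: L1_loc_conv_def)
    have iv: "integrable (lebesgue_on K) v" "\<And>k. integrable (lebesgue_on K) (u k)"
      using vl X_loc[OF u] K by (auto simp: Lp_loc_1_iff)
    show "(\<lambda>k. LINT x|lebesgue_on K. norm (z k x - v x)) \<longlonglongrightarrow> 0"
    proof (rule LIMSEQ_I)
      fix r :: real assume r: "0 < r"
      then have "\<forall>\<^sub>F k in sequentially. (LINT x|lebesgue_on K. norm (u k x - v x)) < r / 2"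
        using lim by (intro order_tendstoD) auto
      then obtain N where N: "\<And>k. k \<ge> N \<Longrightarrow> (LINT x|lebesgue_on K. norm (u k x - v x)) < r / 2"
        by (auto simp: eventually_sequentially)
      have "norm ((LINT x|lebesgue_on K. norm (z k x - v x)) - 0) < r" if "k \<ge> N" for k
      proof -
        have "(LINT x|lebesgue_on K. \<bar>z k x - v x\<bar>) \<le> r / 2"
          using cvx_L1[OF z(1)[of k, unfolded T_def] iv(1), of "r / 2"] iv(2) N that
          by (force intro: less_imp_le)
        then show ?thesis using r by simp
      qed
      then show "\<exists>no. \<forall>n\<ge>no. norm ((LINT x|lebesgue_on K. norm (z n x - v x)) - 0) < r" by blast
    qed
  qed
  have ae: "AE x in M. y x = v x" by (rule L1_loc_conv_unique[OF U zy zv])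
  show v: "v \<in> X" using fin_cong_AE(1)[OF _ _ _ ae, of "\<lambda>_. 1" m] y by (simp add: X_eq_fin)
  have eq: "E (\<lambda>x. z i x - v x) = E (\<lambda>x. z i x - y x)" for i
    by (rule fin_cong_AE(2)) (use X_diff[OF zX(1) y(1)] ae in \<open>auto simp: X_eq_fin elim!: eventually_mono\<close>)
  assume e: "0 < e"
  then have "\<forall>\<^sub>F i in sequentially. E (\<lambda>x. z i x - y x) < e" using y(2) by (intro order_tendstoD)
  then obtain n where "\<And>i. i \<ge> n \<Longrightarrow> E (\<lambda>x. z i x - y x) < e" by (auto simp: eventually_sequentially)
  then have "E (\<lambda>x. z (max n N) x - v x) \<le> e" unfolding eq by (simp add: less_imp_le)
  moreover have "z (max n N) \<in> cvx (u ` {N..})" using z(1)[of "max n N"] Tmono[of N "max n N"] unfolding T_def by auto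
  ultimately show "\<exists>z\<in>cvx (u ` {N..}). E (\<lambda>x. z x - v x) \<le> e" by blast
qed

text \<open>Here S is \<open>X\<close> for the coefficients \<open>Vp\<close>,
  \<open>neg_part V\<close> and \<open>w U\<close>, which lie below \<open>m\<close>, but
  \<open>X0\<close> for a general Hardy-weight, whose inequality is extended from test functions by
  density.\<close>

definition dom :: "('a \<Rightarrow> real) set \<Rightarrow> ('a \<Rightarrow> real) \<Rightarrow> ('a \<Rightarrow> real) \<Rightarrow> real \<Rightarrow> bool" where
  "dom S \<alpha> \<beta> C \<longleftrightarrow> coeff \<alpha> \<and> coeff \<beta> \<and> (\<forall>u\<in>S. u \<in> fin \<alpha> \<beta> \<and> I \<alpha> \<beta> u \<le> C * E u)"

lemma domD:
  assumes "dom S \<alpha> \<beta> C"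
  shows "coeff \<alpha>" "coeff \<beta>" "u \<in> S \<Longrightarrow> u \<in> fin \<alpha> \<beta>" "u \<in> S \<Longrightarrow> I \<alpha> \<beta> u \<le> C * E u"
  using assms by (auto simp: dom_def)

lemma powr_near_1:
  assumes "0 < e"
  obtains l where "0 < l" "l < 1" "(1 - l) powr (1 - p) \<le> 1 + e"
proof -
  have "((\<lambda>l::real. (1 - l) powr (1 - p)) \<longlongrightarrow> (1 - 0) powr (1 - p)) (at_right 0)"
    by (intro tendsto_intros) auto
  then have "\<forall>\<^sub>F l in at_right 0. (1 - l) powr (1 - p) < 1 + e"
    using assms by (intro order_tendstoD) auto
  moreover have "\<forall>\<^sub>F l in at_right (0::real). 0 < l \<and> l < 1"
    using eventually_at_right[of 0 1] by (auto intro!: exI[of _ 1] simp: eventually_at_right_field)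
  ultimately have "\<forall>\<^sub>F l in at_right 0. 0 < l \<and> l < 1 \<and> (1 - l) powr (1 - p) < 1 + e"
    by eventually_elim simp
  then obtain l where "0 < l" "l < 1" "(1 - l) powr (1 - p) < 1 + e"
    using eventually_happens' trivial_limit_at_right_real by (metis (mono_tags, lifting))
  then show thesis by (intro that) auto
qed

text \<open>The constant depends on e alone. Cut-offs enter as coefficients, so it can be fixed
  before the cut-offs are constructed, and the cut-offs may be chosen in terms of it.\<close>

lemma fin_perturb_eps:
  assumes "0 < e"
  obtains C where "0 \<le> C" "\<And>\<alpha> \<beta> u v. u \<in> fin \<alpha> \<beta> \<Longrightarrow> v \<in> fin \<alpha> \<beta> \<Longrightarrow> coeff \<alpha> \<Longrightarrow> coeff \<beta> \<Longrightarrow>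
    I \<alpha> \<beta> u \<le> (1 + e) * I \<alpha> \<beta> v + C * I \<alpha> \<beta> (\<lambda>x. u x - v x)"
proof -
  obtain l where l: "0 < l" "l < 1" "(1 - l) powr (1 - p) \<le> 1 + e" using powr_near_1[OF assms] .
  show thesis
  proof (rule that[of "l powr (1 - p)"])
    fix \<alpha> \<beta> u v assume A: "u \<in> fin \<alpha> \<beta>" "v \<in> fin \<alpha> \<beta>" "coeff \<alpha>" "coeff \<beta>"
    have "(1 - l) powr (1 - p) * I \<alpha> \<beta> v \<le> (1 + e) * I \<alpha> \<beta> v"
      by (intro mult_right_mono l I_nonneg A)
    then show "I \<alpha> \<beta> u \<le> (1 + e) * I \<alpha> \<beta> v + l powr (1 - p) * I \<alpha> \<beta> (\<lambda>x. u x - v x)"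
      using fin_perturb[OF A l(1,2)] by linarith
  qed simp
qed

text \<open>The perturbation inequality is applied in both directions. First e is fixed so small
  that its multiple of the limit value is negligible; the constant belonging to it then multiplies a
  null sequence.\<close>

lemma I_continuous:
  assumes S: "\<And>u v. u \<in> S \<Longrightarrow> v \<in> S \<Longrightarrow> (\<lambda>x. u x - v x) \<in> S" and SX: "S \<subseteq> X"
    and d: "dom S \<alpha> \<beta> C" and u: "\<And>k. u k \<in> S" and v: "v \<in> S"
    and lim: "(\<lambda>k. E (\<lambda>x. u k x - v x)) \<longlonglongrightarrow> 0"
  shows "(\<lambda>k. I \<alpha> \<beta> (u k)) \<longlonglongrightarrow> I \<alpha> \<beta> v"
proof -
  note dd = domD[OF d]
  have I0: "(\<lambda>k. I \<alpha> \<beta> (\<lambda>x. u k x - v x)) \<longlonglongrightarrow> 0"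
  proof (rule tendsto_sandwich[OF always_eventually always_eventually tendsto_const])
    show "(\<lambda>k. C * E (\<lambda>x. u k x - v x)) \<longlonglongrightarrow> 0" by (intro tendsto_mult_right_zero lim)
    show "\<forall>k. 0 \<le> I \<alpha> \<beta> (\<lambda>x. u k x - v x)" using dd by (simp add: I_nonneg)
    show "\<forall>k. I \<alpha> \<beta> (\<lambda>x. u k x - v x) \<le> C * E (\<lambda>x. u k x - v x)" using dd S u v by blast
  qed
  show ?thesis
  proof (rule LIMSEQ_I)
    fix r :: real assume r: "0 < r"
    define e where "e = min 1 (r / (8 * (I \<alpha> \<beta> v + 1)))"
    have v0: "0 \<le> I \<alpha> \<beta> v" using dd by (simp add: I_nonneg)
    have e: "0 < e" "e \<le> 1" "e * I \<alpha> \<beta> v \<le> r / 8"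
    proof -
      show "0 < e" "e \<le> 1" using r v0 by (auto simp: e_def)
      have "e * I \<alpha> \<beta> v \<le> (r / (8 * (I \<alpha> \<beta> v + 1))) * I \<alpha> \<beta> v"
        using v0 by (intro mult_right_mono) (auto simp: e_def)
      also have "\<dots> \<le> r / 8" using v0 r by (simp add: field_simps)
      finally show "e * I \<alpha> \<beta> v \<le> r / 8" .
    qed
    obtain L where L: "0 \<le> L" "\<And>\<alpha> \<beta> u v. u \<in> fin \<alpha> \<beta> \<Longrightarrow> v \<in> fin \<alpha> \<beta> \<Longrightarrow> coeff \<alpha> \<Longrightarrow> coeff \<beta> \<Longrightarrow>
      I \<alpha> \<beta> u \<le> (1 + e) * I \<alpha> \<beta> v + L * I \<alpha> \<beta> (\<lambda>x. u x - v x)" using fin_perturb_eps[OF e(1)] by blast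
    have "(\<lambda>k. L * I \<alpha> \<beta> (\<lambda>x. u k x - v x)) \<longlonglongrightarrow> 0" by (intro tendsto_mult_right_zero I0)
    then have "\<forall>\<^sub>F k in sequentially. L * I \<alpha> \<beta> (\<lambda>x. u k x - v x) < r / 8"
      using r by (intro order_tendstoD) auto
    then obtain N where N: "\<And>k. k \<ge> N \<Longrightarrow> L * I \<alpha> \<beta> (\<lambda>x. u k x - v x) < r / 8"
      by (auto simp: eventually_sequentially)
    have "norm (I \<alpha> \<beta> (u k) - I \<alpha> \<beta> v) < r" if k: "k \<ge> N" for k
    proof -
      have 1: "I \<alpha> \<beta> (u k) \<le> I \<alpha> \<beta> v + e * I \<alpha> \<beta> v + L * I \<alpha> \<beta> (\<lambda>x. u k x - v x)"
        using L(2)[OF dd(3)[OF u[of k]] dd(3)[OF v] dd(1,2)] by (simp add: algebra_simps)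
      have "I \<alpha> \<beta> v \<le> I \<alpha> \<beta> (u k) + e * I \<alpha> \<beta> (u k) + L * I \<alpha> \<beta> (\<lambda>x. u k x - v x)"
        using L(2)[OF dd(3)[OF v] dd(3)[OF u[of k]] dd(1,2)]
          I_minus[OF dd(3)[OF v] dd(3)[OF u[of k]] dd(1,2)] by (simp add: algebra_simps)
      moreover have "e * I \<alpha> \<beta> (u k) \<le> e * (I \<alpha> \<beta> v + r / 4)"
        using 1 N[OF k] e r by (intro mult_left_mono) auto
      moreover have "e * (I \<alpha> \<beta> v + r / 4) \<le> r / 8 + r / 4"
        unfolding distrib_left using e(3) mult_right_mono[OF e(2), of "r / 4"] r by linarith
      ultimately have 2: "I \<alpha> \<beta> v < I \<alpha> \<beta> (u k) + r" using N[OF k] r by linarith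
      then show ?thesis using 1 2 e(3) N[OF k] r by simp
    qed
    then show "\<exists>no. \<forall>n\<ge>no. norm (I \<alpha> \<beta> (u n) - I \<alpha> \<beta> v) < r" by blast
  qed
qed

text \<open>Convex combinations of the sequence keep the bound c by convexity, and Mazur's lemma
  makes them converge to v in energy, where the functional is continuous.\<close>

lemma I_weak_lsc:
  assumes S: "\<And>u v. u \<in> S \<Longrightarrow> v \<in> S \<Longrightarrow> (\<lambda>x. u x - v x) \<in> S"
      "\<And>u v t. u \<in> S \<Longrightarrow> v \<in> S \<Longrightarrow> (\<lambda>x. (1 - t) * u x + t * v x) \<in> S" and SX: "S \<subseteq> X"
    and d: "dom S \<alpha> \<beta> C" and u: "\<And>k. u k \<in> S" and v: "v \<in> S"
    and B: "\<And>k. E (u k) \<le> B" and conv: "L1_loc_conv U u v" and le: "\<And>k. I \<alpha> \<beta> (u k) \<le> c"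
  shows "I \<alpha> \<beta> v \<le> c"
proof -
  note dd = domD[OF d]
  have uX: "u k \<in> X" for k using u SX by blast
  have "\<exists>z\<in>cvx (u ` {0..}). E (\<lambda>x. z x - v x) \<le> inverse (real (Suc n))" for n
    by (rule mazur(2)[OF uX B conv]) auto
  then obtain z where z: "\<And>n. z n \<in> cvx (u ` {0..})" "\<And>n. E (\<lambda>x. z n x - v x) \<le> inverse (real (Suc n))"
    by metis
  have zS: "z n \<in> S" for n
    using z(1)[of n] by (induction rule: cvx.induct) (use S u in auto)
  have zc: "I \<alpha> \<beta> (z n) \<le> c" for n
    using cvx_fin[OF z(1) _ dd(1,2), of c] dd(3)[OF u] le by auto
  have "(\<lambda>n. E (\<lambda>x. z n x - v x)) \<longlonglongrightarrow> 0"
    by (rule tendsto_sandwich[OF always_eventually always_eventually tendsto_const LIMSEQ_inverse_real_of_nat])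
      (use z E_nonneg in auto)
  from I_continuous[OF S(1) SX d zS v this] show ?thesis
    by (rule LIMSEQ_le_const2) (use zc in auto)
qed

end

section \<open>Energy estimates for mollifications\<close>

lemma powr_tangent:
  fixes t A p :: real
  assumes "1 \<le> p" "0 \<le> t" "0 < A"
  shows "A powr p + p * A powr (p - 1) * (t - A) \<le> t powr p"
proof -
  have "((\<lambda>x. x powr p) has_real_derivative p * A powr (p - 1)) (at A within {0..})"
    by (rule has_field_derivative_at_within) (use assms in \<open>auto intro!: derivative_eq_intros\<close>)
  then have "p * A powr (p - 1) * (t - A) \<le> t powr p - A powr p"
    using convex_on_imp_above_tangent[OF convex_on_powr_atLeast[OF assms(1)], of A t] assms
    by (auto simp: interior_real_atLeast)
  then show ?thesis by simp
qed

text \<open>Jensen's inequality for the probability density y \<mapsto> \<rho> (x - y), from the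
  tangent of the power at the mean A of the norm of G.\<close>

lemma mollifier_Jensen:
  fixes G :: "'a::euclidean_space \<Rightarrow> 'b::euclidean_space"
  assumes \<rho>: "mollifier e \<rho>" and p: "1 \<le> p" and G: "G \<in> borel_measurable lebesgue"
    and int: "integrable lebesgue (\<lambda>y. norm (G y) powr p)"
  shows "norm (LINT y|lebesgue. \<rho> (x - y) *\<^sub>R G y) powr p \<le> (LINT y|lebesgue. \<rho> (x - y) * norm (G y) powr p)"
    and "integrable lebesgue (\<lambda>y. \<rho> (x - y) * norm (G y) powr p)"
proof -
  note m = mollifier_reflect[OF \<rho>]
  define r where "r y = \<rho> (x - y)" for y
  have rC: "continuous_on UNIV \<rho>" using \<rho> Cc_continuous[of \<rho> UNIV] by (simp add: mollifier_def Cc_inf_def)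
  have rb: "r \<in> borel_measurable borel"
    unfolding r_def by (intro borel_measurable_continuous_onI continuous_intros continuous_on_compose2[OF rC]) auto
  then have rm [measurable]: "r \<in> borel_measurable lebesgue" by (intro measurable_completion) simp
  have ri: "integrable lebesgue r" "(LINT y|lebesgue. r y) = 1"
    using m(1,2)[of x] rb by (auto simp: integrable_completion integral_completion r_def[abs_def])
  have r0: "0 \<le> r y" for y using m(4) by (simp add: r_def)
  have "\<rho> \<in> Cc UNIV" using \<rho> by (simp add: mollifier_def Cc_inf_def)
  then obtain B where B: "\<And>z. \<bar>\<rho> z\<bar> \<le> B" using Cc_bounded by metis
  have ip: "integrable lebesgue (\<lambda>y. r y * norm (G y) powr p)"
    using integrable_mult_bounded[OF int rm, of B] B by (simp add: r_def)
  then show "integrable lebesgue (\<lambda>y. \<rho> (x - y) * norm (G y) powr p)" by (simp add: r_def)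
  have i1: "integrable lebesgue (\<lambda>y. r y * norm (G y))"
  proof (rule Bochner_Integration.integrable_bound)
    show "integrable lebesgue (\<lambda>y. r y + r y * norm (G y) powr p)" using ri ip by simp
    show "(\<lambda>y. r y * norm (G y)) \<in> borel_measurable lebesgue" using G by measurable
    show "AE y in lebesgue. norm (r y * norm (G y)) \<le> norm (r y + r y * norm (G y) powr p)"
    proof (rule AE_I2)
      fix y
      have "norm (G y) \<le> 1 + norm (G y) powr p" using le_eps_powr[of p "norm (G y)" 1] p by simp
      from mult_left_mono[OF this r0[of y]] show "norm (r y * norm (G y)) \<le> norm (r y + r y * norm (G y) powr p)"
        using r0[of y] by (simp add: algebra_simps abs_mult)
    qed
  qed
  define A where "A = (LINT y|lebesgue. r y * norm (G y))"
  have "norm (LINT y|lebesgue. r y *\<^sub>R G y) \<le> (LINT y|lebesgue. norm (r y *\<^sub>R G y))"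
    by (rule integral_norm_bound)
  also have "\<dots> = A" using r0 by (simp add: A_def)
  finally have le: "norm (LINT y|lebesgue. r y *\<^sub>R G y) \<le> A" .
  have A0: "0 \<le> A" using r0 by (simp add: A_def)
  have "A powr p \<le> (LINT y|lebesgue. r y * norm (G y) powr p)"
  proof (cases "A = 0")
    case False
    then have Apos: "0 < A" using A0 by simp
    have "(LINT y|lebesgue. (A powr p - p * A powr (p - 1) * A) * r y + p * A powr (p - 1) * (r y * norm (G y)))
        \<le> (LINT y|lebesgue. r y * norm (G y) powr p)"
    proof (rule integral_mono)
      fix y
      have "A powr p + p * A powr (p - 1) * (norm (G y) - A) \<le> norm (G y) powr p"
        by (rule powr_tangent) (use p Apos in auto)
      from mult_left_mono[OF this r0[of y]]
      show "(A powr p - p * A powr (p - 1) * A) * r y + p * A powr (p - 1) * (r y * norm (G y)) \<le> r y * norm (G y) powr p"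
        by (simp add: algebra_simps)
    qed (use ri i1 ip in auto)
    also have "(LINT y|lebesgue. (A powr p - p * A powr (p - 1) * A) * r y + p * A powr (p - 1) * (r y * norm (G y)))
        = (A powr p - p * A powr (p - 1) * A) + p * A powr (p - 1) * A"
      using ri i1 by (simp add: A_def)
    finally show ?thesis by simp
  qed (use p r0 in simp)
  moreover have "norm (LINT y|lebesgue. r y *\<^sub>R G y) powr p \<le> A powr p"
    using le p by (intro powr_mono2) auto
  ultimately show "norm (LINT y|lebesgue. \<rho> (x - y) *\<^sub>R G y) powr p \<le> (LINT y|lebesgue. \<rho> (x - y) * norm (G y) powr p)"
    by (simp add: r_def)
qed

text \<open>After exchanging the order of integration every point y is counted with the total mass 1
  of the mollifier.\<close>

lemma mollifier_integral_le:
  fixes g :: "'a::euclidean_space \<Rightarrow> real"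
  assumes \<rho>: "mollifier e \<rho>" and g: "integrable lebesgue g" "\<And>y. 0 \<le> g y"
    and h: "continuous_on UNIV h" "\<And>x. 0 \<le> h x"
    and le: "\<And>x. x \<in> K \<Longrightarrow> h x \<le> (LINT y|lebesgue. \<rho> (x - y) * g y)"
    and int: "\<And>x. x \<in> K \<Longrightarrow> integrable lebesgue (\<lambda>y. \<rho> (x - y) * g y)" and K: "compact K"
  shows "(LINT x|lebesgue_on K. h x) \<le> (LINT y|lebesgue. g y)"
proof -
  note m = mollifier_reflect[OF \<rho>]
  have [measurable]: "\<rho> \<in> borel_measurable borel" by (rule m)
  have [measurable]: "h \<in> borel_measurable borel" using h by (simp add: borel_measurable_continuous_onI)
  \<comment> \<open>Tonelli's theorem is used for Borel functions on \<open>lborel\<close>, so g is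
    replaced by a Borel function equal to it almost everywhere.\<close>
  obtain g' where g' [measurable]: "g' \<in> borel_measurable lborel" and ae: "AE y in lborel. g y = g' y"
    using completion_ex_borel_measurable_real[OF borel_measurable_integrable[OF g(1)]] by blast
  have one: "(\<integral>\<^sup>+x. ennreal (\<rho> (x - y)) \<partial>lborel) = 1" for y
  proof -
    have "integrable lborel \<rho>" "(LINT x|lborel. \<rho> x) = 1"
      using \<rho> Cc_integrable[of \<rho>] by (auto simp: mollifier_def Cc_inf_def)
    then have "(\<integral>\<^sup>+x. ennreal (\<rho> x) \<partial>lborel) = 1"
      using m(4) by (simp add: nn_integral_eq_integral)
    then show ?thesis using nn_integral_translate[of "\<lambda>z. ennreal (\<rho> z)" "- y"] by simp
  qed
  have hK: "ennreal (h x) \<le> (\<integral>\<^sup>+y. ennreal (\<rho> (x - y)) * ennreal (g' y) \<partial>lborel)" if x: "x \<in> K" for x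
  proof -
    have "ennreal (h x) \<le> ennreal (LINT y|lebesgue. \<rho> (x - y) * g y)" using le[OF x] by (rule ennreal_leI)
    also have "\<dots> = (\<integral>\<^sup>+y. ennreal (\<rho> (x - y) * g y) \<partial>lebesgue)"
      using int[OF x] m(4) g(2) by (intro nn_integral_eq_integral[symmetric]) auto
    also have "\<dots> = (\<integral>\<^sup>+y. ennreal (\<rho> (x - y) * g y) \<partial>lborel)" by (rule nn_integral_completion)
    also have "\<dots> = (\<integral>\<^sup>+y. ennreal (\<rho> (x - y)) * ennreal (g' y) \<partial>lborel)"
      by (rule nn_integral_cong_AE) (use ae m(4) in \<open>auto simp: ennreal_mult' elim!: eventually_mono\<close>)
    finally show ?thesis .
  qed
  have intK: "integrable (lebesgue_on K) h" using continuous_Lp_loc[OF h(1), of K] K by (auto simp: Lp_loc_1_iff)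
  have "ennreal (LINT x|lebesgue_on K. h x) = (\<integral>\<^sup>+x. ennreal (h x) \<partial>lebesgue_on K)"
    using intK h by (simp add: nn_integral_eq_integral)
  also have "\<dots> = (\<integral>\<^sup>+x. ennreal (h x) * indicator K x \<partial>lborel)"
    using K by (subst nn_integral_restrict_space) (auto simp: nn_integral_completion)
  also have "\<dots> \<le> (\<integral>\<^sup>+x. (\<integral>\<^sup>+y. ennreal (\<rho> (x - y)) * ennreal (g' y) \<partial>lborel) \<partial>lborel)"
    by (rule nn_integral_mono) (use hK in \<open>auto simp: indicator_def\<close>)
  also have "\<dots> = (\<integral>\<^sup>+y. (\<integral>\<^sup>+x. ennreal (\<rho> (x - y)) * ennreal (g' y) \<partial>lborel) \<partial>lborel)"
    by (rule lborel_pair.Fubini'[symmetric]) measurable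
  also have "\<dots> = (\<integral>\<^sup>+y. ennreal (g' y) \<partial>lborel)"
    by (simp add: nn_integral_multc one)
  also have "\<dots> = (\<integral>\<^sup>+y. ennreal (g y) \<partial>lborel)"
    by (rule nn_integral_cong_AE) (use ae in \<open>auto elim!: eventually_mono\<close>)
  also have "\<dots> = (\<integral>\<^sup>+y. ennreal (g y) \<partial>lebesgue)" by (rule nn_integral_completion[symmetric])
  also have "\<dots> = ennreal (LINT y|lebesgue. g y)" using g by (simp add: nn_integral_eq_integral)
  finally show ?thesis using g by (simp add: integral_nonneg_AE)
qed

lemma grad_reflect:
  assumes "Ck 1 \<rho>" shows "grad (\<lambda>y. \<rho> (x - y)) y = - grad \<rho> (x - y)"
proof (rule grad_eqI)
  have "(\<rho> has_derivative (\<lambda>h. h \<bullet> grad \<rho> (x - y))) (at (x - y))"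
    using Ck_1D(1)[OF assms] by (simp add: gderiv_def)
  then have "((\<lambda>y. \<rho> (x - y)) has_derivative (\<lambda>h. (- h) \<bullet> grad \<rho> (x - y))) (at y)"
    by (rule has_derivative_compose[rotated]) (auto intro!: derivative_eq_intros)
  then show "GDERIV (\<lambda>y. \<rho> (x - y)) y :> - grad \<rho> (x - y)" by (simp add: gderiv_def)
qed

text \<open>The kernel y \<mapsto> \<rho> (x - y) is itself a test function of U, since its support
  lies in the ball around x; the derivative is moved from it to f.\<close>

lemma grad_conv_weak:
  assumes U: "open U" and f: "f \<in> Cc U" and wg: "weak_gradient U f G" and \<rho>: "mollifier e \<rho>"
    and x: "cball x e \<subseteq> U"
  shows "grad (conv f \<rho>) x = (LINT y|lebesgue. \<rho> (x - y) *\<^sub>R G y)"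
proof -
  have \<rho>C: "\<rho> \<in> Cc_inf UNIV" "\<rho> \<in> C1c UNIV" using \<rho> Cc_inf_C1c by (auto simp: mollifier_def)
  define \<tau> where "\<tau> y = \<rho> (x - y)" for y
  have Ck: "Ck k \<tau>" for k
    unfolding \<tau>_def using \<rho>C(1) by (intro Ck_translate) (auto simp: Cc_inf_def)
  have out: "\<tau> y = 0" if "y \<notin> cball x e" for y
    using \<rho> that by (auto simp: mollifier_def \<tau>_def dist_norm)
  have \<tau>: "\<tau> \<in> Cc_inf U"
    using CcI[OF Ck_continuous[OF Ck[of 0]] compact_cball x out] Ck by (simp add: Cc_inf_def)
  have g\<tau>: "grad \<tau> y = - grad \<rho> (x - y)" for y
    unfolding \<tau>_def by (rule grad_reflect) (use \<rho>C in \<open>simp add: C1c_def\<close>)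
  have "(LINT y|lebesgue. \<tau> y *\<^sub>R G y) = - (LINT y|lebesgue. f y *\<^sub>R grad \<tau> y)"
    using wg \<tau> by (simp add: weak_gradient_iff[OF U])
  also have "\<dots> = (LINT y|lebesgue. f y *\<^sub>R grad \<rho> (x - y))" by (simp add: g\<tau>)
  also have "\<dots> = (LINT y|lborel. f y *\<^sub>R grad \<rho> (x - y))"
  proof (rule integral_completion)
    have "continuous_on UNIV (\<lambda>y. f y *\<^sub>R grad \<rho> (x - y))"
      by (intro continuous_intros Cc_continuous[OF f] continuous_on_compose2[OF C1cD(4)[OF \<rho>C(2)]]) auto
    then show "(\<lambda>y. f y *\<^sub>R grad \<rho> (x - y)) \<in> lborel \<rightarrow>\<^sub>M borel"
      using borel_measurable_continuous_onI by simp
  qed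
  also have "\<dots> = grad (conv f \<rho>) x"
    by (rule grad_eqI[OF conv_GDERIV[OF Cc_integrable[OF f] \<rho>C(2)], symmetric])
  finally show ?thesis by (simp add: \<tau>_def)
qed

lemma lebesgue_on_indicator_subset:
  fixes f :: "'a::euclidean_space \<Rightarrow> real"
  assumes "U \<in> sets lebesgue" "K \<in> sets lebesgue" "K \<subseteq> U"
  shows "integrable (lebesgue_on U) (\<lambda>x. indicator K x * f x) \<longleftrightarrow> integrable (lebesgue_on K) f"
    and "(LINT x|lebesgue_on U. indicator K x * f x) = (LINT x|lebesgue_on K. f x)"
proof -
  have "(\<lambda>x. indicator U x *\<^sub>R (indicator K x * f x)) = (\<lambda>x. indicator K x *\<^sub>R f x)"
    by (rule ext) (use assms(3) in \<open>auto simp: indicator_def\<close>)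
  then show "integrable (lebesgue_on U) (\<lambda>x. indicator K x * f x) \<longleftrightarrow> integrable (lebesgue_on K) f"
    "(LINT x|lebesgue_on U. indicator K x * f x) = (LINT x|lebesgue_on K. f x)"
    using assms by (simp_all add: integrable_restrict_space integral_restrict_space)
qed

lemma compact_continuous_on_integrable:
  fixes f :: "'a::euclidean_space \<Rightarrow> real"
  assumes "compact K" "continuous_on K f"
  shows "integrable (lebesgue_on K) f"
proof -
  note i = borel_integrable_compact[OF assms]
  have "integrable lebesgue (\<lambda>x. indicator K x *\<^sub>R f x)"
    using integrable_completion[OF borel_measurable_integrable[OF i]] i by blast
  then show ?thesis using assms(1) by (simp add: integrable_restrict_space)
qed

context energy_space
begin

lemma m_integrable:
  assumes "compact K" "K \<subseteq> U" shows "integrable (lebesgue_on K) m"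
  unfolding m_def using assms V_loc compact_continuous_on_integrable[OF assms(1) continuous_on_subset[OF w_cont assms(2)]]
  by (intro Bochner_Integration.integrable_add integrable_abs) (auto simp: Lp_loc_1_iff)

text \<open>The potential is only locally integrable; the bound b on u is what makes the
  zeroth-order part integrable, as it is dominated by b^p times \<open>m\<close> on K.\<close>

lemma X_of_compact:
  assumes K: "compact K" "K \<subseteq> U" and wg: "weak_gradient U u G"
    and out: "\<And>x. x \<notin> K \<Longrightarrow> u x = 0" "AE x in M. x \<notin> K \<longrightarrow> G x = 0"
    and b: "\<And>x. \<bar>u x\<bar> \<le> b" and G: "integrable (lebesgue_on K) (\<lambda>x. norm (G x) powr p)"
    and \<nu>: "0 < \<nu>" "AE x in lebesgue_on K. \<forall>\<xi>. H x \<xi> \<le> \<nu> * norm \<xi>"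
  shows "u \<in> X" "E u \<le> \<nu> powr p * (LINT x|lebesgue_on K. norm (G x) powr p) + b powr p * (LINT x|lebesgue_on K. m x)"
proof -
  have us: "u \<in> sob" using wg Lp_loc_1_measurable[OF U] by (auto simp: sob_def weak_gradient_def has_weak_gradient_def)
  have Kl: "K \<in> sets lebesgue" "U \<in> sets lebesgue" using K U by auto
  define h where "h x = \<nu> powr p * norm (G x) powr p + b powr p * m x" for x
  have hK: "integrable (lebesgue_on K) h" unfolding h_def using G m_integrable[OF K] by simp
  have hM: "integrable M (\<lambda>x. indicator K x * h x)"
    using hK lebesgue_on_indicator_subset(1)[OF Kl(2,1) K(2)] by blast
  have \<nu>M: "AE x in M. x \<in> K \<longrightarrow> (\<forall>\<xi>. H x \<xi> \<le> \<nu> * norm \<xi>)"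
    using \<nu>(2) Kl by (auto simp: AE_restrict_space_iff elim!: eventually_mono)
  have le: "AE x in M. 0 \<le> D (\<lambda>_. 1) m u x \<and> D (\<lambda>_. 1) m u x \<le> indicator K x * h x"
    using wgrad_AE[OF U wg] out(2) \<nu>M H_norm m_nonneg
  proof eventually_elim
    case (elim x)
    show ?case
    proof (cases "x \<in> K")
      case True
      have "H x (G x) powr p \<le> (\<nu> * norm (G x)) powr p"
        using True elim p is_norm_simps(1)[of "H x"] by (intro powr_mono2) auto
      also have "\<dots> = \<nu> powr p * norm (G x) powr p" using \<nu> by (simp add: powr_mult)
      finally have 1: "H x (G x) powr p \<le> \<nu> powr p * norm (G x) powr p" .
      have "\<bar>u x\<bar> powr p \<le> b powr p" using b[of x] p by (intro powr_mono2) auto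
      from mult_left_mono[OF this elim(5)] 1 show ?thesis
        using True elim by (simp add: D_def h_def mult.commute)
    next
      case False
      then show ?thesis using elim out(1)[OF False] is_norm_simps(4)[of "H x" 0] p by (simp add: D_def)
    qed
  qed
  have iD: "integrable M (D (\<lambda>_. 1) m u)"
  proof (rule Bochner_Integration.integrable_bound[OF hM D_meas[OF us]])
    show "AE x in M. norm (D (\<lambda>_. 1) m u x) \<le> norm (indicator K x * h x)"
      using le by eventually_elim auto
  qed auto
  then show "u \<in> X" using us by (simp add: Wt_iff)
  have "E u \<le> (LINT x|M. indicator K x * h x)"
    unfolding I_def by (rule integral_mono_AE[OF iD hM]) (use le in \<open>auto elim!: eventually_mono\<close>)
  also have "\<dots> = (LINT x|lebesgue_on K. h x)" by (rule lebesgue_on_indicator_subset(2)[OF Kl(2,1) K(2)])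
  also have "\<dots> = \<nu> powr p * (LINT x|lebesgue_on K. norm (G x) powr p) + b powr p * (LINT x|lebesgue_on K. m x)"
    unfolding h_def using G m_integrable[OF K] by simp
  finally show "E u \<le> \<nu> powr p * (LINT x|lebesgue_on K. norm (G x) powr p) + b powr p * (LINT x|lebesgue_on K. m x)" .
qed

section \<open>Density of smooth test functions\<close>

lemma norm_grad_powr_continuous:
  "Ck 1 f \<Longrightarrow> continuous_on UNIV (\<lambda>x. norm (grad f x) powr p)"
  using Ck_1D(2)[of f] p by (intro continuous_intros continuous_on_powr') auto

lemma H_upper:
  assumes "compact K" "K \<subseteq> U"
  obtains \<nu> where "0 < \<nu>" "AE x in lebesgue_on K. \<forall>\<xi>. H x \<xi> \<le> \<nu> * norm \<xi>"
proof -
  obtain \<kappa> \<nu> where \<nu>: "0 < \<nu>" "AE x in lebesgue_on K. \<forall>\<xi>. \<kappa> * norm \<xi> \<le> H x \<xi> \<and> H x \<xi> \<le> \<nu> * norm \<xi>"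
    using H_bounds[OF assms] by blast
  then show thesis by (intro that[of \<nu>]) (auto elim: eventually_mono)
qed

lemma C1c_X: assumes f: "f \<in> C1c U" shows "f \<in> X"
proof -
  obtain K where K: "compact K" "K \<subseteq> U" "\<And>x. x \<notin> K \<Longrightarrow> f x = 0" "\<And>x. x \<notin> K \<Longrightarrow> grad f x = 0"
    using C1c_grad_outside[OF f] by metis
  obtain b where b: "\<And>x. \<bar>f x\<bar> \<le> b" using Cc_bounded[OF C1cD(1)[OF f]] by metis
  obtain \<nu> where \<nu>: "0 < \<nu>" "AE x in lebesgue_on K. \<forall>\<xi>. H x \<xi> \<le> \<nu> * norm \<xi>" using H_upper[OF K(1,2)] .
  show ?thesis
    by (rule X_of_compact(1)[OF K(1,2) Ck_1_weak_gradient[OF U C1cD(2)[OF f]] K(3) _ b _ \<nu>])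
      (use K(4) continuous_Lp_loc[OF norm_grad_powr_continuous[OF C1cD(2)[OF f]], of K] K in \<open>auto simp: Lp_loc_1_iff\<close>)
qed

lemma C1c_W1p: assumes f: "f \<in> C1c U" shows "f \<in> W1p U p \<inter> Cc U"
proof -
  obtain K where K: "compact K" "K \<subseteq> U" "\<And>x. x \<notin> K \<Longrightarrow> f x = 0" "\<And>x. x \<notin> K \<Longrightarrow> grad f x = 0"
    using C1c_grad_outside[OF f] by metis
  have wg: "weak_gradient U f (grad f)" by (rule Ck_1_weak_gradient[OF U C1cD(2)[OF f]])
  have *: "F \<in> Lp U p" if F: "continuous_on UNIV F" "\<And>x. x \<notin> K \<Longrightarrow> F x = 0"
    for F :: "'a \<Rightarrow> 'b::euclidean_space"
  proof -
    have c: "continuous_on UNIV (\<lambda>x. norm (F x) powr p)"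
      using F(1) p by (intro continuous_intros continuous_on_powr') auto
    have "integrable lborel (\<lambda>x. norm (F x) powr p)"
      by (rule compact_support_integrable[OF c K(1)]) (use F in auto)
    then have "integrable lebesgue (\<lambda>x. norm (F x) powr p)"
      using borel_measurable_integrable integrable_completion by blast
    then have "integrable M (\<lambda>x. norm (F x) powr p)"
      using lebesgue_on_integral_outside(2)[of U "\<lambda>x. norm (F x) powr p"] F(2) K(2) U by auto
    moreover have "F \<in> borel_measurable M"
      using borel_measurable_continuous_onI[OF F(1)] by (intro measurable_restrict_space1 measurable_completion) simp
    ultimately show ?thesis by (simp add: Lp_def)
  qed
  have 1: "f \<in> Lp U p" by (rule *) (use K C1cD[OF f] in auto)
  have 2: "grad f \<in> Lp U p" by (rule *) (use K C1cD[OF f] in auto)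
  have wm: "wgrad U f \<in> borel_measurable M"
    by (rule wgrad_meas) (use wg in \<open>auto simp: has_weak_gradient_def\<close>)
  have [measurable]: "wgrad U f \<in> borel_measurable M" "grad f \<in> borel_measurable M" using wm 2 by (auto simp: Lp_def)
  have "integrable M (\<lambda>x. norm (wgrad U f x) powr p)"
    using 2 wgrad_AE[OF U wg]
    by (subst integrable_cong_AE[where g = "\<lambda>x. norm (grad f x) powr p"]) (auto simp: Lp_def elim!: eventually_mono)
  then have "wgrad U f \<in> Lp U p" using wm by (simp add: Lp_def)
  then show ?thesis using 1 wg C1cD(1)[OF f] by (auto simp: W1p_def has_weak_gradient_def)
qed

lemma cvx_Cc_inf: "z \<in> cvx A \<Longrightarrow> A \<subseteq> Cc_inf W \<Longrightarrow> z \<in> Cc_inf W"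
  by (induction rule: cvx.induct) (auto intro: Cc_inf_add Cc_inf_cmult)

text \<open>The mollifications are only shown to be bounded in energy and to converge uniformly.
  Mazur's lemma turns this into convex combinations that converge in energy, and these are again
  smooth test functions.\<close>

lemma W1p_Cc_approx:
  assumes f: "f \<in> W1p U p" "f \<in> Cc U"
  shows "f \<in> X" "0 < e \<Longrightarrow> \<exists>h\<in>Cc_inf U. E (\<lambda>x. h x - f x) \<le> e"
proof -
  define G where "G = wgrad U f"
  have wg: "weak_gradient U f G" and GLp: "G \<in> Lp U p"
    using f by (auto simp: W1p_def G_def intro: weak_gradient_wgrad)
  obtain K r \<rho> where K: "compact K" "0 < r" "(\<Union>x\<in>K. cball x r) \<subseteq> U"
    and \<rho>: "\<And>n. mollifier (r / (real n + 1)) (\<rho> n)" and C: "\<And>n. conv f (\<rho> n) \<in> Cc_inf U"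
    and out: "\<And>x. x \<notin> K \<Longrightarrow> f x = 0" "\<And>n x. x \<notin> K \<Longrightarrow> conv f (\<rho> n) x = 0"
    and lim: "uniform_limit UNIV (\<lambda>n. conv f (\<rho> n)) f sequentially"
  proof (rule mollify_Cc[OF f(2) U], goal_cases)
    case prems: (1 K r \<rho>)
    show ?case by (rule prems(1)[OF prems(2-)])
  qed
  have KU: "K \<subseteq> U" using K(2,3) by force
  have C1: "conv f (\<rho> n) \<in> C1c U" for n using C Cc_inf_C1c by auto
  obtain b where b: "\<And>x. \<bar>f x\<bar> \<le> b" using Cc_bounded[OF f(2)] by metis
  have cb: "\<bar>conv f (\<rho> n) x\<bar> \<le> b" for n x
    using conv_diff_le[OF f(2) \<rho>, of x n 0 b] b by simp
  obtain \<nu> where \<nu>: "0 < \<nu>" "AE x in lebesgue_on K. \<forall>\<xi>. H x \<xi> \<le> \<nu> * norm \<xi>" using H_upper[OF K(1) KU] .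
  \<comment> \<open>Extended by 0 outside U, so that the mollified gradient is an integral over the
    whole space; for x in K the kernel vanishes outside U.\<close>
  define G' where "G' x = (if x \<in> U then G x else 0)" for x
  have G'm: "G' \<in> borel_measurable lebesgue"
    unfolding G'_def using GLp U by (simp add: Lp_def borel_measurable_if)
  have "(\<lambda>x. indicator U x *\<^sub>R norm (G x) powr p) = (\<lambda>x. norm (G' x) powr p)"
    using p by (auto simp: G'_def indicator_def)
  then have iG': "integrable lebesgue (\<lambda>x. norm (G' x) powr p)"
    using GLp U by (auto simp: Lp_def integrable_restrict_space)
  define L where "L = (LINT x|lebesgue. norm (G' x) powr p)"
  have gradle: "(LINT x|lebesgue_on K. norm (grad (conv f (\<rho> n)) x) powr p) \<le> L" for n
    unfolding L_def
  proof (rule mollifier_integral_le[OF \<rho>[of n] iG' _ norm_grad_powr_continuous[OF C1cD(2)[OF C1]] _ _ _ K(1)])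
    fix x assume x: "x \<in> K"
    have "r / (real n + 1) \<le> r" using K(2) by (simp add: divide_simps)
    then have "cball x (r / (real n + 1)) \<subseteq> cball x r" by (intro subset_cball)
    then have sub: "cball x (r / (real n + 1)) \<subseteq> U" using x K(3) by blast
    have "grad (conv f (\<rho> n)) x = (LINT y|lebesgue. \<rho> n (x - y) *\<^sub>R G y)"
      by (rule grad_conv_weak[OF U f(2) wg \<rho> sub])
    also have "\<dots> = (LINT y|lebesgue. \<rho> n (x - y) *\<^sub>R G' y)"
    proof (rule Bochner_Integration.integral_cong[OF refl])
      fix y
      have "\<rho> n (x - y) = 0" if "y \<notin> U"
      proof -
        have "y \<notin> cball x (r / (real n + 1))" using sub that by auto
        then show ?thesis using \<rho>[of n] by (auto simp: mollifier_def dist_norm)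
      qed
      then show "\<rho> n (x - y) *\<^sub>R G y = \<rho> n (x - y) *\<^sub>R G' y" by (auto simp: G'_def)
    qed
    finally show "norm (grad (conv f (\<rho> n)) x) powr p \<le> (LINT y|lebesgue. \<rho> n (x - y) * norm (G' y) powr p)"
      using mollifier_Jensen(1)[OF \<rho> _ G'm iG', of n x] p by simp
    show "integrable lebesgue (\<lambda>y. \<rho> n (x - y) * norm (G' y) powr p)"
      using mollifier_Jensen(2)[OF \<rho> _ G'm iG', of n x] p by simp
  qed auto
  have wgn: "weak_gradient U (conv f (\<rho> n)) (grad (conv f (\<rho> n)))" for n
    by (rule Ck_1_weak_gradient[OF U C1cD(2)[OF C1]])
  have grad0: "grad (conv f (\<rho> n)) x = 0" if "x \<notin> K" for n x
    by (rule grad_const_outside[OF compact_imp_closed[OF K(1)] out(2) that])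
  have iK: "integrable (lebesgue_on K) (\<lambda>x. norm (grad (conv f (\<rho> n)) x) powr p)" for n
    using continuous_Lp_loc[OF norm_grad_powr_continuous[OF C1cD(2)[OF C1]], of n K] K(1) by (auto simp: Lp_loc_1_iff)
  have EB: "E (conv f (\<rho> n)) \<le> \<nu> powr p * L + b powr p * (LINT x|lebesgue_on K. m x)" for n
  proof -
    have "E (conv f (\<rho> n)) \<le> \<nu> powr p * (LINT x|lebesgue_on K. norm (grad (conv f (\<rho> n)) x) powr p)
        + b powr p * (LINT x|lebesgue_on K. m x)"
      by (rule X_of_compact(2)[OF K(1) KU wgn out(2) _ cb iK \<nu>]) (use grad0 in auto)
    also have "\<dots> \<le> \<nu> powr p * L + b powr p * (LINT x|lebesgue_on K. m x)"
      using gradle by (intro add_right_mono mult_left_mono) auto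
    finally show ?thesis .
  qed
  have conv: "L1_loc_conv U (\<lambda>n. conv f (\<rho> n)) f"
    unfolding L1_loc_conv_def
  proof (intro conjI allI impI)
    show "conv f (\<rho> k) \<in> Lp_loc U 1" for k by (rule continuous_Lp_loc[OF C1cD(5)[OF C1]])
    show "f \<in> Lp_loc U 1" by (rule continuous_Lp_loc[OF Cc_continuous[OF f(2)]])
    fix K' assume K': "compact K' \<and> K' \<subseteq> U"
    have i1: "integrable (lebesgue_on K') (\<lambda>_. 1::real)"
      using compact_continuous_on_integrable[of K' "\<lambda>_. 1"] K' by simp
    define Q where "Q = (LINT x|lebesgue_on K'. (1::real))"
    have Q: "0 \<le> Q" by (simp add: Q_def)
    have ii: "integrable (lebesgue_on K') (\<lambda>x. norm (conv f (\<rho> n) x - f x))" for n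
      using C1cD(5)[OF C1[of n]] Cc_continuous[OF f(2)] K'
      by (intro compact_continuous_on_integrable continuous_intros) (auto intro: continuous_on_subset)
    show "(\<lambda>n. LINT x|lebesgue_on K'. norm (conv f (\<rho> n) x - f x)) \<longlonglongrightarrow> 0"
    proof (rule LIMSEQ_I)
      fix s :: real assume s: "0 < s"
      have s': "0 < s / (Q + 1)" using s Q by simp
      obtain N where N: "\<And>n x. n \<ge> N \<Longrightarrow> dist (conv f (\<rho> n) x) (f x) < s / (Q + 1)"
        using uniform_limitD[OF lim s'] by (auto simp: eventually_sequentially)
      have "norm ((LINT x|lebesgue_on K'. norm (conv f (\<rho> n) x - f x)) - 0) < s" if "n \<ge> N" for n
      proof -
        have "(LINT x|lebesgue_on K'. norm (conv f (\<rho> n) x - f x)) \<le> (LINT x|lebesgue_on K'. s / (Q + 1) * 1)"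
          using N[OF that] i1 by (intro integral_mono ii integrable_mult_right) (auto simp: dist_norm less_imp_le)
        also have "\<dots> = s / (Q + 1) * Q" unfolding Q_def by (rule integral_mult_right_zero)
        also have "\<dots> < s" using s Q by (simp add: field_simps)
        finally show ?thesis by simp
      qed
      then show "\<exists>no. \<forall>n\<ge>no. norm ((LINT x|lebesgue_on K'. norm (conv f (\<rho> n) x - f x)) - 0) < s" by blast
    qed
  qed
  note mz = mazur[OF C1c_X[OF C1] EB conv]
  show "f \<in> X" by (rule mz(1))
  assume "0 < e"
  from mz(2)[OF this, of 0] obtain z where z: "z \<in> cvx ((\<lambda>n. conv f (\<rho> n)) ` {0..})" "E (\<lambda>x. z x - f x) \<le> e" by blast
  have "z \<in> Cc_inf U" by (rule cvx_Cc_inf[OF z(1)]) (use C in auto)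
  with z(2) show "\<exists>h\<in>Cc_inf U. E (\<lambda>x. h x - f x) \<le> e" by blast
qed

end

lemma L1_loc_conv_subseq:
  "L1_loc_conv U f F \<Longrightarrow> strict_mono s \<Longrightarrow> L1_loc_conv U (\<lambda>k. f (s k)) F"
  unfolding L1_loc_conv_def by (auto intro: LIMSEQ_subseq_LIMSEQ[unfolded o_def])

lemma L1_loc_conv_AE_subseq:
  fixes f :: "nat \<Rightarrow> 'a::euclidean_space \<Rightarrow> 'b::euclidean_space"
  assumes U: "open U" and f: "L1_loc_conv U f F"
  obtains s where "strict_mono s" "AE x in lebesgue_on U. (\<lambda>k. f (s k) x) \<longlonglongrightarrow> F x"
proof -
  have fl: "f k \<in> Lp_loc U 1" "F \<in> Lp_loc U 1" for k using f by (auto simp: L1_loc_conv_def)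
  have cau: "\<exists>N. \<forall>i\<ge>N. \<forall>j\<ge>N. (LINT x|lebesgue_on K. norm (f i x - f j x)) < e"
    if K: "compact K" "K \<subseteq> U" and e: "0 < e" for K e
  proof -
    have i: "integrable (lebesgue_on K) (f k)" "integrable (lebesgue_on K) F" for k
      using fl K by (auto simp: Lp_loc_1_iff)
    have "(\<lambda>k. LINT x|lebesgue_on K. norm (f k x - F x)) \<longlonglongrightarrow> 0" using f K by (simp add: L1_loc_conv_def)
    then have "\<forall>\<^sub>F k in sequentially. (LINT x|lebesgue_on K. norm (f k x - F x)) < e / 2"
      using e by (intro order_tendstoD) auto
    then obtain N where N: "\<And>k. k \<ge> N \<Longrightarrow> (LINT x|lebesgue_on K. norm (f k x - F x)) < e / 2"
      by (auto simp: eventually_sequentially)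
    have "(LINT x|lebesgue_on K. norm (f a x - f b x)) < e" if "a \<ge> N" "b \<ge> N" for a b
    proof -
      have "(LINT x|lebesgue_on K. norm (f a x - f b x)) \<le> (LINT x|lebesgue_on K. norm (f a x - F x) + norm (f b x - F x))"
        using i norm_triangle_ineq4[of "f a x - F x" "f b x - F x" for x] by (intro integral_mono) auto
      also have "\<dots> = (LINT x|lebesgue_on K. norm (f a x - F x)) + (LINT x|lebesgue_on K. norm (f b x - F x))"
        using i by simp
      finally show ?thesis using N[OF that(1)] N[OF that(2)] by linarith
    qed
    then show ?thesis by blast
  qed
  obtain F' s where s: "strict_mono s" and ae: "AE x in lebesgue_on U. (\<lambda>k. f (s k) x) \<longlonglongrightarrow> F' x" and F': "L1_loc_conv U f F'"
    by (rule L1_loc_complete[OF U fl(1) cau])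
  have "AE x in lebesgue_on U. (\<lambda>k. f (s k) x) \<longlonglongrightarrow> F x"
    using ae L1_loc_conv_unique[OF U F' f] by eventually_elim simp
  with s show thesis by (rule that)
qed

lemma infinitely_often_subseq:
  assumes "\<And>N::nat. \<exists>k\<ge>N. P k"
  shows "\<exists>s :: nat \<Rightarrow> nat. strict_mono s \<and> (\<forall>k. P (s k))"
proof -
  have "infinite {k. P k}" using assms by (auto simp: infinite_nat_iff_unbounded_le)
  then show ?thesis using infinite_enumerate[of "{k. P k}"] by auto
qed

section \<open>The closure of the test functions, weak convergence, and Hardy-weights on the
  closure\<close>

context energy_space
begin

lemma E_add_le: "u \<in> X \<Longrightarrow> v \<in> X \<Longrightarrow> E (\<lambda>x. u x + v x) \<le> (1 / 2) powr (1 - p) * (E u + E v)"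
  using fin_add(2)[of u "\<lambda>_. 1" m v "1 / 2"] by (simp add: X_eq_fin distrib_left)

lemma E_minus: "u \<in> X \<Longrightarrow> v \<in> X \<Longrightarrow> E (\<lambda>x. u x - v x) = E (\<lambda>x. v x - u x)"
  using I_minus[of u "\<lambda>_. 1" m v] by (simp add: X_eq_fin)

text \<open>E behaves like the p-th power of a norm: the triangle inequality holds with the factor
  (1 / 2)^(1 - p) = 2^(p - 1).\<close>

lemma E_tri:
  assumes "u \<in> X" "v \<in> X" "z \<in> X"
  shows "E (\<lambda>x. u x - z x) \<le> (1 / 2) powr (1 - p) * (E (\<lambda>x. u x - v x) + E (\<lambda>x. v x - z x))"
  using E_add_le[OF X_diff[OF assms(1,2)] X_diff[OF assms(2,3)]] by simp

lemma Cc_inf_X: "h \<in> Cc_inf U \<Longrightarrow> h \<in> X"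
  using C1c_X Cc_inf_C1c by auto

text \<open>Smooth test functions approximate the compactly supported continuous Sobolev functions
  in energy, so both classes have the same closure; the p-th root in the norm does not affect
  convergence to 0.\<close>

lemma X0_iff: "u \<in> X0 \<longleftrightarrow> u \<in> X \<and> (\<forall>e>0. \<exists>h\<in>Cc_inf U. E (\<lambda>x. h x - u x) \<le> e)"
proof safe
  assume u0: "u \<in> X0"
  then show u: "u \<in> X" by (simp add: Wt0_def)
  fix e :: real assume e: "0 < e"
  obtain \<phi> where \<phi>: "\<And>k::nat. \<phi> k \<in> W1p U p \<inter> Cc U" and lim: "(\<lambda>k. Wt_norm p H V w U (\<lambda>x. u x - \<phi> k x)) \<longlonglongrightarrow> 0"
    using u0 by (auto simp: Wt0_def)
  define c where "c = (1 / 2 :: real) powr (1 - p)"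
  have c: "0 < c" by (simp add: c_def)
  define r where "r = e / (2 * c)"
  have r: "0 < r" using e c by (simp add: r_def)
  then have "\<forall>\<^sub>F k in sequentially. Wt_norm p H V w U (\<lambda>x. u x - \<phi> k x) < r powr (1 / p)"
    using lim by (intro order_tendstoD) auto
  then obtain k where k: "E (\<lambda>x. u x - \<phi> k x) powr (1 / p) < r powr (1 / p)"
    by (auto simp: eventually_sequentially Wt_norm_eq)
  have "E (\<lambda>x. u x - \<phi> k x) < r"
  proof (rule ccontr)
    assume "\<not> E (\<lambda>x. u x - \<phi> k x) < r"
    then have "r powr (1 / p) \<le> E (\<lambda>x. u x - \<phi> k x) powr (1 / p)" using r p by (intro powr_mono2) auto
    then show False using k by simp
  qed
  moreover obtain h where h: "h \<in> Cc_inf U" "E (\<lambda>x. h x - \<phi> k x) \<le> r"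
    using W1p_Cc_approx(2)[of "\<phi> k", OF _ _ r] \<phi>[of k] by blast
  moreover have "\<phi> k \<in> X" using W1p_Cc_approx(1) \<phi>[of k] by blast
  ultimately have "E (\<lambda>x. h x - u x) \<le> c * (r + r)"
    using E_tri[of h "\<phi> k" u] E_minus[of u "\<phi> k"] Cc_inf_X u c unfolding c_def[symmetric]
    by (intro order_trans[OF E_tri[of h "\<phi> k" u, folded c_def]] mult_left_mono add_mono) auto
  then show "\<exists>h\<in>Cc_inf U. E (\<lambda>x. h x - u x) \<le> e" using h c by (auto simp: r_def)
next
  assume u: "u \<in> X" and ap: "\<forall>e>0. \<exists>h\<in>Cc_inf U. E (\<lambda>x. h x - u x) \<le> e"
  have "\<exists>h\<in>Cc_inf U. E (\<lambda>x. h x - u x) \<le> inverse (real (Suc n))" for n using ap by simp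
  then obtain h where h: "\<And>n. h n \<in> Cc_inf U" "\<And>n. E (\<lambda>x. h n x - u x) \<le> inverse (real (Suc n))" by metis
  have "(\<lambda>n. E (\<lambda>x. h n x - u x)) \<longlonglongrightarrow> 0"
    by (rule tendsto_sandwich[OF always_eventually always_eventually tendsto_const LIMSEQ_inverse_real_of_nat])
      (use h E_nonneg in auto)
  then have "(\<lambda>n. E (\<lambda>x. u x - h n x) powr (1 / p)) \<longlonglongrightarrow> 0 powr (1 / p)"
    using p E_nonneg by (intro tendsto_powr') (auto simp: E_minus[OF u Cc_inf_X[OF h(1)]])
  then have "(\<lambda>n. Wt_norm p H V w U (\<lambda>x. u x - h n x)) \<longlonglongrightarrow> 0" by (simp add: Wt_norm_eq)
  moreover have "h n \<in> W1p U p \<inter> Cc U" for n using C1c_W1p Cc_inf_C1c h(1) by blast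
  ultimately show "u \<in> X0" unfolding Wt0_def using u by blast
qed

lemma X0_X: "u \<in> X0 \<Longrightarrow> u \<in> X"
  by (simp add: X0_iff)

lemma W1p_Cc_X0: "f \<in> W1p U p \<Longrightarrow> f \<in> Cc U \<Longrightarrow> f \<in> X0"
  unfolding X0_iff using W1p_Cc_approx by blast

lemma C1c_X0: "f \<in> C1c U \<Longrightarrow> f \<in> X0"
  using C1c_W1p W1p_Cc_X0 by blast

lemma Cc_inf_X0: "f \<in> Cc_inf U \<Longrightarrow> f \<in> X0"
  using C1c_X0 Cc_inf_C1c by blast

lemma X0_seq:
  assumes "u \<in> X0"
  obtains h where "\<And>n::nat. h n \<in> Cc_inf U" "(\<lambda>n. E (\<lambda>x. h n x - u x)) \<longlonglongrightarrow> 0"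
proof -
  have "\<exists>h\<in>Cc_inf U. E (\<lambda>x. h x - u x) \<le> inverse (real (Suc n))" for n using assms by (simp add: X0_iff)
  then obtain h where h: "\<And>n. h n \<in> Cc_inf U" "\<And>n. E (\<lambda>x. h n x - u x) \<le> inverse (real (Suc n))" by metis
  have "(\<lambda>n. E (\<lambda>x. h n x - u x)) \<longlonglongrightarrow> 0"
    by (rule tendsto_sandwich[OF always_eventually always_eventually tendsto_const LIMSEQ_inverse_real_of_nat])
      (use h E_nonneg in auto)
  with h(1) show thesis by (rule that)
qed

lemma X0_closed:
  assumes v: "v \<in> X" and ap: "\<And>e. 0 < e \<Longrightarrow> \<exists>z\<in>X0. E (\<lambda>x. z x - v x) \<le> e"
  shows "v \<in> X0"
  unfolding X0_iff
proof (intro conjI v allI impI)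
  fix e :: real assume e: "0 < e"
  define c where "c = (1 / 2 :: real) powr (1 - p)"
  have c: "0 < c" by (simp add: c_def)
  define r where "r = e / (2 * c)"
  have r: "0 < r" using e c by (simp add: r_def)
  obtain z where z: "z \<in> X0" "E (\<lambda>x. z x - v x) \<le> r" using ap[OF r] by blast
  obtain h where h: "h \<in> Cc_inf U" "E (\<lambda>x. h x - z x) \<le> r" using z(1) r by (auto simp: X0_iff)
  have "E (\<lambda>x. h x - v x) \<le> c * (E (\<lambda>x. h x - z x) + E (\<lambda>x. z x - v x))"
    unfolding c_def by (rule E_tri) (use h z v Cc_inf_X X0_X in auto)
  also have "\<dots> \<le> c * (r + r)" using h z c by (intro mult_left_mono add_mono) auto
  finally show "\<exists>h\<in>Cc_inf U. E (\<lambda>x. h x - v x) \<le> e" using h c by (auto simp: r_def)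
qed

lemma X0_lin:
  assumes u: "u \<in> X0" and v: "v \<in> X0"
  shows "(\<lambda>x. a * u x + b * v x) \<in> X0"
proof -
  obtain h where h: "\<And>n::nat. h n \<in> Cc_inf U" "(\<lambda>n. E (\<lambda>x. h n x - u x)) \<longlonglongrightarrow> 0" using X0_seq[OF u] by blast
  obtain k where k: "\<And>n::nat. k n \<in> Cc_inf U" "(\<lambda>n. E (\<lambda>x. k n x - v x)) \<longlonglongrightarrow> 0" using X0_seq[OF v] by blast
  have hX: "(\<lambda>x. h n x - u x) \<in> X" "(\<lambda>x. k n x - v x) \<in> X" for n
    using X_diff Cc_inf_X h(1) k(1) X0_X u v by blast+
  have le: "E (\<lambda>x. (a * h n x + b * k n x) - (a * u x + b * v x))
      \<le> (1 / 2) powr (1 - p) * (\<bar>a\<bar> powr p * E (\<lambda>x. h n x - u x) + \<bar>b\<bar> powr p * E (\<lambda>x. k n x - v x))" for n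
  proof -
    have sX: "(\<lambda>x. c * f x) \<in> X" "E (\<lambda>x. c * f x) = \<bar>c\<bar> powr p * E f" if "f \<in> X" for c f
      using fin_scale[of f "\<lambda>_. 1" m c] that by (auto simp: X_eq_fin)
    have "(\<lambda>x. (a * h n x + b * k n x) - (a * u x + b * v x)) = (\<lambda>x. a * (h n x - u x) + b * (k n x - v x))"
      by (auto simp: algebra_simps)
    then show ?thesis
      using E_add_le[OF sX(1)[OF hX(1), of a] sX(1)[OF hX(2), of b], of n n] by (simp add: sX(2) hX)
  qed
  have "(\<lambda>n. (1 / 2) powr (1 - p) * (\<bar>a\<bar> powr p * E (\<lambda>x. h n x - u x) + \<bar>b\<bar> powr p * E (\<lambda>x. k n x - v x)))
      \<longlonglongrightarrow> (1 / 2) powr (1 - p) * (\<bar>a\<bar> powr p * 0 + \<bar>b\<bar> powr p * 0)"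
    by (intro tendsto_intros h k)
  then have lim: "(\<lambda>n. (1 / 2) powr (1 - p) * (\<bar>a\<bar> powr p * E (\<lambda>x. h n x - u x) + \<bar>b\<bar> powr p * E (\<lambda>x. k n x - v x))) \<longlonglongrightarrow> 0"
    by simp
  show ?thesis
    unfolding X0_iff
  proof (intro conjI allI impI)
    show "(\<lambda>x. a * u x + b * v x) \<in> X" using X_lin X0_X u v by blast
    fix e :: real assume e: "0 < e"
    obtain n where "(1 / 2) powr (1 - p) * (\<bar>a\<bar> powr p * E (\<lambda>x. h n x - u x) + \<bar>b\<bar> powr p * E (\<lambda>x. k n x - v x)) < e"
      using order_tendstoD(2)[OF lim e] by (auto simp: eventually_sequentially)
    then have "E (\<lambda>x. (a * h n x + b * k n x) - (a * u x + b * v x)) \<le> e" using le[of n] by simp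
    then show "\<exists>f\<in>Cc_inf U. E (\<lambda>x. f x - (a * u x + b * v x)) \<le> e"
      by (intro bexI[of _ "\<lambda>x. a * h n x + b * k n x"] Cc_inf_add Cc_inf_cmult h k)
  qed
qed

lemma X0_diff: "u \<in> X0 \<Longrightarrow> v \<in> X0 \<Longrightarrow> (\<lambda>x. u x - v x) \<in> X0"
  using X0_lin[of u v 1 "- 1"] by simp

lemma X0_scale: "u \<in> X0 \<Longrightarrow> (\<lambda>x. c * u x) \<in> X0"
  using X0_lin[of u u c 0] by simp

lemma cvx_X0: "z \<in> cvx A \<Longrightarrow> A \<subseteq> X0 \<Longrightarrow> z \<in> X0"
  by (induction rule: cvx.induct) (auto intro: X0_lin)

text \<open>A functional that fails to converge stays away from its limit value with one sign along
  a subsequence. Convex combinations inherit this, but some of them converge to v in energy by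
  Mazur's lemma.\<close>

lemma weak_limit:
  assumes u: "\<And>k. u k \<in> X0" and B: "\<And>k. E (u k) \<le> B" and conv: "L1_loc_conv U u v"
  shows "v \<in> X0" and "Wt0_weakly_converges p H V w U u v"
proof -
  have uX: "u k \<in> X" for k using X0_X u by blast
  show v0: "v \<in> X0"
  proof (rule X0_closed[OF mazur(1)[OF uX B conv]])
    fix e :: real assume "0 < e"
    then obtain z where z: "z \<in> cvx (u ` {0..})" "E (\<lambda>x. z x - v x) \<le> e" using mazur(2)[OF uX B conv] by blast
    have "z \<in> X0" by (rule cvx_X0[OF z(1)]) (use u in auto)
    with z(2) show "\<exists>z\<in>X0. E (\<lambda>x. z x - v x) \<le> e" by blast
  qed
  have "(\<lambda>k. l (u k)) \<longlonglongrightarrow> l v" if l: "l \<in> Wt0_dual p H V w U" for l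
  proof (rule ccontr)
    have add: "l (\<lambda>x. a x + b x) = l a + l b" if "a \<in> X0" "b \<in> X0" for a b
      using l that by (auto simp: Wt0_dual_def)
    have scale: "l (\<lambda>x. c * a x) = c * l a" if "a \<in> X0" for a c
      using l that by (auto simp: Wt0_dual_def)
    obtain C where C: "\<forall>a\<in>X0. \<bar>l a\<bar> \<le> C * E a powr (1 / p)"
      using l by (auto simp: Wt0_dual_def Wt_norm_eq)
    assume "\<not> (\<lambda>k. l (u k)) \<longlonglongrightarrow> l v"
    then obtain \<epsilon> where \<epsilon>: "0 < \<epsilon>" "\<And>N. \<exists>k\<ge>N. \<epsilon> \<le> \<bar>l (u k) - l v\<bar>"
      by (auto simp: LIMSEQ_def dist_real_def not_less)
    \<comment> \<open>The sign is fixed because deviations of different signs could cancel in a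
      convex combination.\<close>
    have "\<exists>\<sigma>::real. \<bar>\<sigma>\<bar> = 1 \<and> (\<forall>N. \<exists>k\<ge>N. \<epsilon> \<le> \<sigma> * (l (u k) - l v))"
    proof (rule ccontr)
      assume neg: "\<nexists>\<sigma>::real. \<bar>\<sigma>\<bar> = 1 \<and> (\<forall>N. \<exists>k\<ge>N. \<epsilon> \<le> \<sigma> * (l (u k) - l v))"
      obtain N1 where N1: "\<And>k. k \<ge> N1 \<Longrightarrow> l (u k) - l v < \<epsilon>" using neg[simplified, rule_format, of 1] by (auto simp: not_le)
      obtain N2 where N2: "\<And>k. k \<ge> N2 \<Longrightarrow> - (l (u k) - l v) < \<epsilon>" using neg[simplified, rule_format, of "- 1"] by (auto simp: not_le)
      obtain k where "k \<ge> max N1 N2" "\<epsilon> \<le> \<bar>l (u k) - l v\<bar>" using \<epsilon>(2) by blast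
      then show False using N1[of k] N2[of k] by auto
    qed
    then obtain \<sigma> :: real where \<sigma>: "\<bar>\<sigma>\<bar> = 1" "\<And>N. \<exists>k\<ge>N. \<epsilon> \<le> \<sigma> * (l (u k) - l v)" by blast
    obtain s :: "nat \<Rightarrow> nat" where s: "strict_mono s" "\<And>k. \<epsilon> \<le> \<sigma> * (l (u (s k)) - l v)"
      using infinitely_often_subseq[of "\<lambda>k. \<epsilon> \<le> \<sigma> * (l (u k) - l v)", OF \<sigma>(2)] by blast
    \<comment> \<open>Makes the bound on the deviation, the absolute value of C times e^(1 / p),
      smaller than \<epsilon>.\<close>
    define e where "e = (\<epsilon> / (2 * (\<bar>C\<bar> + 1))) powr p"
    have e: "0 < e" using \<epsilon> by (simp add: e_def)
    obtain z where z: "z \<in> cvx ((\<lambda>k. u (s k)) ` {0..})" "E (\<lambda>x. z x - v x) \<le> e"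
      using mazur(2)[OF uX B L1_loc_conv_subseq[OF conv s(1)] e] by blast
    have zl: "z \<in> X0 \<and> \<epsilon> \<le> \<sigma> * (l z - l v)"
      using z(1)
    proof (induction rule: cvx.induct)
      case (step z z' t)
      have leq: "l (\<lambda>x. (1 - t) * z x + t * z' x) = (1 - t) * l z + t * l z'"
        using step X0_scale by (simp add: add scale)
      have "\<sigma> * (l (\<lambda>x. (1 - t) * z x + t * z' x) - l v) = (1 - t) * (\<sigma> * (l z - l v)) + t * (\<sigma> * (l z' - l v))"
        unfolding leq by (simp add: algebra_simps)
      also have "\<dots> \<ge> (1 - t) * \<epsilon> + t * \<epsilon>" using step by (intro add_mono mult_left_mono) auto
      finally have "\<epsilon> \<le> \<sigma> * (l (\<lambda>x. (1 - t) * z x + t * z' x) - l v)" by (simp add: algebra_simps)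
      then show ?case using step X0_lin by blast
    qed (use s u in auto)
    have "l z - l v = l (\<lambda>x. z x - v x)"
      using add[of z "\<lambda>x. - 1 * v x"] scale[OF v0, of "- 1"] X0_scale[OF v0, of "- 1"] zl by simp
    then have "\<epsilon> \<le> \<bar>l (\<lambda>x. z x - v x)\<bar>"
      using zl \<sigma>(1) abs_mult[of \<sigma> "l z - l v"] abs_ge_self[of "\<sigma> * (l z - l v)"] by simp
    also have "\<dots> \<le> C * E (\<lambda>x. z x - v x) powr (1 / p)" using C X0_diff zl v0 by blast
    also have "\<dots> \<le> \<bar>C\<bar> * e powr (1 / p)" using z(2) E_nonneg p by (intro mult_mono powr_mono2) auto
    also have "e powr (1 / p) = \<epsilon> / (2 * (\<bar>C\<bar> + 1))"
      unfolding e_def powr_powr using p \<epsilon> by simp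
    also have "\<bar>C\<bar> * (\<epsilon> / (2 * (\<bar>C\<bar> + 1))) < \<epsilon>"
    proof -
      have "\<bar>C\<bar> * \<epsilon> < 2 * (\<bar>C\<bar> + 1) * \<epsilon>" using \<epsilon>(1) by (intro mult_strict_right_mono) auto
      then show ?thesis by (simp add: pos_divide_less_eq mult.commute)
    qed
    finally show False by simp
  qed
  then show "Wt0_weakly_converges p H V w U u v" unfolding Wt0_weakly_converges_def using u v0 by blast
qed

subsection \<open>The functional and weighted masses\<close>

definition Vp :: "'a \<Rightarrow> real" where "Vp x = max (V x) 0"

lemma neg_part_meas [measurable]: "neg_part V \<in> borel_measurable M" "Vp \<in> borel_measurable M"
  unfolding neg_part_def Vp_def by measurable

lemma coeff_V [simp]: "coeff Vp" "coeff (neg_part V)"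
proof -
  show "coeff Vp" using neg_part_meas by (auto simp: coeff_def Vp_def)
  show "coeff (neg_part V)" using neg_part_meas by (auto simp: coeff_def neg_part_def)
qed

lemma dom_le_E:
  assumes ab: "coeff \<alpha>" "coeff \<beta>" and le: "AE x in M. \<alpha> x \<le> 1 \<and> \<beta> x \<le> m x"
  shows "dom X \<alpha> \<beta> 1"
  unfolding dom_def
proof (intro conjI ab ballI)
  fix u assume u: "u \<in> X"
  have ae: "AE x in M. 0 \<le> D \<alpha> \<beta> u x \<and> D \<alpha> \<beta> u x \<le> D (\<lambda>_. 1) m u x"
    using D_nonneg[OF ab, of u] le
  proof eventually_elim
    case (elim x)
    have "\<alpha> x * H x (wgrad U u x) powr p \<le> 1 * H x (wgrad U u x) powr p" "\<beta> x * \<bar>u x\<bar> powr p \<le> m x * \<bar>u x\<bar> powr p"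
      using elim by (intro mult_right_mono; simp)+
    then show ?case using elim by (simp add: D_def)
  qed
  have i: "integrable M (D (\<lambda>_. 1) m u)" using u by (simp add: Wt_iff)
  have j: "integrable M (D \<alpha> \<beta> u)"
  proof (rule Bochner_Integration.integrable_bound[OF i D_meas[OF X_sob[OF u] ab]])
    show "AE x in M. norm (D \<alpha> \<beta> u x) \<le> norm (D (\<lambda>_. 1) m u x)" using ae by eventually_elim auto
  qed
  show "u \<in> fin \<alpha> \<beta>" using j X_sob[OF u] by (simp add: fin_def)
  show "I \<alpha> \<beta> u \<le> 1 * E u"
    unfolding I_def mult_1 by (rule integral_mono_AE[OF j i]) (use ae in \<open>auto elim: eventually_mono\<close>)
qed

lemma dom_V: "dom X (\<lambda>_. 1) Vp 1" "dom X (\<lambda>_. 0) (neg_part V) 1" "dom X (\<lambda>_. 0) (w U) 1"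
proof -
  have cw: "coeff (w U)" using AE_in_U w_pos by (auto simp: coeff_def intro: less_imp_le elim!: eventually_mono)
  show "dom X (\<lambda>_. 1) Vp 1" "dom X (\<lambda>_. 0) (neg_part V) 1" "dom X (\<lambda>_. 0) (w U) 1"
    using AE_in_U w_pos cw
    by (intro dom_le_E; force simp: Vp_def neg_part_def m_def intro: less_imp_le elim!: eventually_mono)+
qed

lemma dom_subset: "dom S \<alpha> \<beta> C \<Longrightarrow> S' \<subseteq> S \<Longrightarrow> dom S' \<alpha> \<beta> C"
  by (auto simp: dom_def)

lemma X0_subset: "X0 \<subseteq> X"
  using X0_X by blast

text \<open>Writes Q as a difference of two functionals with nonnegative coefficients, both finite
  on \<open>X\<close>. Each is convex and falls under the calculus of \<open>I\<close>, which Q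
  itself does not.\<close>

lemma Q_eq:
  assumes u: "u \<in> X" shows "Q p H V u U = I (\<lambda>_. 1) Vp u - I (\<lambda>_. 0) (neg_part V) u"
proof -
  have i: "integrable M (D (\<lambda>_. 1) Vp u)" "integrable M (D (\<lambda>_. 0) (neg_part V) u)"
    using domD(3)[OF dom_V(1) u] domD(3)[OF dom_V(2) u] by (auto simp: fin_def)
  have "Vp x * c - neg_part V x * c = V x * c" for x and c :: real
    by (simp add: Vp_def neg_part_def max_def min_def)
  then have "H x (wgrad U u x) powr p + V x * \<bar>u x\<bar> powr p = D (\<lambda>_. 1) Vp u x - D (\<lambda>_. 0) (neg_part V) u x" for x
    by (simp add: D_def add_diff_eq[symmetric])
  then show ?thesis unfolding Q_def I_def using i by simp
qed

lemma mass_eq: "weighted_mass p g u U = I (\<lambda>_. 0) (\<lambda>x. \<bar>g x\<bar>) u"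
  by (simp add: weighted_mass_def I_def D_def)

lemma Q_le_E: "u \<in> X \<Longrightarrow> Q p H V u U \<le> E u"
  using Q_eq[of u] domD(4)[OF dom_V(1), of u] I_nonneg[of "\<lambda>_. 0" "neg_part V" u] by simp

lemma Q_continuous:
  assumes u: "\<And>k. u k \<in> X" and v: "v \<in> X" and lim: "(\<lambda>k. E (\<lambda>x. u k x - v x)) \<longlonglongrightarrow> 0"
  shows "(\<lambda>k. Q p H V (u k) U) \<longlonglongrightarrow> Q p H V v U"
  unfolding Q_eq[OF u] Q_eq[OF v]
  by (intro tendsto_diff I_continuous[OF X_diff order_refl dom_V(1) u v lim] I_continuous[OF X_diff order_refl dom_V(2) u v lim])

text \<open>Follows from |V| = V + 2 V^-. It names the three quantities that must tend to 0 for the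
  energy to tend to 0.\<close>

lemma E_decomp: "u \<in> X \<Longrightarrow> E u = Q p H V u U + 2 * I (\<lambda>_. 0) (neg_part V) u + I (\<lambda>_. 0) (w U) u"
proof -
  assume u: "u \<in> X"
  have i: "integrable M (D (\<lambda>_. 1) Vp u)" "integrable M (D (\<lambda>_. 0) (neg_part V) u)" "integrable M (D (\<lambda>_. 0) (w U) u)"
    using domD(3)[OF dom_V(1) u] domD(3)[OF dom_V(2) u] domD(3)[OF dom_V(3) u] by (auto simp: fin_def)
  have "m x * c = Vp x * c + neg_part V x * c + w U x * c" for x and c :: real
    by (simp add: Vp_def neg_part_def max_def min_def m_def algebra_simps)
  then have eq: "D (\<lambda>_. 1) m u = (\<lambda>x. D (\<lambda>_. 1) Vp u x + D (\<lambda>_. 0) (neg_part V) u x + D (\<lambda>_. 0) (w U) u x)"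
    by (intro ext) (simp add: D_def)
  have "E u = I (\<lambda>_. 1) Vp u + I (\<lambda>_. 0) (neg_part V) u + I (\<lambda>_. 0) (w U) u"
    unfolding I_def eq using i by simp
  then show ?thesis using Q_eq[OF u] by simp
qed

lemma Cc_fin:
  assumes f: "f \<in> Cc U" "f \<in> X" and \<beta>: "\<beta> \<in> Lp_loc U 1" "coeff \<beta>"
  shows "f \<in> fin (\<lambda>_. 0) \<beta>"
proof -
  obtain K where K: "compact K" "K \<subseteq> U" "\<And>x. x \<notin> K \<Longrightarrow> f x = 0" by (metis CcE[OF f(1)])
  have "continuous_on UNIV (\<lambda>x. \<bar>f x\<bar> powr p)"
    using Cc_continuous[OF f(1)] p by (intro continuous_intros continuous_on_powr') auto
  then have "(\<lambda>x. \<bar>f x\<bar> powr p) \<in> Cc U" by (rule CcI[OF _ K(1,2)]) (use K p in auto)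
  from Cc_mult_integrable[OF this \<beta>(1)] have "integrable lebesgue (\<lambda>x. \<beta> x * \<bar>f x\<bar> powr p)"
    by (simp add: mult.commute)
  then have "integrable M (\<lambda>x. \<beta> x * \<bar>f x\<bar> powr p)"
    using lebesgue_on_integral_outside(2)[of U "\<lambda>x. \<beta> x * \<bar>f x\<bar> powr p"] K U p by auto
  then show ?thesis using X_sob[OF f(2)] by (simp add: fin_def D_def[abs_def])
qed

lemma hardy_coeff: "g \<in> Lp_loc U 1 \<Longrightarrow> coeff (\<lambda>x. \<bar>g x\<bar>)" "g \<in> Lp_loc U 1 \<Longrightarrow> (\<lambda>x. \<bar>g x\<bar>) \<in> Lp_loc U 1"
proof -
  assume g: "g \<in> Lp_loc U 1"
  have [measurable]: "g \<in> borel_measurable M" by (rule Lp_loc_1_measurable[OF U g])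
  show "coeff (\<lambda>x. \<bar>g x\<bar>)" by (simp add: coeff_def)
  show "(\<lambda>x. \<bar>g x\<bar>) \<in> Lp_loc U 1" using g by (auto simp: Lp_loc_1_iff)
qed

lemma dom_E: "dom X (\<lambda>_. 1) m 1"
  by (rule dom_le_E) auto

text \<open>For test functions the Hardy inequality and Q \<le> E give the bound. Fatou's lemma,
  along an almost everywhere convergent subsequence of approximating test functions, extends it to
  the closure and yields finiteness there.\<close>

lemma hardy_dom:
  assumes g: "g \<in> hardy_weights p H V U"
  obtains C where "0 \<le> C" "dom X0 (\<lambda>_. 0) (\<lambda>x. \<bar>g x\<bar>) C"
proof -
  obtain c where c: "0 < c" "\<And>\<phi>. \<phi> \<in> Cc_inf U \<Longrightarrow> c * weighted_mass p g \<phi> U \<le> Q p H V \<phi> U" and gl: "g \<in> Lp_loc U 1"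
    using g by (auto simp: hardy_weights_def)
  note gc = hardy_coeff[OF gl]
  have hC: "I (\<lambda>_. 0) (\<lambda>x. \<bar>g x\<bar>) \<phi> \<le> (1 / c) * E \<phi>" "\<phi> \<in> fin (\<lambda>_. 0) (\<lambda>x. \<bar>g x\<bar>)" if "\<phi> \<in> Cc_inf U" for \<phi>
  proof -
    have "c * I (\<lambda>_. 0) (\<lambda>x. \<bar>g x\<bar>) \<phi> \<le> E \<phi>"
      using c(2)[OF that] Q_le_E[OF Cc_inf_X[OF that]] by (simp add: mass_eq)
    then show "I (\<lambda>_. 0) (\<lambda>x. \<bar>g x\<bar>) \<phi> \<le> (1 / c) * E \<phi>" using c(1) by (simp add: field_simps)
    show "\<phi> \<in> fin (\<lambda>_. 0) (\<lambda>x. \<bar>g x\<bar>)" by (rule Cc_fin[OF Cc_inf_Cc[OF that] Cc_inf_X[OF that] gc(2,1)])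
  qed
  show thesis
  proof (rule that[of "1 / c"])
    show "0 \<le> 1 / c" using c by simp
    show "dom X0 (\<lambda>_. 0) (\<lambda>x. \<bar>g x\<bar>) (1 / c)"
      unfolding dom_def
    proof (intro conjI gc(1) ballI)
      fix u assume u: "u \<in> X0"
      obtain h where h: "\<And>n::nat. h n \<in> Cc_inf U" "(\<lambda>n. E (\<lambda>x. h n x - u x)) \<longlonglongrightarrow> 0" using X0_seq[OF u] by blast
      note uX = X0_X[OF u] and hX = Cc_inf_X[OF h(1)]
      obtain s where s: "strict_mono s" "AE x in M. (\<lambda>k. h (s k) x) \<longlonglongrightarrow> u x"
        using L1_loc_conv_AE_subseq[OF U E_tendsto_L1_loc(1)[OF hX uX h(2)]] by blast
      have "(\<lambda>n. E (h n)) \<longlonglongrightarrow> E u"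
        by (rule I_continuous[OF X_diff order_refl dom_E hX uX h(2)])
      from LIMSEQ_subseq_LIMSEQ[OF this s(1)] have Elim: "(\<lambda>k. E (h (s k))) \<longlonglongrightarrow> E u"
        unfolding o_def .
      have lim: "AE x in M. (\<lambda>k. D (\<lambda>_. 0) (\<lambda>x. \<bar>g x\<bar>) (h (s (k + N))) x) \<longlonglongrightarrow> D (\<lambda>_. 0) (\<lambda>x. \<bar>g x\<bar>) u x" for N
        using s(2)
      proof eventually_elim
        case (elim x)
        have D0: "D (\<lambda>_. 0) (\<lambda>x. \<bar>g x\<bar>) f x = \<bar>g x\<bar> * \<bar>f x\<bar> powr p" for f by (simp add: D_def)
        show ?case unfolding D0 using p
          by (intro tendsto_intros tendsto_powr' LIMSEQ_ignore_initial_segment[OF elim]) auto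
      qed
      have *: "u \<in> fin (\<lambda>_. 0) (\<lambda>x. \<bar>g x\<bar>) \<and> I (\<lambda>_. 0) (\<lambda>x. \<bar>g x\<bar>) u \<le> (1 / c) * (E u + e)" if e: "0 < e" for e
      proof -
        have "\<forall>\<^sub>F k in sequentially. E (h (s k)) < E u + e" using Elim e by (intro order_tendstoD) auto
        then obtain N where N: "\<And>k. k \<ge> N \<Longrightarrow> E (h (s k)) < E u + e" by (auto simp: eventually_sequentially)
        have 1: "I (\<lambda>_. 0) (\<lambda>x. \<bar>g x\<bar>) (h (s (k + N))) \<le> (1 / c) * (E u + e)" for k
          using order_trans[OF hC(1)[OF h(1), of "s (k + N)"] mult_left_mono[OF less_imp_le[OF N[of "k + N"]], of "1 / c"]] c by simp
        note fatou = fin_I_le_Fatou[where f = "\<lambda>k. D (\<lambda>_. 0) (\<lambda>x. \<bar>g x\<bar>) (h (s (k + N)))"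
            and B = "(1 / c) * (E u + e)", OF _ _ _ lim X_sob[OF uX] coeff_simps(2) gc(1)]
        have 2: "integrable M (D (\<lambda>_. 0) (\<lambda>x. \<bar>g x\<bar>) (h (s (k + N))))" for k
          using hC(2)[OF h(1)] by (simp add: fin_def)
        show ?thesis
          using fatou[OF 2 D_nonneg[OF coeff_simps(2) gc(1)] 1[unfolded I_def[of "\<lambda>_. 0"]]] by blast
      qed
      then show "u \<in> fin (\<lambda>_. 0) (\<lambda>x. \<bar>g x\<bar>)" using zero_less_one by blast
      show "I (\<lambda>_. 0) (\<lambda>x. \<bar>g x\<bar>) u \<le> 1 / c * E u"
      proof (rule field_le_epsilon)
        fix e :: real assume "0 < e"
        then show "I (\<lambda>_. 0) (\<lambda>x. \<bar>g x\<bar>) u \<le> 1 / c * E u + e" using *[of "c * e"] c by (simp add: field_simps)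
      qed
    qed auto
  qed
qed

end

section \<open>Compactness\<close>

text \<open>The increment is the integral of a directional derivative along the segment; Tonelli's
  theorem and translation invariance remove the dependence on the position.\<close>

lemma C1c_shift_bound:
  fixes f :: "'a::euclidean_space \<Rightarrow> real"
  assumes f: "f \<in> C1c UNIV"
  shows "(\<integral>\<^sup>+x. ennreal \<bar>f (x + z) - f x\<bar> \<partial>lborel) \<le> ennreal (norm z) * (\<integral>\<^sup>+x. ennreal (norm (grad f x)) \<partial>lborel)"
proof -
  note c = C1cD[OF f]
  have [measurable]: "f \<in> borel_measurable borel" "grad f \<in> borel_measurable borel"
    using c by (auto intro: borel_measurable_continuous_onI)
  have pt: "ennreal \<bar>f (x + z) - f x\<bar>
      \<le> (\<integral>\<^sup>+t. ennreal (norm z) * (indicator {0..1} t * ennreal (norm (grad f (x + t *\<^sub>R z)))) \<partial>lborel)" for x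
  proof -
    have hb: "has_bochner_integral lborel (\<lambda>t. indicator {0..1} t *\<^sub>R (z \<bullet> grad f (x + t *\<^sub>R z))) (f (x + 1 *\<^sub>R z) - f (x + 0 *\<^sub>R z))"
    proof (rule has_bochner_integral_FTC_Icc)
      fix t :: real
      have "((\<lambda>t. x + t *\<^sub>R z) has_derivative (\<lambda>h. h *\<^sub>R z)) (at t within {0..1})"
        by (auto intro!: derivative_eq_intros)
      moreover have "(f has_derivative (\<lambda>h. h \<bullet> grad f (x + t *\<^sub>R z))) (at (x + t *\<^sub>R z))"
        using c(3) by (simp add: gderiv_def)
      ultimately have "((\<lambda>t. f (x + t *\<^sub>R z)) has_derivative (\<lambda>h. (h *\<^sub>R z) \<bullet> grad f (x + t *\<^sub>R z))) (at t within {0..1})"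
        by (rule has_derivative_compose)
      then show "((\<lambda>t. f (x + t *\<^sub>R z)) has_vector_derivative z \<bullet> grad f (x + t *\<^sub>R z)) (at t within {0..1})"
        by (simp add: has_vector_derivative_def)
      show "continuous_on {0..1} (\<lambda>t. z \<bullet> grad f (x + t *\<^sub>R z))"
        by (intro continuous_intros continuous_on_compose2[OF c(4)]) auto
    qed simp
    then have "ennreal \<bar>f (x + z) - f x\<bar> = ennreal (norm (LINT t|lborel. indicator {0..1} t *\<^sub>R (z \<bullet> grad f (x + t *\<^sub>R z))))"
      by (simp add: has_bochner_integral_iff)
    also have "\<dots> \<le> (\<integral>\<^sup>+t. ennreal (norm (indicator {0..1} t *\<^sub>R (z \<bullet> grad f (x + t *\<^sub>R z)))) \<partial>lborel)"
      using hb by (intro integral_norm_bound_ennreal) (simp add: has_bochner_integral_iff)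
    also have "\<dots> \<le> (\<integral>\<^sup>+t. ennreal (norm z) * (indicator {0..1} t * ennreal (norm (grad f (x + t *\<^sub>R z)))) \<partial>lborel)"
      using Cauchy_Schwarz_ineq2[of z]
      by (intro nn_integral_mono) (auto simp: indicator_def ennreal_mult'[symmetric] intro!: ennreal_leI)
    finally show ?thesis .
  qed
  have "(\<integral>\<^sup>+x. ennreal \<bar>f (x + z) - f x\<bar> \<partial>lborel)
      \<le> (\<integral>\<^sup>+x. (\<integral>\<^sup>+t. ennreal (norm z) * (indicator {0..1} t * ennreal (norm (grad f (x + t *\<^sub>R z)))) \<partial>lborel) \<partial>lborel)"
    by (rule nn_integral_mono) (rule pt)
  also have "\<dots> = (\<integral>\<^sup>+t. (\<integral>\<^sup>+x. ennreal (norm z) * (indicator {0..1} t * ennreal (norm (grad f (x + t *\<^sub>R z)))) \<partial>lborel) \<partial>(lborel :: real measure))"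
    by (rule lborel_pair.Fubini'[symmetric]) measurable
  also have "\<dots> = (\<integral>\<^sup>+t. ennreal (norm z) * (indicator {0..1} t * (\<integral>\<^sup>+x. ennreal (norm (grad f x)) \<partial>lborel)) \<partial>(lborel :: real measure))"
  proof (rule nn_integral_cong)
    fix t :: real
    have "(\<integral>\<^sup>+x. ennreal (norm (grad f (x + t *\<^sub>R z))) \<partial>lborel) = (\<integral>\<^sup>+x. ennreal (norm (grad f x)) \<partial>lborel)"
      by (rule nn_integral_translate) measurable
    then show "(\<integral>\<^sup>+x. ennreal (norm z) * (indicator {0..1} t * ennreal (norm (grad f (x + t *\<^sub>R z)))) \<partial>lborel)
        = ennreal (norm z) * (indicator {0..1} t * (\<integral>\<^sup>+x. ennreal (norm (grad f x)) \<partial>lborel))"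
      by (simp add: nn_integral_cmult)
  qed
  also have "\<dots> = ennreal (norm z) * (\<integral>\<^sup>+x. ennreal (norm (grad f x)) \<partial>lborel)"
    by (simp add: nn_integral_cmult nn_integral_multc)
  finally show ?thesis .
qed

text \<open>The convolution averages over shifts shorter than e, each of which moves f in L^1 by at
  most e times the L^1 norm of its gradient.\<close>

lemma conv_L1_close:
  fixes f :: "'a::euclidean_space \<Rightarrow> real"
  assumes f: "f \<in> C1c UNIV" and \<rho>: "mollifier e \<rho>" and e: "0 \<le> e"
  shows "(LINT x|lborel. \<bar>conv f \<rho> x - f x\<bar>) \<le> e * (LINT x|lborel. norm (grad f x))"
    and "integrable lborel (\<lambda>x. \<bar>conv f \<rho> x - f x\<bar>)"
proof -
  note c = C1cD[OF f] and m = mollifier_reflect[OF \<rho>]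
  have [measurable]: "f \<in> borel_measurable borel" "grad f \<in> borel_measurable borel" "\<rho> \<in> borel_measurable borel"
    using c m by (auto intro: borel_measurable_continuous_onI)
  have [measurable]: "conv f \<rho> \<in> borel_measurable borel"
    using Ck_continuous[OF Ck_conv[OF Cc_integrable[OF c(1)], of \<rho> 0]] \<rho>
    by (auto simp: mollifier_def intro: borel_measurable_continuous_onI)
  have \<rho>C: "\<rho> \<in> Cc UNIV" using \<rho> by (simp add: mollifier_def Cc_inf_def)
  obtain B where B: "\<And>z. \<bar>\<rho> z\<bar> \<le> B" using Cc_bounded[OF \<rho>C] by metis
  have int: "integrable lborel (\<lambda>y. f y * \<rho> (x - y))" for x
    using integrable_mult_bounded[OF Cc_integrable[OF c(1)], of "\<lambda>y. \<rho> (x - y)" B] B by (simp add: mult.commute)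
  have \<rho>i: "integrable lborel \<rho>" by (rule Cc_integrable[OF \<rho>C])
  have \<rho>1: "(\<integral>\<^sup>+z. ennreal (\<rho> z) \<partial>lborel) = 1"
    using \<rho>i m(4) \<rho> by (simp add: nn_integral_eq_integral mollifier_def)
  have pt: "ennreal \<bar>conv f \<rho> x - f x\<bar> \<le> (\<integral>\<^sup>+z. ennreal (\<rho> z) * ennreal \<bar>f (x - z) - f x\<bar> \<partial>lborel)" for x
  proof -
    have "conv f \<rho> x - f x = (LINT y|lborel. (f y - f x) * \<rho> (x - y))"
      using int[of x] m(1,2)[of x] by (simp add: conv_def left_diff_distrib)
    also have "ennreal \<bar>\<dots>\<bar> \<le> (\<integral>\<^sup>+y. ennreal (norm ((f y - f x) * \<rho> (x - y))) \<partial>lborel)"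
      using integral_norm_bound_ennreal[of lborel "\<lambda>y. (f y - f x) * \<rho> (x - y)"] int[of x] m(2)[of x]
      by (simp add: left_diff_distrib)
    also have "\<dots> = (\<integral>\<^sup>+y. ennreal (norm ((f (x - (x - y)) - f x) * \<rho> (x - y))) \<partial>lborel)" by simp
    also have "\<dots> = (\<integral>\<^sup>+z. ennreal (norm ((f (x - z) - f x) * \<rho> z)) \<partial>lborel)"
      by (rule nn_integral_reflect) measurable
    also have "\<dots> = (\<integral>\<^sup>+z. ennreal (\<rho> z) * ennreal \<bar>f (x - z) - f x\<bar> \<partial>lborel)"
      using m(4) by (intro nn_integral_cong) (simp add: abs_mult ennreal_mult'' mult.commute)
    finally show ?thesis .
  qed
  have gi: "integrable lborel (\<lambda>x. norm (grad f x))"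
    using C1c_grad_outside[OF f] compact_support_integrable[OF c(4)] by (metis integrable_norm)
  define L where "L = (\<integral>\<^sup>+x. ennreal (norm (grad f x)) \<partial>lborel)"
  have L: "L = ennreal (LINT x|lborel. norm (grad f x))" unfolding L_def using gi by (simp add: nn_integral_eq_integral)
  have "(\<integral>\<^sup>+x. ennreal \<bar>conv f \<rho> x - f x\<bar> \<partial>lborel)
      \<le> (\<integral>\<^sup>+x. (\<integral>\<^sup>+z. ennreal (\<rho> z) * ennreal \<bar>f (x - z) - f x\<bar> \<partial>lborel) \<partial>lborel)"
    by (rule nn_integral_mono) (rule pt)
  also have "\<dots> = (\<integral>\<^sup>+z. (\<integral>\<^sup>+x. ennreal (\<rho> z) * ennreal \<bar>f (x - z) - f x\<bar> \<partial>lborel) \<partial>lborel)"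
    by (rule lborel_pair.Fubini'[symmetric]) measurable
  also have "\<dots> \<le> (\<integral>\<^sup>+z. ennreal (\<rho> z) * (ennreal e * L) \<partial>lborel)"
  proof (rule nn_integral_mono)
    fix z
    show "(\<integral>\<^sup>+x. ennreal (\<rho> z) * ennreal \<bar>f (x - z) - f x\<bar> \<partial>lborel) \<le> ennreal (\<rho> z) * (ennreal e * L)"
    proof (cases "e \<le> norm z")
      case True
      then show ?thesis using \<rho> by (simp add: mollifier_def)
    next
      case False
      have "(\<integral>\<^sup>+x. ennreal \<bar>f (x + - z) - f x\<bar> \<partial>lborel) \<le> ennreal (norm (- z)) * L"
        unfolding L_def by (rule C1c_shift_bound[OF f])
      also have "\<dots> \<le> ennreal e * L" using False by (intro mult_right_mono ennreal_leI) auto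
      finally show ?thesis by (simp add: nn_integral_cmult mult_left_mono)
    qed
  qed
  also have "\<dots> = ennreal e * L" by (simp add: nn_integral_multc \<rho>1)
  also have "\<dots> = ennreal (e * (LINT x|lborel. norm (grad f x)))" unfolding L using e by (simp add: ennreal_mult')
  finally have le: "(\<integral>\<^sup>+x. ennreal \<bar>conv f \<rho> x - f x\<bar> \<partial>lborel) \<le> ennreal (e * (LINT x|lborel. norm (grad f x)))" .
  then show i: "integrable lborel (\<lambda>x. \<bar>conv f \<rho> x - f x\<bar>)"
    by (intro integrableI_nonneg) (auto simp: le_less_trans)
  show "(LINT x|lborel. \<bar>conv f \<rho> x - f x\<bar>) \<le> e * (LINT x|lborel. norm (grad f x))"
    using le nn_integral_eq_integral[OF i] e by (simp add: integral_nonneg_AE)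
qed

lemma conv_diff_arg_le:
  assumes f: "f \<in> Cc U" and \<rho>: "mollifier e \<rho>" and d: "\<And>y. \<bar>\<rho> (x - y) - \<rho> (x' - y)\<bar> \<le> d"
  shows "\<bar>conv f \<rho> x - conv f \<rho> x'\<bar> \<le> d * (LINT y|lborel. \<bar>f y\<bar>)"
proof -
  have [measurable]: "\<rho> \<in> borel_measurable borel" by (rule mollifier_reflect[OF \<rho>])
  have \<rho>C: "\<rho> \<in> Cc UNIV" using \<rho> by (simp add: mollifier_def Cc_inf_def)
  obtain B where B: "\<And>z. \<bar>\<rho> z\<bar> \<le> B" using Cc_bounded[OF \<rho>C] by metis
  have fi: "integrable lborel f" by (rule Cc_integrable[OF f])
  have int: "integrable lborel (\<lambda>y. f y * \<rho> (x - y))" for x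
    using integrable_mult_bounded[OF fi, of "\<lambda>y. \<rho> (x - y)" B] B by (simp add: mult.commute)
  have "conv f \<rho> x - conv f \<rho> x' = (LINT y|lborel. f y * \<rho> (x - y) - f y * \<rho> (x' - y))"
    unfolding conv_def using int by simp
  also have "norm \<dots> \<le> (LINT y|lborel. d * \<bar>f y\<bar>)"
  proof (rule Bochner_Integration.integral_norm_bound_integral)
    fix y
    show "norm (f y * \<rho> (x - y) - f y * \<rho> (x' - y)) \<le> d * \<bar>f y\<bar>"
      using mult_right_mono[OF d[of y], of "\<bar>f y\<bar>"] by (simp add: right_diff_distrib[symmetric] abs_mult mult.commute)
  qed (use int fi in auto)
  also have "\<dots> = d * (LINT y|lborel. \<bar>f y\<bar>)" by simp
  finally show ?thesis by simp
qed

text \<open>Mollified at a fixed scale, the sequence is bounded and equicontinuous, so Arzela-Ascoli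
  applies, and it stays uniformly close to the original in L^1. The scale depends on \<eta>, so one
  application reaches only one tolerance; a diagonal argument has to follow.\<close>

lemma rellich_step:
  fixes f :: "nat \<Rightarrow> 'a::euclidean_space \<Rightarrow> real"
  assumes K: "compact K" and f: "\<And>k. f k \<in> C1c UNIV" "\<And>k x. x \<notin> K \<Longrightarrow> f k x = 0"
    and B: "\<And>k. (LINT x|lborel. \<bar>f k x\<bar>) \<le> B" "\<And>k. (LINT x|lborel. norm (grad (f k) x)) \<le> B"
    and h: "0 < \<eta>"
  shows "\<exists>s::nat\<Rightarrow>nat. strict_mono s \<and> (\<exists>N. \<forall>i\<ge>N. \<forall>j\<ge>N. (LINT x|lborel. \<bar>f (s i) x - f (s j) x\<bar>) < \<eta>)"
proof -
  have B0: "0 \<le> B" using B(1)[of 0] by (rule order_trans[rotated]) simp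
  \<comment> \<open>The scale at which every function is within \<eta> / 4 of its mollification in
    L^1.\<close>
  define e where "e = \<eta> / (4 * (B + 1))"
  have e: "0 < e" "e * B \<le> \<eta> / 4" using h B0 by (auto simp: e_def field_simps)
  obtain \<rho> :: "'a \<Rightarrow> real" where \<rho>: "mollifier e \<rho>" using mollifier_exists[OF e(1)] by blast
  have \<rho>C: "\<rho> \<in> Cc UNIV" using \<rho> by (simp add: mollifier_def Cc_inf_def)
  define K' where "K' = (\<Union>x\<in>K. cball x e)"
  have K': "compact K'" unfolding K'_def by (rule compact_thickening[OF K])
  define F where "F k = conv (f k) \<rho>" for k
  have fC: "f k \<in> Cc UNIV" for k by (rule C1cD(1)[OF f(1)])
  have Fout: "F k x = 0" if "x \<notin> K'" for k x
    unfolding F_def by (rule conv_Cc_inf(2)[OF fC K f(2) _ \<rho> order_refl, of UNIV]) (use that in \<open>auto simp: K'_def\<close>)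
  obtain b where b: "\<And>z. \<bar>\<rho> z\<bar> \<le> b" using Cc_bounded[OF \<rho>C] by metis
  have b0: "0 \<le> b" using b[of 0] by linarith
  have uc: "uniformly_continuous_on UNIV \<rho>"
    using CcE[OF \<rho>C] compact_support_uniformly_continuous[OF Cc_continuous[OF \<rho>C]] by metis
  obtain g s where s: "strict_mono (s :: nat \<Rightarrow> nat)"
    and lim: "\<And>e. 0 < e \<Longrightarrow> \<exists>N. \<forall>n x. n \<ge> N \<and> x \<in> K' \<longrightarrow> norm (F (s n) x - g x) < e"
  proof (rule Arzela_Ascoli[OF K', of F "b * B"])
    fix n x assume "x \<in> K'"
    have "\<bar>conv (f n) \<rho> x\<bar> \<le> (LINT y|lborel. \<bar>f n y * \<rho> (x - y)\<bar>)" unfolding conv_def by simp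
    also have "\<dots> \<le> (LINT y|lborel. b * \<bar>f n y\<bar>)"
    proof (rule integral_mono')
      show "integrable lborel (\<lambda>y. b * \<bar>f n y\<bar>)" using Cc_integrable[OF fC] by simp
      show "\<bar>f n y * \<rho> (x - y)\<bar> \<le> b * \<bar>f n y\<bar>" for y
        using mult_right_mono[OF b[of "x - y"], of "\<bar>f n y\<bar>"] by (simp add: abs_mult mult.commute)
    qed (use b0 in simp)
    also have "\<dots> = b * (LINT y|lborel. \<bar>f n y\<bar>)" by simp
    also have "\<dots> \<le> b * B" by (rule mult_left_mono[OF B(1) b0])
    finally show "norm (F n x) \<le> b * B" by (simp add: F_def)
  next
    fix x r assume x: "x \<in> K'" and r: "0 < (r::real)"
    define d where "d = r / (2 * (B + 1))"
    have d: "0 < d" "d * B \<le> r / 2" using r B0 by (auto simp: d_def field_simps)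
    obtain \<delta> where \<delta>: "0 < \<delta>" "\<And>z z'. dist z' z < \<delta> \<Longrightarrow> dist (\<rho> z') (\<rho> z) < d"
      using uc d(1) unfolding uniformly_continuous_on_def by (metis UNIV_I)
    have "norm (F n x - F n y) < r" if y: "norm (x - y) < \<delta>" for n y
    proof -
      have "\<bar>\<rho> (x - z) - \<rho> (y - z)\<bar> \<le> d" for z
        using \<delta>(2)[of "x - z" "y - z"] y by (simp add: dist_norm less_imp_le)
      from conv_diff_arg_le[OF fC \<rho> this]
      have "norm (F n x - F n y) \<le> d * (LINT y|lborel. \<bar>f n y\<bar>)" by (simp add: F_def)
      also have "\<dots> \<le> d * B" using B(1) d by (intro mult_left_mono) auto
      finally show ?thesis using d r by simp
    qed
    then show "\<exists>d>0. \<forall>n y. y \<in> K' \<and> norm (x - y) < d \<longrightarrow> norm (F n x - F n y) < r" using \<delta>(1) by blast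
  qed blast
  define L where "L = measure lborel K'"
  have L0: "0 \<le> L" by (simp add: L_def)
  \<comment> \<open>Integrated over K', of measure L, the uniform distance 2 * q contributes at most
    \<eta> / 4.\<close>
  define q where "q = \<eta> / (8 * (L + 1))"
  have q: "0 < q" "2 * q * L \<le> \<eta> / 4" using h L0 by (auto simp: q_def field_simps)
  obtain N where N: "\<And>n x. n \<ge> N \<Longrightarrow> x \<in> K' \<Longrightarrow> norm (F (s n) x - g x) < q" using lim[OF q(1)] by blast
  have "(LINT x|lborel. \<bar>f (s i) x - f (s j) x\<bar>) < \<eta>" if ij: "i \<ge> N" "j \<ge> N" for i j
  proof -
    note cl = conv_L1_close[OF f(1) \<rho> less_imp_le[OF e(1)], folded F_def]
    have cl': "(LINT x|lborel. \<bar>F k x - f k x\<bar>) \<le> \<eta> / 4" for k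
      using order_trans[OF cl(1)[of k] mult_left_mono[OF B(2)[of k], of e]] e by simp
    have FF: "\<bar>F (s i) x - F (s j) x\<bar> \<le> 2 * q * indicator K' x" for x
    proof (cases "x \<in> K'")
      case True
      then show ?thesis using N[OF ij(1) True] N[OF ij(2) True] by simp
    qed (use Fout in simp)
    have iK: "integrable lborel (\<lambda>x. 2 * q * indicator K' x)"
      using emeasure_compact_finite[OF K'] borel_compact[OF K'] by (intro integrable_mult_right integrable_real_indicator) auto
    have "(LINT x|lborel. \<bar>f (s i) x - f (s j) x\<bar>)
        \<le> (LINT x|lborel. \<bar>F (s i) x - f (s i) x\<bar> + \<bar>F (s j) x - f (s j) x\<bar> + 2 * q * indicator K' x)"
    proof (rule integral_mono')
      show "integrable lborel (\<lambda>x. \<bar>F (s i) x - f (s i) x\<bar> + \<bar>F (s j) x - f (s j) x\<bar> + 2 * q * indicator K' x)"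
        by (intro Bochner_Integration.integrable_add cl(2) iK)
      fix x
      show "\<bar>f (s i) x - f (s j) x\<bar> \<le> \<bar>F (s i) x - f (s i) x\<bar> + \<bar>F (s j) x - f (s j) x\<bar> + 2 * q * indicator K' x"
        using FF[of x] by linarith
    qed (use q(1) in \<open>auto intro!: add_nonneg_nonneg\<close>)
    also have "\<dots> = (LINT x|lborel. \<bar>F (s i) x - f (s i) x\<bar>) + (LINT x|lborel. \<bar>F (s j) x - f (s j) x\<bar>) + 2 * q * L"
      using cl(2)[of "s i"] cl(2)[of "s j"] iK by (simp add: L_def)
    also have "\<dots> \<le> \<eta> / 4 + \<eta> / 4 + \<eta> / 4" by (intro add_mono cl' q)
    also have "\<dots> < \<eta>" using h by simp
    finally show ?thesis .
  qed
  then show ?thesis using s by blast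
qed

lemma spowr_C1:
  assumes p: "1 < p" and u: "Ck 1 u"
  shows "Ck 1 (\<lambda>x. spowr p (u x))" "grad (\<lambda>x. spowr p (u x)) = (\<lambda>x. (p * \<bar>u x\<bar> powr (p - 1)) *\<^sub>R grad u x)"
proof -
  have "GDERIV (\<lambda>x. spowr p (u x)) x :> (p * \<bar>u x\<bar> powr (p - 1)) *\<^sub>R grad u x" for x
    by (rule GDERIV_DERIV_compose[OF Ck_1D(1)[OF u] has_real_derivative_spowr[OF p]])
  moreover have "continuous_on UNIV (\<lambda>x. (p * \<bar>u x\<bar> powr (p - 1)) *\<^sub>R grad u x)"
    using Ck_continuous[OF u] Ck_1D(2)[OF u] p by (intro continuous_intros continuous_on_powr') auto
  ultimately show "Ck 1 (\<lambda>x. spowr p (u x))" "grad (\<lambda>x. spowr p (u x)) = (\<lambda>x. (p * \<bar>u x\<bar> powr (p - 1)) *\<^sub>R grad u x)"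
    by (rule Ck_1I)+
qed

text \<open>A crude form of Young's inequality: both factors are replaced by the larger of the two
  numbers.\<close>

lemma powr_mult_le:
  assumes p: "1 < p" and ab: "0 \<le> a" "0 \<le> (b::real)"
  shows "a powr (p - 1) * b \<le> a powr p + b powr p"
proof -
  define t where "t = max a b"
  have "a powr (p - 1) * b \<le> t powr (p - 1) * t"
    using p ab by (intro mult_mono powr_mono2) (auto simp: t_def)
  also have "\<dots> = t powr p" using ab by (cases "t = 0") (auto simp: t_def powr_diff max_def split: if_splits)
  also have "\<dots> \<le> a powr p + b powr p" by (auto simp: t_def max_def)
  finally show ?thesis .
qed

section \<open>Rellich's theorem for sequences of bounded energy\<close>

context energy_space
begin

lemma Lp_control:
  assumes K: "compact K" "K \<subseteq> U"
  shows "\<exists>C\<ge>0. \<forall>u\<in>X. integrable (lebesgue_on K) (\<lambda>x. \<bar>u x\<bar> powr p + norm (wgrad U u x) powr p) \<and>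
    (LINT x|lebesgue_on K. \<bar>u x\<bar> powr p + norm (wgrad U u x) powr p) \<le> C * E u"
proof -
  obtain c where c: "0 < c" "\<And>x. x \<in> K \<Longrightarrow> c \<le> w U x"
  proof (cases "K = {}")
    case False
    obtain z where "z \<in> K" "\<And>x. x \<in> K \<Longrightarrow> w U z \<le> w U x"
      using continuous_attains_inf[OF K(1) False continuous_on_subset[OF w_cont K(2)]] by blast
    then show thesis using that[of "w U z"] w_pos K by auto
  qed (use that[of 1] in auto)
  obtain \<kappa> \<nu> where \<kappa>: "0 < \<kappa>" "AE x in lebesgue_on K. \<forall>\<xi>. \<kappa> * norm \<xi> \<le> H x \<xi> \<and> H x \<xi> \<le> \<nu> * norm \<xi>"
    using H_bounds[OF K] by blast
  define C0 where "C0 = 1 / c + 1 / \<kappa> powr p"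
  have C0: "0 \<le> C0" using c \<kappa> by (simp add: C0_def)
  have Kl: "K \<in> sets lebesgue" "U \<in> sets lebesgue" using K U by auto
  have AEK: "AE x in lebesgue_on K. x \<in> K" using Kl by (simp add: AE_restrict_space_iff)
  show ?thesis
  proof (intro exI[of _ C0] conjI ballI C0)
    fix u assume u: "u \<in> X"
    let ?D = "D (\<lambda>_. 1) m u"
    let ?P = "\<lambda>x. \<bar>u x\<bar> powr p + norm (wgrad U u x) powr p"
    have iD: "integrable M ?D" and wg: "weak_gradient U u (wgrad U u)"
      using u by (auto simp: Wt_iff sob_def intro: weak_gradient_wgrad)
    have iDK: "integrable (lebesgue_on K) ?D" by (rule integrable_lebesgue_on_subset(1)[OF iD Kl(2,1) K(2)])
    have [measurable]: "u \<in> borel_measurable (lebesgue_on K)" "wgrad U u \<in> borel_measurable (lebesgue_on K)"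
      using weak_gradient_integrable[OF wg K] by auto
    have ae: "AE x in lebesgue_on K. ?P x \<le> C0 * ?D x"
      using \<kappa>(2) AEK
    proof eventually_elim
      case (elim x)
      have m: "c \<le> m x" using c(2)[OF elim(2)] by (simp add: m_def)
      have "norm (wgrad U u x) powr p \<le> (H x (wgrad U u x) / \<kappa>) powr p"
        using elim(1) \<kappa>(1) p by (intro powr_mono2) (auto simp: field_simps)
      also have "\<dots> = H x (wgrad U u x) powr p / \<kappa> powr p"
        by (rule powr_divide)
      also have "\<dots> \<le> ?D x / \<kappa> powr p"
        using m c(1) by (intro divide_right_mono) (auto simp: D_def)
      finally have 1: "norm (wgrad U u x) powr p \<le> ?D x / \<kappa> powr p" .
      have "c * \<bar>u x\<bar> powr p \<le> m x * \<bar>u x\<bar> powr p" using m by (intro mult_right_mono) auto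
      also have "\<dots> \<le> ?D x" by (simp add: D_def)
      finally have 2: "\<bar>u x\<bar> powr p \<le> ?D x / c" using c(1) by (simp add: field_simps)
      show ?case using 1 2 by (simp add: C0_def algebra_simps)
    qed
    have iC: "integrable (lebesgue_on K) (\<lambda>x. C0 * ?D x)" using iDK by simp
    show iP: "integrable (lebesgue_on K) ?P"
    proof (rule Bochner_Integration.integrable_bound[OF iC])
      show "AE x in lebesgue_on K. norm (?P x) \<le> norm (C0 * ?D x)" using ae by eventually_elim auto
    qed measurable
    have "(LINT x|lebesgue_on K. ?P x) \<le> (LINT x|lebesgue_on K. C0 * ?D x)"
      by (rule integral_mono_AE[OF iP iC ae])
    also have "\<dots> = C0 * (LINT x|lebesgue_on K. ?D x)" by simp
    also have "\<dots> \<le> C0 * E u"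
      unfolding I_def by (intro mult_left_mono C0 integrable_lebesgue_on_subset(2)[OF iD Kl(2,1) K(2) D_nonneg]) auto
    finally show "(LINT x|lebesgue_on K. ?P x) \<le> C0 * E u" .
  qed
qed

text \<open>The L^1 criterion is applied to \<open>spowr p (u k)\<close> times a cut-off. The
  gradient of this product is bounded in L^1 by the p-th powers of \<open>u k\<close> and its
  gradient, and L^1 differences of such products dominate L^p differences of the \<open>u k\<close>.
  So convergence comes directly in L^p, with no Sobolev embedding.\<close>

theorem rellich:
  assumes u: "\<And>k. u k \<in> Cc_inf U" and B: "\<And>k. E (u k) \<le> B"
  shows "\<exists>s v. strict_mono (s :: nat \<Rightarrow> nat) \<and> L1_loc_conv U (\<lambda>k. u (s k)) v \<and>
    (\<forall>K. compact K \<longrightarrow> K \<subseteq> U \<longrightarrow> (\<lambda>k. LINT x|lebesgue_on K. \<bar>u (s k) x - v x\<bar> powr p) \<longlonglongrightarrow> 0)"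
proof -
  have uC: "u k \<in> C1c U" for k using u Cc_inf_C1c by auto
  have uX: "u k \<in> X" for k by (rule Cc_inf_X[OF u])
  have uwg: "AE x in M. wgrad U (u k) x = grad (u k) x" for k
    by (rule wgrad_AE[OF U Ck_1_weak_gradient[OF U C1cD(2)[OF uC]]])
  obtain C where C: "\<And>n::nat. compact (C n)" "\<And>n. C n \<subseteq> U" "\<And>K. compact K \<Longrightarrow> K \<subseteq> U \<Longrightarrow> \<exists>N. \<forall>n\<ge>N. K \<subseteq> C n"
    using open_Union_compact_subsets[OF U] by metis
  have "\<exists>\<eta>. \<eta> \<in> Cc_inf U \<and> (\<forall>x\<in>C n. \<eta> x = 1)" for n
    using smooth_cutoff[OF C(1,2) U, of n] by (metis subsetD)
  then obtain \<eta> where \<eta>: "\<And>n. \<eta> n \<in> Cc_inf U" "\<And>n x. x \<in> C n \<Longrightarrow> \<eta> n x = 1" by metis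
  have \<eta>C: "\<eta> n \<in> C1c U" for n using \<eta>(1) Cc_inf_C1c by blast
  define F where "F n k x = spowr p (u k x) * \<eta> n x" for n k x
  have FC: "F n k \<in> C1c U" for n k
    unfolding F_def by (rule C1c_mult[OF \<eta>C spowr_C1(1)[OF p C1cD(2)[OF uC]]])
  have FCU: "F n k \<in> C1c UNIV" for n k using FC C1c_mono[of U UNIV] by blast
  have step: "\<exists>r::nat\<Rightarrow>nat. strict_mono r \<and> (\<exists>N. \<forall>i\<ge>N. \<forall>j\<ge>N. (LINT x|lborel. \<bar>F n (t (r i)) x - F n (t (r j)) x\<bar>) < e)"
    if e: "0 < e" for n e and t :: "nat \<Rightarrow> nat"
  proof -
    obtain K where K: "compact K" "K \<subseteq> U" "\<And>x. x \<notin> K \<Longrightarrow> \<eta> n x = 0" "\<And>x. x \<notin> K \<Longrightarrow> grad (\<eta> n) x = 0"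
      using C1c_grad_outside[OF \<eta>C] by metis
    obtain b where b: "0 < b" "\<And>x. \<bar>\<eta> n x\<bar> \<le> b" using Cc_bounded[OF C1cD(1)[OF \<eta>C]] by metis
    obtain b' where b': "0 < b'" "\<And>x. norm (grad (\<eta> n) x) \<le> b'"
      using compact_support_bounded[OF C1cD(4)[OF \<eta>C] K(1,4)] by metis
    obtain L where L: "0 \<le> L" "\<forall>u\<in>X. integrable (lebesgue_on K) (\<lambda>x. \<bar>u x\<bar> powr p + norm (wgrad U u x) powr p) \<and>
        (LINT x|lebesgue_on K. \<bar>u x\<bar> powr p + norm (wgrad U u x) powr p) \<le> L * E u"
      using Lp_control[OF K(1,2)] by blast
    let ?P = "\<lambda>k x. \<bar>u k x\<bar> powr p + norm (grad (u k) x) powr p"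
    have P: "integrable (lebesgue_on K) (?P k)" "(LINT x|lebesgue_on K. ?P k x) \<le> L * B" for k
    proof -
      have "continuous_on UNIV (\<lambda>x. \<bar>u k x\<bar> powr p)"
        using C1cD(5)[OF uC[of k]] p by (intro continuous_intros continuous_on_powr') auto
      from continuous_on_add[OF this norm_grad_powr_continuous[OF C1cD(2)[OF uC[of k]]]]
      have cont: "continuous_on UNIV (?P k)" .
      then show i: "integrable (lebesgue_on K) (?P k)"
        using continuous_Lp_loc[OF cont, of K] K(1) by (auto simp: Lp_loc_1_iff)
      have "AE x in lebesgue_on K. wgrad U (u k) x = grad (u k) x"
        by (rule AE_lebesgue_on_subset[OF uwg]) (use K U in auto)
      then have "(LINT x|lebesgue_on K. ?P k x) = (LINT x|lebesgue_on K. \<bar>u k x\<bar> powr p + norm (wgrad U (u k) x) powr p)"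
        using i L(2) uX by (intro integral_cong_AE) (auto elim!: eventually_mono)
      also have "\<dots> \<le> L * E (u k)" using L(2) uX by blast
      also have "\<dots> \<le> L * B" by (rule mult_left_mono[OF B L(1)])
      finally show "(LINT x|lebesgue_on K. ?P k x) \<le> L * B" .
    qed
    have toK: "(LINT x|lborel. q x) \<le> c * (L * B)"
      if q: "continuous_on UNIV q" "\<And>x. x \<notin> K \<Longrightarrow> q x = 0" "\<And>x. q x \<le> c * ?P k x" "0 \<le> c" for q c k
    proof -
      have "(LINT x|lborel. q x) = (LINT x|lebesgue. q x)"
        using borel_measurable_continuous_onI[OF q(1)] by (intro integral_completion[symmetric]) simp
      also have "\<dots> = (LINT x|lebesgue_on K. q x)"
        using lebesgue_on_integral_outside(1)[of K q] q(2) K(1) by simp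
      also have "\<dots> \<le> (LINT x|lebesgue_on K. c * ?P k x)"
        using continuous_Lp_loc[OF q(1), of K] K(1) P(1)[of k] q(3) by (intro integral_mono) (auto simp: Lp_loc_1_iff)
      also have "\<dots> = c * (LINT x|lebesgue_on K. ?P k x)" by simp
      also have "\<dots> \<le> c * (L * B)" by (rule mult_left_mono[OF P(2) q(4)])
      finally show ?thesis .
    qed
    have Fout: "F n k x = 0" if "x \<notin> K" for k x using K(3)[OF that] by (simp add: F_def)
    have gradF: "grad (F n k) x = spowr p (u k x) *\<^sub>R grad (\<eta> n) x + (\<eta> n x * (p * \<bar>u k x\<bar> powr (p - 1))) *\<^sub>R grad (u k) x" for k x
      unfolding F_def using grad_mult[OF spowr_C1(1)[OF p C1cD(2)[OF uC]] C1cD(2)[OF \<eta>C], of k n x]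
      by (simp add: spowr_C1(2)[OF p C1cD(2)[OF uC]])
    \<comment> \<open>Collects the bound b of the cut-off, the bound b' of its gradient, and the
      factor p from differentiating \<open>spowr\<close>.\<close>
    define c where "c = b + b' + b * p"
    have c0: "0 \<le> c" using b(1) b'(1) p by (simp add: c_def)
    have F1: "\<bar>F n k x\<bar> \<le> c * ?P k x" for k x
    proof -
      have "\<bar>F n k x\<bar> = \<bar>u k x\<bar> powr p * \<bar>\<eta> n x\<bar>" by (simp add: F_def abs_mult abs_spowr[OF p])
      also have "\<dots> \<le> ?P k x * b" using b(2)[of x] by (intro mult_mono) auto
      also have "\<dots> \<le> ?P k x * c" using b' b p by (intro mult_left_mono) (auto simp: c_def)
      finally show ?thesis by (simp add: mult.commute)
    qed
    have F2: "norm (grad (F n k) x) \<le> c * ?P k x" for k x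
    proof -
      have "norm (grad (F n k) x) \<le> \<bar>u k x\<bar> powr p * norm (grad (\<eta> n) x) + \<bar>\<eta> n x\<bar> * (p * (\<bar>u k x\<bar> powr (p - 1) * norm (grad (u k) x)))"
        unfolding gradF using p by (intro order_trans[OF norm_triangle_ineq]) (simp add: abs_spowr abs_mult mult.assoc)
      also have "\<dots> \<le> ?P k x * b' + b * (p * ?P k x)"
        using b(2)[of x] b'(2)[of x] b(1) p powr_mult_le[OF p, of "\<bar>u k x\<bar>" "norm (grad (u k) x)"]
        by (intro add_mono mult_mono) auto
      also have "\<dots> = (b' + b * p) * ?P k x" by (simp add: algebra_simps)
      also have "\<dots> \<le> c * ?P k x" using b by (intro mult_right_mono) (auto simp: c_def)
      finally show ?thesis .
    qed
    show ?thesis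
    proof (rule rellich_step[OF K(1), where f = "\<lambda>k. F n (t k)" and B = "c * (L * B)", OF FCU Fout])
      show "(LINT x|lborel. \<bar>F n (t k) x\<bar>) \<le> c * (L * B)" for k
        using C1cD(5)[OF FCU] Fout F1[of "t k"] c0 by (intro toK[of _ c "t k"] continuous_intros) auto
      show "(LINT x|lborel. norm (grad (F n (t k)) x)) \<le> c * (L * B)" for k
        using C1cD(4)[OF FCU] grad_const_outside[OF compact_imp_closed[OF K(1)] Fout] F2[of "t k"] c0
        by (intro toK[of _ c "t k"] continuous_intros) auto
    qed (use e in auto)
  qed
  \<comment> \<open>The index l encodes a cut-off n together with a tolerance 1 / (k + 1), so that a
    single diagonal sequence serves all pairs.\<close>
  define P where "P l t \<longleftrightarrow> (\<exists>N. \<forall>i\<ge>N. \<forall>j\<ge>N. (LINT x|lborel. \<bar>F (fst (prod_decode l)) (t i) x - F (fst (prod_decode l)) (t j) x\<bar>)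
      < inverse (real (Suc (snd (prod_decode l)))))" for l and t :: "nat \<Rightarrow> nat"
  interpret subseqs P
  proof
    fix l and t :: "nat \<Rightarrow> nat" assume "strict_mono t"
    show "\<exists>r'. strict_mono r' \<and> P l (t \<circ> r')"
      unfolding P_def o_def by (rule step) simp
  qed
  define t where "t = diagseq"
  have t: "strict_mono t" by (simp add: t_def subseq_diagseq)
  have Pt: "\<exists>N. \<forall>i\<ge>N. \<forall>j\<ge>N. (LINT x|lborel. \<bar>F n (t i) x - F n (t j) x\<bar>) < inverse (real (Suc k))" for n k
  proof -
    define l where "l = prod_encode (n, k)"
    have "P l (diagseq \<circ> (+) (Suc l))"
    proof (rule diagseq_holds)
      fix r s l assume r: "strict_mono (r :: nat \<Rightarrow> nat)" and "P l s"
      then show "P l (s \<circ> r)" unfolding P_def o_def by (meson order_trans seq_suble)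
    qed
    then have "P l (\<lambda>i. t (Suc l + i))" by (simp add: t_def o_def)
    moreover have "fst (prod_decode l) = n" "snd (prod_decode l) = k" by (simp_all add: l_def)
    ultimately obtain N where N: "\<And>i j. i \<ge> N \<Longrightarrow> j \<ge> N \<Longrightarrow>
        (LINT x|lborel. \<bar>F n (t (Suc l + i)) x - F n (t (Suc l + j)) x\<bar>) < inverse (real (Suc k))"
      unfolding P_def by auto
    have "(LINT x|lborel. \<bar>F n (t i) x - F n (t j) x\<bar>) < inverse (real (Suc k))" if "i \<ge> Suc l + N" "j \<ge> Suc l + N" for i j
      using N[of "i - Suc l" "j - Suc l"] that by simp
    then show ?thesis by blast
  qed
  have cauP: "\<exists>N. \<forall>i\<ge>N. \<forall>j\<ge>N. (LINT x|lebesgue_on K. \<bar>u (t i) x - u (t j) x\<bar> powr p) < e"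
    if K: "compact K" "K \<subseteq> U" and e: "0 < e" for K e
  proof -
    obtain n where n: "K \<subseteq> C n" using C(3)[OF K] by blast
    obtain k where k: "inverse (real (Suc k)) < e / 2 powr p"
      using reals_Archimedean[of "e / 2 powr p"] e by auto
    obtain N where N: "\<And>i j. i \<ge> N \<Longrightarrow> j \<ge> N \<Longrightarrow> (LINT x|lborel. \<bar>F n (t i) x - F n (t j) x\<bar>) < inverse (real (Suc k))"
      using Pt by blast
    have "(LINT x|lebesgue_on K. \<bar>u (t i) x - u (t j) x\<bar> powr p) < e" if ij: "i \<ge> N" "j \<ge> N" for i j
    proof -
      have Fi: "integrable lborel (\<lambda>x. \<bar>F n (t i) x - F n (t j) x\<bar>)"
        using Cc_integrable[OF C1cD(1)[OF FCU]] by simp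
      then have Fi': "integrable lebesgue (\<lambda>x. \<bar>F n (t i) x - F n (t j) x\<bar>)"
        using borel_measurable_integrable integrable_completion by blast
      have Fi'': "integrable (lebesgue_on UNIV) (\<lambda>x. \<bar>F n (t i) x - F n (t j) x\<bar>)"
        using Fi' by (simp add: lebesgue_on_UNIV_eq)
      note FK = integrable_lebesgue_on_subset[OF Fi'' _ compact_lebesgue[OF K(1)]]
      have cont: "continuous_on UNIV (\<lambda>x. \<bar>u (t i) x - u (t j) x\<bar> powr p)"
        using C1cD(5)[OF uC] p by (intro continuous_intros continuous_on_powr') auto
      have "(LINT x|lebesgue_on K. \<bar>u (t i) x - u (t j) x\<bar> powr p)
          \<le> (LINT x|lebesgue_on K. 2 powr p * \<bar>F n (t i) x - F n (t j) x\<bar>)"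
      proof (rule integral_mono)
        show "integrable (lebesgue_on K) (\<lambda>x. \<bar>u (t i) x - u (t j) x\<bar> powr p)"
          using continuous_Lp_loc[OF cont, of K] K(1) by (auto simp: Lp_loc_1_iff)
        show "integrable (lebesgue_on K) (\<lambda>x. 2 powr p * \<bar>F n (t i) x - F n (t j) x\<bar>)"
          using FK(1) by simp
        fix x assume "x \<in> space (lebesgue_on K)"
        then have "\<eta> n x = 1" using n \<eta>(2) by auto
        then show "\<bar>u (t i) x - u (t j) x\<bar> powr p \<le> 2 powr p * \<bar>F n (t i) x - F n (t j) x\<bar>"
          using abs_diff_powr_le_spowr[OF p, of "u (t i) x" "u (t j) x"] by (simp add: F_def)
      qed
      also have "\<dots> = 2 powr p * (LINT x|lebesgue_on K. \<bar>F n (t i) x - F n (t j) x\<bar>)" by simp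
      also have "\<dots> \<le> 2 powr p * (LINT x|lebesgue_on UNIV. \<bar>F n (t i) x - F n (t j) x\<bar>)"
        by (intro mult_left_mono FK(2)) auto
      also have "(LINT x|lebesgue_on UNIV. \<bar>F n (t i) x - F n (t j) x\<bar>) = (LINT x|lborel. \<bar>F n (t i) x - F n (t j) x\<bar>)"
        using integral_completion[OF borel_measurable_integrable[OF Fi]] by (simp add: lebesgue_on_UNIV_eq)
      also have "2 powr p * \<dots> < 2 powr p * (e / 2 powr p)"
        using N[OF ij] k by (intro mult_strict_left_mono) auto
      finally show ?thesis by simp
    qed
    then show ?thesis by blast
  qed
  have ul: "u (t k) \<in> Lp_loc U 1" for k by (rule X_loc[OF uX])
  have cau1: "\<exists>N. \<forall>i\<ge>N. \<forall>j\<ge>N. (LINT x|lebesgue_on K. norm (u (t i) x - u (t j) x)) < e"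
    if K: "compact K" "K \<subseteq> U" and e: "0 < e" for K e
  proof -
    define Q where "Q = (LINT x|lebesgue_on K. (1::real))"
    have Q: "0 \<le> Q" by (simp add: Q_def)
    have i1: "integrable (lebesgue_on K) (\<lambda>_. 1::real)"
      using compact_continuous_on_integrable[of K "\<lambda>_. 1"] K by simp
    \<comment> \<open>On a set of finite measure L^p smallness gives L^1 smallness: d * Q takes at
      most e / 2, and the p-th powers are made small in terms of d.\<close>
    define d where "d = e / (2 * (Q + 1))"
    have d: "0 < d" "d * Q \<le> e / 2" using e Q by (auto simp: d_def field_simps)
    obtain N where N: "\<And>i j. i \<ge> N \<Longrightarrow> j \<ge> N \<Longrightarrow> (LINT x|lebesgue_on K. \<bar>u (t i) x - u (t j) x\<bar> powr p) < e / 2 / d powr (1 - p)"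
      using cauP[OF K, of "e / 2 / d powr (1 - p)"] d e by auto
    have "(LINT x|lebesgue_on K. norm (u (t i) x - u (t j) x)) < e" if ij: "i \<ge> N" "j \<ge> N" for i j
    proof -
      have cont: "continuous_on UNIV (\<lambda>x. \<bar>u (t i) x - u (t j) x\<bar> powr p)"
        using C1cD(5)[OF uC] p by (intro continuous_intros continuous_on_powr') auto
      have ip: "integrable (lebesgue_on K) (\<lambda>x. \<bar>u (t i) x - u (t j) x\<bar> powr p)"
        using continuous_Lp_loc[OF cont, of K] K(1) by (auto simp: Lp_loc_1_iff)
      have "(LINT x|lebesgue_on K. norm (u (t i) x - u (t j) x))
          \<le> (LINT x|lebesgue_on K. d * 1 + d powr (1 - p) * \<bar>u (t i) x - u (t j) x\<bar> powr p)"
      proof (rule integral_mono)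
        show "integrable (lebesgue_on K) (\<lambda>x. norm (u (t i) x - u (t j) x))"
          using Lp_loc_1_diff[OF ul ul, of i j] K by (auto simp: Lp_loc_1_iff)
        show "integrable (lebesgue_on K) (\<lambda>x. d * 1 + d powr (1 - p) * \<bar>u (t i) x - u (t j) x\<bar> powr p)"
          by (intro Bochner_Integration.integrable_add integrable_mult_right i1 ip)
        show "norm (u (t i) x - u (t j) x) \<le> d * 1 + d powr (1 - p) * \<bar>u (t i) x - u (t j) x\<bar> powr p" for x
          using le_eps_powr[of p "\<bar>u (t i) x - u (t j) x\<bar>" d] p d by simp
      qed
      also have "\<dots> = d * Q + d powr (1 - p) * (LINT x|lebesgue_on K. \<bar>u (t i) x - u (t j) x\<bar> powr p)"
        unfolding Q_def Bochner_Integration.integral_add[OF integrable_mult_right[OF i1] integrable_mult_right[OF ip]]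
        by (simp only: integral_mult_right_zero)
      also have "\<dots> < e / 2 + d powr (1 - p) * (e / 2 / d powr (1 - p))"
        using d N[OF ij] by (intro add_le_less_mono mult_strict_left_mono) auto
      also have "\<dots> = e" using d by simp
      finally show ?thesis .
    qed
    then show ?thesis by blast
  qed
  obtain v r where r: "strict_mono (r :: nat \<Rightarrow> nat)" and ae: "AE x in M. (\<lambda>k. u (t (r k)) x) \<longlonglongrightarrow> v x"
    and L1: "L1_loc_conv U (\<lambda>k. u (t k)) v"
    by (rule L1_loc_complete[OF U ul cau1])
  show ?thesis
  proof (rule exI[of _ t], rule exI[of _ v], intro conjI t L1 allI impI)
    fix K assume K: "compact K" "K \<subseteq> U"
    have aeK: "AE x in lebesgue_on K. (\<lambda>k. u (t (r k)) x) \<longlonglongrightarrow> v x"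
      by (rule AE_lebesgue_on_subset[OF ae]) (use K U in auto)
    have vm: "v \<in> borel_measurable (lebesgue_on K)"
      using L1 K by (auto simp: L1_loc_conv_def Lp_loc_1_iff)
    have um: "u (t k) \<in> borel_measurable (lebesgue_on K)" for k
      using ul[of k] K by (auto simp: Lp_loc_1_iff)
    show "(\<lambda>k. LINT x|lebesgue_on K. \<bar>u (t k) x - v x\<bar> powr p) \<longlonglongrightarrow> 0"
    proof (rule LIMSEQ_I)
      fix e :: real assume e: "0 < e"
      obtain N where N: "\<And>i j. i \<ge> N \<Longrightarrow> j \<ge> N \<Longrightarrow> (LINT x|lebesgue_on K. \<bar>u (t i) x - u (t j) x\<bar> powr p) < e / 2"
        using cauP[OF K, of "e / 2"] e by auto
      have "(LINT x|lebesgue_on K. \<bar>u (t k) x - v x\<bar> powr p) \<le> e / 2" if k: "k \<ge> N" for k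
      proof (rule fatou_real(2)[where h = "\<lambda>j x. \<bar>u (t k) x - u (t (r (j + N))) x\<bar> powr p"])
        fix j
        have cont: "continuous_on UNIV (\<lambda>x. \<bar>u (t k) x - u (t (r (j + N))) x\<bar> powr p)"
          using C1cD(5)[OF uC] p by (intro continuous_intros continuous_on_powr') auto
        show "integrable (lebesgue_on K) (\<lambda>x. \<bar>u (t k) x - u (t (r (j + N))) x\<bar> powr p)"
          using continuous_Lp_loc[OF cont, of K] K(1) by (auto simp: Lp_loc_1_iff)
        have "N \<le> r (j + N)" using seq_suble[OF r, of "j + N"] by simp
        then show "(LINT x|lebesgue_on K. \<bar>u (t k) x - u (t (r (j + N))) x\<bar> powr p) \<le> e / 2"
          using N[OF k, of "r (j + N)"] by simp
      next
        show "AE x in lebesgue_on K. (\<lambda>j. \<bar>u (t k) x - u (t (r (j + N))) x\<bar> powr p) \<longlonglongrightarrow> \<bar>u (t k) x - v x\<bar> powr p"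
          using aeK
        proof eventually_elim
          case (elim x)
          show ?case using p
            by (intro tendsto_intros tendsto_powr' LIMSEQ_ignore_initial_segment[OF elim]) auto
        qed
        show "(\<lambda>x. \<bar>u (t k) x - v x\<bar> powr p) \<in> borel_measurable (lebesgue_on K)"
          using vm um[of k] by measurable
      qed simp
      then show "\<exists>no. \<forall>n\<ge>no. norm ((LINT x|lebesgue_on K. \<bar>u (t n) x - v x\<bar> powr p) - 0) < e"
        using e by (intro exI[of _ N]) force
    qed
  qed
qed

end

section \<open>Best constants on subdomains\<close>

context energy_space
begin

lemma normalizing_factor:
  assumes "0 < a" shows "\<bar>a powr (- (1 / p))\<bar> powr p = 1 / a"
proof -
  have "\<bar>a powr (- (1 / p))\<bar> powr p = a powr (- (1 / p) * p)" by (simp add: powr_powr del: mult_minus_left)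
  also have "- (1 / p) * p = - 1" using p by simp
  finally show ?thesis using assms by (simp add: powr_minus_divide)
qed

lemma Q_scale: "u \<in> X \<Longrightarrow> Q p H V (\<lambda>x. c * u x) U = \<bar>c\<bar> powr p * Q p H V u U"
proof -
  assume u: "u \<in> X"
  have cu: "(\<lambda>x. c * u x) \<in> X" using X_lin[OF u u, of c 0] by simp
  show ?thesis
    unfolding Q_eq[OF u] Q_eq[OF cu]
    using fin_scale(2)[OF domD(3)[OF dom_V(1) u], of c] fin_scale(2)[OF domD(3)[OF dom_V(2) u], of c]
    by (simp add: right_diff_distrib)
qed

text \<open>\<open>wgrad U f\<close> is chosen separately for each U, whereas the classical gradient
  does not depend on U. This form allows Q to be compared on different sets.\<close>

lemma Q_grad:
  assumes f: "f \<in> C1c U"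
  shows "Q p H V f U = (LINT x|M. H x (grad f x) powr p + V x * \<bar>f x\<bar> powr p)"
  unfolding Q_def
proof (rule integral_cong_AE)
  have fX: "f \<in> X" by (rule C1c_X[OF f])
  have [measurable]: "f \<in> borel_measurable M" "wgrad U f \<in> borel_measurable M"
    using X_sob[OF fX] wgrad_meas by (auto simp: sob_def)
  have [measurable]: "grad f \<in> borel_measurable M"
    using borel_measurable_continuous_onI[OF C1cD(4)[OF f]]
    by (intro measurable_restrict_space1 measurable_completion) simp
  show "(\<lambda>x. H x (wgrad U f x) powr p + V x * \<bar>f x\<bar> powr p) \<in> borel_measurable M"
    "(\<lambda>x. H x (grad f x) powr p + V x * \<bar>f x\<bar> powr p) \<in> borel_measurable M" by measurable
  show "AE x in M. H x (wgrad U f x) powr p + V x * \<bar>f x\<bar> powr p = H x (grad f x) powr p + V x * \<bar>f x\<bar> powr p"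
    using wgrad_AE[OF U Ck_1_weak_gradient[OF U C1cD(2)[OF f]]] by eventually_elim simp
qed

text \<open>Infinitely many exceptions would form a subsequence with values below the value at v by
  e, against weak lower semicontinuity.\<close>

lemma weak_lsc_eventually:
  assumes d: "dom X0 \<alpha> \<beta> C" and u: "\<And>k. u k \<in> X0" and B: "\<And>k. E (u k) \<le> B"
    and conv: "L1_loc_conv U u v" and e: "0 < e"
  shows "\<forall>\<^sub>F k in sequentially. I \<alpha> \<beta> v < I \<alpha> \<beta> (u k) + e"
proof (rule ccontr)
  assume "\<not> ?thesis"
  then have "\<exists>k\<ge>N. I \<alpha> \<beta> (u k) \<le> I \<alpha> \<beta> v - e" for N
    unfolding eventually_sequentially by (force simp: not_less)
  then obtain s where s: "strict_mono (s :: nat \<Rightarrow> nat)" "\<And>k. I \<alpha> \<beta> (u (s k)) \<le> I \<alpha> \<beta> v - e"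
    using infinitely_often_subseq[of "\<lambda>k. I \<alpha> \<beta> (u k) \<le> I \<alpha> \<beta> v - e"] by blast
  have v: "v \<in> X0" by (rule weak_limit(1)[OF u B conv])
  have "I \<alpha> \<beta> v \<le> I \<alpha> \<beta> v - e"
    by (rule I_weak_lsc[OF X0_diff X0_lin X0_subset d u v B L1_loc_conv_subseq[OF conv s(1)] s(2)])
  then show False using e by simp
qed

text \<open>By density and scaling this is the common value of the constant over compactly supported
  Sobolev functions and of the one over elements of \<open>X0\<close> of mass 1.\<close>

definition Tc :: "('a \<Rightarrow> real) \<Rightarrow> ereal" where
  "Tc g = Inf {ereal (Q p H V f U / weighted_mass p g f U) |f. f \<in> Cc_inf U \<and> weighted_mass p g f U > 0}"

lemma mass_continuous:
  assumes g: "g \<in> hardy_weights p H V U" and u: "\<And>k. u k \<in> X0" and v: "v \<in> X0"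
    and lim: "(\<lambda>k. E (\<lambda>x. u k x - v x)) \<longlonglongrightarrow> 0"
  shows "(\<lambda>k. weighted_mass p g (u k) U) \<longlonglongrightarrow> weighted_mass p g v U"
proof -
  obtain C where C: "dom X0 (\<lambda>_. 0) (\<lambda>x. \<bar>g x\<bar>) C" using hardy_dom[OF g] by blast
  show ?thesis unfolding mass_eq by (rule I_continuous[OF X0_diff X0_subset C u v lim])
qed

text \<open>Q and the mass are both continuous on \<open>X0\<close>, so the quotient of u is a limit
  of quotients of test functions, whose masses are eventually positive.\<close>

lemma Tc_le:
  assumes g: "g \<in> hardy_weights p H V U" and u: "u \<in> X0" and pos: "0 < weighted_mass p g u U"
  shows "Tc g \<le> ereal (Q p H V u U / weighted_mass p g u U)"
proof -
  obtain h where h: "\<And>n::nat. h n \<in> Cc_inf U" "(\<lambda>n. E (\<lambda>x. h n x - u x)) \<longlonglongrightarrow> 0" using X0_seq[OF u] by blast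
  have m: "(\<lambda>n. weighted_mass p g (h n) U) \<longlonglongrightarrow> weighted_mass p g u U"
    by (rule mass_continuous[OF g Cc_inf_X0[OF h(1)] u h(2)])
  have q: "(\<lambda>n. Q p H V (h n) U) \<longlonglongrightarrow> Q p H V u U"
    by (rule Q_continuous[OF Cc_inf_X[OF h(1)] X0_X[OF u] h(2)])
  have lim: "(\<lambda>n. ereal (Q p H V (h n) U / weighted_mass p g (h n) U)) \<longlonglongrightarrow> ereal (Q p H V u U / weighted_mass p g u U)"
    using pos by (intro tendsto_intros m q) auto
  have "\<forall>\<^sub>F n in sequentially. 0 < weighted_mass p g (h n) U" using m pos by (rule order_tendstoD)
  then have "\<forall>\<^sub>F n in sequentially. Tc g \<le> ereal (Q p H V (h n) U / weighted_mass p g (h n) U)"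
  proof eventually_elim
    case (elim n)
    then show ?case unfolding Tc_def using h(1)[of n] by (intro Inf_lower) blast
  qed
  then show ?thesis by (intro tendsto_lowerbound[OF lim]) auto
qed

text \<open>One inequality is density. For the other, a test function of positive mass is scaled to
  mass 1, which changes Q into the quotient by p-homogeneity.\<close>

lemma S_on_eq_Tc:
  assumes g: "g \<in> hardy_weights p H V U"
  shows "S_on p H V w g U = Tc g"
proof (rule antisym)
  show "Tc g \<le> S_on p H V w g U"
    unfolding S_on_def
  proof (rule Inf_greatest)
    fix y assume "y \<in> {ereal (Q p H V \<phi> U) |\<phi>. \<phi> \<in> X0 \<and> weighted_mass p g \<phi> U = 1}"
    then obtain \<phi> where "y = ereal (Q p H V \<phi> U)" "\<phi> \<in> X0" "weighted_mass p g \<phi> U = 1" by blast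
    then show "Tc g \<le> y" using Tc_le[OF g, of \<phi>] by simp
  qed
  show "S_on p H V w g U \<le> Tc g"
    unfolding Tc_def
  proof (rule Inf_greatest)
    fix y assume "y \<in> {ereal (Q p H V f U / weighted_mass p g f U) |f. f \<in> Cc_inf U \<and> weighted_mass p g f U > 0}"
    then obtain f where f: "y = ereal (Q p H V f U / weighted_mass p g f U)" "f \<in> Cc_inf U" "weighted_mass p g f U > 0" by blast
    have fX0: "f \<in> X0" by (rule Cc_inf_X0[OF f(2)])
    obtain C where C: "dom X0 (\<lambda>_. 0) (\<lambda>x. \<bar>g x\<bar>) C" using hardy_dom[OF g] by blast
    define c where "c = weighted_mass p g f U powr (- (1 / p))"
    have cp: "\<bar>c\<bar> powr p = 1 / weighted_mass p g f U"
      unfolding c_def by (rule normalizing_factor[OF f(3)])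
    have "weighted_mass p g (\<lambda>x. c * f x) U = \<bar>c\<bar> powr p * weighted_mass p g f U"
      unfolding mass_eq by (rule fin_scale(2)[OF domD(3)[OF C fX0] domD(1,2)[OF C]])
    then have "weighted_mass p g (\<lambda>x. c * f x) U = 1" using cp f(3) by simp
    moreover have "Q p H V (\<lambda>x. c * f x) U = Q p H V f U / weighted_mass p g f U"
      using Q_scale[OF X0_X[OF fX0], of c] cp by simp
    ultimately show "S_on p H V w g U \<le> y"
      unfolding S_on_def f(1) using X0_scale[OF fX0, of c]
      by (intro Inf_lower CollectI exI[of _ "\<lambda>x. c * f x"]) auto
  qed
qed

lemma S_const_eq_Tc:
  assumes g: "g \<in> hardy_weights p H V U"
  shows "S_const p H V U g = Tc g"
proof (rule antisym)
  show "Tc g \<le> S_const p H V U g"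
    unfolding S_const_def
  proof (rule Inf_greatest)
    fix y assume "y \<in> {ereal (Q p H V \<phi> U / weighted_mass p g \<phi> U) |\<phi>. \<phi> \<in> W1p U p \<inter> Cc U \<and> weighted_mass p g \<phi> U > 0}"
    then obtain \<phi> where \<phi>: "y = ereal (Q p H V \<phi> U / weighted_mass p g \<phi> U)" "\<phi> \<in> W1p U p \<inter> Cc U" "weighted_mass p g \<phi> U > 0" by blast
    then show "Tc g \<le> y" using Tc_le[OF g W1p_Cc_X0, of \<phi>] by simp
  qed
  show "S_const p H V U g \<le> Tc g"
    unfolding S_const_def Tc_def using C1c_W1p Cc_inf_C1c by (intro Inf_superset_mono) blast
qed

lemma Q_nonneg_X0:
  assumes "\<And>\<phi>. \<phi> \<in> Cc_inf U \<Longrightarrow> 0 \<le> Q p H V \<phi> U" and u: "u \<in> X0"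
  shows "0 \<le> Q p H V u U"
proof -
  obtain h where h: "\<And>n::nat. h n \<in> Cc_inf U" "(\<lambda>n. E (\<lambda>x. h n x - u x)) \<longlonglongrightarrow> 0" using X0_seq[OF u] by blast
  have q: "(\<lambda>n. Q p H V (h n) U) \<longlonglongrightarrow> Q p H V u U"
    by (rule Q_continuous[OF Cc_inf_X[OF h(1)] X0_X[OF u] h(2)])
  then show ?thesis by (rule LIMSEQ_le_const) (use assms(1)[OF h(1)] in auto)
qed

end

locale hardy_setting =
  fixes p :: real and \<Omega> :: "'a::euclidean_space set" and \<omega> :: "nat \<Rightarrow> 'a set" and H :: "'a \<Rightarrow> 'a \<Rightarrow> real"
    and V g :: "'a \<Rightarrow> real" and w :: "'a set \<Rightarrow> 'a \<Rightarrow> real"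
  assumes p: "1 < p" and dom\<Omega>: "is_domain \<Omega>" and exh: "smooth_exhaustion \<omega> \<Omega>"
    and dom_compl: "\<And>i. is_domain (\<Omega> - closure (\<omega> i))"
    and adm: "admissible_norm_family \<Omega> H" and cuc: "commonly_uniformly_convex \<Omega> H"
    and V_loc: "V \<in> Lp_loc \<Omega> 1" and subcrit: "subcritical p H V \<Omega>"
    and wc: "weight_choice p H V \<Omega> w" and npc: "neg_part_compactness p H V w \<Omega>"
    and g: "g \<in> hardy_weights p H V \<Omega>"

lemma exhaustion_mono:
  assumes "smooth_exhaustion \<omega> \<Omega>"
  shows "i \<le> j \<Longrightarrow> \<omega> i \<subseteq> \<omega> j"
proof (induction j)
  case (Suc j)
  have "\<omega> j \<subseteq> \<omega> (Suc j)"
    using assms closure_subset[of "\<omega> j"] by (auto simp: smooth_exhaustion_def compactly_in_def)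
  then show ?case using Suc by (auto simp: le_Suc_eq)
qed simp

lemma exhaustion_dom:
  assumes ex: "smooth_exhaustion \<omega> \<Omega>"
  shows "is_domain (\<omega> k)" "\<omega> k \<Subset> \<Omega>" "compact (closure (\<omega> k))" "closure (\<omega> k) \<subseteq> \<Omega>" "\<omega> k \<subseteq> \<Omega>"
proof -
  have a: "C1_domain (\<omega> k)" "\<omega> k \<Subset> \<omega> (Suc k)" "\<omega> (Suc k) \<Subset> \<Omega>"
    using ex by (auto simp: smooth_exhaustion_def)
  show "is_domain (\<omega> k)" using a(1) by (simp add: C1_domain_def)
  have "closure (\<omega> k) \<subseteq> \<omega> (Suc k)" "\<omega> (Suc k) \<subseteq> \<Omega>"
    using a(2,3) closure_subset[of "\<omega> (Suc k)"] by (auto simp: compactly_in_def)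
  then show b: "closure (\<omega> k) \<subseteq> \<Omega>" by (rule order_trans)
  show c: "compact (closure (\<omega> k))" using a(2) by (simp add: compactly_in_def)
  show "\<omega> k \<Subset> \<Omega>" using b c by (simp add: compactly_in_def)
  show "\<omega> k \<subseteq> \<Omega>" using b closure_subset[of "\<omega> k"] by (rule order_trans[rotated])
qed

lemma exhaustion_compact:
  assumes ex: "smooth_exhaustion \<omega> \<Omega>" and K: "compact K" "K \<subseteq> \<Omega>"
  obtains k where "K \<subseteq> \<omega> k"
proof -
  have "open (\<omega> k)" for k using ex by (simp add: smooth_exhaustion_def C1_domain_def is_domain_def)
  moreover have "K \<subseteq> (\<Union>k\<in>UNIV. \<omega> k)" using ex K by (simp add: smooth_exhaustion_def)
  ultimately obtain F where F: "finite F" "K \<subseteq> (\<Union>k\<in>F. \<omega> k)"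
    using compactE_image[OF K(1), of UNIV \<omega>] by metis
  have "K \<subseteq> \<omega> (Max F)"
  proof
    fix x assume "x \<in> K"
    then obtain k where "k \<in> F" "x \<in> \<omega> k" using F by blast
    then show "x \<in> \<omega> (Max F)" using exhaustion_mono[OF ex Max_ge[OF F(1)]] by blast
  qed
  then show thesis by (rule that)
qed

lemma Lp_loc_mono: "U \<subseteq> U' \<Longrightarrow> f \<in> Lp_loc U' q \<Longrightarrow> f \<in> Lp_loc U q"
  by (auto simp: Lp_loc_def)

text \<open>The Morrey condition is imposed on domains, so a compact set is first enclosed in a
  member of the exhaustion.\<close>

lemma morrey_loc_Lp_loc:
  fixes V :: "'a::euclidean_space \<Rightarrow> real"
  assumes ex: "smooth_exhaustion \<omega> \<Omega>" and V: "V \<in> morrey_loc p q \<Omega>"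
  shows "V \<in> Lp_loc \<Omega> 1"
  unfolding Lp_loc_1_iff
proof safe
  fix K assume K: "compact K" "K \<subseteq> \<Omega>"
  obtain k where k: "K \<subseteq> \<omega> k" by (rule exhaustion_compact[OF ex K])
  have "is_domain (\<omega> k) \<and> \<omega> k \<Subset> \<Omega>" using exhaustion_dom[OF ex] by blast
  then have Vk: "V \<in> morrey p q (\<omega> k)" and o: "open (\<omega> k)" using V by (auto simp: morrey_loc_def is_domain_def)
  show "integrable (lebesgue_on K) V"
  proof (cases "p > real DIM('a)")
    case True
    then have "V \<in> Lp (\<omega> k) 1" using Vk by (simp add: morrey_def)
    then have "integrable (lebesgue_on (\<omega> k)) V" by (auto simp: Lp_def intro: integrable_abs_cancel)
    then show ?thesis by (rule integrable_lebesgue_on_subset(1)) (use o K k in auto)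
  next
    case False
    then have "V \<in> Lp_loc (\<omega> k) 1" using Vk by (simp add: morrey_def)
    then show ?thesis using K k by (auto simp: Lp_loc_1_iff)
  qed
qed

section \<open>Comparison of subdomains, coercivity of Q, and minimising sequences\<close>

context hardy_setting
begin

lemma open_\<Omega>: "open \<Omega>"
  using dom\<Omega> by (simp add: is_domain_def)

lemmas exh_dom = exhaustion_dom[OF exh]

lemma energy_spaceI:
  assumes U: "open U" "U \<subseteq> \<Omega>" and w': "continuous_on U (w' U)" "\<And>x. x \<in> U \<Longrightarrow> 0 < w' U x"
  shows "energy_space p H V w' U"
proof
  have Ul: "U \<in> sets lebesgue" "\<Omega> \<in> sets lebesgue" using U open_\<Omega> by auto
  note sub = AE_lebesgue_on_subset[OF _ Ul(2,1) U(2)]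
  show "1 < p" "open U" by (fact p, fact U)
  show "AE x in lebesgue_on U. is_norm (H x)" by (rule sub) (use adm in \<open>simp add: admissible_norm_family_def\<close>)
  show "(\<lambda>x. H x \<xi>) \<in> borel_measurable (lebesgue_on U)" for \<xi>
  proof (rule measurable_restrict_mono[OF _ U(2)])
    show "(\<lambda>x. H x \<xi>) \<in> borel_measurable (lebesgue_on \<Omega>)" using adm unfolding admissible_norm_family_def by blast
  qed
  show "\<exists>\<kappa> \<nu>. 0 < \<kappa> \<and> 0 < \<nu> \<and> (AE x in lebesgue_on K. \<forall>\<xi>. \<kappa> * norm \<xi> \<le> H x \<xi> \<and> H x \<xi> \<le> \<nu> * norm \<xi>)"
    if K: "compact K" "K \<subseteq> U" for K
  proof -
    have "K \<subseteq> \<Omega>" using K U by blast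
    then obtain k where k: "K \<subseteq> \<omega> k" by (rule exhaustion_compact[OF exh K(1)])
    obtain \<kappa> \<nu> where \<kappa>: "0 < \<kappa>" "\<kappa> \<le> \<nu>" "AE x in lebesgue_on (\<omega> k). \<forall>\<xi>. \<kappa> * norm \<xi> \<le> H x \<xi> \<and> H x \<xi> \<le> \<nu> * norm \<xi>"
      using adm exh_dom(1,2)[of k] unfolding admissible_norm_family_def by blast
    have "AE x in lebesgue_on K. \<forall>\<xi>. \<kappa> * norm \<xi> \<le> H x \<xi> \<and> H x \<xi> \<le> \<nu> * norm \<xi>"
      by (rule AE_lebesgue_on_subset[OF \<kappa>(3)]) (use k K exh_dom(1)[of k] in \<open>auto simp: is_domain_def\<close>)
    then show ?thesis using \<kappa>(1,2) by (intro exI[of _ \<kappa>] exI[of _ \<nu>]) auto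
  qed
  show "\<exists>\<delta>>0. AE x in lebesgue_on U. convexity_bound (H x) e \<delta>" if e: "0 < e" "e \<le> 1" for e
  proof -
    obtain N where N: "N \<in> null_sets lebesgue" and pos: "\<forall>e\<in>{0<..2}. (INF x\<in>\<Omega> - N. convexity_modulus (H x) e) > 0"
      using cuc by (auto simp: commonly_uniformly_convex_def)
    then have "0 < (INF x\<in>\<Omega> - N. convexity_modulus (H x) e)" using e by simp
    then obtain \<delta> where \<delta>: "0 < ereal \<delta>" "ereal \<delta> < (INF x\<in>\<Omega> - N. convexity_modulus (H x) e)"
      using ereal_dense2 by blast
    have "convexity_bound (H x) e \<delta>" if x: "x \<in> \<Omega> - N" for x
      unfolding convexity_bound_def
    proof (intro allI impI)
      fix \<xi> \<eta> assume A: "H x \<xi> = 1" "H x \<eta> = 1" "e \<le> H x (\<xi> - \<eta>)"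
      have "ereal \<delta> < convexity_modulus (H x) e" using \<delta>(2) INF_lower[OF x] by (rule less_le_trans)
      also have "\<dots> \<le> ereal (1 - H x ((\<xi> + \<eta>) /\<^sub>R 2))"
        unfolding convexity_modulus_def using A by (intro Inf_lower) blast
      finally show "H x ((\<xi> + \<eta>) /\<^sub>R 2) \<le> 1 - \<delta>" by simp
    qed
    moreover have "AE x in lebesgue. x \<notin> N" using N by (rule AE_not_in)
    ultimately have "AE x in lebesgue_on U. convexity_bound (H x) e \<delta>"
      using U(2) Ul by (auto simp: AE_restrict_space_iff elim!: eventually_mono)
    then show ?thesis using \<delta>(1) by auto
  qed
  show "V \<in> Lp_loc U 1" by (rule Lp_loc_mono[OF U(2) V_loc])
qed (use w' in auto)

text \<open>For C^1 functions both values of Q integrate the same expression in the classical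
  gradient. Outside the support this expression vanishes almost everywhere, namely where
  \<open>H x\<close> is a norm.\<close>

lemma
  assumes U: "open U" "U \<subseteq> \<Omega>" and f: "f \<in> C1c U"
  shows Q_local: "Q p H V f U = Q p H V f \<Omega>"
    and mass_local: "weighted_mass p h f U = weighted_mass p h f \<Omega>"
proof -
  \<comment> \<open>The constant weight 1 is taken because weights are chosen for subcritical
    domains only, and U is an arbitrary open set here.\<close>
  interpret U: energy_space p H V "\<lambda>_ _. 1" U by (rule energy_spaceI[OF U]) auto
  interpret O: energy_space p H V "\<lambda>_ _. 1" \<Omega> by (rule energy_spaceI[OF open_\<Omega>]) auto
  have f\<Omega>: "f \<in> C1c \<Omega>" using C1c_mono[OF U(2)] f by blast
  obtain K where K: "compact K" "K \<subseteq> U" "\<And>x. x \<notin> K \<Longrightarrow> f x = 0" "\<And>x. x \<notin> K \<Longrightarrow> grad f x = 0"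
    using C1c_grad_outside[OF f] by metis
  define F where "F x = H x (grad f x) powr p + V x * \<bar>f x\<bar> powr p" for x
  have Ul: "U \<in> sets lebesgue" "\<Omega> \<in> sets lebesgue" using U open_\<Omega> by auto
  have Fm: "F \<in> borel_measurable (lebesgue_on \<Omega>)"
  proof -
    have [measurable]: "f \<in> borel_measurable (lebesgue_on \<Omega>)" "grad f \<in> borel_measurable (lebesgue_on \<Omega>)"
      using borel_measurable_continuous_onI[OF C1cD(4)[OF f]] borel_measurable_continuous_onI[OF C1cD(5)[OF f]]
      by (intro measurable_restrict_space1 measurable_completion, simp)+
    show ?thesis unfolding F_def by measurable
  qed
  have Fm': "(\<lambda>x. indicator \<Omega> x *\<^sub>R F x) \<in> borel_measurable lebesgue"
    using Fm Ul by (simp add: borel_measurable_restrict_space_iff mult.commute)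
  have "(LINT x|lebesgue_on U. F x) = (LINT x|lebesgue. indicator U x *\<^sub>R F x)" using Ul by (simp add: integral_restrict_space)
  also have "\<dots> = (LINT x|lebesgue. indicator \<Omega> x *\<^sub>R F x)"
  proof (rule integral_cong_AE[OF _ Fm'])
    have "(\<lambda>x. indicator U x *\<^sub>R F x) = (\<lambda>x. indicator U x *\<^sub>R (indicator \<Omega> x *\<^sub>R F x))"
      by (rule ext) (use U(2) in \<open>auto simp: indicator_def\<close>)
    then show "(\<lambda>x. indicator U x *\<^sub>R F x) \<in> borel_measurable lebesgue" using Fm' Ul by simp
    have "AE x in lebesgue. x \<in> \<Omega> \<longrightarrow> is_norm (H x)" using O.H_norm Ul by (simp add: AE_restrict_space_iff)
    then show "AE x in lebesgue. indicator U x *\<^sub>R F x = indicator \<Omega> x *\<^sub>R F x"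
    proof eventually_elim
      case (elim x)
      show ?case
      proof (cases "x \<in> \<Omega> \<and> x \<notin> U")
        case True
        then have "x \<notin> K" using K(2) by blast
        with True have "F x = 0" using elim K(2) K(3,4)[of x] is_norm_simps(4)[of "H x" 0] p by (auto simp: F_def)
        then show ?thesis by simp
      qed (use U(2) in \<open>auto simp: indicator_def\<close>)
    qed
  qed
  also have "\<dots> = (LINT x|lebesgue_on \<Omega>. F x)" using Ul by (simp add: integral_restrict_space)
  finally show "Q p H V f U = Q p H V f \<Omega>" unfolding U.Q_grad[OF f] O.Q_grad[OF f\<Omega>] F_def .
  have f0: "f x = 0" if "x \<notin> U" for x using K(2) K(3)[of x] that by blast
  then have f0': "f x = 0" if "x \<notin> \<Omega>" for x using U(2) that by blast
  show "weighted_mass p h f U = weighted_mass p h f \<Omega>"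
    unfolding weighted_mass_def
    using lebesgue_on_integral_outside(1)[of U "\<lambda>x. \<bar>h x\<bar> * \<bar>f x\<bar> powr p"]
      lebesgue_on_integral_outside(1)[of \<Omega> "\<lambda>x. \<bar>h x\<bar> * \<bar>f x\<bar> powr p"] Ul p by (simp add: f0 f0')
qed

lemma hardy_weights_mono:
  assumes U: "open U" "U \<subseteq> \<Omega>" and h: "h \<in> hardy_weights p H V \<Omega>"
  shows "h \<in> hardy_weights p H V U"
proof -
  obtain C where C: "0 < C" "\<forall>\<phi>\<in>Cc_inf \<Omega>. Q p H V \<phi> \<Omega> \<ge> C * weighted_mass p h \<phi> \<Omega>" and hl: "h \<in> Lp_loc \<Omega> 1"
    using h by (auto simp: hardy_weights_def)
  have "Q p H V \<phi> U \<ge> C * weighted_mass p h \<phi> U" if \<phi>: "\<phi> \<in> Cc_inf U" for \<phi>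
  proof -
    have "\<phi> \<in> C1c U" "\<phi> \<in> Cc_inf \<Omega>" using \<phi> Cc_inf_C1c Cc_inf_mono[OF U(2)] by blast+
    then show ?thesis using C(2) Q_local[OF U] mass_local[OF U] by auto
  qed
  then show ?thesis using C(1) Lp_loc_mono[OF U(2) hl] by (auto simp: hardy_weights_def)
qed

text \<open>Hardy inequalities restrict to the test functions of U, and the weight chosen for
  \<Omega> is positive on the nonempty open set U.\<close>

lemma subcritical_sub:
  assumes U: "is_domain U" "U \<subseteq> \<Omega>"
  shows "subcritical p H V U"
proof -
  have oU: "open U" "U \<noteq> {}" using U by (auto simp: is_domain_def)
  have w\<Omega>: "w \<Omega> \<in> hardy_weights p H V \<Omega>" "\<And>x. x \<in> \<Omega> \<Longrightarrow> 0 < w \<Omega> x"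
    using wc dom\<Omega> subcrit by (auto simp: weight_choice_def)
  have "nonzero_on U (w \<Omega>)"
    unfolding nonzero_on_def
  proof
    assume "AE x in lebesgue_on U. w \<Omega> x = 0"
    then have "AE x in lebesgue. x \<in> U \<longrightarrow> w \<Omega> x = 0" using oU by (simp add: AE_restrict_space_iff)
    then have "AE x in lebesgue. x \<notin> U"
    proof eventually_elim
      case (elim x)
      then show ?case using w\<Omega>(2)[of x] U(2) by auto
    qed
    then have "U \<in> null_sets lebesgue" using oU by (simp add: AE_iff_null_sets)
    then have "negligible U" by (simp add: negligible_iff_null_sets)
    then show False using open_not_negligible[OF oU] by blast
  qed
  moreover have "0 \<le> Q p H V \<phi> U" if \<phi>: "\<phi> \<in> Cc_inf U" for \<phi>
  proof -
    have "\<phi> \<in> C1c U" "\<phi> \<in> Cc_inf \<Omega>" using \<phi> Cc_inf_C1c Cc_inf_mono[OF U(2)] by blast+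
    then show ?thesis using subcrit Q_local[OF oU(1) U(2)] by (auto simp: subcritical_def)
  qed
  ultimately show ?thesis
    unfolding subcritical_def using hardy_weights_mono[OF oU(1) U(2) w\<Omega>(1)] by blast
qed

lemma energy_space_sub:
  assumes U: "is_domain U" "U \<subseteq> \<Omega>"
  shows "energy_space p H V w U"
  by (rule energy_spaceI) (use U wc subcritical_sub[OF U] in \<open>auto simp: is_domain_def weight_choice_def\<close>)

text \<open>All quotients are evaluated in \<Omega>, and U only restricts the test functions. This
  makes monotonicity in U immediate and lets bounds from different pieces be added.\<close>

definition T :: "'a set \<Rightarrow> ereal" where
  "T U = Inf {ereal (Q p H V f \<Omega> / weighted_mass p g f \<Omega>) |f. f \<in> Cc_inf U \<and> weighted_mass p g f \<Omega> > 0}"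

lemma T_antimono: "U \<subseteq> U' \<Longrightarrow> T U' \<le> T U"
  unfolding T_def using Cc_inf_mono by (intro Inf_superset_mono) blast

lemma S_on_eq:
  assumes U: "is_domain U" "U \<subseteq> \<Omega>" shows "S_on p H V w g U = T U"
proof -
  interpret U: energy_space p H V w U by (rule energy_space_sub[OF U])
  have eq: "Q p H V f U = Q p H V f \<Omega> \<and> weighted_mass p g f U = weighted_mass p g f \<Omega>" if "f \<in> Cc_inf U" for f
    using Q_local[OF U.U U(2)] mass_local[OF U.U U(2)] that Cc_inf_C1c by blast
  have "U.Tc g = T U"
    unfolding U.Tc_def T_def
  proof (rule arg_cong[of _ _ Inf], intro Collect_cong ex_cong1)
    fix y f
    show "(y = ereal (Q p H V f U / weighted_mass p g f U) \<and> f \<in> Cc_inf U \<and> weighted_mass p g f U > 0)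
      = (y = ereal (Q p H V f \<Omega> / weighted_mass p g f \<Omega>) \<and> f \<in> Cc_inf U \<and> weighted_mass p g f \<Omega> > 0)"
      using eq[of f] by auto
  qed
  then show ?thesis using U.S_on_eq_Tc[OF hardy_weights_mono[OF U.U U(2) g]] by simp
qed

sublocale O: energy_space p H V w \<Omega>
  by (rule energy_space_sub[OF dom\<Omega> order_refl])

lemma S_const_eq: "S_const p H V \<Omega> g = T \<Omega>"
  using O.S_const_eq_Tc[OF g] by (simp add: O.Tc_def T_def)

lemma Q_nonneg: "u \<in> O.X0 \<Longrightarrow> 0 \<le> Q p H V u \<Omega>"
  using O.Q_nonneg_X0 subcrit by (auto simp: subcritical_def)

text \<open>Passes from smooth to C^1 test functions, the class to which the cut-off sequences
  belong. If the mass vanishes, the bound is Q \<ge> 0.\<close>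

lemma T_bound:
  assumes U: "is_domain U" "U \<subseteq> \<Omega>" and c: "ereal c \<le> T U" and f: "f \<in> C1c U"
  shows "c * weighted_mass p g f \<Omega> \<le> Q p H V f \<Omega>"
proof -
  interpret U: energy_space p H V w U by (rule energy_space_sub[OF U])
  have f\<Omega>: "f \<in> O.X0" using C1c_mono[OF U(2)] f O.C1c_X0 by blast
  have m0: "0 \<le> weighted_mass p g f \<Omega>" by (simp add: weighted_mass_def)
  note l = Q_local[OF U.U U(2) f] mass_local[OF U.U U(2) f, of g]
  show ?thesis
  proof (cases "weighted_mass p g f \<Omega> = 0")
    case False
    then have pos: "0 < weighted_mass p g f U" using m0 l by simp
    have gU: "g \<in> hardy_weights p H V U" by (rule hardy_weights_mono[OF U.U U(2) g])
    have "ereal c \<le> U.Tc g" using c S_on_eq[OF U] U.S_on_eq_Tc[OF gU] by simp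
    also have "\<dots> \<le> ereal (Q p H V f U / weighted_mass p g f U)" by (rule U.Tc_le[OF gU U.C1c_X0[OF f] pos])
    finally show ?thesis using pos l by (simp add: field_simps)
  qed (use Q_nonneg[OF f\<Omega>] in simp)
qed

text \<open>The constants increase with i, so the \<open>lim\<close> in the definition is a genuine
  limit and equals the supremum.\<close>

lemma S_infinity_bound:
  assumes "c < S_infinity p H V w \<Omega> \<omega> g"
  obtains i where "\<And>j. i \<le> j \<Longrightarrow> c < T (\<Omega> - closure (\<omega> j))"
proof -
  have eq: "S_on p H V w g (\<Omega> - closure (\<omega> i)) = T (\<Omega> - closure (\<omega> i))" for i
    by (rule S_on_eq[OF dom_compl]) auto
  have inc: "T (\<Omega> - closure (\<omega> i)) \<le> T (\<Omega> - closure (\<omega> j))" if "i \<le> j" for i j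
    by (rule T_antimono) (use closure_mono[OF exhaustion_mono[OF exh that]] in auto)
  have "(\<lambda>i. T (\<Omega> - closure (\<omega> i))) \<longlonglongrightarrow> (SUP i. T (\<Omega> - closure (\<omega> i)))"
    using inc by (intro LIMSEQ_SUP) (auto simp: incseq_def)
  then have "S_infinity p H V w \<Omega> \<omega> g = (SUP i. T (\<Omega> - closure (\<omega> i)))"
    unfolding S_infinity_def eq by (rule limI)
  then obtain i where "c < T (\<Omega> - closure (\<omega> i))" using assms by (auto simp: less_SUP_iff)
  then show thesis using inc by (intro that[of i]) (rule less_le_trans)
qed

text \<open>For x inside \<Omega> and small r the intersection with \<Omega> is the ball itself, a
  domain. The constants grow as r decreases, so the \<open>Lim\<close> is the supremum over small
  radii.\<close>

lemma S_local_bound: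
  assumes x: "x \<in> \<Omega>" and c: "c < S_local p H V w \<Omega> g x"
  obtains r0 where "0 < r0" "\<And>r. 0 < r \<Longrightarrow> r \<le> r0 \<Longrightarrow> ball x r \<subseteq> \<Omega> \<and> c < T (ball x r)"
proof -
  obtain R where R: "0 < R" "ball x R \<subseteq> \<Omega>" using open_\<Omega> x by (meson open_contains_ball)
  define f where "f r = S_on p H V w g (\<Omega> \<inter> ball x r)" for r
  have feq: "f r = T (ball x r)" and sub: "ball x r \<subseteq> \<Omega>" if r: "0 < r" "r \<le> R" for r
  proof -
    show sub: "ball x r \<subseteq> \<Omega>" using R(2) subset_ball[OF r(2), of x] by blast
    then have "\<Omega> \<inter> ball x r = ball x r" by blast
    then show "f r = T (ball x r)" using S_on_eq[of "ball x r"] sub r by (simp add: f_def is_domain_def)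
  qed
  have anti: "T (ball x r') \<le> T (ball x r)" if "r \<le> r'" for r r'
    by (rule T_antimono[OF subset_ball[OF that]])
  define L where "L = (SUP r\<in>{0<..R}. f r)"
  have "(f \<longlongrightarrow> L) (at_right 0)"
  proof (rule order_tendstoI)
    fix a assume "a < L"
    then obtain r where r: "0 < r" "r \<le> R" "a < f r" by (auto simp: L_def less_SUP_iff)
    have "\<forall>\<^sub>F s in at_right 0. s \<in> {0<..<r}" by (rule eventually_at_right_real[OF r(1)])
    then show "\<forall>\<^sub>F s in at_right 0. a < f s"
    proof eventually_elim
      case (elim s)
      then show ?case using r anti[of s r] feq[of s] feq[of r] by (auto intro: less_le_trans)
    qed
  next
    fix a assume a: "L < a"
    have "\<forall>\<^sub>F s in at_right 0. s \<in> {0<..<R}" by (rule eventually_at_right_real[OF R(1)])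
    then show "\<forall>\<^sub>F s in at_right 0. f s < a"
    proof eventually_elim
      case (elim s)
      then have "f s \<le> L" unfolding L_def by (intro SUP_upper) auto
      then show ?case using a by simp
    qed
  qed
  then have "S_local p H V w \<Omega> g x = L"
    unfolding S_local_def f_def[symmetric] by (intro tendsto_Lim) auto
  then obtain r0 where r0: "0 < r0" "r0 \<le> R" "c < f r0" using c by (auto simp: L_def less_SUP_iff)
  show thesis
  proof (rule that[OF r0(1)])
    fix r assume r: "0 < r" "r \<le> r0"
    then show "ball x r \<subseteq> \<Omega> \<and> c < T (ball x r)"
      using sub[of r] anti[OF r(2)] r0 feq[OF r0(1,2)] by (auto intro: less_le_trans)
  qed
qed

lemma w_hardy: "w \<Omega> \<in> hardy_weights p H V \<Omega>"
  using wc dom\<Omega> subcrit by (auto simp: weight_choice_def)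

lemma neg_part_subseq:
  assumes "Wt0_weakly_converges p H V w \<Omega> u v"
  obtains s where "strict_mono (s :: nat \<Rightarrow> nat)"
    "(\<lambda>k. O.I (\<lambda>_. 0) (neg_part V) (u (s k))) \<longlonglongrightarrow> O.I (\<lambda>_. 0) (neg_part V) v"
proof -
  have "\<exists>s. strict_mono (s :: nat \<Rightarrow> nat) \<and> (\<lambda>k. LINT x|lebesgue_on \<Omega>. neg_part V x * \<bar>u (s k) x\<bar> powr p)
      \<longlonglongrightarrow> (LINT x|lebesgue_on \<Omega>. neg_part V x * \<bar>v x\<bar> powr p)"
    using npc assms unfolding neg_part_compactness_def by blast
  then show thesis using that by (auto simp: O.I_def O.D_def)
qed

text \<open>A normalised counterexample sequence has vanishing \<open>Q\<close>, hence vanishing \<open>w\<close>-mass, hence weak limit \<open>0\<close>;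
  then compactness of \<open>V\<^sup>-\<close> makes its energy vanish.\<close>
lemma E_le_Q: "\<exists>C. \<forall>f\<in>Cc_inf \<Omega>. O.E f \<le> C * Q p H V f \<Omega>"
proof (rule ccontr)
  assume "\<not> ?thesis"
  then have "\<forall>n. \<exists>f. f \<in> Cc_inf \<Omega> \<and> real n * Q p H V f \<Omega> < O.E f" by (meson not_le)
  then obtain f where f: "\<And>n. f n \<in> Cc_inf \<Omega>" "\<And>n. real n * Q p H V (f n) \<Omega> < O.E (f n)" by metis
  have Epos: "0 < O.E (f n)" for n
  proof -
    have "0 \<le> real n * Q p H V (f n) \<Omega>" using Q_nonneg[OF O.Cc_inf_X0[OF f(1)]] by simp
    then show ?thesis using f(2)[of n] by linarith
  qed
  define h where "h n x = O.E (f n) powr (- (1 / p)) * f n x" for n x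
  have h: "h n \<in> Cc_inf \<Omega>" for n unfolding h_def by (rule Cc_inf_cmult[OF f(1)])
  have Eh: "O.E (h n) = 1" for n
    using O.fin_scale(2)[of "f n" "\<lambda>_. 1" O.m "O.E (f n) powr (- (1 / p))"] O.Cc_inf_X[OF f(1)] O.X_eq_fin
      O.normalizing_factor[OF Epos[of n]] Epos[of n] by (simp add: h_def[abs_def])
  have Qh: "real n * Q p H V (h n) \<Omega> \<le> 1" for n
  proof -
    have "real n * Q p H V (h n) \<Omega> = real n * Q p H V (f n) \<Omega> / O.E (f n)"
      using O.Q_scale[OF O.Cc_inf_X[OF f(1)], of "O.E (f n) powr (- (1 / p))" n] O.normalizing_factor[OF Epos[of n]]
      by (simp add: h_def[abs_def])
    also have "\<dots> \<le> 1" using f(2)[of n] Epos[of n] by simp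
    finally show ?thesis .
  qed
  obtain s v where s: "strict_mono (s :: nat \<Rightarrow> nat)" "L1_loc_conv \<Omega> (\<lambda>k. h (s k)) v"
    using O.rellich[of h 1] h Eh by auto
  have hX0: "h k \<in> O.X0" for k by (rule O.Cc_inf_X0[OF h])
  have weak: "Wt0_weakly_converges p H V w \<Omega> (\<lambda>k. h (s k)) v"
    by (rule O.weak_limit(2)[OF hX0 _ s(2), where B = 1]) (simp add: Eh)
  obtain r where r: "strict_mono (r :: nat \<Rightarrow> nat)"
    "(\<lambda>k. O.I (\<lambda>_. 0) (neg_part V) (h (s (r k)))) \<longlonglongrightarrow> O.I (\<lambda>_. 0) (neg_part V) v"
    using neg_part_subseq[OF weak] by blast
  define z where "z k = h (s (r k))" for k
  have zX0: "z k \<in> O.X0" for k unfolding z_def by (rule hX0)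
  have Q0: "0 \<le> Q p H V (z k) \<Omega>" for k by (rule Q_nonneg[OF zX0])
  have "Q p H V (z k) \<Omega> \<le> inverse (real k)" if "0 < k" for k
  proof -
    have "k \<le> s (r k)" using strict_mono_imp_increasing[OF r(1), of k] strict_mono_imp_increasing[OF s(1), of "r k"] by simp
    then have "real k * Q p H V (z k) \<Omega> \<le> real (s (r k)) * Q p H V (z k) \<Omega>" by (intro mult_right_mono Q0) simp
    also have "\<dots> \<le> 1" unfolding z_def by (rule Qh)
    finally show ?thesis using that by (simp add: field_simps)
  qed
  then have "\<forall>\<^sub>F k in sequentially. Q p H V (z k) \<Omega> \<le> inverse (real k)"
    using eventually_gt_at_top[of 0] by (rule eventually_mono[rotated])
  then have Qlim: "(\<lambda>k. Q p H V (z k) \<Omega>) \<longlonglongrightarrow> 0"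
    by (intro tendsto_sandwich[OF always_eventually _ tendsto_const lim_inverse_n] allI Q0)
  obtain C where C: "0 < C" "\<And>\<phi>. \<phi> \<in> Cc_inf \<Omega> \<Longrightarrow> C * weighted_mass p (w \<Omega>) \<phi> \<Omega> \<le> Q p H V \<phi> \<Omega>"
    using w_hardy by (auto simp: hardy_weights_def)
  have weq: "O.I (\<lambda>_. 0) (w \<Omega>) u = weighted_mass p (w \<Omega>) u \<Omega>" for u
    unfolding weighted_mass_def O.I_def O.D_def
  proof (rule Bochner_Integration.integral_cong)
    fix x assume "x \<in> space O.M"
    then have "0 < w \<Omega> x" by (intro O.w_pos) simp
    then show "0 * H x (wgrad \<Omega> u x) powr p + w \<Omega> x * \<bar>u x\<bar> powr p = \<bar>w \<Omega> x\<bar> * \<bar>u x\<bar> powr p" by simp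
  qed simp
  have wlim: "(\<lambda>k. O.I (\<lambda>_. 0) (w \<Omega>) (z k)) \<longlonglongrightarrow> 0"
  proof (rule tendsto_sandwich[OF _ _ tendsto_const])
    show "(\<lambda>k. Q p H V (z k) \<Omega> / C) \<longlonglongrightarrow> 0" using tendsto_divide[OF Qlim tendsto_const, of C] C(1) by simp
    show "\<forall>\<^sub>F k in sequentially. 0 \<le> O.I (\<lambda>_. 0) (w \<Omega>) (z k)"
      using O.dom_V(3) by (intro always_eventually allI O.I_nonneg) (auto simp: O.dom_def)
    show "\<forall>\<^sub>F k in sequentially. O.I (\<lambda>_. 0) (w \<Omega>) (z k) \<le> Q p H V (z k) \<Omega> / C"
      using C(2)[OF h] C(1) by (intro always_eventually allI) (simp add: weq z_def field_simps)
  qed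
  have zconv: "L1_loc_conv \<Omega> z v" unfolding z_def by (rule L1_loc_conv_subseq[OF s(2) r(1)])
  \<comment> \<open>Weak lower semicontinuity passes the vanishing mass of weight
    \<open>w \<Omega>\<close> on to v; as this weight is positive, v is 0 almost everywhere.\<close>
  have Iv: "O.I (\<lambda>_. 0) (w \<Omega>) v \<le> 0"
  proof (rule field_le_epsilon)
    fix e :: real assume e: "0 < e"
    have "\<forall>\<^sub>F k in sequentially. O.I (\<lambda>_. 0) (w \<Omega>) v < O.I (\<lambda>_. 0) (w \<Omega>) (z k) + e / 2"
      by (rule O.weak_lsc_eventually[OF O.dom_subset[OF O.dom_V(3) O.X0_subset] zX0 _ zconv, where B = 1])
        (use Eh e in \<open>auto simp: z_def\<close>)
    moreover have "\<forall>\<^sub>F k in sequentially. O.I (\<lambda>_. 0) (w \<Omega>) (z k) < e / 2"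
      using wlim e by (intro order_tendstoD) auto
    ultimately have "\<forall>\<^sub>F k in sequentially. O.I (\<lambda>_. 0) (w \<Omega>) v \<le> 0 + e" by eventually_elim linarith
    then show "O.I (\<lambda>_. 0) (w \<Omega>) v \<le> 0 + e" by simp
  qed
  have vX: "v \<in> O.X" using O.weak_limit(1)[OF hX0 _ s(2), where B = 1] Eh O.X0_X by simp
  have fin_v: "v \<in> O.fin (\<lambda>_. 0) (w \<Omega>)" and cw: "O.coeff (w \<Omega>)" using O.domD[OF O.dom_V(3)] vX by auto
  have "O.I (\<lambda>_. 0) (w \<Omega>) v = 0" using Iv O.I_nonneg[OF _ cw, of "\<lambda>_. 0" v] by simp
  then have "AE x in O.M. O.D (\<lambda>_. 0) (w \<Omega>) v x = 0"
    using integral_nonneg_eq_0_iff_AE[of O.M "O.D (\<lambda>_. 0) (w \<Omega>) v"] fin_v O.D_nonneg[OF _ cw]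
    by (auto simp: O.fin_def O.I_def)
  then have v0: "AE x in O.M. v x = 0"
    using O.AE_in_U
  proof eventually_elim
    case (elim x)
    then show ?case using O.w_pos[of x] by (auto simp: O.D_def)
  qed
  have Pv: "O.I (\<lambda>_. 0) (neg_part V) v = 0"
    unfolding O.I_def
  proof (rule integral_eq_zero_AE)
    show "AE x in O.M. O.D (\<lambda>_. 0) (neg_part V) v x = 0" using v0 by eventually_elim (use p in \<open>simp add: O.D_def\<close>)
  qed
  \<comment> \<open>The three summands of \<open>E_decomp\<close> tend to 0, although their sum is
    the normalised energy 1.\<close>
  have "(\<lambda>k. Q p H V (z k) \<Omega> + 2 * O.I (\<lambda>_. 0) (neg_part V) (z k) + O.I (\<lambda>_. 0) (w \<Omega>) (z k)) \<longlonglongrightarrow> 0 + 2 * 0 + 0"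
    using r(2) Pv by (intro tendsto_intros Qlim wlim) (simp add: z_def)
  moreover have "Q p H V (z k) \<Omega> + 2 * O.I (\<lambda>_. 0) (neg_part V) (z k) + O.I (\<lambda>_. 0) (w \<Omega>) (z k) = 1" for k
    using O.E_decomp[OF O.X0_X[OF zX0]] Eh by (simp add: z_def)
  ultimately have "(\<lambda>k::nat. 1::real) \<longlonglongrightarrow> 0" by simp
  then show False by (simp add: tendsto_const_iff)
qed

text \<open>All convergences are arranged along one sequence. The last one permits later estimates
  to work with the positive part of Q only: its limit and that of Q then differ by a known number,
  the V^- integral of \<phi>.\<close>

lemma minimizing_sequence:
  assumes S: "T \<Omega> = ereal S"
  obtains u \<phi> B where "\<And>k::nat. u k \<in> Cc_inf \<Omega>" "\<And>k. weighted_mass p g (u k) \<Omega> = 1"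
    "(\<lambda>k. Q p H V (u k) \<Omega>) \<longlonglongrightarrow> S" "\<And>k. O.E (u k) \<le> B" "L1_loc_conv \<Omega> u \<phi>"
    "\<And>K. compact K \<Longrightarrow> K \<subseteq> \<Omega> \<Longrightarrow> (\<lambda>k. LINT x|lebesgue_on K. \<bar>u k x - \<phi> x\<bar> powr p) \<longlonglongrightarrow> 0"
    "(\<lambda>k. O.I (\<lambda>_. 0) (neg_part V) (u k)) \<longlonglongrightarrow> O.I (\<lambda>_. 0) (neg_part V) \<phi>"
proof -
  obtain Cg where Cg: "O.dom O.X0 (\<lambda>_. 0) (\<lambda>x. \<bar>g x\<bar>) Cg" using O.hardy_dom[OF g] by blast
  have ex: "\<exists>h. h \<in> Cc_inf \<Omega> \<and> weighted_mass p g h \<Omega> = 1 \<and> S \<le> Q p H V h \<Omega> \<and> Q p H V h \<Omega> < S + 1 / (1 + real n)" for n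
  proof -
    have "T \<Omega> < ereal (S + 1 / (1 + real n))" unfolding S by (simp add: add_pos_nonneg)
    then obtain f where f: "f \<in> Cc_inf \<Omega>" "0 < weighted_mass p g f \<Omega>"
        "Q p H V f \<Omega> / weighted_mass p g f \<Omega> < S + 1 / (1 + real n)"
      unfolding T_def Inf_less_iff by auto
    define c where "c = weighted_mass p g f \<Omega> powr (- (1 / p))"
    define h where "h x = c * f x" for x
    note cp = O.normalizing_factor[OF f(2), folded c_def]
    have h: "h \<in> Cc_inf \<Omega>" unfolding h_def by (rule Cc_inf_cmult[OF f(1)])
    have mh: "weighted_mass p g h \<Omega> = 1"
      using O.fin_scale(2)[OF O.domD(3)[OF Cg O.Cc_inf_X0[OF f(1)]] O.domD(1,2)[OF Cg], of c] cp f(2)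
      unfolding O.mass_eq h_def[abs_def] by simp
    have Qh: "Q p H V h \<Omega> = Q p H V f \<Omega> / weighted_mass p g f \<Omega>"
      unfolding h_def[abs_def] O.Q_scale[OF O.Cc_inf_X[OF f(1)]] cp by simp
    have "T \<Omega> \<le> ereal (Q p H V h \<Omega> / weighted_mass p g h \<Omega>)"
      unfolding T_def using h mh by (intro Inf_lower CollectI exI[of _ h]) simp
    then show ?thesis using h mh Qh f(3) by (intro exI[of _ h]) (simp add: S)
  qed
  then obtain h where h: "\<And>n. h n \<in> Cc_inf \<Omega>" "\<And>n. weighted_mass p g (h n) \<Omega> = 1"
      "\<And>n. S \<le> Q p H V (h n) \<Omega>" "\<And>n. Q p H V (h n) \<Omega> < S + 1 / (1 + real n)"
    by metis
  have "(\<lambda>n. S + 1 / (1 + real n)) \<longlonglongrightarrow> S + 0"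
    using LIMSEQ_inverse_real_of_nat by (intro tendsto_intros) (simp add: inverse_eq_divide)
  then have up: "(\<lambda>n. S + 1 / (1 + real n)) \<longlonglongrightarrow> S" by simp
  have Qlim: "(\<lambda>n. Q p H V (h n) \<Omega>) \<longlonglongrightarrow> S"
  proof (rule tendsto_sandwich[OF _ _ tendsto_const up])
    show "\<forall>\<^sub>F n in sequentially. S \<le> Q p H V (h n) \<Omega>" using h(3) by (rule always_eventually[OF allI])
    show "\<forall>\<^sub>F n in sequentially. Q p H V (h n) \<Omega> \<le> S + 1 / (1 + real n)"
      using less_imp_le[OF h(4)] by (rule always_eventually[OF allI])
  qed
  obtain C where C: "\<And>f. f \<in> Cc_inf \<Omega> \<Longrightarrow> O.E f \<le> C * Q p H V f \<Omega>" using E_le_Q by blast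
  have EB: "O.E (h n) \<le> \<bar>C\<bar> * (S + 1)" for n
  proof -
    have Q0: "0 \<le> Q p H V (h n) \<Omega>" by (rule Q_nonneg[OF O.Cc_inf_X0[OF h(1)]])
    have "O.E (h n) \<le> C * Q p H V (h n) \<Omega>" by (rule C[OF h(1)])
    also have "\<dots> \<le> \<bar>C\<bar> * Q p H V (h n) \<Omega>" using Q0 by (intro mult_right_mono) auto
    also have "\<dots> \<le> \<bar>C\<bar> * (S + 1)"
    proof (rule mult_left_mono)
      have "1 / (1 + real n) \<le> 1" by simp
      then show "Q p H V (h n) \<Omega> \<le> S + 1" using h(4)[of n] by linarith
    qed simp
    finally show ?thesis .
  qed
  obtain s v where "strict_mono (s :: nat \<Rightarrow> nat) \<and> L1_loc_conv \<Omega> (\<lambda>k. h (s k)) v \<and>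
    (\<forall>K. compact K \<longrightarrow> K \<subseteq> \<Omega> \<longrightarrow> (\<lambda>k. LINT x|lebesgue_on K. \<bar>h (s k) x - v x\<bar> powr p) \<longlonglongrightarrow> 0)"
    using O.rellich[of h, OF h(1) EB] by (elim exE) (rule that)
  then have s: "strict_mono s" "L1_loc_conv \<Omega> (\<lambda>k. h (s k)) v"
    "compact K \<Longrightarrow> K \<subseteq> \<Omega> \<Longrightarrow> (\<lambda>k. LINT x|lebesgue_on K. \<bar>h (s k) x - v x\<bar> powr p) \<longlonglongrightarrow> 0" for K
    by simp_all
    have "Wt0_weakly_converges p H V w \<Omega> (\<lambda>k. h (s k)) v"
      by (rule O.weak_limit(2)[OF O.Cc_inf_X0[OF h(1)] EB s(2)])
    then obtain r where r: "strict_mono (r :: nat \<Rightarrow> nat)"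
      "(\<lambda>k. O.I (\<lambda>_. 0) (neg_part V) (h (s (r k)))) \<longlonglongrightarrow> O.I (\<lambda>_. 0) (neg_part V) v"
      by (rule neg_part_subseq)
    have sr: "strict_mono (s \<circ> r)" by (rule strict_mono_o[OF s(1) r(1)])
  show thesis
    proof (rule that[of "\<lambda>k. h (s (r k))" "\<bar>C\<bar> * (S + 1)" v])
      show "(\<lambda>k. Q p H V (h (s (r k))) \<Omega>) \<longlonglongrightarrow> S" using LIMSEQ_subseq_LIMSEQ[OF Qlim sr] by (simp add: o_def)
      show "L1_loc_conv \<Omega> (\<lambda>k. h (s (r k))) v" by (rule L1_loc_conv_subseq[OF s(2) r(1)])
      show "(\<lambda>k. LINT x|lebesgue_on K. \<bar>h (s (r k)) x - v x\<bar> powr p) \<longlonglongrightarrow> 0" if "compact K" "K \<subseteq> \<Omega>" for K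
        using LIMSEQ_subseq_LIMSEQ[OF s(3)[OF that] r(1)] by (simp add: o_def)
    qed (use h EB r(2) in auto)
qed

end

section \<open>Localisation\<close>

lemma powr_C1:
  fixes u :: "'a::euclidean_space \<Rightarrow> real"
  assumes u: "Ck 1 u" "\<And>x. 0 < u x"
  shows "Ck 1 (\<lambda>x. u x powr a)"
proof (rule Ck_1I(1))
  show "GDERIV (\<lambda>x. u x powr a) x :> (a * u x powr (a - 1)) *\<^sub>R grad u x" for x
    by (rule GDERIV_DERIV_compose[OF Ck_1D(1)[OF u(1)] has_real_derivative_powr[OF u(2)]])
  have "u x \<noteq> 0" for x using u(2)[of x] by simp
  then show "continuous_on UNIV (\<lambda>x. (a * u x powr (a - 1)) *\<^sub>R grad u x)"
    using Ck_continuous[OF u(1)] Ck_1D(2)[OF u(1)] by (intro continuous_intros) auto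
qed

text \<open>Divides by the p-th root of the sum of the p-th powers. That sum is positive everywhere
  and of class C^1, since on nonnegative numbers the power agrees with
  \<open>spowr p\<close>.\<close>

lemma normalized_partition:
  fixes b :: "'i \<Rightarrow> 'a::euclidean_space \<Rightarrow> real"
  assumes p: "1 < p" and J: "finite J" and b: "\<And>j. j \<in> J \<Longrightarrow> Ck 1 (b j)" "\<And>j x. j \<in> J \<Longrightarrow> 0 \<le> b j x"
    and pos: "\<And>x. \<exists>j\<in>J. 0 < b j x"
  shows "\<exists>s. (\<forall>x. 0 < s x) \<and> (\<forall>j\<in>J. Ck 1 (\<lambda>x. s x * b j x)) \<and> (\<forall>x. (\<Sum>j\<in>J. (s x * b j x) powr p) = 1)"
proof -
  define t where "t x = (\<Sum>j\<in>J. spowr p (b j x))" for x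
  have teq: "t x = (\<Sum>j\<in>J. b j x powr p)" for x
    unfolding t_def by (intro sum.cong refl spowr_nonneg b p)
  have tpos: "0 < t x" for x
  proof -
    obtain j where j: "j \<in> J" "0 < b j x" using pos by blast
    then show ?thesis unfolding teq by (intro sum_pos2[OF J j(1)]) auto
  qed
  have tC: "Ck 1 t" unfolding t_def[abs_def] by (intro Ck_sum spowr_C1[OF p] b)
  show ?thesis
  proof (intro exI[of _ "\<lambda>x. t x powr (- (1 / p))"] conjI allI ballI)
    show "0 < t x powr (- (1 / p))" for x using tpos[of x] by simp
    show "Ck 1 (\<lambda>x. t x powr (- (1 / p)) * b j x)" if "j \<in> J" for j
      by (intro Ck_mult powr_C1 tC tpos b that)
    show "(\<Sum>j\<in>J. (t x powr (- (1 / p)) * b j x) powr p) = 1" for x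
    proof -
      have "(\<Sum>j\<in>J. (t x powr (- (1 / p)) * b j x) powr p) = (\<Sum>j\<in>J. (t x powr (- (1 / p) * p)) * b j x powr p)"
        using tpos[of x] b by (intro sum.cong refl) (simp add: powr_mult powr_powr)
      also have "- (1 / p) * p = - 1" using p by simp
      also have "(\<Sum>j\<in>J. t x powr - 1 * b j x powr p) = t x powr - 1 * t x"
        by (simp only: sum_distrib_left teq)
      also have "\<dots> = 1" using tpos[of x] by (simp add: powr_minus_divide)
      finally show ?thesis .
    qed
  qed
qed

text \<open>The index \<open>None\<close> stands for the piece near infinity and
  \<open>Some y\<close> for the ball around y. That all gradients vanish outside one compact set L
  is the point: cutting off v then costs only an L^p norm of v over L.\<close>

lemma smooth_partition:
  fixes K \<Omega> :: "'a::euclidean_space set"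
  assumes p: "1 < p" and \<Omega>: "open \<Omega>" and K: "compact K" "K \<subseteq> \<Omega>"
    and r: "\<forall>x\<in>\<Omega>. 0 < r x \<and> ball x (r x) \<subseteq> \<Omega>"
  shows "\<exists>F L \<psi>. finite F \<and> F \<subseteq> \<Omega> \<and> compact L \<and> L \<subseteq> \<Omega> \<and>
    (\<forall>j\<in>insert None (Some ` F). Ck 1 (\<psi> j) \<and> (\<forall>x. 0 \<le> \<psi> j x) \<and> (\<forall>x. x \<notin> L \<longrightarrow> grad (\<psi> j) x = 0)) \<and>
    (\<forall>x. (\<Sum>j\<in>insert None (Some ` F). \<psi> j x powr p) = 1) \<and>
    (\<forall>y\<in>F. \<exists>C. closed C \<and> C \<subseteq> ball y (r y) \<and> (\<forall>x. x \<notin> C \<longrightarrow> \<psi> (Some y) x = 0)) \<and>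
    (\<exists>W. open W \<and> K \<subseteq> W \<and> (\<forall>x\<in>W. \<psi> None x = 0))"
proof -
  obtain \<eta> W where \<eta>: "\<eta> \<in> Cc_inf \<Omega>" "\<And>x. 0 \<le> \<eta> x" "\<And>x. \<eta> x \<le> 1" and W: "open W" "K \<subseteq> W" "\<And>x. x \<in> W \<Longrightarrow> \<eta> x = 1"
    using smooth_cutoff[OF K \<Omega>] by blast
  obtain L where L: "compact L" "L \<subseteq> \<Omega>" "\<And>x. x \<notin> L \<Longrightarrow> \<eta> x = 0" using CcE[OF Cc_inf_Cc[OF \<eta>(1)]] by metis
  \<comment> \<open>Balls of half the radius already cover L, so a cut-off equal to 1 on the half
    ball can be supported in the full ball.\<close>
  have "L \<subseteq> (\<Union>x\<in>\<Omega>. ball x (r x / 2))"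
  proof
    fix x assume "x \<in> L"
    then have "x \<in> \<Omega>" using L(2) by blast
    moreover from this have "x \<in> ball x (r x / 2)" using bspec[OF r, of x] by simp
    ultimately show "x \<in> (\<Union>x\<in>\<Omega>. ball x (r x / 2))" by blast
  qed
  then obtain F where F: "F \<subseteq> \<Omega>" "finite F" "L \<subseteq> (\<Union>x\<in>F. ball x (r x / 2))"
    using compactE_image[OF L(1), of \<Omega> "\<lambda>x. ball x (r x / 2)"] by (metis open_ball)
  define P where "P y b C \<longleftrightarrow> b \<in> Cc_inf (ball y (r y)) \<and> (\<forall>x. 0 \<le> b x) \<and> (\<forall>x\<in>ball y (r y / 2). b x = 1) \<and>
    compact C \<and> C \<subseteq> ball y (r y) \<and> (\<forall>x. x \<notin> C \<longrightarrow> b x = 0)" for y b C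
  have "\<forall>y\<in>F. \<exists>b C. P y b C"
  proof
    fix y assume "y \<in> F"
    then have ry: "0 < r y" using F(1) r by blast
    have "cball y (r y / 2) \<subseteq> ball y (r y)" using ry by auto
    from smooth_cutoff[OF compact_cball this open_ball]
    obtain b W' where b: "b \<in> Cc_inf (ball y (r y))" "\<And>x. 0 \<le> b x" "\<And>x. b x \<le> 1" "open W'"
        "cball y (r y / 2) \<subseteq> W'" "\<And>x. x \<in> W' \<Longrightarrow> b x = 1"
      by blast
    obtain C where "compact C" "C \<subseteq> ball y (r y)" "\<And>x. x \<notin> C \<Longrightarrow> b x = 0" using CcE[OF Cc_inf_Cc[OF b(1)]] by metis
    moreover have "\<forall>x\<in>ball y (r y / 2). b x = 1" using b(5,6) ball_subset_cball by blast
    ultimately show "\<exists>b C. P y b C"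
      unfolding P_def using b(1,2) by (intro exI[of _ b] exI[of _ C]) auto
  qed
  then obtain b C where "\<And>y. y \<in> F \<Longrightarrow> P y (b y) (C y)" by metis
  then have b: "\<And>y. y \<in> F \<Longrightarrow> b y \<in> Cc_inf (ball y (r y))" "\<And>y x. y \<in> F \<Longrightarrow> 0 \<le> b y x"
      "\<And>y x. y \<in> F \<Longrightarrow> x \<in> ball y (r y / 2) \<Longrightarrow> b y x = 1"
    and C: "\<And>y. y \<in> F \<Longrightarrow> compact (C y)" "\<And>y. y \<in> F \<Longrightarrow> C y \<subseteq> ball y (r y)" "\<And>y x. y \<in> F \<Longrightarrow> x \<notin> C y \<Longrightarrow> b y x = 0"
    unfolding P_def by blast+
  define \<beta> where "\<beta> j = (case j of None \<Rightarrow> (\<lambda>x. 1 - \<eta> x) | Some y \<Rightarrow> b y)" for j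
  define J where "J = insert None (Some ` F)"
  have J: "finite J" using F(2) by (simp add: J_def)
  have \<beta>: "Ck 1 (\<beta> j)" "\<And>x. 0 \<le> \<beta> j x" if "j \<in> J" for j
  proof -
    have "Ck 1 \<eta>" using Cc_inf_C1c \<eta>(1) C1cD(2) by blast
    then have "Ck 1 (\<lambda>x. 1 - \<eta> x)" by (intro Ck_diff Ck_const)
    moreover have "Ck 1 (b y)" if "y \<in> F" for y using Cc_inf_C1c b(1)[OF that] C1cD(2) by blast
    ultimately show "Ck 1 (\<beta> j)" "\<And>x. 0 \<le> \<beta> j x"
      using that b(2) \<eta>(3) unfolding J_def \<beta>_def by (auto simp del: One_nat_def)
  qed
  have pos: "\<exists>j\<in>J. 0 < \<beta> j x" for x
  proof (cases "x \<in> L")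
    case True
    then obtain y where y: "y \<in> F" "x \<in> ball y (r y / 2)" using F(3) by blast
    then show ?thesis using b(3)[OF y] by (intro bexI[of _ "Some y"]) (auto simp: \<beta>_def J_def)
  next
    case False
    then show ?thesis using L(3)[OF False] by (intro bexI[of _ None]) (auto simp: \<beta>_def J_def)
  qed
  obtain s where s: "\<And>x. 0 < s x" "\<And>j. j \<in> J \<Longrightarrow> Ck 1 (\<lambda>x. s x * \<beta> j x)" "\<And>x. (\<Sum>j\<in>J. (s x * \<beta> j x) powr p) = 1"
    using normalized_partition[of p J \<beta>, OF p J \<beta> pos] by blast
  define \<psi> where "\<psi> j x = s x * \<beta> j x" for j x
  define L' where "L' = L \<union> (\<Union>y\<in>F. C y)"
  have L': "compact L'" "L' \<subseteq> \<Omega>"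
  proof -
    show "compact L'" unfolding L'_def by (intro compact_Un compact_UN F(2) L(1) C(1))
    have "C y \<subseteq> \<Omega>" if "y \<in> F" for y using C(2)[OF that] bspec[OF r, of y] F(1) that by blast
    then show "L' \<subseteq> \<Omega>" unfolding L'_def using L(2) by blast
  qed
  have \<psi>: "0 \<le> \<psi> j x" if "j \<in> J" for j x using s(1)[of x] \<beta>(2)[OF that] by (simp add: \<psi>_def)
  have Some0: "\<psi> (Some y) x = 0" if "y \<in> F" "x \<notin> C y" for y x using C(3)[OF that] by (simp add: \<psi>_def \<beta>_def)
  \<comment> \<open>Outside the supports of the ball pieces the normalisation leaves the piece
    \<open>None\<close> alone, so it is 1 there and its gradient is 0.\<close>
  have None1: "\<psi> None x = 1" if x: "x \<notin> L'" for x
  proof -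
    have "(\<Sum>j\<in>J. \<psi> j x powr p) = \<psi> None x powr p + (\<Sum>j\<in>Some ` F. \<psi> j x powr p)"
      unfolding J_def using F(2) by (subst sum.insert) auto
    also have "(\<Sum>j\<in>Some ` F. \<psi> j x powr p) = 0" using x Some0 p by (intro sum.neutral) (auto simp: L'_def)
    finally have "\<psi> None x powr p = 1" using s(3)[of x] by (simp add: \<psi>_def)
    then have "(\<psi> None x powr p) powr (1 / p) = 1" by simp
    then show ?thesis using \<psi>[of None x] p by (simp add: J_def powr_powr)
  qed
  have grad: "grad (\<psi> j) x = 0" if j: "j \<in> J" and x: "x \<notin> L'" for j x
  proof (cases j)
    case None
    show ?thesis unfolding None by (rule grad_const_outside[OF compact_imp_closed[OF L'(1)] None1 x])
  next
    case (Some y)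
    then have y: "y \<in> F" using j by (auto simp: J_def)
    have xC: "x \<notin> C y" using x y by (auto simp: L'_def)
    show ?thesis unfolding Some by (rule grad_const_outside[OF compact_imp_closed[OF C(1)[OF y]] Some0[OF y] xC])
  qed
  show ?thesis
  proof (rule exI[of _ F], rule exI[of _ L'], rule exI[of _ \<psi>], fold J_def, intro conjI ballI allI impI)
    show "Ck 1 (\<psi> j)" if "j \<in> J" for j unfolding \<psi>_def[abs_def] by (rule s(2)[OF that])
    show "(\<Sum>j\<in>J. \<psi> j x powr p) = 1" for x unfolding \<psi>_def by (rule s(3))
    show "\<exists>C. closed C \<and> C \<subseteq> ball y (r y) \<and> (\<forall>x. x \<notin> C \<longrightarrow> \<psi> (Some y) x = 0)" if "y \<in> F" for y
      using C[OF that] Some0[OF that] compact_imp_closed by blast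
    show "\<exists>W. open W \<and> K \<subseteq> W \<and> (\<forall>x\<in>W. \<psi> None x = 0)"
      using W by (intro exI[of _ W]) (simp add: \<psi>_def \<beta>_def)
  qed (use F L' \<psi> grad in auto)
qed

section \<open>Cutting off sequences that vanish locally\<close>

context energy_space
begin

lemma I_sum:
  assumes "\<And>j. j \<in> J \<Longrightarrow> u \<in> fin (\<alpha> j) (\<beta> j)"
  shows "I (\<lambda>x. \<Sum>j\<in>J. \<alpha> j x) (\<lambda>x. \<Sum>j\<in>J. \<beta> j x) u = (\<Sum>j\<in>J. I (\<alpha> j) (\<beta> j) u)"
proof -
  have "D (\<lambda>x. \<Sum>j\<in>J. \<alpha> j x) (\<lambda>x. \<Sum>j\<in>J. \<beta> j x) u = (\<lambda>x. \<Sum>j\<in>J. D (\<alpha> j) (\<beta> j) u x)"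
    by (rule ext) (simp add: D_def sum.distrib sum_distrib_right)
  then show ?thesis unfolding I_def using assms by (simp add: fin_def Bochner_Integration.integral_sum)
qed

text \<open>By the product rule the gradient of \<psi> v is \<psi> grad v plus v grad \<psi>. The
  second term lives on L and is bounded there by a multiple of v, so it may be separated from the
  first at the price of a large constant.\<close>

lemma cutoff_energy:
  assumes v: "\<And>k. v k \<in> C1c U" and L: "compact L" "L \<subseteq> U"
    and \<psi>: "Ck 1 \<psi>" "\<And>x. 0 \<le> \<psi> x" "\<And>x. \<psi> x \<le> 1" "\<And>x. x \<notin> L \<Longrightarrow> grad \<psi> x = 0" and e: "0 < e"
    and lim: "(\<lambda>k. LINT x|lebesgue_on L. \<bar>v k x\<bar> powr p) \<longlonglongrightarrow> 0"
  shows "\<exists>z. z \<longlonglongrightarrow> 0 \<and> (\<forall>k. I (\<lambda>_. 1) Vp (\<lambda>x. \<psi> x * v k x)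
    \<le> (1 + e) * I (\<lambda>x. \<psi> x powr p) (\<lambda>x. \<psi> x powr p * Vp x) (v k) + z k)"
proof -
  obtain l where l: "0 < l" "l < 1" "(1 - l) powr (1 - p) \<le> 1 + e" using powr_near_1[OF e] by blast
  obtain \<nu> where \<nu>: "0 < \<nu>" "AE x in lebesgue_on L. \<forall>\<xi>. H x \<xi> \<le> \<nu> * norm \<xi>" by (rule H_upper[OF L])
  obtain B where B: "0 < B" "\<And>x. norm (grad \<psi> x) \<le> B"
    using compact_support_bounded[OF Ck_1D(2)[OF \<psi>(1)] L(1) \<psi>(4)] by metis
  \<comment> \<open>The factor l^(1 - p) is the price for keeping the constant 1 + e on the main
    gradient term; the other factor bounds \<open>H x\<close> of grad \<psi> on L.\<close>
  define C where "C = l powr (1 - p) * (\<nu> * B) powr p"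
  define z where "z k = C * (LINT x|lebesgue_on L. \<bar>v k x\<bar> powr p)" for k
  have \<psi>m: "\<psi> \<in> borel_measurable M"
    using borel_measurable_continuous_onI[OF Ck_continuous[OF \<psi>(1)]] by (intro measurable_restrict_space1 measurable_completion) simp
  have \<psi>p: "\<psi> x powr p \<le> 1" for x using powr_mono2[of p "\<psi> x" 1] \<psi>(2,3) p by simp
  have c1: "coeff (\<lambda>x. \<psi> x powr p)" "coeff (\<lambda>x. \<psi> x powr p * Vp x)"
    using \<psi>m coeff_V(1) by (auto simp: coeff_def)
  have d1: "dom X (\<lambda>x. \<psi> x powr p) (\<lambda>x. \<psi> x powr p * Vp x) 1"
  proof (rule dom_le_E[OF c1])
    show "AE x in M. \<psi> x powr p \<le> 1 \<and> \<psi> x powr p * Vp x \<le> m x"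
      using AE_in_U
    proof eventually_elim
      case (elim x)
      have "\<psi> x powr p * Vp x \<le> 1 * Vp x" using \<psi>p by (intro mult_right_mono) (auto simp: Vp_def)
      also have "\<dots> \<le> m x" using w_pos[OF elim] by (auto simp: Vp_def m_def)
      finally show ?case using \<psi>p by simp
    qed
  qed
  have AEL: "AE x in M. x \<in> L \<longrightarrow> (\<forall>\<xi>. H x \<xi> \<le> \<nu> * norm \<xi>)"
  proof -
    have "AE x in lebesgue. x \<in> L \<longrightarrow> (\<forall>\<xi>. H x \<xi> \<le> \<nu> * norm \<xi>)"
      using \<nu>(2) L(1) by (simp add: AE_restrict_space_iff)
    then show ?thesis unfolding AE_M by eventually_elim simp
  qed
  have "I (\<lambda>_. 1) Vp (\<lambda>x. \<psi> x * v k x) \<le> (1 + e) * I (\<lambda>x. \<psi> x powr p) (\<lambda>x. \<psi> x powr p * Vp x) (v k) + z k" for k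
  proof -
    have vX: "v k \<in> X" by (rule C1c_X[OF v])
    have \<psi>v: "(\<lambda>x. \<psi> x * v k x) \<in> C1c U" by (rule C1c_mult[OF v \<psi>(1)])
    have i1: "integrable M (D (\<lambda>_. 1) Vp (\<lambda>x. \<psi> x * v k x))"
      using domD(3)[OF dom_V(1) C1c_X[OF \<psi>v]] by (simp add: fin_def)
    have i2: "integrable M (D (\<lambda>x. \<psi> x powr p) (\<lambda>x. \<psi> x powr p * Vp x) (v k))"
      using domD(3)[OF d1 vX] by (simp add: fin_def)
    have "continuous_on UNIV (\<lambda>x. \<bar>v k x\<bar> powr p)"
      using C1cD(5)[OF v[of k]] p by (intro continuous_intros continuous_on_powr') auto
    then have "integrable (lebesgue_on L) (\<lambda>x. \<bar>v k x\<bar> powr p)"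
      by (intro compact_continuous_on_integrable[OF L(1)]) (rule continuous_on_subset, auto)
    then have i3: "integrable M (\<lambda>x. indicator L x * \<bar>v k x\<bar> powr p)"
      using L U by (subst lebesgue_on_indicator_subset(1)) auto
    have "AE x in M. D (\<lambda>_. 1) Vp (\<lambda>x. \<psi> x * v k x) x \<le>
        (1 + e) * D (\<lambda>x. \<psi> x powr p) (\<lambda>x. \<psi> x powr p * Vp x) (v k) x + C * (indicator L x * \<bar>v k x\<bar> powr p)"
      using wgrad_AE[OF U Ck_1_weak_gradient[OF U C1cD(2)[OF \<psi>v]]] wgrad_AE[OF U Ck_1_weak_gradient[OF U C1cD(2)[OF v[of k]]]] AEL H_norm
    proof eventually_elim
      case (elim x)
      note N = is_norm_simps[OF elim(4)]
      have "H x (wgrad U (\<lambda>x. \<psi> x * v k x) x) powr p = H x (\<psi> x *\<^sub>R grad (v k) x + v k x *\<^sub>R grad \<psi> x) powr p"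
        using elim(1) grad_mult[OF \<psi>(1) C1cD(2)[OF v[of k]]] by simp
      also have "\<dots> \<le> (1 - l) powr (1 - p) * H x (\<psi> x *\<^sub>R grad (v k) x) powr p + l powr (1 - p) * H x (v k x *\<^sub>R grad \<psi> x) powr p"
        by (rule is_norm_powr_add[OF elim(4) l(1,2)])
      also have "(1 - l) powr (1 - p) * H x (\<psi> x *\<^sub>R grad (v k) x) powr p \<le> (1 + e) * (\<psi> x powr p * H x (wgrad U (v k) x) powr p)"
      proof -
        have "H x (\<psi> x *\<^sub>R grad (v k) x) powr p = \<psi> x powr p * H x (wgrad U (v k) x) powr p"
          using elim(2) N(2) N(1) \<psi>(2)[of x] by (simp add: powr_mult)
        then show ?thesis using l(3) by (simp add: mult_right_mono)
      qed
      also have "l powr (1 - p) * H x (v k x *\<^sub>R grad \<psi> x) powr p \<le> C * (indicator L x * \<bar>v k x\<bar> powr p)"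
      proof (cases "x \<in> L")
        case True
        have "H x (v k x *\<^sub>R grad \<psi> x) \<le> \<nu> * norm (v k x *\<^sub>R grad \<psi> x)" using elim(3) True by blast
        also have "\<dots> = \<nu> * norm (grad \<psi> x) * \<bar>v k x\<bar>" by simp
        also have "\<dots> \<le> \<nu> * B * \<bar>v k x\<bar>" using B(2)[of x] \<nu>(1) by (intro mult_right_mono mult_left_mono) auto
        finally have "H x (v k x *\<^sub>R grad \<psi> x) powr p \<le> (\<nu> * B * \<bar>v k x\<bar>) powr p" using p N(1) by (intro powr_mono2) auto
        also have "\<dots> = (\<nu> * B) powr p * \<bar>v k x\<bar> powr p" using \<nu>(1) B(1) by (simp add: powr_mult)
        finally show ?thesis using True by (simp add: C_def mult.assoc mult_left_mono)
      next
        case False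
        have "H x 0 = 0" using N(4)[of 0] by simp
        then show ?thesis using False \<psi>(4)[OF False] p by simp
      qed
      finally have "H x (wgrad U (\<lambda>x. \<psi> x * v k x) x) powr p
        \<le> (1 + e) * (\<psi> x powr p * H x (wgrad U (v k) x) powr p) + C * (indicator L x * \<bar>v k x\<bar> powr p)" by simp
      moreover have "Vp x * \<bar>\<psi> x * v k x\<bar> powr p \<le> (1 + e) * (\<psi> x powr p * Vp x * \<bar>v k x\<bar> powr p)"
      proof -
        have "Vp x * \<bar>\<psi> x * v k x\<bar> powr p = 1 * (\<psi> x powr p * Vp x * \<bar>v k x\<bar> powr p)"
          using \<psi>(2)[of x] by (simp add: abs_mult powr_mult)
        also have "\<dots> \<le> (1 + e) * (\<psi> x powr p * Vp x * \<bar>v k x\<bar> powr p)"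
          using e by (intro mult_right_mono) (auto simp: Vp_def)
        finally show ?thesis .
      qed
      ultimately show ?case unfolding D_def distrib_left by linarith
    qed
    then have "I (\<lambda>_. 1) Vp (\<lambda>x. \<psi> x * v k x) \<le> (LINT x|M. (1 + e) * D (\<lambda>x. \<psi> x powr p) (\<lambda>x. \<psi> x powr p * Vp x) (v k) x
        + C * (indicator L x * \<bar>v k x\<bar> powr p))"
      unfolding I_def using i1 i2 i3 by (intro integral_mono_AE) auto
    also have "\<dots> = (1 + e) * I (\<lambda>x. \<psi> x powr p) (\<lambda>x. \<psi> x powr p * Vp x) (v k) + C * (LINT x|M. indicator L x * \<bar>v k x\<bar> powr p)"
      unfolding I_def using i2 i3 by (subst Bochner_Integration.integral_add) auto
    also have "(LINT x|M. indicator L x * \<bar>v k x\<bar> powr p) = (LINT x|lebesgue_on L. \<bar>v k x\<bar> powr p)"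
      using L U by (intro lebesgue_on_indicator_subset(2)) auto
    finally show ?thesis by (simp add: z_def)
  qed
  moreover have "z \<longlonglongrightarrow> 0" unfolding z_def[abs_def] using tendsto_mult[OF tendsto_const lim, of C] by simp
  ultimately show ?thesis by blast
qed

end

text \<open>The product \<psi> v is a test function of U, so the best constant of U applies. The V^-
  integral, which only lowers Q, is dropped; what is left is linear in \<psi>^p and can be summed
  over a partition.\<close>

lemma (in hardy_setting) piece_bound:
  assumes U: "is_domain U" "U \<subseteq> \<Omega>" and c: "ereal c \<le> T U" and v: "\<And>k. v k \<in> C1c \<Omega>" and L: "compact L" "L \<subseteq> \<Omega>"
    and \<psi>: "Ck 1 \<psi>" "\<And>x. 0 \<le> \<psi> x" "\<And>x. \<psi> x \<le> 1" "\<And>x. x \<notin> L \<Longrightarrow> grad \<psi> x = 0" and e: "0 < e"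
    and C: "closed C" "C \<inter> \<Omega> \<subseteq> U" "\<And>x. x \<notin> C \<Longrightarrow> \<psi> x = 0"
    and lim: "(\<lambda>k. LINT x|lebesgue_on L. \<bar>v k x\<bar> powr p) \<longlonglongrightarrow> 0"
  shows "\<exists>z. z \<longlonglongrightarrow> 0 \<and> (\<forall>k. c * O.I (\<lambda>_. 0) (\<lambda>x. \<psi> x powr p * \<bar>g x\<bar>) (v k)
    \<le> (1 + e) * O.I (\<lambda>x. \<psi> x powr p) (\<lambda>x. \<psi> x powr p * O.Vp x) (v k) + z k)"
proof -
  obtain z where z: "z \<longlonglongrightarrow> 0" "\<And>k. O.I (\<lambda>_. 1) O.Vp (\<lambda>x. \<psi> x * v k x)
    \<le> (1 + e) * O.I (\<lambda>x. \<psi> x powr p) (\<lambda>x. \<psi> x powr p * O.Vp x) (v k) + z k"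
    using O.cutoff_energy[OF v L \<psi> e lim] by blast
  have "c * O.I (\<lambda>_. 0) (\<lambda>x. \<psi> x powr p * \<bar>g x\<bar>) (v k)
    \<le> (1 + e) * O.I (\<lambda>x. \<psi> x powr p) (\<lambda>x. \<psi> x powr p * O.Vp x) (v k) + z k" for k
  proof -
    have \<psi>v: "(\<lambda>x. \<psi> x * v k x) \<in> C1c \<Omega>" by (rule C1c_mult[OF v \<psi>(1)])
    obtain K where K: "compact K" "K \<subseteq> \<Omega>" "\<And>x. x \<notin> K \<Longrightarrow> v k x = 0" using CcE[OF C1cD(1)[OF v[of k]]] by metis
    \<comment> \<open>The support of \<psi> need not be compact, but v has compact support in
      \<Omega>; the closed set C meets it in a compact subset of U.\<close>
    have "(\<lambda>x. \<psi> x * v k x) \<in> Cc U"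
    proof (rule CcI[OF C1cD(5)[OF \<psi>v]])
      show "compact (C \<inter> K)" by (rule closed_Int_compact[OF C(1) K(1)])
      show "C \<inter> K \<subseteq> U" using C(2) K(2) by blast
      show "\<psi> x * v k x = 0" if "x \<notin> C \<inter> K" for x using that C(3) K(3) by auto
    qed
    then have \<psi>vU: "(\<lambda>x. \<psi> x * v k x) \<in> C1c U" using C1cD(2)[OF \<psi>v] by (simp add: C1c_def del: One_nat_def)
    have "O.I (\<lambda>_. 0) (\<lambda>x. \<psi> x powr p * \<bar>g x\<bar>) (v k) = weighted_mass p g (\<lambda>x. \<psi> x * v k x) \<Omega>"
      unfolding weighted_mass_def O.I_def O.D_def using \<psi>(2)
      by (intro Bochner_Integration.integral_cong) (auto simp: abs_mult powr_mult)
    then have "c * O.I (\<lambda>_. 0) (\<lambda>x. \<psi> x powr p * \<bar>g x\<bar>) (v k) \<le> Q p H V (\<lambda>x. \<psi> x * v k x) \<Omega>"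
      using T_bound[OF U c \<psi>vU] by simp
    also have "\<dots> \<le> O.I (\<lambda>_. 1) O.Vp (\<lambda>x. \<psi> x * v k x)"
      unfolding O.Q_eq[OF O.C1c_X[OF \<psi>v]] using O.I_nonneg[of "\<lambda>_. 0" "neg_part V"] by simp
    finally show ?thesis using z(2)[of k] by linarith
  qed
  then show ?thesis using z(1) by blast
qed

lemma integral_indicator_tendsto_0:
  fixes f :: "'a \<Rightarrow> real"
  assumes f: "integrable M f" and A: "\<And>n::nat. A n \<in> sets M" and ae: "AE x in M. \<forall>\<^sub>F n in sequentially. x \<notin> A n"
  shows "(\<lambda>n. LINT x|M. indicator (A n) x * f x) \<longlonglongrightarrow> 0"
proof -
  have [measurable]: "f \<in> borel_measurable M" "\<And>n. A n \<in> sets M" using f A by auto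
  have "(\<lambda>n. LINT x|M. indicator (A n) x * f x) \<longlonglongrightarrow> (LINT x|M. 0)"
  proof (rule integral_dominated_convergence)
    show "integrable M (\<lambda>x. \<bar>f x\<bar>)" using f by simp
    show "AE x in M. (\<lambda>n. indicator (A n) x * f x) \<longlonglongrightarrow> 0"
      using ae
    proof eventually_elim
      case (elim x)
      then have "\<forall>\<^sub>F n in sequentially. indicator (A n) x * f x = 0" by eventually_elim simp
      then show ?case by (rule tendsto_eventually)
    qed
    show "AE x in M. norm (indicator (A n) x * f x) \<le> \<bar>f x\<bar>" for n
      by (rule AE_I2) (simp add: indicator_def)
  qed auto
  then show ?thesis by simp
qed

text \<open>Open neighbourhoods of N with measures below 2^(-n) have a finite sum of measures. By
  Borel-Cantelli almost every point leaves them eventually, and dominated convergence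
  applies.\<close>

lemma null_set_open_small:
  fixes f :: "'a::euclidean_space \<Rightarrow> real"
  assumes N: "N \<in> null_sets lebesgue" and U: "U \<in> sets lebesgue" and f: "integrable (lebesgue_on U) f" and e: "0 < e"
  shows "\<exists>G. open G \<and> N \<subseteq> G \<and> (LINT x|lebesgue_on U. indicator G x * f x) < e"
proof -
  have "\<exists>G. open G \<and> N \<subseteq> G \<and> emeasure lebesgue (G - N) < ennreal ((1 / 2) ^ n)" for n
    using sets_lebesgue_outer_open[of N "(1 / 2) ^ n"] N by (metis null_setsD2 zero_less_power half_gt_zero zero_less_one)
  then obtain G where G: "\<And>n. open (G n)" "\<And>n. N \<subseteq> G n" "\<And>n. emeasure lebesgue (G n - N) < ennreal ((1 / 2) ^ n)"
    by metis
  have em: "emeasure lebesgue (G n) < ennreal ((1 / 2) ^ n)" for n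
    using emeasure_Diff_null_set[OF N, of "G n"] G(1,3)[of n] by simp
  have meas: "measure lebesgue (G n) \<le> (1 / 2) ^ n" for n
    using em[of n] by (simp add: measure_def enn2real_leI less_imp_le)
  have "summable (\<lambda>n. (1 / 2 :: real) ^ n)" by (rule summable_geometric) simp
  then have sm: "summable (\<lambda>n. measure lebesgue (G n))"
    by (rule summable_comparison_test_ev[rotated]) (use meas in auto)
  have fin: "emeasure lebesgue (G n) < \<infinity>" for n
    using em[of n] by (rule less_trans) simp
  have "AE x in lebesgue. \<forall>\<^sub>F n in sequentially. x \<in> space lebesgue - G n"
    by (rule borel_cantelli_AE1[OF _ fin sm]) (use G(1) in auto)
  then have "AE x in lebesgue. \<forall>\<^sub>F n in sequentially. x \<notin> G n" by simp
  then have "AE x in lebesgue. x \<in> U \<longrightarrow> (\<forall>\<^sub>F n in sequentially. x \<notin> G n \<inter> U)"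
  proof eventually_elim
    case (elim x)
    then have "\<forall>\<^sub>F n in sequentially. x \<notin> G n \<inter> U" by eventually_elim simp
    then show ?case by blast
  qed
  then have "AE x in lebesgue_on U. \<forall>\<^sub>F n in sequentially. x \<notin> G n \<inter> U"
    by (rule AE_restrict_space_iff[THEN iffD2, rotated]) (use U in simp)
  then have "(\<lambda>n. LINT x|lebesgue_on U. indicator (G n \<inter> U) x * f x) \<longlonglongrightarrow> 0"
    using G(1) U by (intro integral_indicator_tendsto_0[OF f]) (auto simp: sets_restrict_space)
  then have "\<forall>\<^sub>F n in sequentially. (LINT x|lebesgue_on U. indicator (G n \<inter> U) x * f x) < e"
    using e by (rule order_tendstoD)
  then obtain n where "(LINT x|lebesgue_on U. indicator (G n \<inter> U) x * f x) < e"
    by (auto simp: eventually_sequentially)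
  also have "(LINT x|lebesgue_on U. indicator (G n \<inter> U) x * f x) = (LINT x|lebesgue_on U. indicator (G n) x * f x)"
    by (rule Bochner_Integration.integral_cong) (auto simp: indicator_def)
  finally show ?thesis using G(1,2) by blast
qed

section \<open>Splitting the functionals by a weight \<theta>\<close>

context energy_space
begin

lemma coeff_mult:
  assumes "coeff \<beta>" "\<theta> \<in> borel_measurable M" "\<And>x. 0 \<le> \<theta> x"
  shows "coeff (\<lambda>x. \<theta> x * \<beta> x)"
  using assms by (auto simp: coeff_def)

lemma D_mult: "D (\<lambda>x. \<theta> x * \<alpha> x) (\<lambda>x. \<theta> x * \<beta> x) u x = \<theta> x * D \<alpha> \<beta> u x"
  by (simp add: D_def algebra_simps)

lemma fin_mult:
  assumes u: "u \<in> fin \<alpha> \<beta>" and ab: "coeff \<alpha>" "coeff \<beta>"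
    and \<theta>: "\<theta> \<in> borel_measurable M" "\<And>x. 0 \<le> \<theta> x" "\<And>x. \<theta> x \<le> 1"
  shows "u \<in> fin (\<lambda>x. \<theta> x * \<alpha> x) (\<lambda>x. \<theta> x * \<beta> x)"
    and "I (\<lambda>x. \<theta> x * \<alpha> x) (\<lambda>x. \<theta> x * \<beta> x) u \<le> I \<alpha> \<beta> u"
proof -
  have us: "u \<in> sob" and i: "integrable M (D \<alpha> \<beta> u)" using u by (auto simp: fin_def)
  have i': "integrable M (\<lambda>x. \<theta> x * D \<alpha> \<beta> u x)"
  proof (rule Bochner_Integration.integrable_bound[OF i])
    show "(\<lambda>x. \<theta> x * D \<alpha> \<beta> u x) \<in> borel_measurable M" using \<theta>(1) i by auto
    have "\<bar>\<theta> x * D \<alpha> \<beta> u x\<bar> \<le> 1 * \<bar>D \<alpha> \<beta> u x\<bar>" for x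
      unfolding abs_mult using \<theta>(2,3)[of x] by (intro mult_right_mono) auto
    then show "AE x in M. norm (\<theta> x * D \<alpha> \<beta> u x) \<le> norm (D \<alpha> \<beta> u x)" by simp
  qed
  have eq: "D (\<lambda>x. \<theta> x * \<alpha> x) (\<lambda>x. \<theta> x * \<beta> x) u = (\<lambda>x. \<theta> x * D \<alpha> \<beta> u x)" by (rule ext) (rule D_mult)
  show "u \<in> fin (\<lambda>x. \<theta> x * \<alpha> x) (\<lambda>x. \<theta> x * \<beta> x)" using us i' by (simp add: fin_def eq)
  show "I (\<lambda>x. \<theta> x * \<alpha> x) (\<lambda>x. \<theta> x * \<beta> x) u \<le> I \<alpha> \<beta> u"
    unfolding I_def eq
  proof (rule integral_mono_AE[OF i' i])
    show "AE x in M. \<theta> x * D \<alpha> \<beta> u x \<le> D \<alpha> \<beta> u x"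
      using D_nonneg[OF ab, of u]
    proof eventually_elim
      case (elim x)
      then show ?case using mult_right_mono[OF \<theta>(3) elim, of x] by simp
    qed
  qed
qed

lemma dom_mult:
  assumes d: "dom S \<alpha> \<beta> C" and \<theta>: "\<theta> \<in> borel_measurable M" "\<And>x. 0 \<le> \<theta> x" "\<And>x. \<theta> x \<le> 1"
  shows "dom S (\<lambda>x. \<theta> x * \<alpha> x) (\<lambda>x. \<theta> x * \<beta> x) C"
  unfolding dom_def
proof (intro conjI ballI)
  show "coeff (\<lambda>x. \<theta> x * \<alpha> x)" "coeff (\<lambda>x. \<theta> x * \<beta> x)" by (rule coeff_mult[OF _ \<theta>(1,2)], rule domD[OF d])+
  fix u assume "u \<in> S"
  note u = domD(3,4)[OF d this]
  show "u \<in> fin (\<lambda>x. \<theta> x * \<alpha> x) (\<lambda>x. \<theta> x * \<beta> x)" by (rule fin_mult(1)[OF u(1) domD(1,2)[OF d] \<theta>])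
  show "I (\<lambda>x. \<theta> x * \<alpha> x) (\<lambda>x. \<theta> x * \<beta> x) u \<le> C * E u"
    using fin_mult(2)[OF u(1) domD(1,2)[OF d] \<theta>] u(2) by linarith
qed

lemma I_split:
  assumes u: "u \<in> fin \<alpha> \<beta>" and ab: "coeff \<alpha>" "coeff \<beta>"
    and \<theta>: "\<theta> \<in> borel_measurable M" "\<And>x. 0 \<le> \<theta> x" "\<And>x. \<theta> x \<le> 1"
  shows "I (\<lambda>x. \<theta> x * \<alpha> x) (\<lambda>x. \<theta> x * \<beta> x) u + I (\<lambda>x. (1 - \<theta> x) * \<alpha> x) (\<lambda>x. (1 - \<theta> x) * \<beta> x) u = I \<alpha> \<beta> u"
proof -
  have \<theta>': "(\<lambda>x. 1 - \<theta> x) \<in> borel_measurable M" "\<And>x. 0 \<le> 1 - \<theta> x" "\<And>x. 1 - \<theta> x \<le> 1" using \<theta> by auto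
  note i = fin_mult(1)[OF u ab \<theta>] fin_mult(1)[OF u ab \<theta>']
  have "D \<alpha> \<beta> u = (\<lambda>x. D (\<lambda>x. \<theta> x * \<alpha> x) (\<lambda>x. \<theta> x * \<beta> x) u x + D (\<lambda>x. (1 - \<theta> x) * \<alpha> x) (\<lambda>x. (1 - \<theta> x) * \<beta> x) u x)"
    by (rule ext) (simp add: D_mult distrib_right[symmetric])
  then show ?thesis
    unfolding I_def using i by (simp only: fin_def mem_Collect_eq Bochner_Integration.integral_add)
qed

lemma Lp_conv:
  assumes u: "\<And>k. u k \<in> X" and v: "v \<in> X" and lim: "(\<lambda>k. E (\<lambda>x. u k x - v x)) \<longlonglongrightarrow> 0" and K: "compact K" "K \<subseteq> U"
  shows "(\<lambda>k. LINT x|lebesgue_on K. \<bar>u k x - v x\<bar> powr p) \<longlonglongrightarrow> 0"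
proof -
  obtain C where C: "0 \<le> C" "\<And>u. u \<in> X \<Longrightarrow> integrable (lebesgue_on K) (\<lambda>x. \<bar>u x\<bar> powr p + norm (wgrad U u x) powr p)"
      "\<And>u. u \<in> X \<Longrightarrow> (LINT x|lebesgue_on K. \<bar>u x\<bar> powr p + norm (wgrad U u x) powr p) \<le> C * E u"
    using Lp_control[OF K] by blast
  have le: "(LINT x|lebesgue_on K. \<bar>u k x - v x\<bar> powr p) \<le> C * E (\<lambda>x. u k x - v x)" for k
  proof -
    have d: "(\<lambda>x. u k x - v x) \<in> X" by (rule X_diff[OF u v])
    have "(LINT x|lebesgue_on K. \<bar>u k x - v x\<bar> powr p)
      \<le> (LINT x|lebesgue_on K. \<bar>u k x - v x\<bar> powr p + norm (wgrad U (\<lambda>x. u k x - v x) x) powr p)"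
      by (rule Bochner_Integration.integral_mono'[OF C(2)[OF d]]) auto
    also have "\<dots> \<le> C * E (\<lambda>x. u k x - v x)" by (rule C(3)[OF d])
    finally show ?thesis .
  qed
  have lim': "(\<lambda>k. C * E (\<lambda>x. u k x - v x)) \<longlonglongrightarrow> 0" using tendsto_mult[OF tendsto_const lim, of C] by simp
  show ?thesis
    by (rule tendsto_sandwich[OF _ _ tendsto_const lim']) (use le in \<open>auto intro!: always_eventually\<close>)
qed

lemma X_powr_integrable:
  assumes u: "u \<in> X" and K: "compact K" "K \<subseteq> U"
  shows "integrable (lebesgue_on K) (\<lambda>x. \<bar>u x\<bar> powr p)"
proof -
  have i: "integrable (lebesgue_on K) (\<lambda>x. \<bar>u x\<bar> powr p + norm (wgrad U u x) powr p)"
    using Lp_control[OF K] u by blast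
  have "u \<in> borel_measurable (lebesgue_on K)"
    using X_loc[OF u] K by (auto simp: Lp_loc_1_iff)
  then show ?thesis by (intro Bochner_Integration.integrable_bound[OF i]) auto
qed

end

section \<open>Summing local bounds over a partition\<close>

context hardy_setting
begin

text \<open>The functionals are linear in their coefficients, so the bounds for the single pieces
  add up to one whose cut-off is the sum of the \<psi>^p; finitely many null sequences are added as
  well.\<close>

lemma group_bound:
  assumes A: "finite A" and v: "\<And>k. v k \<in> C1c \<Omega>" and L: "compact L" "L \<subseteq> \<Omega>" and e: "0 < e"
    and \<psi>: "\<And>j. j \<in> A \<Longrightarrow> Ck 1 (\<psi> j)" "\<And>j x. j \<in> A \<Longrightarrow> 0 \<le> \<psi> j x" "\<And>j x. j \<in> A \<Longrightarrow> \<psi> j x \<le> 1"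
      "\<And>j x. j \<in> A \<Longrightarrow> x \<notin> L \<Longrightarrow> grad (\<psi> j) x = 0"
    and U: "\<And>j. j \<in> A \<Longrightarrow> \<exists>U C. is_domain U \<and> U \<subseteq> \<Omega> \<and> ereal c \<le> T U \<and> closed C \<and> C \<inter> \<Omega> \<subseteq> U \<and> (\<forall>x. x \<notin> C \<longrightarrow> \<psi> j x = 0)"
    and lim: "(\<lambda>k. LINT x|lebesgue_on L. \<bar>v k x\<bar> powr p) \<longlonglongrightarrow> 0"
  shows "\<exists>z. z \<longlonglongrightarrow> 0 \<and> (\<forall>k. c * O.I (\<lambda>_. 0) (\<lambda>x. (\<Sum>j\<in>A. \<psi> j x powr p) * \<bar>g x\<bar>) (v k)
    \<le> (1 + e) * O.I (\<lambda>x. \<Sum>j\<in>A. \<psi> j x powr p) (\<lambda>x. (\<Sum>j\<in>A. \<psi> j x powr p) * O.Vp x) (v k) + z k)"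
proof -
  define a b where "a j k = O.I (\<lambda>_. 0) (\<lambda>x. \<psi> j x powr p * \<bar>g x\<bar>) (v k)"
    and "b j k = O.I (\<lambda>x. \<psi> j x powr p) (\<lambda>x. \<psi> j x powr p * O.Vp x) (v k)" for j k
  have "\<forall>j\<in>A. \<exists>z. z \<longlonglongrightarrow> 0 \<and> (\<forall>k. c * a j k \<le> (1 + e) * b j k + z k)"
  proof
    fix j assume j: "j \<in> A"
    obtain U C where UC: "is_domain U" "U \<subseteq> \<Omega>" "ereal c \<le> T U" "closed C" "C \<inter> \<Omega> \<subseteq> U" "\<And>x. x \<notin> C \<Longrightarrow> \<psi> j x = 0"
      using U[OF j] by blast
    show "\<exists>z. z \<longlonglongrightarrow> 0 \<and> (\<forall>k. c * a j k \<le> (1 + e) * b j k + z k)"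
      unfolding a_def b_def
      by (rule piece_bound[of U c v L "\<psi> j" e C, OF UC(1-3) v L \<psi>[OF j] e UC(4-6) lim])
  qed
  then obtain z where z: "\<And>j. j \<in> A \<Longrightarrow> z j \<longlonglongrightarrow> 0" "\<And>j k. j \<in> A \<Longrightarrow> c * a j k \<le> (1 + e) * b j k + z j k"
    by metis
  obtain Cg where Cg: "O.dom O.X0 (\<lambda>_. 0) (\<lambda>x. \<bar>g x\<bar>) Cg" using O.hardy_dom[OF g] by blast
  have \<theta>: "(\<lambda>x. \<psi> j x powr p) \<in> borel_measurable O.M" "\<And>x. 0 \<le> \<psi> j x powr p" "\<And>x. \<psi> j x powr p \<le> 1" if j: "j \<in> A" for j
  proof -
    have "\<psi> j \<in> borel_measurable O.M"
      using borel_measurable_continuous_onI[OF Ck_continuous[OF \<psi>(1)[OF j]]]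
      by (intro measurable_restrict_space1 measurable_completion) simp
    then show "(\<lambda>x. \<psi> j x powr p) \<in> borel_measurable O.M" by measurable
    show "\<psi> j x powr p \<le> 1" for x using powr_mono2[of p "\<psi> j x" 1] \<psi>(2,3)[OF j] p by simp
  qed simp
  have sa: "(\<Sum>j\<in>A. a j k) = O.I (\<lambda>_. 0) (\<lambda>x. (\<Sum>j\<in>A. \<psi> j x powr p) * \<bar>g x\<bar>) (v k)" for k
    using O.I_sum[of A "v k" "\<lambda>_ _. 0" "\<lambda>j x. \<psi> j x powr p * \<bar>g x\<bar>"]
      O.domD(3)[OF O.dom_mult[OF Cg \<theta>] O.C1c_X0[OF v]] by (simp add: a_def sum_distrib_right)
  have sb: "(\<Sum>j\<in>A. b j k) = O.I (\<lambda>x. \<Sum>j\<in>A. \<psi> j x powr p) (\<lambda>x. (\<Sum>j\<in>A. \<psi> j x powr p) * O.Vp x) (v k)" for k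
    using O.I_sum[of A "v k" "\<lambda>j x. \<psi> j x powr p" "\<lambda>j x. \<psi> j x powr p * O.Vp x"]
      O.domD(3)[OF O.dom_mult[OF O.dom_V(1) \<theta>] O.C1c_X[OF v]] by (simp add: b_def sum_distrib_right)
  have "c * (\<Sum>j\<in>A. a j k) \<le> (1 + e) * (\<Sum>j\<in>A. b j k) + (\<Sum>j\<in>A. z j k)" for k
    unfolding sum_distrib_left sum.distrib[symmetric] by (intro sum_mono z(2))
  moreover have "(\<lambda>k. \<Sum>j\<in>A. z j k) \<longlonglongrightarrow> 0" using tendsto_sum[of A "\<lambda>j. z j" "\<lambda>_. 0"] z(1) by simp
  ultimately show ?thesis unfolding sa sb by (intro exI[of _ "\<lambda>k. \<Sum>j\<in>A. z j k"]) auto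
qed

lemma exhaustion_eventually: "x \<in> \<Omega> \<Longrightarrow> \<forall>\<^sub>F i in sequentially. x \<in> \<omega> i"
proof -
  assume "x \<in> \<Omega>"
  then obtain i where "x \<in> \<omega> i" using exh by (auto simp: smooth_exhaustion_def)
  then show ?thesis unfolding eventually_sequentially using exhaustion_mono[OF exh, of i] by blast
qed

text \<open>\<open>\<theta>\<close> collects the cut-offs near infinity and near \<open>\<Sigma>\<^sub>g\<close>, where the best constant exceeds \<open>c\<close>; on the
  remaining pieces it exceeds the arbitrary number \<open>R\<close>.\<close>
lemma localisation:
  assumes c: "ereal c < S_star p H V w \<Omega> g" "ereal c < S_infinity p H V w \<Omega> \<omega> g"
    and null: "closure (Sigma_set p H V w \<Omega> g) \<in> null_sets lebesgue"
    and \<phi>: "\<phi> \<in> O.X0" and \<tau>: "0 < \<tau>"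
  obtains \<theta> L where "\<theta> \<in> borel_measurable O.M" "\<And>x. 0 \<le> \<theta> x" "\<And>x. \<theta> x \<le> 1" "compact L" "L \<subseteq> \<Omega>"
    "O.I \<theta> (\<lambda>x. \<theta> x * O.Vp x) \<phi> + O.I (\<lambda>_. 0) (\<lambda>x. \<theta> x * \<bar>g x\<bar>) \<phi> < \<tau>"
    "\<And>e v. 0 < e \<Longrightarrow> (\<And>k. v k \<in> C1c \<Omega>) \<Longrightarrow> (\<lambda>k. LINT x|lebesgue_on L. \<bar>v k x\<bar> powr p) \<longlonglongrightarrow> 0 \<Longrightarrow>
      \<exists>z. z \<longlonglongrightarrow> 0 \<and> (\<forall>k. c * O.I (\<lambda>_. 0) (\<lambda>x. \<theta> x * \<bar>g x\<bar>) (v k)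
        \<le> (1 + e) * O.I \<theta> (\<lambda>x. \<theta> x * O.Vp x) (v k) + z k)"
    "\<And>e v. 0 < e \<Longrightarrow> (\<And>k. v k \<in> C1c \<Omega>) \<Longrightarrow> (\<lambda>k. LINT x|lebesgue_on L. \<bar>v k x\<bar> powr p) \<longlonglongrightarrow> 0 \<Longrightarrow>
      \<exists>z. z \<longlonglongrightarrow> 0 \<and> (\<forall>k. R * O.I (\<lambda>_. 0) (\<lambda>x. (1 - \<theta> x) * \<bar>g x\<bar>) (v k)
        \<le> (1 + e) * O.I (\<lambda>x. 1 - \<theta> x) (\<lambda>x. (1 - \<theta> x) * O.Vp x) (v k) + z k)"
proof -
  define N where "N = closure (Sigma_set p H V w \<Omega> g)"
  \<comment> \<open>The density of all that has to be small where \<theta> lives: the positive part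
    of the energy of \<phi> together with its mass.\<close>
  define f where "f x = O.D (\<lambda>_. 1) O.Vp \<phi> x + O.D (\<lambda>_. 0) (\<lambda>x. \<bar>g x\<bar>) \<phi> x" for x
  obtain Cg where Cg: "O.dom O.X0 (\<lambda>_. 0) (\<lambda>x. \<bar>g x\<bar>) Cg" using O.hardy_dom[OF g] by blast
  note fin1 = O.domD(3)[OF O.dom_V(1) O.X0_X[OF \<phi>]] and fin2 = O.domD(3)[OF Cg \<phi>]
  have f: "integrable O.M f" using fin1 fin2 by (auto simp: O.fin_def f_def[abs_def])
  have f0: "AE x in O.M. 0 \<le> f x"
    using O.D_nonneg[OF O.domD(1,2)[OF O.dom_V(1)], of \<phi>] O.D_nonneg[OF O.domD(1,2)[OF Cg], of \<phi>]
    by eventually_elim (simp add: f_def)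
  have \<Omega>l: "\<Omega> \<in> sets lebesgue" using open_\<Omega> by simp
  \<comment> \<open>Balls centred in N will be chosen inside G, so that \<phi> is small on their
    union, however many of them the partition uses.\<close>
  obtain G where G: "open G" "N \<subseteq> G" "(LINT x|O.M. indicator G x * f x) < \<tau> / 2"
    using null_set_open_small[OF null[folded N_def] \<Omega>l f, of "\<tau> / 2"] \<tau> by auto
  have ol: "\<omega> i \<in> sets lebesgue" for i using exh_dom(1)[of i] by (simp add: is_domain_def)
  have "(\<lambda>i. LINT x|O.M. indicator (\<Omega> - \<omega> i) x * f x) \<longlonglongrightarrow> 0"
  proof (rule integral_indicator_tendsto_0[OF f])
    show "\<Omega> - \<omega> i \<in> sets O.M" for i using \<Omega>l ol by (auto simp: sets_restrict_space_iff)
    show "AE x in O.M. \<forall>\<^sub>F i in sequentially. x \<notin> \<Omega> - \<omega> i"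
      using O.AE_in_U
    proof eventually_elim
      case (elim x)
      show ?case using exhaustion_eventually[OF elim] by eventually_elim simp
    qed
  qed
  then have "\<forall>\<^sub>F i in sequentially. (LINT x|O.M. indicator (\<Omega> - \<omega> i) x * f x) < \<tau> / 2"
    by (rule order_tendstoD) (use \<tau> in simp)
  then obtain i1 where i1: "\<And>i. i1 \<le> i \<Longrightarrow> (LINT x|O.M. indicator (\<Omega> - \<omega> i) x * f x) < \<tau> / 2"
    by (auto simp: eventually_sequentially)
  obtain i2 where i2: "\<And>j. i2 \<le> j \<Longrightarrow> ereal c < T (\<Omega> - closure (\<omega> j))" using S_infinity_bound[OF c(2)] by blast
  define i where "i = max i1 i2"
  have tail: "(LINT x|O.M. indicator (\<Omega> - \<omega> i) x * f x) < \<tau> / 2" and inf: "ereal c < T (\<Omega> - closure (\<omega> i))"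
    using i1[of i] i2[of i] by (auto simp: i_def)
  \<comment> \<open>Off N the local constant is infinite, so small balls have a best constant above
    R. At points of N only the bound c below \<open>S_star\<close> is available.\<close>
  have "\<forall>x\<in>\<Omega>. \<exists>r. 0 < r \<and> ball x r \<subseteq> \<Omega> \<and> (if x \<in> N then ball x r \<subseteq> G \<and> ereal c < T (ball x r) else ereal R < T (ball x r))"
  proof
    fix x assume x: "x \<in> \<Omega>"
    have x': "x \<in> closure \<Omega>" using x closure_subset by blast
    show "\<exists>r. 0 < r \<and> ball x r \<subseteq> \<Omega> \<and> (if x \<in> N then ball x r \<subseteq> G \<and> ereal c < T (ball x r) else ereal R < T (ball x r))"
    proof (cases "x \<in> N")
      case True
      have "S_star p H V w \<Omega> g \<le> S_local p H V w \<Omega> g x" unfolding S_star_def by (rule INF_lower[OF x'])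
      with c(1) have "ereal c < S_local p H V w \<Omega> g x" by (rule less_le_trans)
      then obtain r0 where r0: "0 < r0" "\<And>r. 0 < r \<Longrightarrow> r \<le> r0 \<Longrightarrow> ball x r \<subseteq> \<Omega> \<and> ereal c < T (ball x r)"
        using S_local_bound[OF x] by blast
      obtain r1 where r1: "0 < r1" "ball x r1 \<subseteq> G" using G(1,2) True by (meson open_contains_ball subsetD)
      have "ball x (min r0 r1) \<subseteq> G" using r1(2) subset_ball[of "min r0 r1" r1 x] by simp
      then show ?thesis using r0(1) r0(2)[of "min r0 r1"] r1(1) True by (intro exI[of _ "min r0 r1"]) auto
    next
      case False
      then have "x \<notin> Sigma_set p H V w \<Omega> g" unfolding N_def using closure_subset by blast
      then have "ereal R < S_local p H V w \<Omega> g x" using x' by (simp add: Sigma_set_def)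
      then obtain r0 where "0 < r0" "\<And>r. 0 < r \<Longrightarrow> r \<le> r0 \<Longrightarrow> ball x r \<subseteq> \<Omega> \<and> ereal R < T (ball x r)"
        using S_local_bound[OF x] by blast
      then show ?thesis using False by (intro exI[of _ r0]) auto
    qed
  qed
  then obtain r where r: "\<And>x. x \<in> \<Omega> \<Longrightarrow> 0 < r x \<and> ball x (r x) \<subseteq> \<Omega>"
      "\<And>x. x \<in> \<Omega> \<Longrightarrow> x \<in> N \<Longrightarrow> ball x (r x) \<subseteq> G \<and> ereal c < T (ball x (r x))"
      "\<And>x. x \<in> \<Omega> \<Longrightarrow> x \<notin> N \<Longrightarrow> ereal R < T (ball x (r x))"
    by metis
  have rb: "\<forall>x\<in>\<Omega>. 0 < r x \<and> ball x (r x) \<subseteq> \<Omega>" using r(1) by blast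
  obtain F L \<psi> where F: "finite F" "F \<subseteq> \<Omega>" and L: "compact L" "L \<subseteq> \<Omega>"
    and \<psi>: "\<forall>j\<in>insert None (Some ` F). Ck 1 (\<psi> j) \<and> (\<forall>x. 0 \<le> \<psi> j x) \<and> (\<forall>x. x \<notin> L \<longrightarrow> grad (\<psi> j) x = 0)"
    and one: "\<forall>x. (\<Sum>j\<in>insert None (Some ` F). \<psi> j x powr p) = 1"
    and ball: "\<forall>y\<in>F. \<exists>C. closed C \<and> C \<subseteq> ball y (r y) \<and> (\<forall>x. x \<notin> C \<longrightarrow> \<psi> (Some y) x = 0)"
    and out: "\<exists>W. open W \<and> closure (\<omega> i) \<subseteq> W \<and> (\<forall>x\<in>W. \<psi> None x = 0)"
    using smooth_partition[OF p open_\<Omega> exh_dom(3,4)[of i] rb] by (elim exE conjE) (rule that, assumption+, blast)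
  define J A A' where "J = insert None (Some ` F)" and "A = insert None (Some ` (F \<inter> N))" and "A' = Some ` (F - N)"
  have J: "J = A \<union> A'" "A \<inter> A' = {}" "finite A" "finite A'" using F(1) by (auto simp: J_def A_def A'_def)
  note \<psi>J = \<psi>[folded J_def, rule_format] and oneJ = one[folded J_def, rule_format]
  have \<psi>1: "\<psi> j x \<le> 1" if j: "j \<in> J" for j x
  proof -
    have "\<psi> j x powr p \<le> (\<Sum>j\<in>J. \<psi> j x powr p)" using J j by (intro member_le_sum) auto
    then have "(\<psi> j x powr p) powr (1 / p) \<le> 1 powr (1 / p)" unfolding oneJ using p by (intro powr_mono2) auto
    then show ?thesis using \<psi>J[OF j] p by (simp add: powr_powr)
  qed
  define \<theta> where "\<theta> x = (\<Sum>j\<in>A. \<psi> j x powr p)" for x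
  have \<theta>': "1 - \<theta> x = (\<Sum>j\<in>A'. \<psi> j x powr p)" for x
    using oneJ[of x] sum.union_disjoint[OF J(3,4,2), of "\<lambda>j. \<psi> j x powr p"] by (simp add: J(1) \<theta>_def)
  have \<theta>0: "0 \<le> \<theta> x" for x unfolding \<theta>_def by (rule sum_nonneg) simp
  have \<theta>1: "\<theta> x \<le> 1" for x using \<theta>'[of x] sum_nonneg[of A' "\<lambda>j. \<psi> j x powr p"] by simp
  have \<theta>m: "\<theta> \<in> borel_measurable O.M"
  proof -
    have "(\<lambda>x. \<psi> j x powr p) \<in> borel_measurable O.M" if "j \<in> A" for j
    proof -
      have [measurable]: "\<psi> j \<in> borel_measurable O.M"
        using borel_measurable_continuous_onI[OF Ck_continuous[of 1 "\<psi> j"]] \<psi>J[of j] that J(1)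
        by (intro measurable_restrict_space1 measurable_completion) (simp del: One_nat_def)
      show ?thesis by measurable
    qed
    then show ?thesis unfolding \<theta>_def[abs_def] by (rule borel_measurable_sum)
  qed
  \<comment> \<open>\<theta> lives in G and near infinity, the two regions on which the integral of
    f is below \<tau> / 2.\<close>
  have supp: "\<theta> x \<le> indicator G x + indicator (\<Omega> - \<omega> i) x" if x: "x \<in> \<Omega>" for x
  proof (cases "x \<in> G \<or> x \<notin> \<omega> i")
    case True
    then show ?thesis using \<theta>1[of x] x by (auto simp: indicator_def)
  next
    case False
    have "\<psi> j x = 0" if j: "j \<in> A" for j
    proof (cases j)
      case None
      then show ?thesis using out False closure_subset[of "\<omega> i"] by blast
    next
      case (Some y)
      then have y: "y \<in> F" "y \<in> N" using j by (auto simp: A_def)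
      then have "ball y (r y) \<subseteq> G" using r(2)[of y] F(2) by blast
      then show ?thesis using ball[rule_format, OF y(1)] False Some by blast
    qed
    then have "\<theta> x = 0" using p by (simp add: \<theta>_def)
    then show ?thesis by simp
  qed
  have small: "O.I \<theta> (\<lambda>x. \<theta> x * O.Vp x) \<phi> + O.I (\<lambda>_. 0) (\<lambda>x. \<theta> x * \<bar>g x\<bar>) \<phi> < \<tau>"
  proof -
    have i1: "integrable O.M (O.D (\<lambda>x. \<theta> x * 1) (\<lambda>x. \<theta> x * O.Vp x) \<phi>)"
      using O.fin_mult(1)[OF fin1 O.domD(1,2)[OF O.dom_V(1)] \<theta>m \<theta>0 \<theta>1] by (simp add: O.fin_def)
    have i2: "integrable O.M (O.D (\<lambda>x. \<theta> x * 0) (\<lambda>x. \<theta> x * \<bar>g x\<bar>) \<phi>)"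
      using O.fin_mult(1)[OF fin2 O.domD(1,2)[OF Cg] \<theta>m \<theta>0 \<theta>1] by (simp add: O.fin_def)
    have \<theta>f: "(\<lambda>x. \<theta> x * f x) = (\<lambda>x. O.D (\<lambda>x. \<theta> x * 1) (\<lambda>x. \<theta> x * O.Vp x) \<phi> x + O.D (\<lambda>x. \<theta> x * 0) (\<lambda>x. \<theta> x * \<bar>g x\<bar>) \<phi> x)"
      by (rule ext) (simp only: O.D_mult f_def distrib_left)
    have iG: "integrable O.M (\<lambda>x. indicator G x * f x)"
    proof (rule Bochner_Integration.integrable_bound[OF f])
      have "G \<inter> \<Omega> \<in> sets O.M" using G(1) \<Omega>l by (auto simp: sets_restrict_space)
      then have "(\<lambda>x. indicator (G \<inter> \<Omega>) x * f x) \<in> borel_measurable O.M" using f by auto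
      then show "(\<lambda>x. indicator G x * f x) \<in> borel_measurable O.M"
        by (rule measurable_cong[THEN iffD1, rotated]) (auto simp: indicator_def)
    qed (auto simp: indicator_def)
    have i\<omega>: "integrable O.M (\<lambda>x. indicator (\<Omega> - \<omega> i) x * f x)"
      using integrable_mult_indicator[of "\<Omega> - \<omega> i" O.M f] f \<Omega>l ol by (auto simp: sets_restrict_space_iff)
    have "O.I (\<lambda>x. \<theta> x * 1) (\<lambda>x. \<theta> x * O.Vp x) \<phi> + O.I (\<lambda>x. \<theta> x * 0) (\<lambda>x. \<theta> x * \<bar>g x\<bar>) \<phi>
        = (LINT x|O.M. \<theta> x * f x)"
      unfolding O.I_def \<theta>f by (rule Bochner_Integration.integral_add[OF i1 i2, symmetric])
    also have "\<dots> \<le> (LINT x|O.M. indicator G x * f x + indicator (\<Omega> - \<omega> i) x * f x)"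
    proof (rule integral_mono_AE)
      show "integrable O.M (\<lambda>x. \<theta> x * f x)"
        unfolding \<theta>f by (rule Bochner_Integration.integrable_add[OF i1 i2])
      show "integrable O.M (\<lambda>x. indicator G x * f x + indicator (\<Omega> - \<omega> i) x * f x)" using iG i\<omega> by simp
      show "AE x in O.M. \<theta> x * f x \<le> indicator G x * f x + indicator (\<Omega> - \<omega> i) x * f x"
        using f0 O.AE_in_U
      proof eventually_elim
        case (elim x)
        then show ?case using mult_right_mono[OF supp[OF elim(2)] elim(1)] by (simp add: distrib_right)
      qed
    qed
    also have "\<dots> < \<tau>" using G(3) tail iG i\<omega> by simp
    finally show ?thesis by simp
  qed
  have UA: "\<exists>U C. is_domain U \<and> U \<subseteq> \<Omega> \<and> ereal c \<le> T U \<and> closed C \<and> C \<inter> \<Omega> \<subseteq> U \<and> (\<forall>x. x \<notin> C \<longrightarrow> \<psi> j x = 0)" if j: "j \<in> A" for j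
  proof (cases j)
    case None
    \<comment> \<open>The cut-off vanishes on a whole neighbourhood W of the closure of \<omega> i,
      so the complement of W is a closed set whose part in \<Omega> stays inside the domain near
      infinity.\<close>
    obtain W where W: "open W" "closure (\<omega> i) \<subseteq> W" "\<forall>x\<in>W. \<psi> None x = 0" using out by blast
    show ?thesis
    proof (rule exI[of _ "\<Omega> - closure (\<omega> i)"], rule exI[of _ "- W"], intro conjI)
      show "ereal c \<le> T (\<Omega> - closure (\<omega> i))" using inf by simp
    qed (use W None dom_compl in auto)
  next
    case (Some y)
    then have y: "y \<in> F" "y \<in> N" using j by (auto simp: A_def)
    have y\<Omega>: "y \<in> \<Omega>" using y F(2) by blast
    obtain C where "closed C" "C \<subseteq> ball y (r y)" "\<forall>x. x \<notin> C \<longrightarrow> \<psi> (Some y) x = 0" using ball y(1) by blast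
    then show ?thesis
      using r(1)[OF y\<Omega>] r(2)[OF y\<Omega> y(2)] Some
      by (intro exI[of _ "ball y (r y)"] exI[of _ C]) (auto simp: is_domain_def less_imp_le)
  qed
  have UA': "\<exists>U C. is_domain U \<and> U \<subseteq> \<Omega> \<and> ereal R \<le> T U \<and> closed C \<and> C \<inter> \<Omega> \<subseteq> U \<and> (\<forall>x. x \<notin> C \<longrightarrow> \<psi> j x = 0)" if j: "j \<in> A'" for j
  proof -
    obtain y where y: "y \<in> F" "y \<notin> N" "j = Some y" using j by (auto simp: A'_def)
    have y\<Omega>: "y \<in> \<Omega>" using y F(2) by blast
    obtain C where "closed C" "C \<subseteq> ball y (r y)" "\<forall>x. x \<notin> C \<longrightarrow> \<psi> (Some y) x = 0" using ball y(1) by blast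
    then show ?thesis
      using r(1)[OF y\<Omega>] r(3)[OF y\<Omega> y(2)] y(3)
      by (intro exI[of _ "ball y (r y)"] exI[of _ C]) (auto simp: is_domain_def less_imp_le)
  qed
  have \<psi>A: "Ck 1 (\<psi> j)" "0 \<le> \<psi> j x" "\<psi> j x \<le> 1" "x \<notin> L \<Longrightarrow> grad (\<psi> j) x = 0" if "j \<in> A \<or> j \<in> A'" for j x
    using \<psi>J[of j] \<psi>1[of j x] that J(1) by auto
  show thesis
  proof (rule that[OF \<theta>m \<theta>0 \<theta>1 L small])
    fix e :: real and v
    assume a: "0 < e" "\<And>k. v k \<in> C1c \<Omega>" "(\<lambda>k. LINT x|lebesgue_on L. \<bar>v k x\<bar> powr p) \<longlonglongrightarrow> 0"
    show "\<exists>z. z \<longlonglongrightarrow> 0 \<and> (\<forall>k. c * O.I (\<lambda>_. 0) (\<lambda>x. \<theta> x * \<bar>g x\<bar>) (v k)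
        \<le> (1 + e) * O.I \<theta> (\<lambda>x. \<theta> x * O.Vp x) (v k) + z k)"
      unfolding \<theta>_def[abs_def] using \<psi>A UA by (intro group_bound[of A v L e \<psi> c, OF J(3) a(2) L a(1)] a(3)) blast+
    show "\<exists>z. z \<longlonglongrightarrow> 0 \<and> (\<forall>k. R * O.I (\<lambda>_. 0) (\<lambda>x. (1 - \<theta> x) * \<bar>g x\<bar>) (v k)
        \<le> (1 + e) * O.I (\<lambda>x. 1 - \<theta> x) (\<lambda>x. (1 - \<theta> x) * O.Vp x) (v k) + z k)"
      unfolding \<theta>' using \<psi>A UA' by (intro group_bound[of A' v L e \<psi> R, OF J(4) a(2) L a(1)] a(3)) blast+
  qed
qed

section \<open>Existence of a minimiser\<close>

text \<open>The mass \<open>1 - t\<close> lost in the limit costs at least \<open>c (1 - t)\<close>.\<close>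
lemma mass_defect:
  assumes c: "0 \<le> c" "ereal c < S_star p H V w \<Omega> g" "ereal c < S_infinity p H V w \<Omega> \<omega> g"
    and null: "closure (Sigma_set p H V w \<Omega> g) \<in> null_sets lebesgue"
    and u: "\<And>k. u k \<in> Cc_inf \<Omega>" "\<And>k. weighted_mass p g (u k) \<Omega> = 1" "(\<lambda>k. Q p H V (u k) \<Omega>) \<longlonglongrightarrow> S"
      "\<And>k. O.E (u k) \<le> B" and conv: "L1_loc_conv \<Omega> u \<phi>"
    and loc: "\<And>K. compact K \<Longrightarrow> K \<subseteq> \<Omega> \<Longrightarrow> (\<lambda>k. LINT x|lebesgue_on K. \<bar>u k x - \<phi> x\<bar> powr p) \<longlonglongrightarrow> 0"
    and neg: "(\<lambda>k. O.I (\<lambda>_. 0) (neg_part V) (u k)) \<longlonglongrightarrow> O.I (\<lambda>_. 0) (neg_part V) \<phi>"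
  shows "c * (1 - weighted_mass p g \<phi> \<Omega>) \<le> S - Q p H V \<phi> \<Omega>"
proof -
  define t where "t = weighted_mass p g \<phi> \<Omega>"
  have uX0: "u k \<in> O.X0" for k by (rule O.Cc_inf_X0[OF u(1)])
  have uX: "u k \<in> O.X" for k by (rule O.X0_X[OF uX0])
  have \<phi>X0: "\<phi> \<in> O.X0" by (rule O.weak_limit(1)[OF uX0 u(4) conv])
  have \<phi>X: "\<phi> \<in> O.X" by (rule O.X0_X[OF \<phi>X0])
  obtain a where a: "\<And>k::nat. a k \<in> Cc_inf \<Omega>" "(\<lambda>k. O.E (\<lambda>x. a k x - \<phi> x)) \<longlonglongrightarrow> 0" using O.X0_seq[OF \<phi>X0] by blast
  have aX0: "a k \<in> O.X0" for k by (rule O.Cc_inf_X0[OF a(1)])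
  have aX: "a k \<in> O.X" for k by (rule O.X0_X[OF aX0])
  obtain Cg where Cg: "O.dom O.X0 (\<lambda>_. 0) (\<lambda>x. \<bar>g x\<bar>) Cg" using O.hardy_dom[OF g] by blast
  define v where "v k x = u k x - a k x" for k x
  have vC: "v k \<in> Cc_inf \<Omega>" for k unfolding v_def[abs_def] by (rule Cc_inf_diff[OF u(1) a(1)])
  have vX0: "v k \<in> O.X0" for k by (rule O.Cc_inf_X0[OF vC])
  have vX: "v k \<in> O.X" for k by (rule O.X0_X[OF vX0])
  have vC1: "v k \<in> C1c \<Omega>" for k using vC Cc_inf_C1c by blast
  have "Bseq (\<lambda>k. O.E (\<lambda>x. a k x - \<phi> x))" using a(2) by (rule convergentI[THEN convergent_imp_Bseq])
  then obtain Ba where Ba: "\<And>k. \<bar>O.E (\<lambda>x. a k x - \<phi> x)\<bar> \<le> Ba" by (auto simp: Bseq_def)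
  define B' where "B' = (1 / 2) powr (1 - p) * ((1 / 2) powr (1 - p) * (B + O.E \<phi>) + Ba)"
  have EvB: "O.E (v k) \<le> B'" for k
  proof -
    have m\<phi>: "O.E (\<lambda>x. u k x - \<phi> x) \<le> (1 / 2) powr (1 - p) * (B + O.E \<phi>)"
    proof -
      have z: "(\<lambda>x. 0) \<in> O.X" using O.X_diff[OF \<phi>X \<phi>X] by simp
      have "O.E (\<lambda>x. u k x - \<phi> x) \<le> (1 / 2) powr (1 - p) * (O.E (\<lambda>x. u k x - 0) + O.E (\<lambda>x. 0 - \<phi> x))"
        by (rule O.E_tri[OF uX z \<phi>X])
      also have "O.E (\<lambda>x. 0 - \<phi> x) = O.E \<phi>" using O.E_minus[OF z \<phi>X] by simp
      also have "(1 / 2) powr (1 - p) * (O.E (\<lambda>x. u k x - 0) + O.E \<phi>) \<le> (1 / 2) powr (1 - p) * (B + O.E \<phi>)"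
        using u(4)[of k] by (intro mult_left_mono) auto
      finally show ?thesis .
    qed
    have "O.E (v k) \<le> (1 / 2) powr (1 - p) * (O.E (\<lambda>x. u k x - \<phi> x) + O.E (\<lambda>x. \<phi> x - a k x))"
      unfolding v_def[abs_def] by (rule O.E_tri[OF uX \<phi>X aX])
    also have "O.E (\<lambda>x. \<phi> x - a k x) = O.E (\<lambda>x. a k x - \<phi> x)" by (rule O.E_minus[OF \<phi>X aX])
    also have "(1 / 2) powr (1 - p) * (O.E (\<lambda>x. u k x - \<phi> x) + O.E (\<lambda>x. a k x - \<phi> x)) \<le> B'"
      unfolding B'_def using m\<phi> Ba[of k] by (intro mult_left_mono add_mono) auto
    finally show ?thesis .
  qed
  have vloc: "(\<lambda>k. LINT x|lebesgue_on K. \<bar>v k x\<bar> powr p) \<longlonglongrightarrow> 0" if K: "compact K" "K \<subseteq> \<Omega>" for K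
  proof -
    have l1: "(\<lambda>k. LINT x|lebesgue_on K. \<bar>u k x - \<phi> x\<bar> powr p) \<longlonglongrightarrow> 0" by (rule loc[OF K])
    have l2: "(\<lambda>k. LINT x|lebesgue_on K. \<bar>a k x - \<phi> x\<bar> powr p) \<longlonglongrightarrow> 0" by (rule O.Lp_conv[OF aX \<phi>X a(2) K])
    have le: "(LINT x|lebesgue_on K. \<bar>v k x\<bar> powr p)
      \<le> 2 powr p * ((LINT x|lebesgue_on K. \<bar>u k x - \<phi> x\<bar> powr p) + (LINT x|lebesgue_on K. \<bar>a k x - \<phi> x\<bar> powr p))" for k
    proof -
      have i: "integrable (lebesgue_on K) (\<lambda>x. \<bar>u k x - \<phi> x\<bar> powr p)" "integrable (lebesgue_on K) (\<lambda>x. \<bar>a k x - \<phi> x\<bar> powr p)"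
        using O.X_powr_integrable[OF O.X_diff[OF uX \<phi>X] K] O.X_powr_integrable[OF O.X_diff[OF aX \<phi>X] K] by auto
      have "\<bar>v k x\<bar> powr p \<le> 2 powr p * (\<bar>u k x - \<phi> x\<bar> powr p + \<bar>a k x - \<phi> x\<bar> powr p)" for x
      proof -
        have "\<bar>v k x\<bar> powr p \<le> (\<bar>u k x - \<phi> x\<bar> + \<bar>a k x - \<phi> x\<bar>) powr p" using p by (intro powr_mono2) (auto simp: v_def)
        also have "\<dots> \<le> 2 powr p * (\<bar>u k x - \<phi> x\<bar> powr p + \<bar>a k x - \<phi> x\<bar> powr p)" using p by (intro powr_add_le_two) auto
        finally show ?thesis .
      qed
      then have "(LINT x|lebesgue_on K. \<bar>v k x\<bar> powr p)
        \<le> (LINT x|lebesgue_on K. 2 powr p * (\<bar>u k x - \<phi> x\<bar> powr p + \<bar>a k x - \<phi> x\<bar> powr p))"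
        using i by (intro Bochner_Integration.integral_mono') auto
      then show ?thesis using i by simp
    qed
    have up: "(\<lambda>k. 2 powr p * ((LINT x|lebesgue_on K. \<bar>u k x - \<phi> x\<bar> powr p) + (LINT x|lebesgue_on K. \<bar>a k x - \<phi> x\<bar> powr p))) \<longlonglongrightarrow> 0"
      using tendsto_mult[OF tendsto_const tendsto_add[OF l1 l2], of "2 powr p"] by simp
    show ?thesis by (rule tendsto_sandwich[OF _ _ tendsto_const up]) (use le in \<open>auto intro!: always_eventually\<close>)
  qed
  \<comment> \<open>All errors are expressed in one parameter e. At e = 0 the inequality reads c
    \<le> S - Q[\<phi>] + c * t, which is the claim.\<close>
  have key: "c \<le> (1 + e) * ((1 + e) * ((1 + e) * (S - Q p H V \<phi> \<Omega> + 3 * e) + 2 * e) + e) + c * (3 * e + (1 + e) * (t + e))"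
    if e: "0 < e" "e < 1" for e
  proof -
    obtain C where C: "0 \<le> C" "\<And>\<alpha> \<beta> u v. u \<in> O.fin \<alpha> \<beta> \<Longrightarrow> v \<in> O.fin \<alpha> \<beta> \<Longrightarrow> O.coeff \<alpha> \<Longrightarrow> O.coeff \<beta> \<Longrightarrow>
      O.I \<alpha> \<beta> u \<le> (1 + e) * O.I \<alpha> \<beta> v + C * O.I \<alpha> \<beta> (\<lambda>x. u x - v x)" using O.fin_perturb_eps[OF e(1)] by blast
    \<comment> \<open>The functions a k inherit the bound 2 * \<tau> from \<phi> for large k; even
      multiplied by the perturbation constant C it stays below e.\<close>
    define \<tau> where "\<tau> = e / (2 * (C + 1))"
    have \<tau>: "0 < \<tau>" "\<tau> \<le> e" "C * (2 * \<tau>) \<le> e" using e C(1) by (auto simp: \<tau>_def field_simps)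
    have B'0: "0 \<le> B'" using EvB[of 0] O.E_nonneg[of "v 0"] by linarith
    \<comment> \<open>The energy of v is at most B', so R times its mass away from \<theta> is at
      most 2 * B' + 1. Hence C times that mass is at most e.\<close>
    define R where "R = C * (2 * B' + 1) / e + 1"
    have "0 \<le> C * (2 * B' + 1) / e" using e C(1) B'0 by simp
    then have R: "0 < R" by (simp add: R_def)
    have "e * R = e * (C * (2 * B' + 1) / e) + e" by (simp add: R_def distrib_left)
    also have "e * (C * (2 * B' + 1) / e) = C * (2 * B' + 1)" using e(1) by (simp only: times_divide_eq_right nonzero_mult_div_cancel_left)
    finally have Re: "C * (2 * B' + 1) \<le> e * R" using e(1) by linarith
    show ?thesis
    proof (rule localisation[OF c(2,3) null \<phi>X0 \<tau>(1), where R = R], goal_cases)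
      case L: (1 \<theta> L)
      define \<theta>' where "\<theta>' x = 1 - \<theta> x" for x
      have \<theta>': "\<theta>' \<in> borel_measurable O.M" "\<And>x. 0 \<le> \<theta>' x" "\<And>x. \<theta>' x \<le> 1"
        using L(1,2,3) by (auto simp: \<theta>'_def[abs_def])
      define G Gc GR where "G = O.I (\<lambda>_. 1) O.Vp" and "Gc = O.I \<theta> (\<lambda>x. \<theta> x * O.Vp x)" and "GR = O.I \<theta>' (\<lambda>x. \<theta>' x * O.Vp x)"
      define mc mR where "mc = O.I (\<lambda>_. 0) (\<lambda>x. \<theta> x * \<bar>g x\<bar>)" and "mR = O.I (\<lambda>_. 0) (\<lambda>x. \<theta>' x * \<bar>g x\<bar>)"
      have dc: "O.dom O.X \<theta> (\<lambda>x. \<theta> x * O.Vp x) 1" using O.dom_mult[OF O.dom_V(1) L(1,2,3)] by simp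
      have dR: "O.dom O.X \<theta>' (\<lambda>x. \<theta>' x * O.Vp x) 1" using O.dom_mult[OF O.dom_V(1) \<theta>'] by simp
      have ec: "O.dom O.X0 (\<lambda>_. 0) (\<lambda>x. \<theta> x * \<bar>g x\<bar>) Cg" using O.dom_mult[OF Cg L(1,2,3)] by simp
      have eR: "O.dom O.X0 (\<lambda>_. 0) (\<lambda>x. \<theta>' x * \<bar>g x\<bar>) Cg" using O.dom_mult[OF Cg \<theta>'] by simp
      have G_split: "Gc h + GR h = G h" if "h \<in> O.X" for h
        using O.I_split[OF O.domD(3)[OF O.dom_V(1) that] O.domD(1,2)[OF O.dom_V(1)] L(1,2,3)]
        by (simp add: Gc_def GR_def G_def \<theta>'_def[abs_def])
      have m_split: "mc h + mR h = weighted_mass p g h \<Omega>" if "h \<in> O.X0" for h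
        using O.I_split[OF O.domD(3)[OF Cg that] O.domD(1,2)[OF Cg] L(1,2,3)]
        by (simp add: mc_def mR_def O.mass_eq \<theta>'_def)
      have nonneg: "0 \<le> Gc h" "0 \<le> GR h" "0 \<le> mc h" "0 \<le> mR h" for h
        unfolding Gc_def GR_def mc_def mR_def using O.domD(1,2)[OF dc] O.domD(1,2)[OF dR] O.domD(1,2)[OF ec] O.domD(1,2)[OF eR]
        by (auto intro: O.I_nonneg)
      have small: "Gc \<phi> + mc \<phi> < \<tau>" using L(6) by (simp add: Gc_def mc_def)
      have QG: "Q p H V h \<Omega> = G h - O.I (\<lambda>_. 0) (neg_part V) h" if "h \<in> O.X" for h
        unfolding G_def by (rule O.Q_eq[OF that])
      have uv: "(\<lambda>x. u k x - v k x) = a k" "(\<lambda>x. u k x - a k x) = v k" for k by (simp_all add: v_def fun_eq_iff)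
      obtain z where z: "z \<longlonglongrightarrow> 0" "\<And>k. c * mc (v k) \<le> (1 + e) * Gc (v k) + z k"
        using L(7)[OF e(1) vC1 vloc[OF L(4,5)]] unfolding mc_def Gc_def by blast
      obtain z' where z': "z' \<longlonglongrightarrow> 0" "\<And>k. R * mR (v k) \<le> (1 + e) * GR (v k) + z' k"
        using L(8)[OF e(1) vC1 vloc[OF L(4,5)]] unfolding mR_def GR_def \<theta>'_def[abs_def] by blast
      have lim_Gc: "(\<lambda>k. Gc (a k)) \<longlonglongrightarrow> Gc \<phi>"
        unfolding Gc_def by (rule O.I_continuous[OF O.X_diff order_refl dc aX \<phi>X a(2)])
      have lim_mc: "(\<lambda>k. mc (a k)) \<longlonglongrightarrow> mc \<phi>"
        unfolding mc_def by (rule O.I_continuous[OF O.X0_diff O.X0_subset ec aX0 \<phi>X0 a(2)])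
      have lim_m: "(\<lambda>k. weighted_mass p g (a k) \<Omega>) \<longlonglongrightarrow> t"
        unfolding t_def by (rule O.mass_continuous[OF g aX0 \<phi>X0 a(2)])
      have lim_G: "(\<lambda>k. G (u k)) \<longlonglongrightarrow> S + O.I (\<lambda>_. 0) (neg_part V) \<phi>"
        using tendsto_add[OF u(3) neg] by (simp add: QG[OF uX])
      have "\<forall>\<^sub>F k in sequentially. z k < e" by (rule order_tendstoD(2)[OF z(1) e(1)])
      moreover have "\<forall>\<^sub>F k in sequentially. z' k < 1" by (rule order_tendstoD(2)[OF z'(1)]) simp
      moreover have "\<forall>\<^sub>F k in sequentially. Gc (a k) < 2 * \<tau>"
        by (rule order_tendstoD(2)[OF lim_Gc]) (use small nonneg(3)[of \<phi>] \<tau>(1) in linarith)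
      moreover have "\<forall>\<^sub>F k in sequentially. mc (a k) < 2 * \<tau>"
        by (rule order_tendstoD(2)[OF lim_mc]) (use small nonneg(1)[of \<phi>] \<tau>(1) in linarith)
      moreover have "\<forall>\<^sub>F k in sequentially. weighted_mass p g (a k) \<Omega> < t + e"
        by (rule order_tendstoD(2)[OF lim_m]) (use e in simp)
      moreover have "\<forall>\<^sub>F k in sequentially. G (u k) < S + O.I (\<lambda>_. 0) (neg_part V) \<phi> + e"
        by (rule order_tendstoD(2)[OF lim_G]) (use e in simp)
      moreover have "\<forall>\<^sub>F k in sequentially. GR \<phi> < GR (u k) + e"
        unfolding GR_def by (rule O.weak_lsc_eventually[OF O.dom_subset[OF dR O.X0_subset] uX0 u(4) conv e(1)])
      ultimately have "\<forall>\<^sub>F k in sequentially. z k < e \<and> z' k < 1 \<and> Gc (a k) < 2 * \<tau> \<and> mc (a k) < 2 * \<tau> \<and>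
        weighted_mass p g (a k) \<Omega> < t + e \<and> G (u k) < S + O.I (\<lambda>_. 0) (neg_part V) \<phi> + e \<and> GR \<phi> < GR (u k) + e"
        by eventually_elim simp
      then obtain k where k: "z k < e" "z' k < 1" "Gc (a k) < 2 * \<tau>" "mc (a k) < 2 * \<tau>"
        "weighted_mass p g (a k) \<Omega> < t + e" "G (u k) < S + O.I (\<lambda>_. 0) (neg_part V) \<phi> + e" "GR \<phi> < GR (u k) + e"
        by (auto simp: eventually_sequentially)
      have f1: "mc (u k) + mR (u k) = 1" using m_split[OF uX0] u(2) by simp
      \<comment> \<open>On the support of \<theta> the function a k is negligible, so the mass of u
        is compared with that of v.\<close>
      have f2: "mc (u k) \<le> (1 + e) * mc (v k) + e"
      proof -
        have "mc (u k) \<le> (1 + e) * mc (v k) + C * mc (a k)"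
          using C(2)[OF O.domD(3)[OF ec uX0[of k]] O.domD(3)[OF ec vX0[of k]] O.domD(1,2)[OF ec]] uv(1)[of k] by (simp add: mc_def)
        moreover have "C * mc (a k) \<le> C * (2 * \<tau>)" using k(4) C(1) by (intro mult_left_mono) auto
        ultimately show ?thesis using \<tau>(3) by linarith
      qed
      have f6: "C * mR (v k) \<le> e"
      proof -
        have "GR (v k) \<le> B'" using O.domD(4)[OF dR vX[of k]] EvB[of k] by (simp add: GR_def)
        then have "(1 + e) * GR (v k) \<le> 2 * B'" using e nonneg(2)[of "v k"] by (intro mult_mono) auto
        then have "R * mR (v k) \<le> 2 * B' + 1" using z'(2)[of k] k(2) by linarith
        then have "C * (R * mR (v k)) \<le> C * (2 * B' + 1)" using C(1) by (rule mult_left_mono)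
        also have "\<dots> \<le> e * R" by (rule Re)
        finally have "R * (C * mR (v k)) \<le> R * e" by (simp add: mult_ac)
        then show ?thesis using R by simp
      qed
      \<comment> \<open>Away from \<theta> the roles are exchanged: the mass of v is negligible by
        the choice of R, and u is compared with a, whose mass is close to t.\<close>
      have f3: "mR (u k) \<le> (1 + e) * (t + e) + e"
      proof -
        have "mR (u k) \<le> (1 + e) * mR (a k) + C * mR (v k)"
          using C(2)[OF O.domD(3)[OF eR uX0[of k]] O.domD(3)[OF eR aX0[of k]] O.domD(1,2)[OF eR]] uv(2)[of k] by (simp add: mR_def)
        moreover have "mR (a k) \<le> t + e" using m_split[OF aX0[of k]] nonneg(3)[of "a k"] k(5) by linarith
        then have "(1 + e) * mR (a k) \<le> (1 + e) * (t + e)" using e by (intro mult_left_mono) auto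
        ultimately show ?thesis using f6 by linarith
      qed
      have f8: "Gc (v k) \<le> (1 + e) * Gc (u k) + e"
      proof -
        have fu: "u k \<in> O.fin \<theta> (\<lambda>x. \<theta> x * O.Vp x)" and fv: "v k \<in> O.fin \<theta> (\<lambda>x. \<theta> x * O.Vp x)"
          by (rule O.domD(3)[OF dc uX], rule O.domD(3)[OF dc vX])
        have "Gc (v k) \<le> (1 + e) * Gc (u k) + C * Gc (a k)"
          using C(2)[OF fv fu O.domD(1,2)[OF dc]] O.I_minus[OF fv fu O.domD(1,2)[OF dc]] uv(1)[of k] by (simp add: Gc_def)
        moreover have "C * Gc (a k) \<le> C * (2 * \<tau>)" using k(3) C(1) by (intro mult_left_mono) auto
        ultimately show ?thesis using \<tau>(3) by linarith
      qed
      \<comment> \<open>Lower semicontinuity keeps at least the energy of \<phi> in the region of 1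
        - \<theta>, so only the difference of the totals is left for \<theta>. In the totals the V^-
        integrals cancel and turn the positive parts into S and Q[\<phi>].\<close>
      have f9: "Gc (u k) \<le> S - Q p H V \<phi> \<Omega> + 3 * e"
        using G_split[OF uX[of k]] G_split[OF \<phi>X] QG[OF \<phi>X] k(6,7) small nonneg(3)[of \<phi>] \<tau>(2) by linarith
      have f10: "Gc (v k) \<le> (1 + e) * (S - Q p H V \<phi> \<Omega> + 3 * e) + 2 * e"
        using f8 mult_left_mono[OF f9, of "1 + e"] e by linarith
      have f11: "c * mc (v k) \<le> (1 + e) * ((1 + e) * (S - Q p H V \<phi> \<Omega> + 3 * e) + 2 * e) + e"
        using z(2)[of k] k(1) mult_left_mono[OF f10, of "1 + e"] e by linarith
      have f12: "1 \<le> (1 + e) * mc (v k) + (3 * e + (1 + e) * (t + e))" using f1 f2 f3 e by linarith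
      have "c * 1 \<le> c * ((1 + e) * mc (v k) + (3 * e + (1 + e) * (t + e)))" using f12 c(1) by (rule mult_left_mono)
      also have "\<dots> = (1 + e) * (c * mc (v k)) + c * (3 * e + (1 + e) * (t + e))" by (simp add: algebra_simps)
      also have "\<dots> \<le> (1 + e) * ((1 + e) * ((1 + e) * (S - Q p H V \<phi> \<Omega> + 3 * e) + 2 * e) + e) + c * (3 * e + (1 + e) * (t + e))"
        using mult_left_mono[OF f11, of "1 + e"] e by simp
      finally show ?case by simp
    qed
  qed
  let ?F = "\<lambda>e. (1 + e) * ((1 + e) * ((1 + e) * (S - Q p H V \<phi> \<Omega> + 3 * e) + 2 * e) + e) + c * (3 * e + (1 + e) * (t + e))"
  have "(?F \<longlongrightarrow> ?F 0) (at_right 0)" by (intro tendsto_intros)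
  moreover have "\<forall>\<^sub>F e in at_right 0. c \<le> ?F e"
    using eventually_at_right_real[of 0 1] by (rule eventually_mono[OF _ key]) auto
  ultimately have "c \<le> ?F 0" by (rule tendsto_lowerbound) simp
  then show ?thesis by (simp add: t_def algebra_simps)
qed

lemma minimizer:
  assumes less: "S_const p H V \<Omega> g < min (S_star p H V w \<Omega> g) (S_infinity p H V w \<Omega> \<omega> g)"
    and null: "closure (Sigma_set p H V w \<Omega> g) \<in> null_sets lebesgue"
  shows "\<exists>\<phi>\<in>Wt0 p H V w \<Omega>. nonzero_on \<Omega> \<phi> \<and> weighted_mass p g \<phi> \<Omega> > 0 \<and>
    S_const p H V \<Omega> g = ereal (Q p H V \<phi> \<Omega> / weighted_mass p g \<phi> \<Omega>)"
proof -
  have m0: "0 \<le> weighted_mass p g f \<Omega>" for f by (simp add: weighted_mass_def)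
  have T0: "0 \<le> T \<Omega>"
    unfolding T_def
  proof (rule Inf_greatest)
    fix y assume "y \<in> {ereal (Q p H V f \<Omega> / weighted_mass p g f \<Omega>) |f. f \<in> Cc_inf \<Omega> \<and> 0 < weighted_mass p g f \<Omega>}"
    then obtain f where "y = ereal (Q p H V f \<Omega> / weighted_mass p g f \<Omega>)" "f \<in> Cc_inf \<Omega>" by blast
    then show "0 \<le> y" using Q_nonneg[OF O.Cc_inf_X0] m0[of f] by simp
  qed
  have less': "T \<Omega> < min (S_star p H V w \<Omega> g) (S_infinity p H V w \<Omega> \<omega> g)" using less by (simp only: S_const_eq)
  \<comment> \<open>The strict inequality rules out an infimum over the empty set, which would be
    \<infinity>.\<close>
  then have "T \<Omega> \<noteq> \<infinity>" by auto
  then obtain S where S: "T \<Omega> = ereal S" "0 \<le> S" using T0 by (cases "T \<Omega>") auto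
  obtain c where c: "ereal S < ereal c" "ereal c < min (S_star p H V w \<Omega> g) (S_infinity p H V w \<Omega> \<omega> g)"
    using ereal_dense2[OF less'] S(1) by auto
  have c': "0 \<le> c" "S < c" "ereal c < S_star p H V w \<Omega> g" "ereal c < S_infinity p H V w \<Omega> \<omega> g" using c S(2) by auto
  show ?thesis
  proof (rule minimizing_sequence[OF S(1)], goal_cases)
    case u: (1 u \<phi> B)
    have \<phi>: "\<phi> \<in> O.X0" by (rule O.weak_limit(1)[OF O.Cc_inf_X0[OF u(1)] u(4) u(5)])
    define t where "t = weighted_mass p g \<phi> \<Omega>"
    have defect: "c * (1 - t) \<le> S - Q p H V \<phi> \<Omega>"
      unfolding t_def by (rule mass_defect[OF c'(1,3,4) null u])
    obtain Cg where Cg: "O.dom O.X0 (\<lambda>_. 0) (\<lambda>x. \<bar>g x\<bar>) Cg" using O.hardy_dom[OF g] by blast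
    have m1: "O.I (\<lambda>_. 0) (\<lambda>x. \<bar>g x\<bar>) (u k) \<le> 1" for k using u(2)[of k] unfolding O.mass_eq by simp
    have t1: "t \<le> 1"
      unfolding t_def O.mass_eq
      by (rule O.I_weak_lsc[OF O.X0_diff O.X0_lin O.X0_subset Cg O.Cc_inf_X0[OF u(1)] \<phi> u(4) u(5) m1])
    have lower: "S * t \<le> Q p H V \<phi> \<Omega>"
    proof (cases "t = 0")
      case True
      then show ?thesis using Q_nonneg[OF \<phi>] by simp
    next
      case False
      then have pos: "0 < t" using m0[of \<phi>] by (simp add: t_def)
      have "ereal S \<le> ereal (Q p H V \<phi> \<Omega> / t)"
        using O.Tc_le[OF g \<phi>] pos S(1) by (simp add: t_def O.Tc_def T_def)
      then show ?thesis using pos by (simp add: field_simps)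
    qed
    have "(c - S) * (1 - t) \<le> 0" using defect lower by (simp add: algebra_simps)
    then have t: "t = 1" using c'(2) t1 by (simp add: mult_le_0_iff)
    then have QS: "Q p H V \<phi> \<Omega> = S" using defect lower by simp
    have "nonzero_on \<Omega> \<phi>"
      unfolding nonzero_on_def
    proof
      assume "AE x in lebesgue_on \<Omega>. \<phi> x = 0"
      then have "AE x in lebesgue_on \<Omega>. \<bar>g x\<bar> * \<bar>\<phi> x\<bar> powr p = 0" by eventually_elim (use p in simp)
      then have "t = 0" unfolding t_def weighted_mass_def by (rule integral_eq_zero_AE)
      then show False using t by simp
    qed
    then show ?case using \<phi> t QS S(1) by (intro bexI[of _ \<phi>]) (auto simp: S_const_eq t_def)
  qed
qed

end

theorem theorem4p40:
  fixes p q :: real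
    and \<Omega> :: "'a::euclidean_space set"
    and \<omega> :: "nat \<Rightarrow> 'a set"
    and H :: "'a \<Rightarrow> 'a \<Rightarrow> real"
    and V g d :: "'a \<Rightarrow> real"
    and w :: "'a set \<Rightarrow> 'a \<Rightarrow> real"
  assumes "1 < p" and "DIM('a) \<ge> 2"
    and "is_domain \<Omega>"
    and "\<And>x. x \<in> frontier \<Omega> \<Longrightarrow> \<forall>\<^sub>F r in at_right 0. is_domain (\<Omega> \<inter> ball x r)"
    and "smooth_exhaustion \<omega> \<Omega>"
    and "\<And>i. is_domain (\<Omega> - closure (\<omega> i))"
    and "admissible_norm_family \<Omega> H"
    and "commonly_uniformly_convex \<Omega> H"
    and "bregman_lower_bound p \<Omega> H d"
    and "morrey_exponent (real DIM('a)) p q"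
    and "V \<in> morrey_loc p q \<Omega>"
    and "gradient_regularity p \<Omega> H d V"
    and "subcritical p H V \<Omega>"
    and "weight_choice p H V \<Omega> w"
    and "neg_part_compactness p H V w \<Omega>"
    and "g \<in> hardy_weights p H V \<Omega>" and "nonzero_on \<Omega> g"
    and "S_const p H V \<Omega> g < min (S_star p H V w \<Omega> g) (S_infinity p H V w \<Omega> \<omega> g)"
    and "closure (Sigma_set p H V w \<Omega> g) \<in> null_sets lebesgue"
  shows "\<exists>\<phi>\<in>Wt0 p H V w \<Omega>. nonzero_on \<Omega> \<phi> \<and> weighted_mass p g \<phi> \<Omega> > 0 \<and>
           S_const p H V \<Omega> g = ereal (Q p H V \<phi> \<Omega> / weighted_mass p g \<phi> \<Omega>)"
proof -
  interpret hardy_setting p \<Omega> \<omega> H V g w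
    by unfold_locales (fact assms morrey_loc_Lp_loc[OF assms(5,11)])+
  show ?thesis by (rule minimizer[OF assms(18,19)])
qed

end
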